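(* Let $s,\sigma\in(0,1)$ and $\epsilon\in(0,1/4)$. Let $(u_i,E_i)$, $i\in\{1,2\}$, be admissible pairs in $B_2\subset\mathbb R^n$, and let $\overline u_i$ be the $s$-extension of $u_i$ and $U_i$ the $\sigma$-extension of $E_i$. Let $\phi=\phi_\epsilon$ be a cutoff function as described in the context. Then there exist $F\subseteq\mathbb R^n$, $\overline v:\mathbb R^{n+1}_+\to\mathbb R$ and $V:\mathbb R^{n+1}_+\to\mathbb R$ such that $$F\cap B_1=E_1\cap B_1\quad\text{and}\quad F\setminus B_1=E_2\setminus B_1,$$ and (i) $V=U_2$ in a neighborhood of $\partial\mathcal B_{3/2}^+$; (ii) the trace of $V$ on $\{z=0\}$ is $\chi_F-\chi_{F^c}$; (iii) $\overline v=\overline u_2$ in a neighborhood of $\partial\mathcal B_{3/2}^+$, and $\overline v|_{\{z=0\}}\ge0$ a.e. in $F$ and $\overline v|_{\{z=0\}}\le0$ a.e. in $F^c$. Also, $$\int_{\mathcal B_{3/2}^+}z^{1-2s}\left(|\nabla\overline v|^2-|\nabla\overline u_2|^2\right)dX\le\int_{\mathcal B_1^+}z^{1-2s}\left(|\nabla\overline u_1|^2-|\nabla\overline u_2|^2\right)dX+C\epsilon^{-2}\int_{\mathcal B_{1+\epsilon}^+\setminus\mathcal B_{1-\epsilon}^+}z^{1-2s}|\overline u_1-\overline u_2|^2\,dX+C\int_{\mathcal B_{1+\epsilon}^+\setminus\mathcal B_{1-\epsilon}^+}z^{1-2s}\left(|\nabla\overline u_1|^2+|\nabla\overline u_2|^2\right)dX$$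 and $$\int_{\mathcal B_{3/2}^+}z^{1-\sigma}\left(|\nabla V|^2-|\nabla U_2|^2\right)dX\le\int_{\mathcal B_1^+}z^{1-\sigma}\left(|\nabla U_1|^2-|\nabla U_2|^2\right)dX+C\int_{\mathcal B_{1+\epsilon}^+\setminus\mathcal B_{1-\epsilon}^+}z^{1-\sigma}|\nabla\phi|^2|U_1-U_2|^2\,dX+C\int_{\mathcal B_{1+\epsilon}^+\setminus\mathcal B_{1-\epsilon}^+}z^{1-\sigma}\left(|\nabla U_1|^2+|\nabla U_2|^2\right)dX$$ for some constant $C>0$ (independent of $\epsilon$ and of the pairs).
   Context: $B_r=\{x\in\mathbb R^n:|x|<r\}$; $A^c=\mathbb R^n\setminus A$; $\mathbb R^{n+1}_+=\{X=(x,z):x\in\mathbb R^n,z>0\}$, $\mathcal B_r^+=\{X\in\mathbb R^{n+1}_+:|X|<r\}$; in (i), (iii) "neighborhood of $\partial\mathcal B_{3/2}^+$" refers to the spherical part $\{|X|=3/2,\ z\ge0\}$. Admissible pair in $B_2$: a measurable function $u:\mathbb R^n\to\mathbb R$ and a measurable set $E\subseteq\mathbb R^n$ with $u\ge0$ a.e. in $E$, $u\le0$ a.e. in $E^c$, and finite energy $$\iint_{\mathbb R^{2n}\setminus(B_2^c)^2}\frac{|u(x)-u(y)|^2}{|x-y|^{n+2s}}dx\,dy+\mathrm{Per}_\sigma(E,B_2)<+\infty,$$ where $\mathrm{Per}_\sigma(E,\Omega)=\mathcal L(E\cap\Omega,E^c\cap\Omega)+\mathcal L(E\cap\Omega,E^c\cap\Omega^c)+\mathcal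 L(E\cap\Omega^c,E^c\cap\Omega)$ and $\mathcal L(A,B)=\iint_{A\times B}\frac{dx\,dy}{|x-y|^{n+\sigma}}$. Extensions: $\overline u(\cdot,z)=u*P_s(\cdot,z)$ with $P_s(x,z)=c_{n,s}\frac{z^{2s}}{(|x|^2+z^2)^{(n+2s)/2}}$; $U(\cdot,z)=(\chi_E-\chi_{E^c})*P_\sigma(\cdot,z)$ with $P_\sigma(x,z)=c_{n,\sigma}\frac{z^\sigma}{(|x|^2+z^2)^{(n+\sigma)/2}}$ (constants chosen so that both kernels have unit integral in $x$). Cutoff $\phi=\phi_\epsilon:\overline{\mathbb R^{n+1}_+}\to[0,1]$: set $\epsilon'=\epsilon/2$ and, for $X=(x,z)$, $z>0$, let $\phi_1(X)=0$ if $|X|<1-\epsilon'$, $\phi_1(X)=(|X|-1+\epsilon')/(2\epsilon')$ if $1-\epsilon'\le|X|<1+\epsilon'$, $\phi_1(X)=1$ if $|X|\ge1+\epsilon'$; $\phi_2(X)=0$ if $|x|<1-z$, $\phi_2(X)=(|x|-1+z)/(2z)$ if $1-z\le|x|<1+z$, $\phi_2(X)=1$ if $|x|\ge1+z$; $\eta(X)=\min\{z/\epsilon',1\}$; and $\phi=\eta\phi_1+(1-\eta)\phi_2$. It satisfies $\phi=0$ in $\mathcal B_{1-\epsilon}^+$, $\phi=1$ in $\mathbb R^{n+1}_+\setminus\mathcal B_{1+\epsilon}^+$, and $\phi(x,0)=\chi_{\mathbb R^n\setminus B_1}(x)$ for a.e. $x$. *)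

theory Defs
  imports "HOL-Analysis.Analysis"
begin

text \<open>Points of the upper half-space are pairs \<open>X = (x, z)\<close> in \<open>(real ^ 'n) \<times> real\<close>; the norm of the
  product type is the Euclidean one, and \<open>n\<close> is \<open>CARD('n)\<close>.\<close>

definition half_space :: "((real ^ 'n) \<times> real) set" where
  "half_space = {X. snd X > 0}"

definition half_ball :: "real \<Rightarrow> ((real ^ 'n) \<times> real) set" where
  "half_ball r = {X \<in> half_space. norm X < r}"

section \<open>Admissible pairs\<close>

text \<open>In both double integrals the integrand takes the value \<open>0\<close> on the diagonal (division by
  zero); the diagonal is a null set.\<close>

definition interaction :: "real \<Rightarrow> (real ^ 'n) set \<Rightarrow> (real ^ 'n) set \<Rightarrow> ennreal" where
  "interaction \<sigma> A B =
     (\<integral>\<^sup>+ p \<in> A \<times> B. ennreal (1 / norm (fst p - snd p) powr (real CARD('n) + \<sigma>))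
        \<partial>(lebesgue \<Otimes>\<^sub>M lebesgue))"

definition fractional_perimeter :: "real \<Rightarrow> (real ^ 'n) set \<Rightarrow> (real ^ 'n) set \<Rightarrow> ennreal" where
  "fractional_perimeter \<sigma> E \<Omega> =
     interaction \<sigma> (E \<inter> \<Omega>) (- E \<inter> \<Omega>) + interaction \<sigma> (E \<inter> \<Omega>) (- E \<inter> - \<Omega>)
       + interaction \<sigma> (E \<inter> - \<Omega>) (- E \<inter> \<Omega>)"

definition gagliardo_energy :: "real \<Rightarrow> (real ^ 'n \<Rightarrow> real) \<Rightarrow> (real ^ 'n) set \<Rightarrow> ennreal" where
  "gagliardo_energy s u \<Omega> =
     (\<integral>\<^sup>+ p \<in> - ((- \<Omega>) \<times> (- \<Omega>)).
        ennreal (\<bar>u (fst p) - u (snd p)\<bar>\<^sup>2 / norm (fst p - snd p) powr (real CARD('n) + 2 * s))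
        \<partial>(lebesgue \<Otimes>\<^sub>M lebesgue))"

definition admissible_pair ::
  "real \<Rightarrow> real \<Rightarrow> (real ^ 'n) set \<Rightarrow> (real ^ 'n \<Rightarrow> real) \<Rightarrow> (real ^ 'n) set \<Rightarrow> bool" where
  "admissible_pair s \<sigma> \<Omega> u E \<longleftrightarrow>
     u \<in> borel_measurable lebesgue \<and> E \<in> sets lebesgue \<and>
     (AE x in lebesgue. x \<in> E \<longrightarrow> u x \<ge> 0) \<and>
     (AE x in lebesgue. x \<in> - E \<longrightarrow> u x \<le> 0) \<and>
     gagliardo_energy s u \<Omega> + fractional_perimeter \<sigma> E \<Omega> < \<infinity>"

section \<open>Extensions to the half-space\<close>

text \<open>The profile \<open>z\<^sup>a / (|x|\<^sup>2 + z\<^sup>2)\<^bsup>(n+a)/2\<^esup>\<close>, to be used with \<open>a = 2 s\<close> and \<open>a = \<sigma>\<close>. Its integral in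
  \<open>x\<close> does not depend on \<open>z > 0\<close> (substitute \<open>x = z y\<close>), so normalising at \<open>z = 1\<close> gives unit
  integral for every \<open>z > 0\<close>.\<close>

definition poisson_profile :: "real \<Rightarrow> real ^ 'n \<Rightarrow> real \<Rightarrow> real" where
  "poisson_profile a x z =
     z powr a / ((norm x)\<^sup>2 + z\<^sup>2) powr ((real CARD('n) + a) / 2)"

definition poisson_kernel :: "real \<Rightarrow> real ^ 'n \<Rightarrow> real \<Rightarrow> real" where
  "poisson_kernel a x z =
     poisson_profile a x z / (LINT y|lebesgue. poisson_profile a (y :: real ^ 'n) 1)"

definition poisson_extension ::
  "real \<Rightarrow> (real ^ 'n \<Rightarrow> real) \<Rightarrow> (real ^ 'n) \<times> real \<Rightarrow> real" where
  "poisson_extension a f X =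
     (LINT y|lebesgue. f y * poisson_kernel a (fst X - y) (snd X))"

definition sign_of_set :: "'a set \<Rightarrow> 'a \<Rightarrow> real" where
  "sign_of_set E x = indicator E x - indicator (- E) x"

definition s_extension ::
  "real \<Rightarrow> (real ^ 'n \<Rightarrow> real) \<Rightarrow> (real ^ 'n) \<times> real \<Rightarrow> real" where
  "s_extension s u = poisson_extension (2 * s) u"

definition sigma_extension ::
  "real \<Rightarrow> (real ^ 'n) set \<Rightarrow> (real ^ 'n) \<times> real \<Rightarrow> real" where
  "sigma_extension \<sigma> E = poisson_extension \<sigma> (sign_of_set E)"

section \<open>The cutoff\<close>

definition cutoff :: "real \<Rightarrow> (real ^ 'n) \<times> real \<Rightarrow> real" where
  "cutoff \<epsilon> X =
     (let \<epsilon>' = \<epsilon> / 2; x = fst X; z = snd X;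
          \<phi>1 = (if norm X < 1 - \<epsilon>' then 0
                else if norm X < 1 + \<epsilon>' then (norm X - 1 + \<epsilon>') / (2 * \<epsilon>') else 1);
          \<phi>2 = (if norm x < 1 - z then 0
                else if norm x < 1 + z then (norm x - 1 + z) / (2 * z) else 1);
          \<eta> = min (z / \<epsilon>') 1
      in \<eta> * \<phi>1 + (1 - \<eta>) * \<phi>2)"

section \<open>Weak gradients and traces\<close>

definition locally_integrable ::
  "'a::euclidean_space set \<Rightarrow> ('a \<Rightarrow> 'b::euclidean_space) \<Rightarrow> bool" where
  "locally_integrable \<Omega> f \<longleftrightarrow> (\<forall>K. compact K \<and> K \<subseteq> \<Omega> \<longrightarrow> set_integrable lebesgue K f)"

text \<open>Distributional gradient, tested (as in Evans and Gariepy) against compactly supported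
  \<open>C\<^sup>1\<close> functions \<open>\<psi>\<close>, whose gradient is \<open>g\<close>; the identity is the vector form of
  \<open>\<integral> f \<partial>\<^sub>i\<psi> = - \<integral> G\<^sub>i \<psi>\<close>.\<close>

definition is_weak_gradient ::
  "'a::euclidean_space set \<Rightarrow> ('a \<Rightarrow> real) \<Rightarrow> ('a \<Rightarrow> 'a) \<Rightarrow> bool" where
  "is_weak_gradient \<Omega> f G \<longleftrightarrow>
     locally_integrable \<Omega> f \<and> locally_integrable \<Omega> G \<and>
     (\<forall>\<psi> g K. (\<forall>x. GDERIV \<psi> x :> g x) \<and> continuous_on UNIV g \<and>
        compact K \<and> K \<subseteq> \<Omega> \<and> (\<forall>x. x \<notin> K \<longrightarrow> \<psi> x = 0) \<longrightarrow>
        (LINT x:\<Omega>|lebesgue. f x *\<^sub>R g x) = - (LINT x:\<Omega>|lebesgue. \<psi> x *\<^sub>R G x))"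

definition weakly_differentiable :: "'a::euclidean_space set \<Rightarrow> ('a \<Rightarrow> real) \<Rightarrow> bool" where
  "weakly_differentiable \<Omega> f \<longleftrightarrow> (\<exists>G. is_weak_gradient \<Omega> f G)"

text \<open>The weak gradient on the open half-space, which is unique up to null sets. For the
  extensions it is almost everywhere the classical gradient.\<close>

definition grad ::
  "((real ^ 'n) \<times> real \<Rightarrow> real) \<Rightarrow> (real ^ 'n) \<times> real \<Rightarrow> (real ^ 'n) \<times> real" where
  "grad f = (SOME G. is_weak_gradient half_space f G)"

definition finite_weighted_energy ::
  "real \<Rightarrow> real \<Rightarrow> ((real ^ 'n) \<times> real \<Rightarrow> real) \<Rightarrow> bool" where
  "finite_weighted_energy b r f \<longleftrightarrow>
     weakly_differentiable half_space f \<and>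
     set_integrable lebesgue (half_ball r) (\<lambda>X. snd X powr b * (norm (grad f X))\<^sup>2)"

text \<open>The trace on \<open>{z = 0}\<close>, as the limit of the horizontal slices in \<open>L\<^sup>1\<close> on compact sets.\<close>

definition has_trace :: "((real ^ 'n) \<times> real \<Rightarrow> real) \<Rightarrow> (real ^ 'n \<Rightarrow> real) \<Rightarrow> bool" where
  "has_trace f g \<longleftrightarrow>
     (\<forall>K. compact K \<longrightarrow>
        set_integrable lebesgue K g \<and>
        (\<forall>\<^sub>F z in at_right 0. set_integrable lebesgue K (\<lambda>x. f (x, z))) \<and>
        ((\<lambda>z. LINT x:K|lebesgue. \<bar>f (x, z) - g x\<bar>) \<longlongrightarrow> 0) (at_right 0))"

definition agree_near_hemisphere ::
  "real \<Rightarrow> ((real ^ 'n) \<times> real \<Rightarrow> real) \<Rightarrow> ((real ^ 'n) \<times> real \<Rightarrow> real) \<Rightarrow> bool" where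
  "agree_near_hemisphere r f h \<longleftrightarrow>
     (\<exists>N. open N \<and> {X. norm X = r \<and> snd X \<ge> 0} \<subseteq> N \<and> (\<forall>X \<in> N \<inter> half_space. f X = h X))"

end

theory Submission
  imports Defs
begin

text \<open>The set is glued with the given cutoff, \<open>V = (1 - \<phi>) U\<^sub>1 + \<phi> U\<^sub>2\<close>: since \<open>\<phi>\<close> has the discontinuous
  boundary values \<open>0\<close> inside and \<open>1\<close> outside \<open>B\<^sub>1\<close>, the trace is the one of \<open>F\<close>, and the price is
  \<open>|\<nabla>\<phi>|\<^sup>2 |U\<^sub>1 - U\<^sub>2|\<^sup>2\<close>, which is integrable because \<open>|\<nabla>\<phi>| \<le> C (1/\<epsilon> + 1/z)\<close>, the second term being
  present only for \<open>||x| - 1| \<le> z\<close>, and \<open>\<sigma> < 1\<close>. The phases tolerate only gradients of size \<open>1/\<epsilon>\<close>, hence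
  cutoffs that are radial in \<open>X\<close>, and a linear blend of these would violate the sign condition where \<open>u\<^sub>1\<close>
  and \<open>u\<^sub>2\<close> have opposite signs. So \<open>v\<close> passes from \<open>w\<^sub>1\<close> to \<open>w\<^sub>2\<close> through their common part \<open>h(w\<^sub>1, w\<^sub>2)\<close>, where
  \<open>h\<close> is Lipschitz, vanishes if the signs of the arguments differ, has their common sign otherwise, and
  satisfies \<open>|h(a, b) - a| \<le> 9 |a - b|\<close>: the common part is reached from the inside before \<open>|X| = 1\<close> and left
  only afterwards.

  The weighted energies of the extensions are finite by the weighted Cauchy-Schwarz inequality, as the gradient of
  the Poisson kernel has integral zero and \<open>u(y)\<close> may be replaced by \<open>u(y) - u(x)\<close>.\<close>

section \<open>Locally bounded limits of continuously differentiable functions\<close>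

text \<open>\<open>grad\<close> is a choice among weak gradients, so nothing can be computed from it
  before uniqueness almost everywhere is known; after that, every integral of the statement is
  rewritten with an explicit Borel gradient and treated over \<open>lborel\<close>. The common part
  is \<open>h(a, b) = 2 (a + b) (max 0 (a b))^2 / (a^2 + b^2)^2\<close>. It is positively
  homogeneous of degree one, so its first derivatives are homogeneous of degree zero and therefore
  bounded; the square on the positive part makes it C^1 away from the origin. With
  \<open>d > 0\<close> added in the denominator the derivative bound 9 holds for every
  \<open>d\<close>, so the chain rule is only ever applied to C^1 functions. Comparison of
  \<open>h(a, b)\<close> with \<open>h(a, a) = a\<close> bounds the distance to either argument, and
  this is why the gradients of the radial cutoffs multiply only the difference of the two
  extensions. The comparison of energies integrates a pointwise inequality, and Bochner integrals of
  functions that are not integrable are 0; so integrability of every term has to come before any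
  estimate.\<close>

lemma integrable_compact_support:
  fixes h :: "'a::euclidean_space \<Rightarrow> 'b::euclidean_space"
  assumes "continuous_on UNIV h" "compact K" "\<And>x. x \<notin> K \<Longrightarrow> h x = 0"
  shows "integrable lborel h"
proof -
  have "integrable lborel (\<lambda>x. indicator K x *\<^sub>R h x)"
    using assms by (intro borel_integrable_compact) (auto intro: continuous_on_subset)
  also have "(\<lambda>x. indicator K x *\<^sub>R h x) = h"
    using assms(3) by (auto simp: fun_eq_iff indicator_def)
  finally show ?thesis .
qed

lemma GDERIV_imp_continuous_on:
  assumes "\<And>x. x \<in> S \<Longrightarrow> GDERIV f x :> g x"
  shows "continuous_on S f"
  using assms unfolding gderiv_def
  by (meson continuous_at_imp_continuous_on has_derivative_continuous)

lemma GDERIV_transform_open: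
  assumes "GDERIV f x :> D" "open S" "x \<in> S" "\<And>y. y \<in> S \<Longrightarrow> f y = h y"
  shows "GDERIV h x :> D"
  using assms unfolding gderiv_def by (rule has_derivative_transform_within_open)

lemma GDERIV_unique:
  assumes "GDERIV f x :> D" "GDERIV f x :> D'"
  shows "D = D'"
proof -
  have "(\<lambda>h. inner h D) = (\<lambda>h. inner h D')"
    using assms unfolding gderiv_def by (rule has_derivative_unique)
  then have "inner (D - D') D = inner (D - D') D'" by metis
  then have "inner (D - D') (D - D') = 0" by (simp add: inner_diff_right)
  then show ?thesis by simp
qed

lemma GDERIV_zero_outside:
  assumes "\<And>x. GDERIV f x :> g x" "closed K" "\<And>x. x \<notin> K \<Longrightarrow> f x = (0::real)" "x \<notin> K"
  shows "g x = 0"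
proof -
  have "GDERIV f x :> 0"
    by (rule GDERIV_transform_open[OF GDERIV_const[of 0], of "- K"]) (use assms in auto)
  then show ?thesis using assms(1) GDERIV_unique by blast
qed

text \<open>By translation invariance of \<open>lborel\<close> the difference quotients of
  \<open>f\<close> have integral zero. They converge to the partial derivative, dominated by the
  Lipschitz constant of \<open>f\<close> on a ball that contains all supports, since the steps
  \<open>t k\<close> are at most 1.\<close>

lemma integral_gradient_compact_support:
  fixes f :: "'a::euclidean_space \<Rightarrow> real"
  assumes f: "\<And>x. GDERIV f x :> g x" and g: "continuous_on UNIV g"
    and K: "compact K" "\<And>x. x \<notin> K \<Longrightarrow> f x = 0"
  shows "integrable lborel g" "(LINT x|lborel. g x) = 0"
proof -
  have g0: "g x = 0" if "x \<notin> K" for x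
    using GDERIV_zero_outside[OF f compact_imp_closed[OF K(1)] K(2) that] by simp
  show gi: "integrable lborel g" using integrable_compact_support[OF g K(1) g0] .
  have cf: "continuous_on UNIV f" using f by (intro GDERIV_imp_continuous_on)
  have fi: "integrable lborel f" using integrable_compact_support[OF cf K] .
  obtain M where M: "M > 0" "\<And>x. x \<in> K \<Longrightarrow> norm (g x) \<le> M"
    using compact_imp_bounded[OF compact_continuous_image[OF continuous_on_subset[OF g subset_UNIV] K(1)]]
    unfolding bounded_pos by auto
  then have M': "norm (g x) \<le> M" for x using g0[of x] by (cases "x \<in> K") auto
  have on: "onorm (\<lambda>h. inner h (g x)) \<le> M" for x
  proof (rule onorm_le)
    show "norm (inner h (g x)) \<le> M * norm h" for h
      using Cauchy_Schwarz_ineq2[of h "g x"] mult_left_mono[OF M'[of x] norm_ge_zero[of h]]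
      by (simp add: mult.commute)
  qed
  have lip: "\<bar>f x - f y\<bar> \<le> M * norm (x - y)" for x y
    using differentiable_bound[OF convex_UNIV, of f "\<lambda>x h. inner h (g x)" M x y] f on
    unfolding gderiv_def by simp
  obtain R where R: "\<And>x. x \<in> K \<Longrightarrow> norm x \<le> R" using compact_imp_bounded[OF K(1)] unfolding bounded_iff by auto
  have "inner (LINT x|lborel. g x) e = 0" if e: "e \<in> Basis" for e
  proof -
    define t where "t k = 1 / real (Suc k)" for k
    define D where "D k x = (f (x + t k *\<^sub>R e) - f x) / t k" for k x
    have tpos: "t k > 0" "t k \<le> 1" for k by (auto simp: t_def)
    have t0: "t \<longlonglongrightarrow> 0" unfolding t_def by (rule LIMSEQ_Suc[OF lim_1_over_n])
    have lim: "(\<lambda>k. D k x) \<longlonglongrightarrow> inner (g x) e" for x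
    proof -
      have "((\<lambda>s. f (x + s *\<^sub>R e)) has_derivative (\<lambda>s. inner (s *\<^sub>R e) (g x))) (at 0)"
        by (rule has_derivative_compose[where g=f and f="\<lambda>s. x + s *\<^sub>R e"])
          (use f[unfolded gderiv_def, of x] in \<open>auto intro!: derivative_eq_intros\<close>)
      then have "((\<lambda>s. f (x + s *\<^sub>R e)) has_field_derivative (inner (g x) e)) (at 0)"
        unfolding has_field_derivative_def by (rule has_derivative_eq_rhs) (auto simp: inner_commute)
      then have "((\<lambda>s. (f (x + s *\<^sub>R e) - f x) / s) \<longlongrightarrow> inner (g x) e) (at 0)"
        unfolding DERIV_def by simp
      moreover have "filterlim t (at 0) sequentially"
        using t0 tpos(1) by (simp add: filterlim_at less_imp_neq[symmetric])
      ultimately show ?thesis unfolding D_def by (rule filterlim_compose)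
    qed
    have Dint: "integrable lborel (D k)" "(LINT x|lborel. D k x) = 0" for k
    proof -
      have i: "integrable lborel (\<lambda>x. f (t k *\<^sub>R e + x))"
        "(LINT x|lborel. f (t k *\<^sub>R e + x)) = (LINT x|lborel. f x)"
        using fi integrable_distr_eq[of "(+) (t k *\<^sub>R e)" lborel borel f]
          integral_distr[of "(+) (t k *\<^sub>R e)" lborel borel f] lborel_distr_plus[of "t k *\<^sub>R e"]
        by (auto simp: cf borel_measurable_continuous_onI)
      then show "integrable lborel (D k)" "(LINT x|lborel. D k x) = 0"
        unfolding D_def using fi by (auto simp: add.commute)
    qed
    have "(\<lambda>k. LINT x|lborel. D k x) \<longlonglongrightarrow> (LINT x|lborel. inner (g x) e)"
    proof (rule integral_dominated_convergence[where w="\<lambda>x. indicator (cball 0 (R + 1)) x *\<^sub>R M"])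
      show "integrable lborel (\<lambda>x. indicator (cball (0::'a) (R + 1)) x *\<^sub>R M)"
        by (intro borel_integrable_compact) auto
      show "AE x in lborel. norm (D k x) \<le> indicator (cball 0 (R + 1)) x *\<^sub>R M" for k
      proof (intro AE_I2)
        fix x
        have 1: "\<bar>D k x\<bar> \<le> M"
          using lip[of "x + t k *\<^sub>R e" x] tpos[of k] e by (simp add: D_def field_simps)
        have 2: "D k x = 0" if "x \<notin> cball 0 (R + 1)"
        proof -
          have n: "norm x > R + 1" using that by simp
          have "norm x \<le> norm (x + t k *\<^sub>R e) + norm (t k *\<^sub>R e)"
            by (metis add_diff_cancel norm_triangle_ineq4)
          then have "norm (x + t k *\<^sub>R e) > R" using n tpos[of k] e by simp
          then have "x \<notin> K" "x + t k *\<^sub>R e \<notin> K" using R n by (force, force)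
          then show ?thesis by (simp add: D_def K(2))
        qed
        show "norm (D k x) \<le> indicator (cball 0 (R + 1)) x *\<^sub>R M"
          using 1 2 by (auto simp: indicator_def)
      qed
    qed (use gi Dint lim in auto)
    then show ?thesis using Dint(2) gi by (simp add: LIMSEQ_const_iff)
  qed
  then show "(LINT x|lborel. g x) = 0" by (subst euclidean_eq_iff) simp
qed

text \<open>The statement integrates over \<open>lebesgue\<close>, while Fubini and changes of
  variables are carried out over \<open>lborel\<close>; this is the bridge for integrands that are
  Borel after restriction to \<open>A\<close>.\<close>

lemma set_integrable_lebesgue_eq:
  fixes f :: "'a::euclidean_space \<Rightarrow> 'b::{banach, second_countable_topology}"
  assumes "(\<lambda>x. indicator A x *\<^sub>R f x) \<in> borel_measurable borel"
  shows "set_integrable lebesgue A f \<longleftrightarrow> set_integrable lborel A f"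
    "set_lebesgue_integral lebesgue A f = set_lebesgue_integral lborel A f"
  using assms integrable_completion[of "\<lambda>x. indicator A x *\<^sub>R f x" lborel]
    integral_completion[of "\<lambda>x. indicator A x *\<^sub>R f x" lborel]
  unfolding set_integrable_def set_lebesgue_integral_def by simp_all

lemma locally_integrable_continuous:
  fixes f :: "'a::euclidean_space \<Rightarrow> 'b::euclidean_space"
  assumes "continuous_on \<Omega> f" shows "locally_integrable \<Omega> f"
  unfolding locally_integrable_def
proof safe
  fix K assume K: "compact K" "K \<subseteq> \<Omega>"
  have "integrable lborel (\<lambda>x. indicator K x *\<^sub>R f x)"
    using K assms by (intro borel_integrable_compact) (auto intro: continuous_on_subset)
  then show "set_integrable lebesgue K f"
    unfolding set_integrable_def by (simp add: integrable_completion borel_measurable_integrable)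
qed

text \<open>The open set \<Omega> and the open complement of \<open>K\<close>, on which the
  extension is zero, cover the space.\<close>

lemma continuous_on_zero_extension:
  fixes h :: "'a::topological_space \<Rightarrow> 'b::real_normed_vector"
  assumes "open \<Omega>" "closed K" "K \<subseteq> \<Omega>" "continuous_on \<Omega> h" "\<And>x. x \<in> \<Omega> - K \<Longrightarrow> h x = 0"
  shows "continuous_on UNIV (\<lambda>x. indicator \<Omega> x *\<^sub>R h x)"
proof -
  have "continuous_on (\<Omega> \<union> - K) (\<lambda>x. indicator \<Omega> x *\<^sub>R h x)"
  proof (rule continuous_on_open_Un)
    show "continuous_on \<Omega> (\<lambda>x. indicator \<Omega> x *\<^sub>R h x)"
      using assms(4) by (rule continuous_on_eq) auto
    show "continuous_on (- K) (\<lambda>x. indicator \<Omega> x *\<^sub>R h x)"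
      by (rule continuous_on_eq[of _ "\<lambda>_. 0"]) (use assms(5) in \<open>auto simp: indicator_def\<close>)
  qed (use assms in auto)
  moreover have "\<Omega> \<union> - K = UNIV" using assms(3) by auto
  ultimately show ?thesis by simp
qed

text \<open>Integration by parts without boundary terms: the product of \<open>f\<close> and the
  test function, extended by zero, is C^1 with compact support, so its gradient, the sum of the two
  integrands, has integral zero.\<close>

lemma is_weak_gradient_C1:
  fixes f :: "'a::euclidean_space \<Rightarrow> real"
  assumes \<Omega>: "open \<Omega>" and f: "\<And>x. x \<in> \<Omega> \<Longrightarrow> GDERIV f x :> G x" and G: "continuous_on \<Omega> G"
  shows "is_weak_gradient \<Omega> f G"
  unfolding is_weak_gradient_def
proof (intro conjI allI impI)
  have cf: "continuous_on \<Omega> f" using f by (rule GDERIV_imp_continuous_on)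
  show "locally_integrable \<Omega> f" "locally_integrable \<Omega> G"
    using cf G by (auto intro: locally_integrable_continuous)
  fix \<psi> g K
  assume *: "(\<forall>x. GDERIV \<psi> x :> g x) \<and> continuous_on UNIV g \<and> compact K \<and> K \<subseteq> \<Omega> \<and> (\<forall>x. x \<notin> K \<longrightarrow> \<psi> x = 0)"
  then have \<psi>: "\<And>x. GDERIV \<psi> x :> g x" "continuous_on UNIV g" and K: "compact K" "K \<subseteq> \<Omega>"
    and \<psi>0: "\<And>x. x \<notin> K \<Longrightarrow> \<psi> x = 0" by auto
  have clK: "closed K" using K compact_imp_closed by auto
  have g0: "g x = 0" if "x \<notin> K" for x
    using GDERIV_zero_outside[OF \<psi>(1) clK \<psi>0 that] by simp
  have c\<psi>: "continuous_on UNIV \<psi>" using \<psi>(1) by (intro GDERIV_imp_continuous_on)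
  define A where "A x = indicator \<Omega> x *\<^sub>R (f x *\<^sub>R g x)" for x
  define B where "B x = indicator \<Omega> x *\<^sub>R (\<psi> x *\<^sub>R G x)" for x
  have cA: "continuous_on UNIV A" unfolding A_def
    by (rule continuous_on_zero_extension[OF \<Omega> clK K(2)])
      (use cf \<psi>(2) g0 in \<open>auto intro!: continuous_intros intro: continuous_on_subset\<close>)
  have cB: "continuous_on UNIV B" unfolding B_def
    by (rule continuous_on_zero_extension[OF \<Omega> clK K(2)])
      (use c\<psi> G \<psi>0 in \<open>auto intro!: continuous_intros intro: continuous_on_subset\<close>)
  have iA: "integrable lborel A" and iB: "integrable lborel B"
    by (rule integrable_compact_support[OF cA K(1)], use g0 in \<open>simp add: A_def\<close>)
      (rule integrable_compact_support[OF cB K(1)], use \<psi>0 in \<open>simp add: B_def\<close>)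
  have "GDERIV (\<lambda>x. indicator \<Omega> x * (f x * \<psi> x)) x :> A x + B x" for x
  proof (cases "x \<in> \<Omega>")
    case True
    show ?thesis
      by (rule GDERIV_transform_open[OF _ \<Omega> True, of "\<lambda>x. f x * \<psi> x"])
        (use GDERIV_mult[OF f[OF True] \<psi>(1)[of x]] True in \<open>auto simp: A_def B_def\<close>)
  next
    case False
    then have xK: "x \<in> - K" using K by auto
    show ?thesis
      by (rule GDERIV_transform_open[of "\<lambda>_. 0" x _ "- K"])
       (use False xK clK \<psi>0 in \<open>auto simp: A_def B_def GDERIV_const\<close>)
  qed
  then have "(LINT x|lborel. A x + B x) = 0"
    by (rule integral_gradient_compact_support(2)[OF _ _ K(1)])
      (use cA cB \<psi>0 in \<open>auto intro!: continuous_intros\<close>)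
  then have "(LINT x|lborel. A x) = - (LINT x|lborel. B x)"
    using iA iB by (simp add: eq_neg_iff_add_eq_0)
  then show "(LINT x:\<Omega>|lebesgue. f x *\<^sub>R g x) = - (LINT x:\<Omega>|lebesgue. \<psi> x *\<^sub>R G x)"
    unfolding set_lebesgue_integral_def A_def[symmetric] B_def[symmetric]
    using iA iB by (simp add: integral_completion borel_measurable_integrable)
qed

text \<open>Dominated convergence turns these pointwise limits into weak gradients. The class contains all the
  competitors below and is closed under sums and products, so that no general Sobolev calculus is needed.\<close>

definition c1_limit :: "'a::euclidean_space set \<Rightarrow> ('a \<Rightarrow> real) \<Rightarrow> ('a \<Rightarrow> 'a) \<Rightarrow> bool" where
  "c1_limit \<Omega> f G \<longleftrightarrow> (\<exists>F H. (\<forall>k::nat. \<forall>x\<in>\<Omega>. GDERIV (F k) x :> H k x) \<and> (\<forall>k. continuous_on \<Omega> (H k)) \<and>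
     (\<forall>x\<in>\<Omega>. (\<lambda>k. F k x) \<longlonglongrightarrow> f x) \<and> (\<forall>x\<in>\<Omega>. (\<lambda>k. H k x) \<longlonglongrightarrow> G x) \<and>
     (\<forall>K. compact K \<and> K \<subseteq> \<Omega> \<longrightarrow> (\<exists>B. \<forall>k. \<forall>x\<in>K. \<bar>F k x\<bar> \<le> B \<and> norm (H k x) \<le> B)))"

lemma borel_measurable_limit_indicator:
  fixes F :: "nat \<Rightarrow> 'a::topological_space \<Rightarrow> 'b::euclidean_space"
  assumes "A \<in> sets borel" "\<And>k. continuous_on A (F k)" "\<And>x. x \<in> A \<Longrightarrow> (\<lambda>k. F k x) \<longlonglongrightarrow> f x"
  shows "(\<lambda>x. indicator A x *\<^sub>R f x) \<in> borel_measurable borel"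
proof (rule borel_measurable_LIMSEQ_metric)
  show "(\<lambda>x. indicator A x *\<^sub>R F k x) \<in> borel_measurable borel" for k
    using assms by (intro borel_measurable_continuous_on_indicator)
  show "(\<lambda>k. indicator A x *\<^sub>R F k x) \<longlonglongrightarrow> indicator A x *\<^sub>R f x" for x
    using assms(3)[of x] by (auto simp: indicator_def)
qed

text \<open>A limit is prescribed only on \<Omega>, hence the products with the indicator.\<close>

lemma c1_limit_measurable:
  fixes f :: "'a::euclidean_space \<Rightarrow> real"
  assumes "c1_limit \<Omega> f G" "open \<Omega>"
  shows "(\<lambda>x. indicator \<Omega> x * f x) \<in> borel_measurable borel"
    "(\<lambda>x. indicator \<Omega> x *\<^sub>R G x) \<in> borel_measurable borel"
proof -
  obtain F H where *: "\<And>k x. x \<in> \<Omega> \<Longrightarrow> GDERIV (F k) x :> H k x" "\<And>k. continuous_on \<Omega> (H k)"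
     "\<And>x. x \<in> \<Omega> \<Longrightarrow> (\<lambda>k::nat. F k x) \<longlonglongrightarrow> f x" "\<And>x. x \<in> \<Omega> \<Longrightarrow> (\<lambda>k. H k x) \<longlonglongrightarrow> G x"
    using assms(1) unfolding c1_limit_def by metis
  show "(\<lambda>x. indicator \<Omega> x *\<^sub>R G x) \<in> borel_measurable borel"
    using assms(2) *(2,4) by (intro borel_measurable_limit_indicator[of _ H]) auto
  have "(\<lambda>x. indicator \<Omega> x *\<^sub>R f x) \<in> borel_measurable borel"
    using assms(2) *(3) GDERIV_imp_continuous_on[OF *(1)]
    by (intro borel_measurable_limit_indicator[of _ F]) auto
  then show "(\<lambda>x. indicator \<Omega> x * f x) \<in> borel_measurable borel" by simp
qed

lemma set_integrable_bounded_limit: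
  fixes F :: "nat \<Rightarrow> 'a::euclidean_space \<Rightarrow> 'b::euclidean_space"
  assumes K: "compact K" "\<And>k. continuous_on K (F k)" "\<And>x. x \<in> K \<Longrightarrow> (\<lambda>k. F k x) \<longlonglongrightarrow> f x"
    "\<And>k x. x \<in> K \<Longrightarrow> norm (F k x) \<le> B"
  shows "set_integrable lebesgue K f"
proof -
  have m: "(\<lambda>x. indicator K x *\<^sub>R f x) \<in> borel_measurable borel"
    using K by (intro borel_measurable_limit_indicator[of _ F]) (auto intro: borel_compact)
  have "norm (f x) \<le> B" if "x \<in> K" for x
    using tendsto_norm[OF K(3)[OF that]] K(4)[OF that] by (intro LIMSEQ_le_const2) auto
  then have "integrable lborel (\<lambda>x. indicator K x *\<^sub>R f x)"
    using m borel_integrable_compact[OF K(1), of "\<lambda>_. B"]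
    by (intro Bochner_Integration.integrable_bound[of lborel "\<lambda>x. indicator K x *\<^sub>R B" "\<lambda>x. indicator K x *\<^sub>R f x"])
      (auto simp: indicator_def intro!: AE_I2 order_trans[OF _ abs_ge_self])
  then show ?thesis
    unfolding set_integrable_lebesgue_eq(1)[OF m] by (simp add: set_integrable_def)
qed

lemma tendsto_integral_compact:
  fixes F :: "nat \<Rightarrow> 'a::euclidean_space \<Rightarrow> 'b::euclidean_space"
  assumes K: "compact K" "\<And>k. continuous_on K (F k)" "\<And>x. x \<in> K \<Longrightarrow> (\<lambda>k. F k x) \<longlonglongrightarrow> f x"
    "\<And>k x. x \<in> K \<Longrightarrow> norm (F k x) \<le> B"
  shows "(\<lambda>k. LINT x|lebesgue. indicator K x *\<^sub>R F k x) \<longlonglongrightarrow> (LINT x|lebesgue. indicator K x *\<^sub>R f x)"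
proof (rule integral_dominated_convergence[where w="\<lambda>x. indicator K x *\<^sub>R B"])
  show "integrable lebesgue (\<lambda>x. indicator K x *\<^sub>R B)"
    by (rule integrable_completion[THEN iffD2])
      (use borel_integrable_compact[OF K(1), of "\<lambda>_. B"] in \<open>auto intro: borel_measurable_integrable\<close>)
  show "(\<lambda>x. indicator K x *\<^sub>R f x) \<in> borel_measurable lebesgue"
    by (rule measurable_completion)
      (use borel_measurable_limit_indicator[of K F f] K in \<open>auto intro: borel_compact\<close>)
  show "(\<lambda>x. indicator K x *\<^sub>R F k x) \<in> borel_measurable lebesgue" for k
    by (rule measurable_completion)
      (use borel_measurable_continuous_on_indicator[of K "F k"] K in \<open>auto intro: borel_compact\<close>)
qed (use K in \<open>auto simp: indicator_def intro!: AE_I2\<close>)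

lemma c1_limit_is_weak_gradient:
  fixes f :: "'a::euclidean_space \<Rightarrow> real"
  assumes lim: "c1_limit \<Omega> f G" and \<Omega>: "open \<Omega>"
  shows "is_weak_gradient \<Omega> f G"
proof -
  obtain F H where 1: "\<And>k x. x \<in> \<Omega> \<Longrightarrow> GDERIV (F k) x :> H k x" "\<And>k. continuous_on \<Omega> (H k)"
     "\<And>x. x \<in> \<Omega> \<Longrightarrow> (\<lambda>k::nat. F k x) \<longlonglongrightarrow> f x" "\<And>x. x \<in> \<Omega> \<Longrightarrow> (\<lambda>k. H k x) \<longlonglongrightarrow> G x"
    and bd: "\<And>K. compact K \<and> K \<subseteq> \<Omega> \<Longrightarrow> (\<exists>B. \<forall>k. \<forall>x\<in>K. \<bar>F k x\<bar> \<le> B \<and> norm (H k x) \<le> B)"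
    using lim unfolding c1_limit_def by metis
  have cF: "continuous_on \<Omega> (F k)" for k using 1(1) by (rule GDERIV_imp_continuous_on)
  have LI: "set_integrable lebesgue K f" "set_integrable lebesgue K G" if K: "compact K" "K \<subseteq> \<Omega>" for K
  proof -
    obtain B where "\<And>k x. x \<in> K \<Longrightarrow> \<bar>F k x\<bar> \<le> B \<and> norm (H k x) \<le> B" using bd K by metis
    then show "set_integrable lebesgue K f" "set_integrable lebesgue K G"
      using K 1(3,4) continuous_on_subset[OF cF K(2)] continuous_on_subset[OF 1(2) K(2)]
        set_integrable_bounded_limit[of K F f B] set_integrable_bounded_limit[of K H G B]
      by (auto simp: subset_iff)
  qed
  show ?thesis unfolding is_weak_gradient_def locally_integrable_def
  proof (intro conjI allI impI)
    fix \<psi> g K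
    assume *: "(\<forall>x. GDERIV \<psi> x :> g x) \<and> continuous_on UNIV g \<and> compact K \<and> K \<subseteq> \<Omega> \<and> (\<forall>x. x \<notin> K \<longrightarrow> \<psi> x = 0)"
    then have \<psi>: "\<And>x. GDERIV \<psi> x :> g x" "continuous_on UNIV g" and K: "compact K" "K \<subseteq> \<Omega>"
      and \<psi>0: "\<And>x. x \<notin> K \<Longrightarrow> \<psi> x = 0" by auto
    have clK: "closed K" using K compact_imp_closed by auto
    have g0: "g x = 0" if "x \<notin> K" for x
      using GDERIV_zero_outside[OF \<psi>(1) clK \<psi>0 that] by simp
    have c\<psi>: "continuous_on UNIV \<psi>" using \<psi>(1) by (intro GDERIV_imp_continuous_on)
    have eq: "(LINT x:\<Omega>|lebesgue. h x) = (LINT x|lebesgue. indicator K x *\<^sub>R h x)"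
      if "\<And>x. x \<notin> K \<Longrightarrow> h x = 0" for h :: "'a \<Rightarrow> 'a"
      unfolding set_lebesgue_integral_def
      by (intro Bochner_Integration.integral_cong) (use that K in \<open>auto simp: indicator_def\<close>)
    obtain B where B: "\<And>k x. x \<in> K \<Longrightarrow> \<bar>F k x\<bar> \<le> B" "\<And>k x. x \<in> K \<Longrightarrow> norm (H k x) \<le> B" using bd K by metis
    obtain C where C: "\<And>x. x \<in> K \<Longrightarrow> norm (g x) \<le> C" "\<And>x. x \<in> K \<Longrightarrow> \<bar>\<psi> x\<bar> \<le> C"
    proof -
      have "bounded (g ` K)" "bounded (\<psi> ` K)"
        using c\<psi> \<psi>(2) K by (auto intro!: compact_imp_bounded compact_continuous_image intro: continuous_on_subset)
      then obtain C1 C2 where "\<And>x. x \<in> K \<Longrightarrow> norm (g x) \<le> C1" "\<And>x. x \<in> K \<Longrightarrow> \<bar>\<psi> x\<bar> \<le> C2"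
        unfolding bounded_iff by auto
      then show ?thesis by (intro that[of "max C1 C2"]) (auto simp: le_max_iff_disj)
    qed
    have "(\<lambda>k. LINT x|lebesgue. indicator K x *\<^sub>R (F k x *\<^sub>R g x)) \<longlonglongrightarrow> (LINT x|lebesgue. indicator K x *\<^sub>R (f x *\<^sub>R g x))"
    proof (rule tendsto_integral_compact[OF K(1)])
      show "continuous_on K (\<lambda>x. F k x *\<^sub>R g x)" for k
        using cF \<psi>(2) K by (auto intro!: continuous_intros intro: continuous_on_subset)
      show "norm (F k x *\<^sub>R g x) \<le> B * C" if "x \<in> K" for k x
        using mult_mono[OF B(1)[OF that, of k] C(1)[OF that]] B(1)[OF that, of k] by auto
      show "(\<lambda>k. F k x *\<^sub>R g x) \<longlonglongrightarrow> f x *\<^sub>R g x" if "x \<in> K" for x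
        using 1(3) K that by (intro tendsto_intros) auto
    qed
    then have L1: "(\<lambda>k. LINT x:\<Omega>|lebesgue. F k x *\<^sub>R g x) \<longlonglongrightarrow> (LINT x:\<Omega>|lebesgue. f x *\<^sub>R g x)"
      using g0 by (simp add: eq)
    have "(\<lambda>k. LINT x|lebesgue. indicator K x *\<^sub>R (\<psi> x *\<^sub>R H k x)) \<longlonglongrightarrow> (LINT x|lebesgue. indicator K x *\<^sub>R (\<psi> x *\<^sub>R G x))"
    proof (rule tendsto_integral_compact[OF K(1)])
      show "continuous_on K (\<lambda>x. \<psi> x *\<^sub>R H k x)" for k
        using 1(2) c\<psi> K by (auto intro!: continuous_intros intro: continuous_on_subset)
      show "norm (\<psi> x *\<^sub>R H k x) \<le> C * B" if "x \<in> K" for k x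
        using mult_mono[OF C(2)[OF that] B(2)[OF that, of k]] C(2)[OF that] by auto
      show "(\<lambda>k. \<psi> x *\<^sub>R H k x) \<longlonglongrightarrow> \<psi> x *\<^sub>R G x" if "x \<in> K" for x
        using 1(4) K that by (intro tendsto_intros) auto
    qed
    then have L2: "(\<lambda>k. LINT x:\<Omega>|lebesgue. \<psi> x *\<^sub>R H k x) \<longlonglongrightarrow> (LINT x:\<Omega>|lebesgue. \<psi> x *\<^sub>R G x)"
      using \<psi>0 by (simp add: eq)
    have "(LINT x:\<Omega>|lebesgue. F k x *\<^sub>R g x) = - (LINT x:\<Omega>|lebesgue. \<psi> x *\<^sub>R H k x)" for k
      using is_weak_gradient_C1[OF \<Omega> 1(1)[of _ k] 1(2)] * unfolding is_weak_gradient_def by blast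
    then show "(LINT x:\<Omega>|lebesgue. f x *\<^sub>R g x) = - (LINT x:\<Omega>|lebesgue. \<psi> x *\<^sub>R G x)"
      using L1 tendsto_minus[OF L2] LIMSEQ_unique by force
  qed (use LI in auto)
qed

section \<open>Uniqueness of weak gradients\<close>

text \<open>The basic C^1 function that vanishes on a half-line. Test functions in
  \<open>is_weak_gradient\<close> are only C^1, so bumps can be built from it; it also underlies
  \<open>smooth_norm\<close>, \<open>smooth_step\<close> and the numerator of
  \<open>common_part\<close>.\<close>

definition pos_part_sq :: "real \<Rightarrow> real" where "pos_part_sq t = (max 0 t)\<^sup>2"

lemma DERIV_pos_part_sq: "DERIV pos_part_sq t :> 2 * max 0 t"
proof (cases "t = 0")
  case True
  have "(\<lambda>h. \<bar>pos_part_sq h / h\<bar>) \<midarrow>0\<rightarrow> 0"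
  proof (rule tendsto_sandwich[of "\<lambda>_. 0" _ _ "\<lambda>h. \<bar>h\<bar>"])
    show "\<forall>\<^sub>F h in at 0. \<bar>pos_part_sq h / h\<bar> \<le> \<bar>h\<bar>"
      by (intro always_eventually allI) (auto simp: pos_part_sq_def max_def power2_eq_square)
  qed (auto intro!: tendsto_eq_intros)
  then have "(\<lambda>h. pos_part_sq h / h) \<midarrow>0\<rightarrow> 0" by (rule tendsto_rabs_zero_cancel)
  then show ?thesis using True by (simp add: DERIV_def) (simp add: pos_part_sq_def)
next
  case False
  then consider "t > 0" | "t < 0" by linarith
  then show ?thesis
  proof cases
    case 1
    have "DERIV (\<lambda>t. t\<^sup>2) t :> 2 * t" by (auto intro!: derivative_eq_intros)
    then show ?thesis
      using 1 by (subst DERIV_cong_ev[where g="\<lambda>t. t\<^sup>2", OF refl])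
        (auto simp: pos_part_sq_def intro!: eventually_mono[OF eventually_nhds_in_open[of "{0<..}"]])
  next
    case 2
    then show ?thesis
      by (subst DERIV_cong_ev[where g="\<lambda>t. 0", OF refl])
        (auto simp: pos_part_sq_def intro!: eventually_mono[OF eventually_nhds_in_open[of "{..<0}"]])
  qed
qed

lemma continuous_on_pos_part_sq [continuous_intros]:
  "continuous_on S f \<Longrightarrow> continuous_on S (\<lambda>x. pos_part_sq (f x))"
  unfolding pos_part_sq_def by (auto intro!: continuous_intros)

definition continuously_differentiable :: "('a::euclidean_space \<Rightarrow> real) \<Rightarrow> bool" where
  "continuously_differentiable f \<longleftrightarrow> (\<exists>g. (\<forall>x. GDERIV f x :> g x) \<and> continuous_on UNIV g)"

lemma continuously_differentiable_mult:
  assumes "continuously_differentiable f" "continuously_differentiable g"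
  shows "continuously_differentiable (\<lambda>x. f x * g x)"
proof -
  obtain f' g' where *: "\<And>x. GDERIV f x :> f' x" "continuous_on UNIV f'"
    "\<And>x. GDERIV g x :> g' x" "continuous_on UNIV g'"
    using assms unfolding continuously_differentiable_def by auto
  then have "continuous_on UNIV f" "continuous_on UNIV g"
    by (auto intro: GDERIV_imp_continuous_on)
  then show ?thesis unfolding continuously_differentiable_def
    using * by (intro exI[of _ "\<lambda>x. f x *\<^sub>R g' x + g x *\<^sub>R f' x"])
     (auto intro!: continuous_intros GDERIV_mult)
qed

lemma continuously_differentiable_const: "continuously_differentiable (\<lambda>x. c)"
  unfolding continuously_differentiable_def by (intro exI[of _ "\<lambda>x. 0"]) (auto simp: GDERIV_const)

lemma continuously_differentiable_prod:
  assumes "\<And>i. i \<in> I \<Longrightarrow> continuously_differentiable (f i)"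
  shows "continuously_differentiable (\<lambda>x. \<Prod>i\<in>I. f i x)"
  using assms
  by (induction I rule: infinite_finite_induct)
    (auto intro: continuously_differentiable_const continuously_differentiable_mult)

lemma continuously_differentiable_compose:
  assumes "continuously_differentiable f" "\<And>x. DERIV h (f x) :> h' (f x)" "continuous_on (range f) h'"
  shows "continuously_differentiable (\<lambda>x. h (f x))"
proof -
  obtain f' where *: "\<And>x. GDERIV f x :> f' x" "continuous_on UNIV f'"
    using assms unfolding continuously_differentiable_def by auto
  then have "continuous_on UNIV f"
    by (auto intro: GDERIV_imp_continuous_on)
  then have "continuous_on UNIV (\<lambda>x. h' (f x))"
    using continuous_on_compose2[OF assms(3)] by auto
  then show ?thesis unfolding continuously_differentiable_def
    using * assms(2) by (intro exI[of _ "\<lambda>x. h' (f x) *\<^sub>R f' x"])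
     (auto intro!: continuous_intros intro: GDERIV_DERIV_compose[of f _ _ h])
qed

lemma continuously_differentiable_inner_diff:
  "continuously_differentiable (\<lambda>x. inner x i - c)" "continuously_differentiable (\<lambda>x. c - inner x i)"
  unfolding continuously_differentiable_def gderiv_def
proof -
  show "\<exists>g. (\<forall>x. ((\<lambda>x. inner x i - c) has_derivative (\<lambda>h. inner h (g x))) (at x)) \<and> continuous_on UNIV g"
    by (rule exI[of _ "\<lambda>_. i"]) (auto intro!: derivative_eq_intros)
  show "\<exists>g. (\<forall>x. ((\<lambda>x. c - inner x i) has_derivative (\<lambda>h. inner h (g x))) (at x)) \<and> continuous_on UNIV g"
    by (rule exI[of _ "\<lambda>_. - i"]) (auto intro!: derivative_eq_intros)
qed

text \<open>\<open>p\<close> is positive exactly in the box, as a product of one-sided squares, one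
  for each face. Then \<open>1 - 1 / (1 + k p)\<close> is 0 where \<open>p\<close> is 0 and tends to
  1 where \<open>p\<close> is positive.\<close>

lemma bump_box:
  fixes a b :: "'a::euclidean_space"
  obtains \<psi> :: "nat \<Rightarrow> 'a \<Rightarrow> real" where
    "\<And>k. continuously_differentiable (\<psi> k)" "\<And>k x. x \<notin> box a b \<Longrightarrow> \<psi> k x = 0"
    "\<And>k x. \<bar>\<psi> k x\<bar> \<le> 1" "\<And>x. (\<lambda>k. \<psi> k x) \<longlonglongrightarrow> indicator (box a b) x"
proof -
  define p where "p x = (\<Prod>i\<in>Basis. pos_part_sq (inner x i - inner a i) * pos_part_sq (inner b i - inner x i))" for x
  have p0: "p x \<ge> 0" for x unfolding p_def pos_part_sq_def by (intro prod_nonneg) auto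
  have pz: "p x = 0" if x: "x \<notin> box a b" for x
  proof -
    obtain i where "i \<in> Basis" "\<not> (inner a i < inner x i \<and> inner x i < inner b i)"
      using x unfolding mem_box by blast
    then show ?thesis unfolding p_def by (intro prod_zero) (auto simp: pos_part_sq_def intro!: bexI[of _ i])
  qed
  have pp: "p x > 0" if "x \<in> box a b" for x
    using that unfolding p_def by (intro prod_pos) (auto simp: mem_box pos_part_sq_def)
  have cpos: "continuously_differentiable (\<lambda>x. pos_part_sq (f x))" if "continuously_differentiable f" for f :: "'a \<Rightarrow> real"
    by (rule continuously_differentiable_compose[OF that DERIV_pos_part_sq]) (intro continuous_intros)
  have cp: "continuously_differentiable p"
    unfolding p_def
    by (intro continuously_differentiable_prod continuously_differentiable_mult cpos
        continuously_differentiable_inner_diff)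
  define \<psi> where "\<psi> k x = 1 - inverse (1 + real k * p x)" for k x
  have pos: "1 + real k * p x \<ge> 1" for k x using p0 by simp
  then have ne: "1 + real k * p x \<noteq> 0" for k x by (metis not_one_le_zero)
  show ?thesis
  proof (rule that[of \<psi>])
    show "continuously_differentiable (\<psi> k)" for k
      unfolding \<psi>_def
    proof (rule continuously_differentiable_compose[OF cp, of "\<lambda>t. 1 - inverse (1 + real k * t)"
          "\<lambda>t. real k / (1 + real k * t)\<^sup>2"])
      show "((\<lambda>t. 1 - inverse (1 + real k * t)) has_real_derivative real k / (1 + real k * p x)\<^sup>2) (at (p x))" for x
        using pos[of k x] by (auto intro!: derivative_eq_intros simp: power2_eq_square divide_inverse)
      show "continuous_on (range p) (\<lambda>t. real k / (1 + real k * t)\<^sup>2)"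
        using ne[of k] by (intro continuous_intros) auto
    qed
    show "\<psi> k x = 0" if "x \<notin> box a b" for k x using pz[OF that] by (simp add: \<psi>_def)
    show "\<bar>\<psi> k x\<bar> \<le> 1" for k x
      using pos[of k x] le_imp_inverse_le[of 1 "1 + real k * p x"] by (simp add: \<psi>_def)
    show "(\<lambda>k. \<psi> k x) \<longlonglongrightarrow> indicator (box a b) x" for x
    proof (cases "x \<in> box a b")
      case True
      have "filterlim (\<lambda>k. 1 + real k * p x) at_infinity sequentially"
        using pp[OF True] by (intro filterlim_at_top_imp_at_infinity filterlim_tendsto_add_at_top[OF tendsto_const]
          filterlim_at_top_mult_tendsto_pos[OF tendsto_const] filterlim_real_sequentially)
      then have "(\<lambda>k. inverse (1 + real k * p x)) \<longlonglongrightarrow> 0" by (rule tendsto_inverse_0[THEN filterlim_compose])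
      then have "(\<lambda>k. 1 - inverse (1 + real k * p x)) \<longlonglongrightarrow> 1 - 0" by (intro tendsto_intros)
      then show ?thesis using True by (simp add: \<psi>_def)
    qed (simp add: \<psi>_def pz)
  qed
qed

lemma sigma_finite_completion:
  assumes "sigma_finite_measure M" shows "sigma_finite_measure (completion M)"
proof -
  interpret sigma_finite_measure M by fact
  obtain A where "countable A" "A \<subseteq> sets M" "\<Union>A = space M" "\<forall>a\<in>A. emeasure M a \<noteq> \<infinity>"
    using sigma_finite_countable by blast
  then show ?thesis
    by (intro sigma_finite_measure.intro exI[of _ A]) (auto simp: subset_iff)
qed

text \<open>A Dynkin argument: boxes are stable under intersections and generate the Borel sets. The
  integral over the whole space, which is not a box, is a separate hypothesis and serves for
  complements.\<close>

lemma AE_eq_0_if_box_integrals: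
  fixes D :: "'a::euclidean_space \<Rightarrow> 'b::euclidean_space"
  assumes D: "integrable lebesgue D"
    and 0: "\<And>a b. (LINT x:box a b|lebesgue. D x) = 0" "(LINT x|lebesgue. D x) = 0"
  shows "AE x in lebesgue. D x = 0"
proof (rule sigma_finite_measure.density_zero[OF sigma_finite_completion[OF sigma_finite_lborel] D])
  have si: "set_integrable lebesgue A D" if "A \<in> sets lebesgue" for A
    using integrable_mult_indicator[OF that D] by (simp add: set_integrable_def)
  have B: "(LINT x:A|lebesgue. D x) = 0" if "A \<in> sets borel" for A
  proof -
    have *: "A \<in> sigma_sets UNIV (range (\<lambda>(a, b). box a b))"
      using that unfolding borel_eq_box by simp
    have sub: "sigma_sets UNIV (range (\<lambda>(a, b). box a b :: 'a set)) = sets borel"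
      unfolding borel_eq_box by simp
    show ?thesis
    proof (rule sigma_sets_induct_disjoint[OF _ _ *])
      show "Int_stable (range (\<lambda>(a, b). box a b :: 'a set))"
        by (auto simp: Int_stable_def box_Int_box)
      show "(LINT x:X|lebesgue. D x) = 0" if "X \<in> range (\<lambda>(a, b). box a b)" for X
        using that 0(1) by auto
      show "(LINT x:UNIV - X|lebesgue. D x) = 0" if X: "X \<in> sigma_sets UNIV (range (\<lambda>(a, b). box a b))"
        "(LINT x:X|lebesgue. D x) = 0" for X
      proof -
        have XL: "X \<in> sets lebesgue" using X(1) unfolding sub by simp
        have "(LINT x:UNIV|lebesgue. D x) = (LINT x:X \<union> (UNIV - X)|lebesgue. D x)" by simp
        also have "\<dots> = (LINT x:X|lebesgue. D x) + (LINT x:UNIV - X|lebesgue. D x)"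
          using XL by (intro set_integral_Un si) auto
        finally show ?thesis using X(2) 0(2) by (simp add: set_lebesgue_integral_def)
      qed
      show "(LINT x:\<Union>(range X)|lebesgue. D x) = 0"
        if X: "disjoint_family X" "range X \<subseteq> sigma_sets UNIV (range (\<lambda>(a, b). box a b))"
        "\<And>i. (LINT x:X i|lebesgue. D x) = 0" for X :: "nat \<Rightarrow> 'a set"
      proof -
        have XL: "X i \<in> sets lebesgue" for i using X(2) unfolding sub by auto
        have "(LINT x:\<Union>(range X)|lebesgue. D x) = (\<Sum>i. (LINT x:X i|lebesgue. D x))"
          using X(1) XL by (intro lebesgue_integral_countable_add si) (auto simp: disjoint_family_on_def)
        then show ?thesis using X(3) by simp
      qed
    qed (auto simp: set_lebesgue_integral_def)
  qed
  \<comment> \<open>A Lebesgue set is a Borel set up to a subset of a null set.\<close>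
  fix A :: "'a set" assume A: "A \<in> sets lebesgue"
  then obtain S N N' where S: "A = S \<union> N" "N \<subseteq> N'" "N' \<in> null_sets lborel" "S \<in> sets lborel"
    by (rule sets_completionE)
  have "AE x in lborel. x \<notin> N'" using S(3) by (rule AE_not_in)
  then have "AE x in lebesgue. x \<notin> N'" by (rule AE_completion)
  then have "AE x in lebesgue. indicator A x *\<^sub>R D x = indicator S x *\<^sub>R D x"
    by eventually_elim (use S in \<open>auto simp: indicator_def\<close>)
  then have "(LINT x:A|lebesgue. D x) = (LINT x:S|lebesgue. D x)"
    unfolding set_lebesgue_integral_def
    using si[OF A] si[of S] S(4) unfolding set_integrable_def
    by (intro integral_cong_AE) (auto intro: borel_measurable_integrable)
  then show "(LINT x:A|lebesgue. D x) = 0" using B S(4) by simp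
qed

text \<open>Both gradients have the same integrals against bump functions, hence, in the limit, over
  boxes. As they are only locally integrable, the argument runs inside closed boxes contained in
  \<Omega>, countably many of which cover \<Omega>.\<close>

lemma is_weak_gradient_unique:
  fixes f :: "'a::euclidean_space \<Rightarrow> real"
  assumes \<Omega>: "open \<Omega>" and G: "is_weak_gradient \<Omega> f G" "is_weak_gradient \<Omega> f G'"
  shows "AE x in lebesgue. x \<in> \<Omega> \<longrightarrow> G x = G' x"
proof -
  have LI: "set_integrable lebesgue K G" "set_integrable lebesgue K G'" if "compact K" "K \<subseteq> \<Omega>" for K
    using G that unfolding is_weak_gradient_def locally_integrable_def by auto
  have box0: "AE x in lebesgue. x \<in> cbox c d \<longrightarrow> G x = G' x" if cd: "cbox c d \<subseteq> \<Omega>" for c d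
  proof -
    \<comment> \<open>Test functions must vanish off a compact subset of \<Omega>, for which
      \<open>cbox c d\<close> serves. \<open>D\<close> lives on the open box, so that its integral
      over any box is one over an open box inside \<open>cbox c d\<close>, whose indicator is a
      limit of bumps.\<close>
    define D where "D x = indicator (box c d) x *\<^sub>R (G x - G' x)" for x
    define D0 where "D0 x = indicator (cbox c d) x *\<^sub>R (G x - G' x)" for x
    have "integrable lebesgue (\<lambda>x. indicator (cbox c d) x *\<^sub>R G x - indicator (cbox c d) x *\<^sub>R G' x)"
      using LI[OF compact_cbox cd] by (intro Bochner_Integration.integrable_diff) (auto simp: set_integrable_def)
    then have iD0: "integrable lebesgue D0" by (simp add: D0_def[abs_def] algebra_simps)
    have DD0: "D = (\<lambda>x. indicator (box c d) x *\<^sub>R D0 x)"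
      using box_subset_cbox[of c d] by (auto simp: fun_eq_iff D_def D0_def indicator_def)
    have iD: "integrable lebesgue D" unfolding DD0 by (rule integrable_mult_indicator[OF _ iD0]) auto
    have ib: "(LINT x:box a b|lebesgue. D x) = 0" for a b
    proof -
      obtain a' b' where ab: "box a b \<inter> box c d = box a' b'"
        unfolding box_Int_box by blast
      have sub: "box a' b' \<subseteq> cbox c d" using ab box_subset_cbox[of c d] by blast
      obtain \<psi> where \<psi>: "\<And>k. continuously_differentiable (\<psi> k)" "\<And>k x. x \<notin> box a' b' \<Longrightarrow> \<psi> k x = 0"
        "\<And>k x. \<bar>\<psi> k x\<bar> \<le> 1" "\<And>x. (\<lambda>k::nat. \<psi> k x) \<longlonglongrightarrow> indicator (box a' b') x"
        using bump_box[of a' b'] by blast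
      have c\<psi>: "continuous_on UNIV (\<psi> k)" for k
        using \<psi>(1) unfolding continuously_differentiable_def by (meson GDERIV_imp_continuous_on)
      have m\<psi>: "\<psi> k \<in> borel_measurable lebesgue" for k
        by (rule measurable_completion) (simp add: borel_measurable_continuous_onI c\<psi>)
      have m: "(\<lambda>x. \<psi> k x *\<^sub>R D0 x) \<in> borel_measurable lebesgue" for k
        by (intro borel_measurable_scaleR m\<psi> borel_measurable_integrable[OF iD0])
      have "(\<lambda>k. LINT x|lebesgue. \<psi> k x *\<^sub>R D0 x) \<longlonglongrightarrow> (LINT x|lebesgue. indicator (box a' b') x *\<^sub>R D0 x)"
      proof (rule integral_dominated_convergence[where w="\<lambda>x. norm (D0 x)"])
        show "AE x in lebesgue. (\<lambda>k. \<psi> k x *\<^sub>R D0 x) \<longlonglongrightarrow> indicator (box a' b') x *\<^sub>R D0 x"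
          using \<psi>(4) by (auto intro!: tendsto_intros)
        show "AE x in lebesgue. norm (\<psi> k x *\<^sub>R D0 x) \<le> norm (D0 x)" for k
          using \<psi>(3)[of k] by (auto intro!: AE_I2 mult_left_le_one_le)
      qed (use m iD0 in \<open>auto simp: integrable_norm intro!: borel_measurable_scaleR borel_measurable_indicator\<close>)
      moreover have "(LINT x|lebesgue. \<psi> k x *\<^sub>R D0 x) = 0" for k
      proof -
        obtain g where g: "\<And>x. GDERIV (\<psi> k) x :> g x" "continuous_on UNIV g"
          using \<psi>(1) unfolding continuously_differentiable_def by blast
        have i: "integrable lebesgue (\<lambda>x. \<psi> k x *\<^sub>R (indicator (cbox c d) x *\<^sub>R H x))"
          if H: "set_integrable lebesgue (cbox c d) H" for H :: "'a \<Rightarrow> 'a"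
        proof (rule Bochner_Integration.integrable_bound)
          show "integrable lebesgue (\<lambda>x. indicator (cbox c d) x *\<^sub>R H x)" using H unfolding set_integrable_def .
          show "(\<lambda>x. \<psi> k x *\<^sub>R (indicator (cbox c d) x *\<^sub>R H x)) \<in> borel_measurable lebesgue"
            by (intro borel_measurable_scaleR[OF m\<psi>] borel_measurable_integrable H[unfolded set_integrable_def])
          show "AE x in lebesgue. norm (\<psi> k x *\<^sub>R (indicator (cbox c d) x *\<^sub>R H x)) \<le> norm (indicator (cbox c d) x *\<^sub>R H x)"
            using \<psi>(3)[of k] by (auto simp: indicator_def intro!: AE_I2 mult_left_le_one_le)
        qed
        have e: "\<psi> k x *\<^sub>R (indicator (cbox c d) x *\<^sub>R H x) = indicator \<Omega> x *\<^sub>R (\<psi> k x *\<^sub>R H x)"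
          for x and H :: "'a \<Rightarrow> 'a"
          using \<psi>(2)[of x k] sub cd by (auto simp: indicator_def)
        have "(LINT x:\<Omega>|lebesgue. f x *\<^sub>R g x) = - (LINT x:\<Omega>|lebesgue. \<psi> k x *\<^sub>R H x)"
          if "is_weak_gradient \<Omega> f H" for H
        proof (rule that[unfolded is_weak_gradient_def, THEN conjunct2, THEN conjunct2, rule_format, of _ _ "cbox c d"])
          show "(\<forall>x. GDERIV (\<psi> k) x :> g x) \<and> continuous_on UNIV g \<and> compact (cbox c d) \<and> cbox c d \<subseteq> \<Omega> \<and>
              (\<forall>x. x \<notin> cbox c d \<longrightarrow> \<psi> k x = 0)"
          proof (intro conjI allI impI)
            show "\<psi> k x = 0" if "x \<notin> cbox c d" for x using that \<psi>(2)[of x k] sub by auto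
          qed (use g cd in auto)
        qed
        from trans[OF this[OF G(1), symmetric] this[OF G(2)]]
        have "(LINT x:\<Omega>|lebesgue. \<psi> k x *\<^sub>R G x) = (LINT x:\<Omega>|lebesgue. \<psi> k x *\<^sub>R G' x)"
          by (simp only: neg_equal_iff_equal)
        then have "(LINT x|lebesgue. \<psi> k x *\<^sub>R (indicator (cbox c d) x *\<^sub>R G x)) =
            (LINT x|lebesgue. \<psi> k x *\<^sub>R (indicator (cbox c d) x *\<^sub>R G' x))"
          unfolding e set_lebesgue_integral_def .
        then show ?thesis
          using i[OF LI(1)[OF compact_cbox cd]] i[OF LI(2)[OF compact_cbox cd]]
          by (simp add: D0_def scaleR_diff_right)
      qed
      ultimately have "(LINT x|lebesgue. indicator (box a' b') x *\<^sub>R D0 x) = 0" by (simp add: LIMSEQ_const_iff)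
      moreover have "(LINT x:box a b|lebesgue. D x) = (LINT x|lebesgue. indicator (box a' b') x *\<^sub>R D0 x)"
        unfolding set_lebesgue_integral_def DD0 ab[symmetric]
        by (intro Bochner_Integration.integral_cong) (auto simp: indicator_def)
      ultimately show ?thesis by simp
    qed
    have "(LINT x|lebesgue. D x) = (LINT x:box c d|lebesgue. D x)"
      unfolding set_lebesgue_integral_def
      by (intro Bochner_Integration.integral_cong) (auto simp: indicator_def D_def)
    then have "AE x in lebesgue. D x = 0"
      by (intro AE_eq_0_if_box_integrals iD) (use ib in auto)
    \<comment> \<open>\<open>D\<close> says nothing about the boundary of the box, but this is a
      null set.\<close>
    moreover have "AE x in lebesgue. x \<notin> cbox c d - box c d"
      using negligible_frontier_interval[of c d] unfolding negligible_iff_null_sets by (rule AE_not_in)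
    ultimately show ?thesis by eventually_elim (auto simp: D_def indicator_def split: if_splits)
  qed
  obtain \<D> where \<D>: "countable \<D>" "\<D> \<subseteq> Pow \<Omega>" "\<And>X. X \<in> \<D> \<Longrightarrow> \<exists>a b. X = cbox a b" "\<Union>\<D> = \<Omega>"
    using open_countable_Union_open_cbox[OF \<Omega>] by metis
  have "AE x in lebesgue. \<forall>X\<in>\<D>. x \<in> X \<longrightarrow> G x = G' x"
    using \<D>(2,3) box0 by (subst AE_ball_countable[OF \<D>(1)]) blast
  then show ?thesis by eventually_elim (use \<D>(4) in auto)
qed

section \<open>Derivatives of Poisson extensions\<close>

text \<open>The hypothesis bounds \<open>|f|^2\<close> by \<open>u v\<close>, which avoids square
  roots of the weights. The inequality comes from \<open>2 |f| \<le> l u + v / l\<close>, with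
  \<open>l\<close> chosen after integration.\<close>

lemma integral_Cauchy_Schwarz:
  fixes f :: "'a \<Rightarrow> 'b::{banach, second_countable_topology}"
  assumes f: "f \<in> borel_measurable M" and u: "integrable M u" and v: "integrable M v"
    and nn: "\<And>x. u x \<ge> 0" "\<And>x. v x \<ge> 0" and fuv: "\<And>x. (norm (f x))\<^sup>2 \<le> u x * v x"
  shows "integrable M f" "(norm (LINT x|M. f x))\<^sup>2 \<le> (LINT x|M. u x) * (LINT x|M. v x)"
proof -
  have b: "norm (f x) \<le> (l * u x + v x / l) / 2" if l: "l > 0" for l x
  proof (rule power2_le_imp_le)
    have "4 * (u x * v x) \<le> (l * u x + v x / l)\<^sup>2"
      using l zero_le_power2[of "l * u x - v x / l"] by (simp add: power2_eq_square algebra_simps)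
    then show "(norm (f x))\<^sup>2 \<le> ((l * u x + v x / l) / 2)\<^sup>2" using fuv[of x] by (simp add: power_divide)
    show "0 \<le> (l * u x + v x / l) / 2" using l nn[of x] by simp
  qed
  show fi: "integrable M f"
  proof (rule Bochner_Integration.integrable_bound[OF _ f])
    show "integrable M (\<lambda>x. (1 * u x + v x / 1) / 2)" using u v by simp
    show "AE x in M. norm (f x) \<le> norm ((1 * u x + v x / 1) / 2)"
      using b[of 1] by (auto intro!: AE_I2 order_trans[OF _ abs_ge_self])
  qed
  define A B where "A = (LINT x|M. u x)" and "B = (LINT x|M. v x)"
  have AB: "A \<ge> 0" "B \<ge> 0" unfolding A_def B_def using nn by (auto intro: integral_nonneg_AE)
  have le: "norm (LINT x|M. f x) \<le> (l * A + B / l) / 2" if "l > 0" for l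
  proof -
    have "norm (LINT x|M. f x) \<le> (LINT x|M. norm (f x))" by (rule integral_norm_bound)
    also have "\<dots> \<le> (LINT x|M. (l * u x + v x / l) / 2)"
      using fi u v b[OF that] by (intro integral_mono) auto
    also have "\<dots> = (l * A + B / l) / 2" using u v by (simp add: A_def B_def)
    finally show ?thesis .
  qed
  have e: "(norm (LINT x|M. f x))\<^sup>2 \<le> (A + e) * (B + e)" if "e > 0" for e
  proof -
    \<comment> \<open>The minimiser of \<open>l (A + e) + (B + e) / l\<close>; both integrals are
      raised by \<open>e\<close> because they may vanish, and \<open>e\<close> tends to 0 in the
      end.\<close>
    define l where "l = sqrt ((B + e) / (A + e))"
    have l: "l > 0" "l\<^sup>2 = (B + e) / (A + e)" using AB that by (auto simp: l_def)
    have "norm (LINT x|M. f x) \<le> (l * A + B / l) / 2" by (rule le[OF l(1)])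
    also have "\<dots> \<le> (l * (A + e) + (B + e) / l) / 2"
      using that l(1) by (intro divide_right_mono add_mono mult_left_mono) auto
    finally have "(norm (LINT x|M. f x))\<^sup>2 \<le> ((l * (A + e) + (B + e) / l) / 2)\<^sup>2" by (intro power_mono) auto
    also have "\<dots> = (A + e) * (B + e)"
    proof -
      define S T where ST0: "S = A + e" "T = B + e"
      then have ST: "S = A + e" "T = B + e" "S > 0" "T > 0" using AB that by auto
      have "((l * S + T / l) / 2)\<^sup>2 = (l\<^sup>2 * S\<^sup>2 + 2 * S * T + T\<^sup>2 / l\<^sup>2) / 4"
        using l(1) by (simp add: power2_eq_square field_simps)
      also have "\<dots> = S * T"
        unfolding l(2) ST(1,2)[symmetric] using ST(3,4) by (simp add: power2_eq_square field_simps)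
      finally show ?thesis by (simp add: ST)
    qed
    finally show ?thesis .
  qed
  have "((\<lambda>e. (A + e) * (B + e)) \<longlongrightarrow> (A + 0) * (B + 0)) (at_right 0)" by (intro tendsto_intros)
  then have "(norm (LINT x|M. f x))\<^sup>2 \<le> (A + 0) * (B + 0)"
    by (rule tendsto_lowerbound) (auto simp: eventually_at_right_field intro!: exI[of _ 1] e)
  then show "(norm (LINT x|M. f x))\<^sup>2 \<le> (LINT x|M. u x) * (LINT x|M. v x)" by (simp add: A_def B_def)
qed

text \<open>The Japanese bracket of \<open>y\<close> to the power \<open>-p\<close>. With
  \<open>p = n + a\<close> it is, up to normalisation, the Poisson kernel at height 1, and thus the
  weight against which boundary data must be integrable.\<close>

definition bracket :: "real \<Rightarrow> 'a::real_normed_vector \<Rightarrow> real" where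
  "bracket p y = (1 + (norm y)\<^sup>2) powr (- p / 2)"

lemma bracket_pos: "bracket p y > 0"
  unfolding bracket_def using zero_le_power2[of "norm y"] by (simp add: add_nonneg_eq_0_iff)

lemma bracket_measurable [measurable]: "bracket p \<in> borel_measurable borel"
  unfolding bracket_def by measurable

text \<open>Each \<open>y\<close> lies in a smallest ball of radius \<open>2^k\<close>, and there
  the weight is at most \<open>2^(p - k p)\<close>, because |y| is at least \<open>2^(k - 1)\<close>
  for \<open>k > 0\<close>. Multiplied by the volume, of order \<open>2^(k n)\<close>, this leaves a
  geometric series of ratio \<open>2^(n - p) < 1\<close>.\<close>

lemma nn_integral_bracket_finite:
  assumes p: "p > real DIM('a)"
  shows "(\<integral>\<^sup>+ y. ennreal (bracket p (y::'a::euclidean_space)) \<partial>lborel) < \<infinity>"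
proof -
  have p0: "p > 0" using p by (meson of_nat_0_le_iff order_le_less_trans)
  have single: "f k \<le> (\<Sum>i. f i)" for f :: "nat \<Rightarrow> ennreal" and k
    using sum_le_suminf[of f "{k}"] by simp
  have le: "ennreal (bracket p y) \<le> (\<Sum>k. ennreal (2 powr (p - real k * p)) * indicator (ball 0 (2 ^ k)) y)"
    for y :: 'a
  proof -
    obtain k where k: "y \<in> ball 0 (2 ^ k)" "\<And>j. j < k \<Longrightarrow> y \<notin> ball 0 (2 ^ j)"
    proof -
      obtain n where "norm y < 2 ^ n" using real_arch_pow[of 2 "norm y"] by auto
      then have *: "y \<in> ball 0 (2 ^ n)" by simp
      show ?thesis by (rule that[of "LEAST k. y \<in> ball 0 (2 ^ k)"])
         (use LeastI[of "\<lambda>k. y \<in> ball 0 (2 ^ k)", OF *] not_less_Least in auto)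
    qed
    have "bracket p y \<le> 2 powr (p - real k * p)"
    proof (cases k)
      case 0
      have "bracket p y \<le> 1"
        using powr_mono2'[of "- p / 2" 1 "1 + (norm y)\<^sup>2"] p0 by (simp add: bracket_def)
      also have "1 \<le> 2 powr p" using p0 by (intro ge_one_powr_ge_zero) auto
      finally show ?thesis using 0 by simp
    next
      case (Suc j)
      then have "norm y \<ge> 2 ^ j" using k(2)[of j] by simp
      then have "(2 ^ j)\<^sup>2 \<le> 1 + (norm y)\<^sup>2" by (meson add_increasing power_mono zero_le_numeral zero_le_one zero_le_power)
      then have "bracket p y \<le> ((2 ^ j)\<^sup>2) powr (- p / 2)"
        unfolding bracket_def using p0 by (intro powr_mono2') auto
      also have "(2 ^ j)\<^sup>2 = (2::real) powr (2 * real j)"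
        using powr_realpow[of 2 "j * 2"] by (simp add: power_mult mult.commute)
      also have "\<dots> powr (- p / 2) = 2 powr (p - real k * p)" using Suc by (simp add: powr_powr algebra_simps)
      finally show ?thesis .
    qed
    then have "ennreal (bracket p y) \<le> ennreal (2 powr (p - real k * p)) * indicator (ball 0 (2 ^ k)) y"
      using k(1) by (simp add: ennreal_leI)
    also have "\<dots> \<le> (\<Sum>k. ennreal (2 powr (p - real k * p)) * indicator (ball 0 (2 ^ k)) y)"
      by (rule single)
    finally show ?thesis .
  qed
  define V where "V = unit_ball_vol (real DIM('a))"
  have V: "V \<ge> 0" by (simp add: V_def)
  define q where "q = 2 powr (real DIM('a) - p)"
  have q: "0 \<le> q" "q < 1" using p by (auto simp: q_def powr_less_one)
  have "(\<integral>\<^sup>+ y. ennreal (bracket p (y::'a)) \<partial>lborel)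
      \<le> (\<integral>\<^sup>+ y. (\<Sum>k. ennreal (2 powr (p - real k * p)) * indicator (ball (0::'a) (2 ^ k)) y) \<partial>lborel)"
    by (intro nn_integral_mono le)
  also have "\<dots> = (\<Sum>k. \<integral>\<^sup>+ y. ennreal (2 powr (p - real k * p)) * indicator (ball (0::'a) (2 ^ k)) y \<partial>lborel)"
    by (subst nn_integral_suminf) (rule borel_measurable_times_ennreal borel_measurable_const
        borel_measurable_indicator refl | simp)+
  also have "\<dots> = (\<Sum>k. ennreal (2 powr p * V * q ^ k))"
  proof (intro suminf_cong)
    fix k
    have eq: "2 powr (p - real k * p) * (V * (2 ^ k) ^ DIM('a)) = 2 powr p * V * q ^ k"
    proof -
      have "q ^ k = 2 powr (real k * (real DIM('a) - p))"
        using powr_realpow[of q k] by (simp add: q_def powr_powr mult.commute)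
      moreover have "(2 ^ k) ^ DIM('a) = (2::real) powr (real k * real DIM('a))"
        using powr_realpow[of 2 "k * DIM('a)"] by (simp add: power_mult)
      ultimately show ?thesis
        by (simp only: powr_add[symmetric] mult.assoc mult.left_commute[of _ V]) (simp add: algebra_simps)
    qed
    show "(\<integral>\<^sup>+ y. ennreal (2 powr (p - real k * p)) * indicator (ball (0::'a) (2 ^ k)) y \<partial>lborel) = ennreal (2 powr p * V * q ^ k)"
      unfolding eq[symmetric] using V by (simp add: nn_integral_cmult_indicator emeasure_ball ennreal_mult[symmetric] V_def[symmetric])
  qed
  also have "\<dots> < \<infinity>"
    using q V by (simp add: less_top[symmetric] ennreal_suminf_neq_top)
  finally show ?thesis .
qed

lemma integrable_bracket:
  assumes "p > real DIM('a)"
  shows "integrable lborel (bracket p :: 'a::euclidean_space \<Rightarrow> real)"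
  using nn_integral_bracket_finite[OF assms] bracket_pos[of p]
  by (intro integrableI_nonneg) (auto intro: less_imp_le)

lemma lborel_integral_affine:
  fixes g :: "'a::euclidean_space \<Rightarrow> 'b::{banach, second_countable_topology}"
  assumes [measurable]: "g \<in> borel_measurable borel" and c: "c \<noteq> 0"
  shows "integrable lborel g \<longleftrightarrow> integrable lborel (\<lambda>x. g (t + c *\<^sub>R x))"
    "(LINT x|lborel. g x) = \<bar>c\<bar> ^ DIM('a) *\<^sub>R (LINT x|lborel. g (t + c *\<^sub>R x))"
proof -
  define N where "N = density (distr lborel borel (\<lambda>x::'a. t + c *\<^sub>R x)) (\<lambda>_. ennreal (\<bar>c\<bar> ^ DIM('a)))"
  have N: "lborel = N" unfolding N_def by (rule lborel_affine[OF c])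
  have "integrable N g \<longleftrightarrow> integrable lborel (\<lambda>x. \<bar>c\<bar> ^ DIM('a) *\<^sub>R g (t + c *\<^sub>R x))"
    unfolding N_def by (subst integrable_density) (auto simp: integrable_distr_eq)
  also have "\<dots> \<longleftrightarrow> integrable lborel (\<lambda>x. g (t + c *\<^sub>R x))"
  proof
    assume "integrable lborel (\<lambda>x. \<bar>c\<bar> ^ DIM('a) *\<^sub>R g (t + c *\<^sub>R x))"
    from integrable_scaleR_right[of "inverse (\<bar>c\<bar> ^ DIM('a))", OF this]
    show "integrable lborel (\<lambda>x. g (t + c *\<^sub>R x))" using c by simp
  qed auto
  finally show "integrable lborel g \<longleftrightarrow> integrable lborel (\<lambda>x. g (t + c *\<^sub>R x))"
    by (simp add: N[symmetric])
  have "(LINT x|N. g x) = (LINT x|lborel. \<bar>c\<bar> ^ DIM('a) *\<^sub>R g (t + c *\<^sub>R x))"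
    unfolding N_def by (subst integral_density) (auto simp: integral_distr)
  then show "(LINT x|lborel. g x) = \<bar>c\<bar> ^ DIM('a) *\<^sub>R (LINT x|lborel. g (t + c *\<^sub>R x))"
    by (simp add: N[symmetric])
qed

lemma nn_integral_affine:
  fixes g :: "'a::euclidean_space \<Rightarrow> ennreal"
  assumes [measurable]: "g \<in> borel_measurable borel" and c: "c \<noteq> 0"
  shows "(\<integral>\<^sup>+ x. g x \<partial>lborel) = ennreal (\<bar>c\<bar> ^ DIM('a)) * (\<integral>\<^sup>+ x. g (t + c *\<^sub>R x) \<partial>lborel)"
  by (subst lborel_affine[OF c, of t]) (simp add: nn_integral_density nn_integral_distr nn_integral_cmult)

lemma dilated_bracket:
  fixes x y :: "'a::euclidean_space"
  assumes z: "z > 0"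
  shows "((norm (x - (x + z *\<^sub>R y)))\<^sup>2 + z\<^sup>2) powr (- q / 2) = z powr (- q) * bracket q y"
proof -
  have "(norm (x - (x + z *\<^sub>R y)))\<^sup>2 + z\<^sup>2 = z\<^sup>2 * (1 + (norm y)\<^sup>2)"
    using z by (simp add: power_mult_distrib algebra_simps)
  moreover have "(z\<^sup>2) powr (- q / 2) = z powr (- q)"
    using z powr_powr[of z 2 "- q / 2"] by simp
  ultimately show ?thesis unfolding bracket_def using z by (simp add: powr_mult)
qed

lemma integral_dilated_bracket:
  fixes x :: "'a::euclidean_space"
  assumes z: "z > 0" and q: "q > real DIM('a)"
  shows "integrable lborel (\<lambda>y. ((norm (x - y))\<^sup>2 + z\<^sup>2) powr (- q / 2))"
    "(LINT y|lborel. ((norm (x - y))\<^sup>2 + z\<^sup>2) powr (- q / 2))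
       = z powr (real DIM('a) - q) * (LINT y|lborel. bracket q (y::'a))"
proof -
  have m: "(\<lambda>y. ((norm (x - y))\<^sup>2 + z\<^sup>2) powr (- q / 2)) \<in> borel_measurable borel" by measurable
  show "integrable lborel (\<lambda>y. ((norm (x - y))\<^sup>2 + z\<^sup>2) powr (- q / 2))"
    unfolding lborel_integral_affine(1)[OF m z[THEN less_imp_neq, symmetric], of x] dilated_bracket[OF z]
    using integrable_bracket[OF q] by simp
  show "(LINT y|lborel. ((norm (x - y))\<^sup>2 + z\<^sup>2) powr (- q / 2))
       = z powr (real DIM('a) - q) * (LINT y|lborel. bracket q (y::'a))"
    unfolding lborel_integral_affine(2)[OF m z[THEN less_imp_neq, symmetric], of x] dilated_bracket[OF z]
    using z by (simp add: powr_realpow[symmetric] powr_add[symmetric])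
qed

lemma integral_bracket_pos:
  assumes q: "q > real DIM('a)"
  shows "(LINT y|lborel. bracket q (y::'a::euclidean_space)) > 0"
proof -
  have "(LINT y|lborel. bracket q (y::'a)) \<noteq> 0"
  proof
    assume "(LINT y|lborel. bracket q (y::'a)) = 0"
    then have "AE y in lborel. bracket q (y::'a) = 0"
      using integrable_bracket[OF q] bracket_pos
      by (subst (asm) integral_nonneg_eq_0_iff_AE) (auto intro: less_imp_le)
    then have "AE y::'a in lborel. False" using bracket_pos[of q] by (auto elim!: eventually_mono simp: less_le)
    then have "ae_filter (lborel :: 'a measure) = bot" by (simp add: trivial_limit_def)
    then show False by (simp add: ae_filter_eq_bot_iff)
  qed
  moreover have "(LINT y|lborel. bracket q (y::'a)) \<ge> 0"
    using bracket_pos[of q] by (intro integral_nonneg_AE) (auto intro: less_imp_le)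
  ultimately show ?thesis by simp
qed

text \<open>Serves as a majorant that is uniform for \<open>x\<close> in a ball and \<open>z\<close>
  away from 0: in \<open>1 + |y|^2 \<le> 2 |x - y|^2 + (1 + 2 R^2)\<close> the constant is absorbed
  by \<open>z^2 \<ge> \<delta>^2\<close>.\<close>

lemma bracket_comparison:
  fixes x y :: "'a::real_normed_vector"
  assumes "norm x \<le> R" "\<delta> > 0" "\<delta> \<le> z" "q \<ge> 0"
  shows "((norm (x - y))\<^sup>2 + z\<^sup>2) powr (- q / 2) \<le> (2 + (1 + 2 * R\<^sup>2) / \<delta>\<^sup>2) powr (q / 2) * bracket q y"
proof -
  define C where "C = 2 + (1 + 2 * R\<^sup>2) / \<delta>\<^sup>2"
  have C: "C > 0" unfolding C_def using assms by (intro add_pos_nonneg) auto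
  have "norm y \<le> norm (x - y) + norm x" by (metis add.commute norm_minus_commute norm_triangle_sub)
  then have "(norm y)\<^sup>2 \<le> (norm (x - y) + norm x)\<^sup>2" by (intro power_mono) auto
  also have "\<dots> \<le> 2 * (norm (x - y))\<^sup>2 + 2 * (norm x)\<^sup>2"
    using zero_le_power2[of "norm (x - y) - norm x"] by (simp add: power2_eq_square algebra_simps)
  also have "(norm x)\<^sup>2 \<le> R\<^sup>2" using assms(1) by (intro power_mono) auto
  finally have 1: "1 + (norm y)\<^sup>2 \<le> 2 * (norm (x - y))\<^sup>2 + (1 + 2 * R\<^sup>2)" by simp
  have "\<delta>\<^sup>2 \<le> z\<^sup>2" using assms by (intro power_mono) auto
  then have "(1 + 2 * R\<^sup>2) * 1 \<le> (1 + 2 * R\<^sup>2) * (z\<^sup>2 / \<delta>\<^sup>2)"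
    using assms(2) by (intro mult_left_mono) (auto simp: add_nonneg_nonneg)
  then have 2: "1 + 2 * R\<^sup>2 \<le> (1 + 2 * R\<^sup>2) / \<delta>\<^sup>2 * z\<^sup>2" by simp
  have "1 + (norm y)\<^sup>2 \<le> C * ((norm (x - y))\<^sup>2 + z\<^sup>2)"
  proof -
    have "0 \<le> (1 + 2 * R\<^sup>2) / \<delta>\<^sup>2 * (norm (x - y))\<^sup>2" "0 \<le> z\<^sup>2" by auto
    then show ?thesis using 1 2 unfolding C_def by (simp only: distrib_left distrib_right)
  qed
  then have "(1 + (norm y)\<^sup>2) / C \<le> (norm (x - y))\<^sup>2 + z\<^sup>2"
    using C by (simp add: field_simps)
  then have "((norm (x - y))\<^sup>2 + z\<^sup>2) powr (- q / 2) \<le> ((1 + (norm y)\<^sup>2) / C) powr (- q / 2)"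
    using C assms(4) by (intro powr_mono2') (auto simp: add_pos_nonneg)
  also have "\<dots> = C powr (q / 2) * bracket q y"
    using C unfolding bracket_def by (simp add: powr_divide powr_minus field_simps)
  finally show ?thesis unfolding C_def .
qed

text \<open>The majorant \<open>w\<close> is local, since the bounds for the Poisson kernels
  degenerate as \<open>z\<close> tends to 0. Limits are taken along sequences, to which dominated
  convergence applies.\<close>

lemma GDERIV_under_integral:
  fixes k :: "'b::euclidean_space \<Rightarrow> 'y \<Rightarrow> real"
  assumes S: "open S"
    and k: "\<And>X y. X \<in> S \<Longrightarrow> GDERIV (\<lambda>X. k X y) X :> K X y"
    and cK: "\<And>y. continuous_on S (\<lambda>X. K X y)"
    and ki: "\<And>X. X \<in> S \<Longrightarrow> integrable M (k X)"
    and Km: "\<And>X. X \<in> S \<Longrightarrow> K X \<in> borel_measurable M"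
    and dom: "\<And>X. X \<in> S \<Longrightarrow> \<exists>e>0. \<exists>w. integrable M w \<and> ball X e \<subseteq> S \<and> (\<forall>X'\<in>ball X e. \<forall>y. norm (K X' y) \<le> w y)"
  shows "X \<in> S \<Longrightarrow> GDERIV (\<lambda>X. LINT y|M. k X y) X :> (LINT y|M. K X y)"
    and "continuous_on S (\<lambda>X. LINT y|M. K X y)"
    and "X \<in> S \<Longrightarrow> integrable M (K X)"
proof -
  have Ki: "integrable M (K X)" if X: "X \<in> S" for X
  proof -
    obtain e w where e: "e > 0" and w: "integrable M w" "ball X e \<subseteq> S"
      "\<And>X' y. X' \<in> ball X e \<Longrightarrow> norm (K X' y) \<le> w y" using dom[OF X] by metis
    show "integrable M (K X)"
      by (rule Bochner_Integration.integrable_bound[OF w(1) Km[OF X]])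
        (use w(3)[of X] e in \<open>auto intro!: AE_I2 order_trans[OF _ abs_ge_self]\<close>)
  qed
  show "integrable M (K X)" if "X \<in> S" using Ki[OF that] .
  show "continuous_on S (\<lambda>X. LINT y|M. K X y)"
  proof (rule continuous_at_imp_continuous_on, rule ballI)
    fix X assume X: "X \<in> S"
    obtain e w where e: "e > 0" and w: "integrable M w" "ball X e \<subseteq> S"
      "\<And>X' y. X' \<in> ball X e \<Longrightarrow> norm (K X' y) \<le> w y" using dom[OF X] by metis
    have "continuous (at X within ball X e) (\<lambda>X. LINT y|M. K X y)"
      unfolding continuous_within_sequentially o_def
    proof (intro allI impI, elim conjE)
      fix s assume s: "\<forall>n. s n \<in> ball X e" "s \<longlonglongrightarrow> X"
      show "(\<lambda>n. LINT y|M. K (s n) y) \<longlonglongrightarrow> (LINT y|M. K X y)"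
      proof (rule integral_dominated_convergence[where w=w])
        show "K (s n) \<in> borel_measurable M" for n using s(1) w(2) Km by blast
        show "AE y in M. (\<lambda>n. K (s n) y) \<longlonglongrightarrow> K X y"
        proof (rule AE_I2)
          fix y
          have "isCont (\<lambda>X. K X y) X" using cK[of y] S X by (simp add: continuous_on_eq_continuous_at)
          then show "(\<lambda>n. K (s n) y) \<longlonglongrightarrow> K X y" using s(2) by (rule isCont_tendsto_compose)
        qed
        show "AE y in M. norm (K (s n) y) \<le> w y" for n using w(3) s(1) by auto
      qed (use w Km X in auto)
    qed
    then show "isCont (\<lambda>X. LINT y|M. K X y) X" using e by (simp add: at_within_open[OF centre_in_ball[THEN iffD2] open_ball])
  qed
  show "GDERIV (\<lambda>X. LINT y|M. k X y) X :> (LINT y|M. K X y)" if X: "X \<in> S" for X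
  proof -
    obtain e w where e: "e > 0" and w: "integrable M w" "ball X e \<subseteq> S"
      "\<And>X' y. X' \<in> ball X e \<Longrightarrow> norm (K X' y) \<le> w y" using dom[OF X] by metis
    have lip: "\<bar>k X' y - k X y\<bar> \<le> w y * norm (X' - X)" if X': "X' \<in> ball X e" for X' y
    proof -
      have "norm (k X' y - k X y) \<le> w y * norm (X' - X)"
      proof (rule differentiable_bound[OF convex_ball, of X e _ "\<lambda>X h. inner h (K X y)"])
        show "((\<lambda>X. k X y) has_derivative (\<lambda>h. inner h (K x y))) (at x within ball X e)" if "x \<in> ball X e" for x
          using k[of x y] w(2) that unfolding gderiv_def by (blast intro: has_derivative_at_withinI)
        show "onorm (\<lambda>h. inner h (K x y)) \<le> w y" if "x \<in> ball X e" for x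
        proof (rule onorm_le)
          show "norm (inner h (K x y)) \<le> w y * norm h" for h
            using Cauchy_Schwarz_ineq2[of h "K x y"] mult_right_mono[OF w(3)[OF that, of y] norm_ge_zero[of h]]
            by (simp add: mult.commute)
        qed
      qed (use X' e in auto)
      then show ?thesis by simp
    qed
    let ?F = "\<lambda>X. LINT y|M. k X y" and ?G = "LINT y|M. K X y"
    have "((\<lambda>Y. (1 / norm (Y - X)) *\<^sub>R (?F Y - (?F X + inner (Y - X) ?G))) \<longlongrightarrow> 0) (at X within ball X e)"
      unfolding tendsto_at_iff_sequentially o_def
    proof (intro allI impI)
      fix s assume s: "\<forall>i. s i \<in> ball X e - {X}" "s \<longlonglongrightarrow> X"
      define q where "q i y = (1 / norm (s i - X)) *\<^sub>R (k (s i) y - (k X y + inner (s i - X) (K X y)))" for i y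
      have sS: "s i \<in> S" for i using s(1) w(2) by blast
      have qi: "(LINT y|M. q i y) = (1 / norm (s i - X)) *\<^sub>R (?F (s i) - (?F X + inner (s i - X) ?G))" for i
        unfolding q_def using ki[OF X] ki[OF sS] Ki[OF X] by simp
      have "(\<lambda>i. LINT y|M. q i y) \<longlonglongrightarrow> (LINT y|M. 0)"
      proof (rule integral_dominated_convergence[where w="\<lambda>y. 2 * w y"])
        show "q i \<in> borel_measurable M" for i
          unfolding q_def[abs_def] using ki[OF X] ki[OF sS] Ki[OF X] by (auto intro!: borel_measurable_scaleR borel_measurable_diff borel_measurable_add borel_measurable_inner)
        show "AE y in M. (\<lambda>i. q i y) \<longlonglongrightarrow> 0"
        proof (rule AE_I2)
          fix y
          have "((\<lambda>X. k X y) has_derivative (\<lambda>h. inner h (K X y))) (at X within ball X e)"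
            using k[OF X] unfolding gderiv_def by (rule has_derivative_at_withinI)
          then show "(\<lambda>i. q i y) \<longlonglongrightarrow> 0"
            unfolding has_derivative_within tendsto_at_iff_sequentially q_def o_def using s by blast
        qed
        \<comment> \<open>One \<open>w\<close> comes from the Lipschitz bound for the increment, the
          other from the linear term.\<close>
        show "AE y in M. norm (q i y) \<le> 2 * w y" for i
        proof (rule AE_I2)
          fix y
          have n: "norm (s i - X) > 0" using s(1) by auto
          have "\<bar>k (s i) y - (k X y + inner (s i - X) (K X y))\<bar> \<le> w y * norm (s i - X) + norm (s i - X) * w y"
          proof -
            have "s i \<in> ball X e" "X \<in> ball X e" using s(1) e by auto
            then show ?thesis
              using lip[of "s i" y] Cauchy_Schwarz_ineq2[of "s i - X" "K X y"]
                mult_left_mono[OF w(3)[of X y] norm_ge_zero[of "s i - X"]] by linarith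
          qed
          then show "norm (q i y) \<le> 2 * w y" using n by (simp add: q_def field_simps)
        qed
      qed (use w in auto)
      then show "(\<lambda>i. (1 / norm (s i - X)) *\<^sub>R (?F (s i) - (?F X + inner (s i - X) ?G))) \<longlonglongrightarrow> 0"
        by (simp add: qi)
    qed
    then have "(?F has_derivative (\<lambda>h. inner h ?G)) (at X within ball X e)"
      unfolding has_derivative_within by (auto intro: bounded_linear_inner_left)
    then show ?thesis unfolding gderiv_def using e by (simp add: at_within_open[OF centre_in_ball[THEN iffD2] open_ball])
  qed
qed

section \<open>The Poisson kernel and its gradient\<close>

definition poisson_mass :: "'n::finite itself \<Rightarrow> real \<Rightarrow> real" where
  "poisson_mass _ a = (LINT y|lborel. bracket (real CARD('n) + a) (y :: real ^ 'n))"

lemma poisson_mass_pos: "a > 0 \<Longrightarrow> poisson_mass TYPE('n::finite) a > 0"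
  unfolding poisson_mass_def by (rule integral_bracket_pos) simp

lemma poisson_kernel_eq:
  fixes x :: "real ^ 'n"
  shows "poisson_kernel a x z =
    z powr a * ((norm x)\<^sup>2 + z\<^sup>2) powr (- (real CARD('n) + a) / 2) / poisson_mass TYPE('n) a"
proof -
  have "poisson_profile a (y :: real ^ 'n) 1 = bracket (real CARD('n) + a) y" for y
    using powr_minus_divide[of "1 + (norm y)\<^sup>2" "(real CARD('n) + a) / 2"]
    unfolding poisson_profile_def bracket_def minus_divide_left[symmetric]
    by (simp add: add.commute[of 1 "(norm y)\<^sup>2"])
  then have "(LINT y|lebesgue. poisson_profile a (y :: real ^ 'n) 1) = poisson_mass TYPE('n) a"
    by (simp add: poisson_mass_def integral_completion)
  moreover have "poisson_profile a x z = z powr a * ((norm x)\<^sup>2 + z\<^sup>2) powr (- (real CARD('n) + a) / 2)"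
    using powr_minus_divide[of "(norm x)\<^sup>2 + z\<^sup>2" "(real CARD('n) + a) / 2"]
    unfolding poisson_profile_def minus_divide_left[symmetric] by simp
  ultimately show ?thesis by (simp add: poisson_kernel_def)
qed

definition poisson_grad :: "real \<Rightarrow> (real ^ 'n) \<times> real \<Rightarrow> real ^ 'n \<Rightarrow> (real ^ 'n) \<times> real" where
  "poisson_grad a X y =
    (let z = snd X; d = fst X - y; D = (norm d)\<^sup>2 + z\<^sup>2; p = real CARD('n) + a
     in (1 / poisson_mass TYPE('n) a) *\<^sub>R
       (- (p * z powr a * D powr (- p / 2 - 1)) *\<^sub>R d,
        a * z powr (a - 1) * D powr (- p / 2) - p * z powr (a + 1) * D powr (- p / 2 - 1)))"

lemma open_half_space: "open (half_space :: ((real ^ 'n) \<times> real) set)"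
  unfolding half_space_def by (intro open_Collect_less continuous_intros)

lemma half_spaceD: "X \<in> half_space \<Longrightarrow> snd X > 0"
  by (simp add: half_space_def)

lemma GDERIV_snd:
  "GDERIV snd (X :: (real ^ 'n) \<times> real) :> (0, 1)"
proof -
  have "(\<lambda>h :: (real ^ 'n) \<times> real. inner h (0, 1)) = snd" by (auto simp: inner_prod_def)
  then show ?thesis
    unfolding gderiv_def using bounded_linear_imp_has_derivative[OF bounded_linear_snd] by simp
qed

lemma GDERIV_dist_sq:
  fixes X :: "(real ^ 'n) \<times> real"
  shows "GDERIV (\<lambda>X. (norm (fst X - y))\<^sup>2 + (snd X)\<^sup>2) X :> (2 *\<^sub>R (fst X - y), 2 * snd X)"
proof -
  have d: "((\<lambda>X. fst X - y) has_derivative fst) (at X)"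
    using has_derivative_diff[OF bounded_linear_imp_has_derivative[OF bounded_linear_fst] has_derivative_const[of y]]
    by simp
  have 1: "GDERIV (\<lambda>X. (norm (fst X - y))\<^sup>2) X :> (2 *\<^sub>R (fst X - y), 0)"
    unfolding gderiv_def power2_norm_eq_inner
    by (rule has_derivative_eq_rhs[OF has_derivative_inner[OF d d]])
      (simp add: fun_eq_iff inner_prod_def inner_commute)
  have 2: "GDERIV (\<lambda>X. (snd X)\<^sup>2) X :> (2 * snd X) *\<^sub>R (0, 1)"
    by (rule GDERIV_DERIV_compose[OF GDERIV_snd]) (auto intro!: derivative_eq_intros)
  show ?thesis by (rule GDERIV_subst[OF GDERIV_add[OF 1 2]]) simp
qed

lemma GDERIV_poisson_kernel:
  fixes X :: "(real ^ 'n) \<times> real"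
  assumes X: "X \<in> half_space" and a: "a > 0"
  shows "GDERIV (\<lambda>X. poisson_kernel a (fst X - y) (snd X)) X :> poisson_grad a X y"
proof -
  define p where "p = real CARD('n) + a"
  define c where "c = poisson_mass TYPE('n) a"
  have z: "snd X > 0" using half_spaceD[OF X] .
  define D where "D = (norm (fst X - y))\<^sup>2 + (snd X)\<^sup>2"
  have D: "D > 0" unfolding D_def using z by (simp add: add_nonneg_pos)
  have 1: "GDERIV (\<lambda>X. (snd X) powr a) X :> (a * (snd X) powr (a - 1)) *\<^sub>R (0, 1)"
    by (rule GDERIV_DERIV_compose[OF GDERIV_snd has_real_derivative_powr]) fact
  have 2: "GDERIV (\<lambda>X. ((norm (fst X - y))\<^sup>2 + (snd X)\<^sup>2) powr (- p / 2)) X :>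
      (- p / 2 * D powr (- p / 2 - 1)) *\<^sub>R (2 *\<^sub>R (fst X - y), 2 * snd X)"
    unfolding D_def by (rule GDERIV_DERIV_compose[OF GDERIV_dist_sq has_real_derivative_powr]) (fact D[unfolded D_def])
  have 3: "GDERIV (\<lambda>t. (1 / c) *\<^sub>R t) t :> (1 / c)" for t :: real
    unfolding gderiv_deriv by (auto intro!: derivative_eq_intros)
  have "GDERIV (\<lambda>X. (1 / c) *\<^sub>R ((snd X) powr a * ((norm (fst X - y))\<^sup>2 + (snd X)\<^sup>2) powr (- p / 2))) X :>
      (1 / c) *\<^sub>R ((snd X) powr a *\<^sub>R ((- p / 2 * D powr (- p / 2 - 1)) *\<^sub>R (2 *\<^sub>R (fst X - y), 2 * snd X))
        + D powr (- p / 2) *\<^sub>R ((a * (snd X) powr (a - 1)) *\<^sub>R (0, 1)))"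
    using GDERIV_DERIV_compose[OF GDERIV_mult[OF 1 2] 3[unfolded gderiv_deriv]] by (simp add: D_def)
  also have "(\<lambda>X. (1 / c) *\<^sub>R ((snd X) powr a * ((norm (fst X - y))\<^sup>2 + (snd X)\<^sup>2) powr (- p / 2)))
     = (\<lambda>X. poisson_kernel a (fst X - y) (snd X))"
    by (simp add: fun_eq_iff poisson_kernel_eq p_def c_def)
  also have "(1 / c) *\<^sub>R ((snd X) powr a *\<^sub>R ((- p / 2 * D powr (- p / 2 - 1)) *\<^sub>R (2 *\<^sub>R (fst X - y), 2 * snd X))
        + D powr (- p / 2) *\<^sub>R ((a * (snd X) powr (a - 1)) *\<^sub>R (0, 1))) = poisson_grad a X y"
    using z unfolding poisson_grad_def Let_def p_def[symmetric] c_def[symmetric] D_def[symmetric]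
    by (simp add: powr_add algebra_simps)
  finally show ?thesis .
qed

lemma continuous_on_poisson_grad:
  "continuous_on half_space (\<lambda>X :: (real ^ 'n) \<times> real. poisson_grad a X y)"
proof -
  have "(norm (fst X - y))\<^sup>2 + (snd X)\<^sup>2 \<noteq> 0" "snd X \<noteq> 0" if "X \<in> half_space" for X :: "(real ^ 'n) \<times> real"
    using half_spaceD[OF that] by (auto simp: sum_power2_eq_zero_iff)
  then show ?thesis unfolding poisson_grad_def Let_def
    by (intro continuous_intros) auto
qed

lemma poisson_grad_measurable [measurable]: "poisson_grad a X \<in> borel_measurable borel"
  unfolding poisson_grad_def Let_def by measurable

definition poisson_grad_const :: "'n::finite itself \<Rightarrow> real \<Rightarrow> real" where
  "poisson_grad_const _ a = (2 * (real CARD('n) + a) + a) / poisson_mass TYPE('n) a"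

lemma poisson_grad_const_pos: "a > 0 \<Longrightarrow> poisson_grad_const TYPE('n::finite) a > 0"
  unfolding poisson_grad_const_def by (intro divide_pos_pos poisson_mass_pos) (auto intro: add_pos_pos)

text \<open>Differentiation costs a factor \<open>1 / z\<close>: with
  \<open>D = |x - y|^2 + z^2\<close>, the bounds \<open>z |x - y| \<le> D\<close> and
  \<open>z^2 \<le> D\<close> absorb the extra power of \<open>D\<close>. The horizontal part
  contributes \<open>p\<close> to the constant and the vertical part \<open>a + p\<close>, where
  \<open>p = n + a\<close>.\<close>

lemma norm_poisson_grad_le:
  fixes X :: "(real ^ 'n) \<times> real"
  assumes X: "X \<in> half_space" and a: "a > 0"
  shows "norm (poisson_grad a X y) \<le> poisson_grad_const TYPE('n) a *
    (snd X powr (a - 1) * ((norm (fst X - y))\<^sup>2 + (snd X)\<^sup>2) powr (- (real CARD('n) + a) / 2))"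
proof -
  define p where "p = real CARD('n) + a"
  define c where "c = poisson_mass TYPE('n) a"
  define z where "z = snd X"
  define r where "r = norm (fst X - y)"
  define D where "D = r\<^sup>2 + z\<^sup>2"
  have z: "z > 0" unfolding z_def using half_spaceD[OF X] .
  have c: "c > 0" unfolding c_def by (rule poisson_mass_pos[OF a])
  have p: "p > 0" unfolding p_def using a by simp
  have D: "D > 0" unfolding D_def using z by (simp add: add_nonneg_pos)
  have "r \<ge> 0" by (simp add: r_def)
  then have "0 \<le> z * r" using z by simp
  moreover have "2 * (z * r) \<le> z * z + r * r" using sum_squares_bound[of z r] by (simp add: power2_eq_square)
  ultimately have zr: "z * r \<le> D" "z * z \<le> D" unfolding D_def power2_eq_square by (linarith, simp)
  have DD: "D powr (- p / 2 - 1) * D = D powr (- p / 2)"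
    using D powr_add[of D "- p / 2 - 1" 1] by simp
  have za: "z powr a = z powr (a - 1) * z" "z powr (a + 1) = z powr (a - 1) * z * z"
    using z powr_add[of z "a - 1" 1] powr_add[of z "a - 1" 2]
    by (auto simp: power2_eq_square add.commute mult.assoc)
  have 1: "p * z powr a * D powr (- p / 2 - 1) * r \<le> p * (z powr (a - 1) * D powr (- p / 2))"
    using mult_left_mono[OF zr(1), of "p * z powr (a - 1) * D powr (- p / 2 - 1)"] p
    unfolding za DD[symmetric] by (simp add: algebra_simps)
  have 2: "p * z powr (a + 1) * D powr (- p / 2 - 1) \<le> p * (z powr (a - 1) * D powr (- p / 2))"
    using mult_left_mono[OF zr(2), of "p * z powr (a - 1) * D powr (- p / 2 - 1)"] p
    unfolding za DD[symmetric] by (simp add: algebra_simps)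
  have nn: "0 \<le> p * z powr (a + 1) * D powr (- p / 2 - 1)" "0 \<le> a * z powr (a - 1) * D powr (- p / 2)"
    using p a by auto
  have gen: "norm ((1 / c) *\<^sub>R (A, B)) \<le> (1 / c) * (norm A + norm B)" for A :: "real ^ 'n" and B :: real
    unfolding norm_scaleR using c norm_Pair_le[of A B] divide_right_mono[of "norm (A, B)" "norm A + norm B" c] by simp
  have A: "norm (- (p * z powr a * D powr (- p / 2 - 1)) *\<^sub>R (fst X - y)) \<le> p * (z powr (a - 1) * D powr (- p / 2))"
    using 1 p by (simp add: r_def abs_mult)
  have B: "norm (a * z powr (a - 1) * D powr (- p / 2) - p * z powr (a + 1) * D powr (- p / 2 - 1))
      \<le> a * (z powr (a - 1) * D powr (- p / 2)) + p * (z powr (a - 1) * D powr (- p / 2))"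
    using 2 nn by (auto simp: abs_le_iff mult.assoc)
  have "norm (poisson_grad a X y) \<le> (1 / c) * (norm (- (p * z powr a * D powr (- p / 2 - 1)) *\<^sub>R (fst X - y))
      + norm (a * z powr (a - 1) * D powr (- p / 2) - p * z powr (a + 1) * D powr (- p / 2 - 1)))"
    unfolding poisson_grad_def Let_def p_def[symmetric] c_def[symmetric] z_def[symmetric] r_def[symmetric] D_def[symmetric]
    by (rule gen)
  also have "\<dots> \<le> 1 / c * (p * (z powr (a - 1) * D powr (- p / 2)) +
      (a * (z powr (a - 1) * D powr (- p / 2)) + p * (z powr (a - 1) * D powr (- p / 2))))"
    using c by (intro mult_left_mono add_mono A B) simp
  also have "\<dots> = (2 * p + a) / c * (z powr (a - 1) * D powr (- p / 2))"
    by (simp add: add_divide_distrib algebra_simps)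
  finally show ?thesis
    using c unfolding poisson_grad_const_def p_def[symmetric] c_def[symmetric] z_def r_def D_def by simp
qed

section \<open>Differentiability of Poisson extensions\<close>

definition extension_grad :: "real \<Rightarrow> (real ^ 'n \<Rightarrow> real) \<Rightarrow> (real ^ 'n) \<times> real \<Rightarrow> (real ^ 'n) \<times> real" where
  "extension_grad a f X = (LINT y|lborel. f y *\<^sub>R poisson_grad a X y)"

lemma abs_bracket [simp]: "\<bar>bracket p y\<bar> = bracket p y"
  using bracket_pos[of p y] by simp

text \<open>The natural class of data, for which the Poisson integral converges absolutely at every
  point of the half-space. Borel measurability keeps the Fubini arguments within
  \<open>lborel\<close>.\<close>

definition weight_integrable :: "real \<Rightarrow> (real ^ 'n \<Rightarrow> real) \<Rightarrow> bool" where
  "weight_integrable a f \<longleftrightarrow> f \<in> borel_measurable borel \<and>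
     integrable lborel (\<lambda>y. f y * bracket (real CARD('n) + a) y)"

lemma poisson_kernel_measurable [measurable]:
  "(\<lambda>y. poisson_kernel a (x - y :: real ^ 'n) z) \<in> borel_measurable borel"
  unfolding poisson_kernel_eq by measurable

lemma poisson_kernel_nonneg: "a > 0 \<Longrightarrow> poisson_kernel a (x :: real ^ 'n) z \<ge> 0"
  unfolding poisson_kernel_eq using poisson_mass_pos[of a, where 'n='n] by simp

lemma poisson_kernel_le_bracket:
  fixes x :: "real ^ 'n"
  assumes "z > 0" "a > 0"
  obtains C where "\<And>y. poisson_kernel a (x - y) z \<le> C * bracket (real CARD('n) + a) y"
proof
  fix y
  show "poisson_kernel a (x - y) z \<le> (z powr a * (2 + (1 + 2 * (norm x)\<^sup>2) / z\<^sup>2) powr ((real CARD('n) + a) / 2) / poisson_mass TYPE('n) a)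
      * bracket (real CARD('n) + a) y"
    unfolding poisson_kernel_eq
    using bracket_comparison[of x "norm x" z z "real CARD('n) + a" y] assms poisson_mass_pos[of a, where 'n='n]
    by (auto simp: mult_left_mono divide_right_mono mult.assoc)
qed

lemma integral_poisson_kernel:
  fixes x :: "real ^ 'n"
  assumes "z > 0" "a > 0"
  shows "integrable lborel (\<lambda>y. poisson_kernel a (x - y) z)" "(LINT y|lborel. poisson_kernel a (x - y) z) = 1"
proof -
  have q: "real DIM(real ^ 'n) < real CARD('n) + a" using assms by simp
  show "integrable lborel (\<lambda>y. poisson_kernel a (x - y) z)"
    unfolding poisson_kernel_eq using integral_dilated_bracket(1)[OF assms(1) q, of x] by simp
  have "(LINT y|lborel. poisson_kernel a (x - y) z) =
     z powr a * (LINT y|lborel. ((norm (x - y))\<^sup>2 + z\<^sup>2) powr (- (real CARD('n) + a) / 2)) / poisson_mass TYPE('n) a"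
    unfolding poisson_kernel_eq by simp
  also have "\<dots> = z powr a * z powr (- a)"
    unfolding integral_dilated_bracket(2)[OF assms(1) q, of x]
    using poisson_mass_pos[of a, where 'n='n] assms by (simp add: poisson_mass_def)
  also have "\<dots> = 1" using assms by (simp add: powr_add[symmetric])
  finally show "(LINT y|lborel. poisson_kernel a (x - y) z) = 1" .
qed

lemma weight_integrable_kernel:
  fixes f :: "real ^ 'n \<Rightarrow> real"
  assumes f: "weight_integrable a f" and a: "a > 0" and z: "z > 0"
  shows "integrable lborel (\<lambda>y. f y * poisson_kernel a (x - y) z)"
proof -
  have [measurable]: "f \<in> borel_measurable borel" and fi: "integrable lborel (\<lambda>y. f y * bracket (real CARD('n) + a) y)"
    using f unfolding weight_integrable_def by auto
  obtain C where C: "\<And>y. poisson_kernel a (x - y) z \<le> C * bracket (real CARD('n) + a) y"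
    using poisson_kernel_le_bracket[OF z a] by metis
  show ?thesis
  proof (rule Bochner_Integration.integrable_bound[where f="\<lambda>y. C * (f y * bracket (real CARD('n) + a) y)"])
    show "AE y in lborel. norm (f y * poisson_kernel a (x - y) z) \<le> norm (C * (f y * bracket (real CARD('n) + a) y))"
    proof (rule AE_I2)
      fix y
      have "\<bar>poisson_kernel a (x - y) z\<bar> \<le> \<bar>C * bracket (real CARD('n) + a) y\<bar>"
        using C[of y] poisson_kernel_nonneg[OF a, of "x - y" z] by linarith
      then show "norm (f y * poisson_kernel a (x - y) z) \<le> norm (C * (f y * bracket (real CARD('n) + a) y))"
        using mult_left_mono[of "\<bar>poisson_kernel a (x - y) z\<bar>" "\<bar>C * bracket (real CARD('n) + a) y\<bar>" "\<bar>f y\<bar>"]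
        by (simp add: abs_mult mult.left_commute)
    qed
  qed (use fi in auto)
qed

lemma poisson_extension_lborel:
  fixes f :: "real ^ 'n \<Rightarrow> real"
  assumes "f \<in> borel_measurable borel"
  shows "poisson_extension a f X = (LINT y|lborel. f y * poisson_kernel a (fst X - y) (snd X))"
proof -
  have [measurable]: "f \<in> borel_measurable borel" by fact
  have "(\<lambda>y. f y * poisson_kernel a (fst X - y) (snd X)) \<in> borel_measurable lborel" by measurable
  then show ?thesis unfolding poisson_extension_def by (rule integral_completion)
qed

lemma ball_half_spaceD:
  fixes X :: "(real ^ 'n) \<times> real"
  assumes "X' \<in> ball X (snd X / 2)"
  shows "snd X / 2 \<le> snd X'" "snd X' \<le> 2 * snd X" "norm (fst X') \<le> norm (fst X) + snd X"
proof -
  have d: "norm (X' - X) < snd X / 2" using assms by (simp add: dist_norm norm_minus_commute)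
  have "\<bar>snd X' - snd X\<bar> < snd X / 2"
    using dist_snd_le[of X' X] d by (simp add: dist_norm)
  moreover have "norm (fst X' - fst X) < snd X / 2"
    using dist_fst_le[of X' X] d by (simp add: dist_norm)
  ultimately show "snd X / 2 \<le> snd X'" "snd X' \<le> 2 * snd X" "norm (fst X') \<le> norm (fst X) + snd X"
    using norm_triangle_sub[of "fst X'" "fst X"] norm_ge_zero[of "fst X' - fst X"] by linarith+
qed

text \<open>In the ball of radius \<open>z / 2\<close> around \<open>X\<close> the height stays
  between \<open>z / 2\<close> and \<open>2 z\<close>, so one multiple of \<open>|f|\<close> times
  the weight dominates the differentiated integrand.\<close>

lemma
  fixes f :: "real ^ 'n \<Rightarrow> real"
  assumes f: "weight_integrable a f" and a: "a > 0"
  shows GDERIV_poisson_extension: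
      "X \<in> half_space \<Longrightarrow> GDERIV (poisson_extension a f) X :> extension_grad a f X"
    and continuous_on_extension_grad: "continuous_on half_space (extension_grad a f)"
    and integrable_extension_grad:
      "X \<in> half_space \<Longrightarrow> integrable lborel (\<lambda>y. f y *\<^sub>R poisson_grad a X y)"
proof -
  define p where "p = real CARD('n) + a"
  have fm [measurable]: "f \<in> borel_measurable borel" and fi: "integrable lborel (\<lambda>y. f y * bracket p y)"
    using f unfolding weight_integrable_def p_def by auto
  define L where "L = poisson_grad_const TYPE('n) a"
  have L: "L > 0" unfolding L_def by (rule poisson_grad_const_pos[OF a])
  have dom: "\<exists>e>0. \<exists>w. integrable lborel w \<and> ball X e \<subseteq> half_space \<and>
      (\<forall>X'\<in>ball X e. \<forall>y. norm (f y *\<^sub>R poisson_grad a X' y) \<le> w y)"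
    if X: "X \<in> half_space" for X :: "(real ^ 'n) \<times> real"
  proof -
    define z where "z = snd X"
    have z: "z > 0" unfolding z_def using half_spaceD[OF X] .
    \<comment> \<open>The exponent \<open>a - 1\<close> may have either sign; the sum of the values
      at the two extreme heights covers both cases.\<close>
    define Q where "Q = (z / 2) powr (a - 1) + (2 * z) powr (a - 1)"
    define C where "C = (2 + (1 + 2 * (norm (fst X) + z)\<^sup>2) / (z / 2)\<^sup>2) powr (p / 2)"
    define w where "w y = L * Q * C * \<bar>f y * bracket p y\<bar>" for y
    have "norm (f y *\<^sub>R poisson_grad a X' y) \<le> w y" if X': "X' \<in> ball X (z / 2)" for X' y
    proof -
      note b = ball_half_spaceD[OF X'[unfolded z_def], folded z_def]
      have hs: "X' \<in> half_space" using b(1) z by (simp add: half_space_def)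
      have Q: "snd X' powr (a - 1) \<le> Q"
      proof (cases "a \<ge> 1")
        case True
        then have "snd X' powr (a - 1) \<le> (2 * z) powr (a - 1)" using b z by (intro powr_mono2) auto
        then show ?thesis unfolding Q_def by (simp add: add_increasing)
      next
        case False
        then have "snd X' powr (a - 1) \<le> (z / 2) powr (a - 1)" using b z by (intro powr_mono2') auto
        then show ?thesis unfolding Q_def by (simp add: add_increasing2)
      qed
      have C: "((norm (fst X' - y))\<^sup>2 + (snd X')\<^sup>2) powr (- p / 2) \<le> C * bracket p y"
        unfolding C_def using b z a by (intro bracket_comparison) (auto simp: p_def)
      have "norm (poisson_grad a X' y) \<le> L * (snd X' powr (a - 1) * ((norm (fst X' - y))\<^sup>2 + (snd X')\<^sup>2) powr (- p / 2))"
        unfolding L_def p_def by (rule norm_poisson_grad_le[OF hs a])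
      also have "\<dots> \<le> L * (Q * (C * bracket p y))"
        using L Q C by (intro mult_left_mono mult_mono) (auto simp: Q_def)
      finally have "\<bar>f y\<bar> * norm (poisson_grad a X' y) \<le> \<bar>f y\<bar> * (L * (Q * (C * bracket p y)))"
        by (intro mult_left_mono) auto
      then show ?thesis unfolding w_def using bracket_pos[of p y] by (simp add: abs_mult ac_simps)
    qed
    moreover have "integrable lborel w" unfolding w_def using fi by (intro integrable_mult_right integrable_abs)
    moreover have "ball X (z / 2) \<subseteq> half_space"
      using ball_half_spaceD(1)[of _ X] z unfolding z_def half_space_def by fastforce
    ultimately show ?thesis using z by (intro exI[of _ "z / 2"]) auto
  qed
  have ki: "integrable lborel (\<lambda>y. f y * poisson_kernel a (fst X - y) (snd X))" if "X \<in> half_space" for X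
    by (rule weight_integrable_kernel[OF f a half_spaceD[OF that]])
  have kd: "GDERIV (\<lambda>X. f y * poisson_kernel a (fst X - y) (snd X)) X :> f y *\<^sub>R poisson_grad a X y"
    if "X \<in> half_space" for X y
    using GDERIV_mult[OF GDERIV_const GDERIV_poisson_kernel[OF that a], of "f y" y] by simp
  have kc: "continuous_on half_space (\<lambda>X. f y *\<^sub>R poisson_grad a X y)" for y
    by (intro continuous_intros continuous_on_poisson_grad)
  have km: "(\<lambda>y. f y *\<^sub>R poisson_grad a X y) \<in> borel_measurable lborel" for X by measurable
  note D = GDERIV_under_integral[where S=half_space and M=lborel and k="\<lambda>X y. f y * poisson_kernel a (fst X - y) (snd X)"
      and K="\<lambda>X y. f y *\<^sub>R poisson_grad a X y", OF open_half_space kd kc ki km dom]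
  show "continuous_on half_space (extension_grad a f)"
    unfolding extension_grad_def by (rule D(2))
  show "integrable lborel (\<lambda>y. f y *\<^sub>R poisson_grad a X y)" if "X \<in> half_space"
    by (rule D(3)) (use that in auto)
  have e: "poisson_extension a f = (\<lambda>X. LINT y|lborel. f y * poisson_kernel a (fst X - y) (snd X))"
    by (rule ext) (rule poisson_extension_lborel[OF fm])
  show "GDERIV (poisson_extension a f) X :> extension_grad a f X" if "X \<in> half_space"
    unfolding extension_grad_def e by (rule D(1)) (use that in auto)
qed

lemma weight_integrable_const:
  assumes "a > 0" shows "weight_integrable a (\<lambda>y :: real ^ 'n. c)"
proof -
  have "real DIM(real ^ 'n) < real CARD('n) + a" using assms by simp
  from integrable_bracket[OF this] show ?thesis unfolding weight_integrable_def by simp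
qed

text \<open>The extension of the constant 1 is constant because the kernel has unit mass, and its
  gradient is the integral in question.\<close>

lemma integral_poisson_grad:
  fixes X :: "(real ^ 'n) \<times> real"
  assumes X: "X \<in> half_space" and a: "a > 0"
  shows "integrable lborel (poisson_grad a X)" "(LINT y|lborel. poisson_grad a X y) = 0"
proof -
  note W = weight_integrable_const[OF a, of 1, where 'n='n]
  show "integrable lborel (poisson_grad a X)" using integrable_extension_grad[OF W a X] by simp
  have "poisson_extension a (\<lambda>y :: real ^ 'n. 1) Y = 1" if "Y \<in> half_space" for Y
    using integral_poisson_kernel(2)[OF half_spaceD[OF that] a, of "fst Y"] by (simp add: poisson_extension_lborel)
  then have "GDERIV (poisson_extension a (\<lambda>y :: real ^ 'n. 1)) X :> 0"
    by (intro GDERIV_transform_open[OF GDERIV_const[of 1] open_half_space X]) simp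
  from GDERIV_unique[OF GDERIV_poisson_extension[OF W a X] this]
  show "(LINT y|lborel. poisson_grad a X y) = 0" by (simp add: extension_grad_def)
qed

section \<open>Energy of Poisson extensions\<close>

text \<open>By symmetry of the integrand this is comparable to the Gagliardo energy over the pairs
  that are not both outside \<open>B_2\<close>; the iterated form is the one that Tonelli acts
  on.\<close>

definition local_energy :: "real \<Rightarrow> (real ^ 'n \<Rightarrow> real) \<Rightarrow> ennreal" where
  "local_energy a f = (\<integral>\<^sup>+ x. indicator (ball 0 2) x * (\<integral>\<^sup>+ y. ennreal (\<bar>f x - f y\<bar>\<^sup>2 / norm (x - y) powr (real CARD('n) + a)) \<partial>lborel) \<partial>lborel)"

text \<open>Finite energy yields one point \<open>x\<close> in \<open>B_2\<close> at which the inner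
  integral is finite. Seen from this \<open>x\<close>, the kernel \<open>1 / |x - y|^p\<close>
  dominates a multiple of the weight, so both terms in
  \<open>f(y)^2 \<le> 2 f(x)^2 + 2 |f(x) - f(y)|^2\<close> are integrable against it.\<close>

lemma local_energy_imp_weight_integrable:
  fixes f :: "real ^ 'n \<Rightarrow> real"
  assumes [measurable]: "f \<in> borel_measurable borel" and a: "a > 0" and J: "local_energy a f < \<infinity>"
  shows "weight_integrable a (\<lambda>y. (f y)\<^sup>2)" "weight_integrable a f"
proof -
  define p where "p = real CARD('n) + a"
  have p: "p > 0" unfolding p_def using a by simp
  define I where "I x = (\<integral>\<^sup>+ y. ennreal (\<bar>f x - f y\<bar>\<^sup>2 / norm (x - y) powr p) \<partial>lborel)" for x
  have [measurable]: "I \<in> borel_measurable borel" unfolding I_def by measurable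
  have J': "(\<integral>\<^sup>+ x. indicator (ball 0 2) x * I x \<partial>lborel) < \<infinity>"
    using J unfolding local_energy_def I_def p_def .
  have "AE x in lborel. indicator (ball 0 2) x * I x \<noteq> \<infinity>"
  proof (rule nn_integral_noteq_infinite)
    show "(\<lambda>x. indicator (ball 0 2) x * I x) \<in> borel_measurable lborel"
      by (intro borel_measurable_times_ennreal borel_measurable_indicator) auto
  qed (use J' in auto)
  \<comment> \<open>\<open>B_2\<close> has positive measure, so finiteness almost everywhere is
    attained at one of its points.\<close>
  moreover have "\<not> (AE x in lborel. x \<notin> ball (0 :: real ^ 'n) 2)"
  proof
    assume "AE x in lborel. x \<notin> ball (0 :: real ^ 'n) 2"
    then have "emeasure lborel (ball (0 :: real ^ 'n) 2) = 0"
      by (subst (asm) AE_iff_measurable[OF _ refl]) (auto simp: ball_def)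
    moreover have "unit_ball_vol (real CARD('n)) * 2 ^ CARD('n) > 0" by (intro mult_pos_pos unit_ball_vol_pos) auto
    ultimately show False by (simp add: emeasure_ball ennreal_eq_0_iff)
  qed
  ultimately have "\<exists>x. x \<in> ball 0 2 \<and> indicator (ball 0 2) x * I x \<noteq> \<infinity>"
    by (metis (mono_tags, lifting) eventually_mono)
  then obtain x where x: "x \<in> ball 0 2" "I x < \<infinity>" by (auto simp: less_top)
  \<comment> \<open>As |x| < 2, one has
    \<open>|x - y|^2 \<le> 8 + 2 |y|^2 \<le> 8 (1 + |y|^2)\<close>. On the diagonal the right-hand
    side would be 0 by division by zero.\<close>
  have br: "bracket p y \<le> 8 powr (p / 2) * (1 / norm (x - y) powr p)" if "x \<noteq> y" for y
  proof -
    have "(norm (x - y))\<^sup>2 \<le> (norm x + norm y)\<^sup>2" by (intro power_mono norm_triangle_ineq4) auto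
    also have "\<dots> \<le> 2 * (norm x)\<^sup>2 + 2 * (norm y)\<^sup>2"
      using zero_le_power2[of "norm x - norm y"] by (simp add: power2_eq_square algebra_simps)
    finally have "(norm (x - y))\<^sup>2 \<le> 2 * (norm x)\<^sup>2 + 2 * (norm y)\<^sup>2" .
    moreover have "(norm x)\<^sup>2 \<le> 4" using power_mono[of "norm x" 2 2] x(1) by simp
    ultimately have "(norm (x - y))\<^sup>2 / 8 \<le> 1 + (norm y)\<^sup>2" using zero_le_power2[of "norm y"] by linarith
    then have "bracket p y \<le> ((norm (x - y))\<^sup>2 / 8) powr (- p / 2)"
      unfolding bracket_def using that p by (intro powr_mono2') auto
    also have "\<dots> = ((norm (x - y))\<^sup>2) powr (- p / 2) * 8 powr (p / 2)"
      by (simp add: powr_divide powr_minus field_simps)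
    also have "((norm (x - y))\<^sup>2) powr (- p / 2) = norm (x - y) powr (- p)"
      using that powr_powr[of "norm (x - y)" 2 "- p / 2"] by simp
    finally show ?thesis by (simp add: powr_minus_divide mult.commute)
  qed
  have le: "(f y)\<^sup>2 * bracket p y \<le> 2 * (f x)\<^sup>2 * bracket p y + 2 * 8 powr (p / 2) * (\<bar>f x - f y\<bar>\<^sup>2 / norm (x - y) powr p)" for y
  proof -
    have "(f y)\<^sup>2 \<le> 2 * (f x)\<^sup>2 + 2 * \<bar>f x - f y\<bar>\<^sup>2"
      using zero_le_power2[of "2 * f x - f y"] by (simp add: power2_eq_square algebra_simps)
    then have "(f y)\<^sup>2 * bracket p y \<le> (2 * (f x)\<^sup>2 + 2 * \<bar>f x - f y\<bar>\<^sup>2) * bracket p y"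
      using bracket_pos[of p y] by (intro mult_right_mono) auto
    moreover have "\<bar>f x - f y\<bar>\<^sup>2 * bracket p y \<le> \<bar>f x - f y\<bar>\<^sup>2 * (8 powr (p / 2) * (1 / norm (x - y) powr p))"
    proof (cases "x = y")
      case False
      from mult_left_mono[OF br[OF False], of "\<bar>f x - f y\<bar>\<^sup>2"] show ?thesis by simp
    qed simp
    ultimately show ?thesis by (simp add: algebra_simps)
  qed
  have q: "real DIM(real ^ 'n) < p" unfolding p_def using a by simp
  note ib = integrable_bracket[OF q]
  have ix: "integrable lborel (\<lambda>y. \<bar>f x - f y\<bar>\<^sup>2 / norm (x - y) powr p)"
    using x(2) unfolding I_def by (intro integrableI_nonneg) auto
  have i2: "integrable lborel (\<lambda>y. (f y)\<^sup>2 * bracket p y)"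
  proof (rule Bochner_Integration.integrable_bound)
    show "integrable lborel (\<lambda>y. 2 * (f x)\<^sup>2 * bracket p y + 2 * 8 powr (p / 2) * (\<bar>f x - f y\<bar>\<^sup>2 / norm (x - y) powr p))"
      using ib ix by (intro Bochner_Integration.integrable_add integrable_mult_right) auto
    show "AE y in lborel. norm ((f y)\<^sup>2 * bracket p y)
        \<le> norm (2 * (f x)\<^sup>2 * bracket p y + 2 * 8 powr (p / 2) * (\<bar>f x - f y\<bar>\<^sup>2 / norm (x - y) powr p))"
      using le bracket_pos[of p] by (auto intro!: AE_I2 order_trans[OF _ abs_ge_self] simp: abs_mult abs_bracket)
  qed auto
  then show "weight_integrable a (\<lambda>y. (f y)\<^sup>2)" unfolding weight_integrable_def p_def by simp
  have "integrable lborel (\<lambda>y. f y * bracket p y)"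
  proof (rule Bochner_Integration.integrable_bound)
    show "integrable lborel (\<lambda>y. bracket p y + (f y)\<^sup>2 * bracket p y)"
      using ib i2 by (intro Bochner_Integration.integrable_add)
    have "\<bar>f y\<bar> \<le> 1 + (f y)\<^sup>2" for y
      using zero_le_power2[of "\<bar>f y\<bar> - 1"] by (simp add: power2_eq_square algebra_simps)
    then have "\<bar>f y\<bar> * bracket p y \<le> (1 + (f y)\<^sup>2) * bracket p y" for y
      using bracket_pos[of p y] by (intro mult_right_mono) auto
    then show "AE y in lborel. norm (f y * bracket p y) \<le> norm (bracket p y + (f y)\<^sup>2 * bracket p y)"
      using bracket_pos[of p] by (auto intro!: AE_I2 order_trans[OF _ abs_ge_self] simp: abs_mult abs_bracket algebra_simps)
  qed auto
  then show "weight_integrable a f" unfolding weight_integrable_def p_def by simp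
qed

lemma bracket_nonneg [simp]: "0 \<le> bracket p y"
  using bracket_pos[of p y] by simp

text \<open>The integral is split at \<open>z = r\<close>: below, the sum of squares is replaced by
  \<open>r^2\<close>, above, by \<open>z^2\<close>. Both parts scale like \<open>r^(-p)\<close>;
  \<open>a > 0\<close> gives convergence at 0 and \<open>p > 0\<close> at infinity.\<close>

lemma nn_integral_powr_kernel:
  fixes r a p :: real
  assumes r: "r > 0" and a: "a > 0" and p: "p > 0"
  shows "(\<integral>\<^sup>+ z. indicator {0<..} z * ennreal (z powr (a / 2 - 1) * (r\<^sup>2 + z\<^sup>2) powr (- (p / 2 + a / 4))) \<partial>lborel)
    \<le> ennreal ((2 / a + 1 / p) * r powr (- p))"
proof -
  define q where "q = p / 2 + a / 4"
  have q: "q > 0" unfolding q_def using a p by simp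
  have ez: "a / 2 - 1 - 2 * q = - p - 1" "a / 2 - 2 * q = - p" unfolding q_def by simp_all
  have sq: "(t\<^sup>2) powr (- q) = t powr (- 2 * q)" if "t > 0" for t :: real
    using that powr_powr[of t 2 "- q"] by simp
  have le: "indicator {0<..} z * ennreal (z powr (a / 2 - 1) * (r\<^sup>2 + z\<^sup>2) powr (- q)) \<le>
      ennreal (z powr (a / 2 - 1)) * indicator {0..r} z * ennreal (r powr (- 2 * q))
      + ennreal (z powr (- p - 1)) * indicator {r..} z" for z
  proof (cases "z > 0")
    case True
    show ?thesis
    proof (cases "z \<le> r")
      case True
      have "(r\<^sup>2 + z\<^sup>2) powr (- q) \<le> (r\<^sup>2) powr (- q)" using r q by (intro powr_mono2') auto
      then have "z powr (a / 2 - 1) * (r\<^sup>2 + z\<^sup>2) powr (- q) \<le> z powr (a / 2 - 1) * r powr (- 2 * q)"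
        unfolding sq[OF r] by (intro mult_left_mono) auto
      then have "ennreal (z powr (a / 2 - 1) * (r\<^sup>2 + z\<^sup>2) powr (- q)) \<le> ennreal (z powr (a / 2 - 1)) * ennreal (r powr (- 2 * q))"
        by (simp add: ennreal_mult[symmetric] ennreal_leI)
      then show ?thesis using True \<open>z > 0\<close> by (simp add: add_increasing2)
    next
      case False
      have "(r\<^sup>2 + z\<^sup>2) powr (- q) \<le> (z\<^sup>2) powr (- q)" using \<open>z > 0\<close> q by (intro powr_mono2') auto
      then have "z powr (a / 2 - 1) * (r\<^sup>2 + z\<^sup>2) powr (- q) \<le> z powr (a / 2 - 1) * z powr (- 2 * q)"
        unfolding sq[OF \<open>z > 0\<close>] by (intro mult_left_mono) auto
      also have "\<dots> = z powr (- p - 1)" by (simp add: powr_add[symmetric] ez)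
      finally show ?thesis using False \<open>z > 0\<close> by (simp add: ennreal_leI)
    qed
  qed simp
  have 1: "(\<integral>\<^sup>+ z. ennreal (z powr (a / 2 - 1)) * indicator {0..r} z \<partial>lborel) = ennreal (r powr (a / 2) / (a / 2))"
    using has_integral_powr_from_0[of "a / 2 - 1" r] a r by (intro nn_integral_has_integral_lebesgue') auto
  have 2: "(\<integral>\<^sup>+ z. ennreal (z powr (- p - 1)) * indicator {r..} z \<partial>lborel) = ennreal (r powr (- p) / p)"
    using has_integral_powr_to_inf[of "- p - 1" r] p r by (intro nn_integral_has_integral_lebesgue') auto
  have "(\<integral>\<^sup>+ z. indicator {0<..} z * ennreal (z powr (a / 2 - 1) * (r\<^sup>2 + z\<^sup>2) powr (- q)) \<partial>lborel) \<le>
      (\<integral>\<^sup>+ z. ennreal (z powr (a / 2 - 1)) * indicator {0..r} z * ennreal (r powr (- 2 * q))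
      + ennreal (z powr (- p - 1)) * indicator {r..} z \<partial>lborel)"
    by (intro nn_integral_mono le)
  also have "\<dots> = (\<integral>\<^sup>+ z. ennreal (z powr (a / 2 - 1)) * indicator {0..r} z \<partial>lborel) * ennreal (r powr (- 2 * q))
      + (\<integral>\<^sup>+ z. ennreal (z powr (- p - 1)) * indicator {r..} z \<partial>lborel)"
    by (subst nn_integral_add) (simp_all add: nn_integral_multc)
  also have "\<dots> = ennreal (r powr (a / 2) / (a / 2) * r powr (- 2 * q) + r powr (- p) / p)"
    unfolding 1 2 using a p by (simp add: ennreal_mult[symmetric] ennreal_plus[symmetric] del: ennreal_plus)
  also have "r powr (a / 2) / (a / 2) * r powr (- 2 * q) + r powr (- p) / p = (2 / a + 1 / p) * r powr (- p)"
  proof -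
    have "r powr (a / 2) * r powr (- 2 * q) = r powr (- p)" by (simp add: powr_add[symmetric] ez)
    then show ?thesis using a p by (simp add: field_simps)
  qed
  finally show ?thesis unfolding q_def .
qed

text \<open>As the kernel gradient has integral zero, \<open>f y\<close> can be replaced by \<open>f y - f x\<close>. The exponent
  \<open>p / 2 + a / 4\<close> comes from Cauchy-Schwarz: it leaves the other factor \<open>D powr (- (n + a / 2) / 2)\<close>, which is
  still integrable, while the integral over \<open>z\<close> converges at both ends.\<close>

lemma extension_grad_bound:
  fixes f :: "real ^ 'n \<Rightarrow> real"
  assumes f: "weight_integrable a f" and a: "a > 0" and X: "X \<in> half_space"
  defines "p \<equiv> real CARD('n) + a"
  defines "K0 \<equiv> (poisson_grad_const TYPE('n) a)\<^sup>2 * (LINT y|lborel. bracket (real CARD('n) + a / 2) (y :: real ^ 'n))"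
  shows "ennreal (snd X powr (1 - a) * (norm (extension_grad a f X))\<^sup>2) \<le>
     ennreal K0 * (\<integral>\<^sup>+ y. ennreal (\<bar>f (fst X) - f y\<bar>\<^sup>2 *
       (snd X powr (a / 2 - 1) * ((norm (fst X - y))\<^sup>2 + (snd X)\<^sup>2) powr (- (p / 2 + a / 4)))) \<partial>lborel)"
proof -
  define x z where "x = fst X" and "z = snd X"
  have z: "z > 0" unfolding z_def using half_spaceD[OF X] .
  define L where "L = poisson_grad_const TYPE('n) a"
  have L: "L > 0" unfolding L_def by (rule poisson_grad_const_pos[OF a])
  define c2 where "c2 = (LINT y|lborel. bracket (real CARD('n) + a / 2) (y :: real ^ 'n))"
  have c2: "c2 > 0" unfolding c2_def using a by (intro integral_bracket_pos) simp
  have K0: "K0 = L\<^sup>2 * c2" "K0 > 0" unfolding K0_def L_def c2_def[symmetric] using c2 L L_def by auto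
  define D where "D y = (norm (x - y))\<^sup>2 + z\<^sup>2" for y
  have D: "D y > 0" for y unfolding D_def using z by (simp add: add_nonneg_pos)
  have [measurable]: "f \<in> borel_measurable borel" using f unfolding weight_integrable_def by simp
  have [measurable]: "D \<in> borel_measurable borel" unfolding D_def by measurable
  define S where "S = (\<integral>\<^sup>+ y. ennreal (\<bar>f x - f y\<bar>\<^sup>2 * (z powr (a / 2 - 1) * D y powr (- (p / 2 + a / 4)))) \<partial>lborel)"
  have "ennreal (z powr (1 - a) * (norm (extension_grad a f X))\<^sup>2) \<le> ennreal K0 * S"
  proof (cases "S < \<infinity>")
    case False
    then have "S = \<infinity>" by (simp add: less_top[symmetric])
    moreover have "ennreal K0 \<noteq> 0" using K0(2) by simp
    ultimately show ?thesis by (simp add: ennreal_mult_top)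
  next
    case True
    define s where "s y = \<bar>f x - f y\<bar>\<^sup>2 * (z powr (a / 2 - 1) * D y powr (- (p / 2 + a / 4)))" for y
    have s0: "s y \<ge> 0" for y unfolding s_def by auto
    have [measurable]: "s \<in> borel_measurable borel" unfolding s_def by measurable
    have si: "integrable lborel s"
      using True s0 unfolding S_def s_def[symmetric] by (intro integrableI_nonneg) auto
    have Ss: "S = ennreal (LINT y|lborel. s y)"
      unfolding S_def s_def[symmetric] using si s0 by (intro nn_integral_eq_integral) auto
    \<comment> \<open>The factor \<open>v\<close> integrates by scaling to a multiple of
      \<open>z powr (a / 2 - 1)\<close>. The powers of \<open>z\<close> outside \<open>s\<close>,
      together with the weight \<open>z powr (1 - a)\<close>, then cancel exactly.\<close>
    define u where "u y = (L\<^sup>2 * z powr (a / 2)) * s y" for y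
    define v where "v y = z powr (a - 1) * D y powr (- (real CARD('n) + a / 2) / 2)" for y
    have q': "real DIM(real ^ 'n) < real CARD('n) + a / 2" using a by simp
    have iv: "integrable lborel v"
      unfolding v_def D_def by (intro integrable_mult_right integral_dilated_bracket(1)[OF z q'])
    have "(LINT y|lborel. v y) = z powr (a - 1) * (z powr (- (a / 2)) * c2)"
      unfolding v_def D_def c2_def using integral_dilated_bracket(2)[OF z q', of x] by simp
    then have Iv: "(LINT y|lborel. v y) = z powr (a / 2 - 1) * c2"
      by (simp add: powr_add[symmetric] mult.assoc[symmetric])
    define g where "g y = (f y - f x) *\<^sub>R poisson_grad a X y" for y
    have guv: "(norm (g y))\<^sup>2 \<le> u y * v y" for y
    proof -
      have "norm (poisson_grad a X y) \<le> L * (z powr (a - 1) * D y powr (- p / 2))"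
        using norm_poisson_grad_le[OF X a, of y] unfolding L_def z_def D_def x_def p_def .
      then have "(norm (g y))\<^sup>2 \<le> (\<bar>f x - f y\<bar> * (L * (z powr (a - 1) * D y powr (- p / 2))))\<^sup>2"
        unfolding g_def norm_scaleR by (intro power_mono mult_mono) (auto simp: abs_minus_commute)
      also have "\<dots> = L\<^sup>2 * \<bar>f x - f y\<bar>\<^sup>2 * ((z powr (a - 1))\<^sup>2 * (D y powr (- p / 2))\<^sup>2)"
        by (simp add: power_mult_distrib)
      also have "(z powr (a - 1))\<^sup>2 = z powr (a / 2) * z powr (a / 2 - 1) * z powr (a - 1)"
        by (simp add: power2_eq_square powr_add[symmetric])
      also have "(D y powr (- p / 2))\<^sup>2 = D y powr (- (p / 2 + a / 4)) * D y powr (- (real CARD('n) + a / 2) / 2)"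
      proof -
        have e: "- p / 2 + - p / 2 = - (p / 2 + a / 4) + - (real CARD('n) + a / 2) / 2"
          unfolding p_def by (simp add: field_simps)
        show ?thesis by (simp only: power2_eq_square powr_add[symmetric] e)
      qed
      finally show ?thesis unfolding u_def v_def s_def by (simp add: ac_simps)
    qed
    have gm: "g \<in> borel_measurable lborel" unfolding g_def by measurable
    have Hg: "extension_grad a f X = (LINT y|lborel. g y)"
      unfolding g_def extension_grad_def scaleR_diff_left
      using integrable_extension_grad[OF f a X] integral_poisson_grad[OF X a] by simp
    have "(norm (extension_grad a f X))\<^sup>2 \<le> (LINT y|lborel. u y) * (LINT y|lborel. v y)"
      unfolding Hg by (rule integral_Cauchy_Schwarz(2)[OF gm _ iv _ _ guv])
        (use si s0 in \<open>auto simp: u_def v_def\<close>)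
    then have "z powr (1 - a) * (norm (extension_grad a f X))\<^sup>2 \<le>
        z powr (1 - a) * ((L\<^sup>2 * z powr (a / 2) * (LINT y|lborel. s y)) * (z powr (a / 2 - 1) * c2))"
      unfolding Iv u_def by (intro mult_left_mono) auto
    also have "\<dots> = K0 * (z powr (1 - a) * z powr (a / 2) * z powr (a / 2 - 1)) * (LINT y|lborel. s y)"
      unfolding K0 by (simp only: ac_simps)
    also have "z powr (1 - a) * z powr (a / 2) * z powr (a / 2 - 1) = 1"
      using z by (simp add: powr_add[symmetric])
    finally show ?thesis unfolding Ss using K0 by (simp add: ennreal_mult''[symmetric] ennreal_leI s0)
  qed
  then show ?thesis unfolding S_def D_def x_def z_def .
qed

lemma half_ball_subset_cylinder:
  "r \<le> 2 \<Longrightarrow> X \<in> half_ball r \<Longrightarrow> fst X \<in> ball 0 2 \<and> snd X \<in> {0<..<2} \<and> X \<in> half_space"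
  unfolding half_ball_def half_space_def
  using norm_fst_le[of "fst X" "snd X"] norm_snd_le[of "snd X" "fst X"] by auto

lemma half_ball_sets [measurable]: "half_ball r \<in> sets (borel :: ((real ^ 'n) \<times> real) measure)"
proof -
  have "half_ball r = (half_space \<inter> ball 0 r :: ((real ^ 'n) \<times> real) set)" by (auto simp: half_ball_def)
  then show ?thesis using borel_open[OF open_Int[OF open_half_space open_ball]] by simp
qed

lemma nn_integral_lborel_pair:
  fixes F :: "'a::euclidean_space \<Rightarrow> 'b::euclidean_space \<Rightarrow> ennreal"
  assumes "(\<lambda>X. F (fst X) (snd X)) \<in> borel_measurable borel"
  shows "(\<integral>\<^sup>+ X. F (fst X) (snd X) \<partial>lborel) = (\<integral>\<^sup>+ x. \<integral>\<^sup>+ z. F x z \<partial>lborel \<partial>lborel)"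
proof -
  have "(\<lambda>X. F (fst X) (snd X)) \<in> borel_measurable (lborel \<Otimes>\<^sub>M lborel)"
    using assms by (simp add: lborel_prod)
  from lborel.nn_integral_fst[OF this] show ?thesis by (simp add: lborel_prod)
qed

text \<open>After Tonelli the integral over \<open>z\<close> turns the kernel at distance
  \<open>r = |x - y|\<close> into a multiple of \<open>1 / r^p\<close>, which leaves the local
  energy. The half-ball is enlarged to the cylinder over \<open>B_2\<close> of infinite height, on
  which the integral over \<open>z\<close> still converges.\<close>

lemma extension_energy_finite:
  fixes f :: "real ^ 'n \<Rightarrow> real"
  assumes fm [measurable]: "f \<in> borel_measurable borel" and a: "a > 0" and J: "local_energy a f < \<infinity>" and r: "r \<le> 2"
  shows "(\<integral>\<^sup>+ X. indicator (half_ball r) X * ennreal (snd X powr (1 - a) * (norm (extension_grad a f X))\<^sup>2) \<partial>lborel) < \<infinity>"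
proof -
  have f: "weight_integrable a f" by (rule local_energy_imp_weight_integrable(2)[OF fm a J])
  define p where "p = real CARD('n) + a"
  have p: "p > 0" unfolding p_def using a by simp
  define K0 where "K0 = (poisson_grad_const TYPE('n) a)\<^sup>2 * (LINT y|lborel. bracket (real CARD('n) + a / 2) (y :: real ^ 'n))"
  define k where "k x z y = ennreal (\<bar>f x - f y\<bar>\<^sup>2 *
       (z powr (a / 2 - 1) * ((norm (x - y))\<^sup>2 + z\<^sup>2) powr (- (p / 2 + a / 4))))" for x y :: "real ^ 'n" and z
  define C3 where "C3 = 2 / a + 1 / p"
  have C30: "C3 \<ge> 0" unfolding C3_def using a p by simp
  define B where "B = (indicator (ball 0 2) :: real ^ 'n \<Rightarrow> ennreal)"
  have [measurable]: "B \<in> borel_measurable borel" unfolding B_def by (rule borel_measurable_indicator) simp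
  have km [measurable]: "(\<lambda>(X, y). k (fst X) (snd X) y) \<in> borel_measurable (borel \<Otimes>\<^sub>M borel)"
    unfolding k_def borel_prod[symmetric] by measurable
  have k1 [measurable]: "(\<lambda>(z, y). k x z y) \<in> borel_measurable (borel \<Otimes>\<^sub>M borel)" for x
    unfolding k_def by measurable
  have Sm [measurable]: "(\<lambda>X :: (real ^ 'n) \<times> real. \<integral>\<^sup>+ y. k (fst X) (snd X) y \<partial>lborel) \<in> borel_measurable borel"
    by (rule lborel.borel_measurable_nn_integral) (use km in \<open>simp add: case_prod_beta'\<close>)
  have BX: "(\<lambda>X :: (real ^ 'n) \<times> real. B (fst X)) \<in> borel_measurable borel"
    unfolding borel_prod[symmetric] by measurable
  have IX: "(\<lambda>X :: (real ^ 'n) \<times> real. indicator {0<..} (snd X) :: ennreal) \<in> borel_measurable borel"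
    unfolding borel_prod[symmetric] by measurable
  have PM: "(\<lambda>X. B (fst X) * (indicator {0<..} (snd X) * (\<integral>\<^sup>+ y. k (fst X) (snd X) y \<partial>lborel))) \<in> borel_measurable borel"
    by (intro borel_measurable_times_ennreal BX IX Sm)
  have "(\<integral>\<^sup>+ X. indicator (half_ball r) X * ennreal (snd X powr (1 - a) * (norm (extension_grad a f X))\<^sup>2) \<partial>lborel)
    \<le> (\<integral>\<^sup>+ X. ennreal K0 * (B (fst X) * (indicator {0<..} (snd X) * (\<integral>\<^sup>+ y. k (fst X) (snd X) y \<partial>lborel))) \<partial>lborel)"
  proof (rule nn_integral_mono)
    fix X :: "(real ^ 'n) \<times> real"
    show "indicator (half_ball r) X * ennreal (snd X powr (1 - a) * (norm (extension_grad a f X))\<^sup>2)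
      \<le> ennreal K0 * (B (fst X) * (indicator {0<..} (snd X) * (\<integral>\<^sup>+ y. k (fst X) (snd X) y \<partial>lborel)))"
    proof (cases "X \<in> half_ball r")
      case True
      note h = half_ball_subset_cylinder[OF r True]
      then show ?thesis using extension_grad_bound[OF f a, of X] True
        unfolding K0_def k_def p_def B_def by simp
    qed simp
  qed
  also have "\<dots> = ennreal K0 * (\<integral>\<^sup>+ X. B (fst X) * (indicator {0<..} (snd X) * (\<integral>\<^sup>+ y. k (fst X) (snd X) y \<partial>lborel)) \<partial>lborel)"
    by (rule nn_integral_cmult) (use PM in simp)
  also have "(\<integral>\<^sup>+ X. B (fst X) * (indicator {0<..} (snd X) * (\<integral>\<^sup>+ y. k (fst X) (snd X) y \<partial>lborel)) \<partial>(lborel :: ((real ^ 'n) \<times> real) measure))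
      = (\<integral>\<^sup>+ x. \<integral>\<^sup>+ z. B x * (indicator {0<..} z * (\<integral>\<^sup>+ y. k x z y \<partial>lborel)) \<partial>lborel \<partial>lborel)"
    by (rule nn_integral_lborel_pair[OF PM])
  also have "\<dots> \<le> (\<integral>\<^sup>+ x. B x * (\<integral>\<^sup>+ y. ennreal C3 * ennreal (\<bar>f x - f y\<bar>\<^sup>2 / norm (x - y) powr p) \<partial>lborel) \<partial>lborel)"
  proof (rule nn_integral_mono)
    fix x :: "real ^ 'n"
    have m1: "(\<lambda>z. \<integral>\<^sup>+ y. k x z y \<partial>lborel) \<in> borel_measurable lborel"
      by (rule lborel.borel_measurable_nn_integral) (use k1 in simp)
    have "(\<integral>\<^sup>+ z. B x * (indicator {0<..} z * (\<integral>\<^sup>+ y. k x z y \<partial>lborel)) \<partial>lborel)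
        = B x * (\<integral>\<^sup>+ z. indicator {0<..} z * (\<integral>\<^sup>+ y. k x z y \<partial>lborel) \<partial>lborel)"
      using m1 by (intro nn_integral_cmult borel_measurable_times_ennreal) auto
    also have "(\<integral>\<^sup>+ z. indicator {0<..} z * (\<integral>\<^sup>+ y. k x z y \<partial>lborel) \<partial>lborel) =
        (\<integral>\<^sup>+ z. (\<integral>\<^sup>+ y. indicator {0<..} z * k x z y \<partial>lborel) \<partial>lborel)"
      by (intro nn_integral_cong nn_integral_cmult[symmetric]) (simp add: k_def)
    also have "\<dots> = (\<integral>\<^sup>+ y. (\<integral>\<^sup>+ z. indicator {0<..} z * k x z y \<partial>lborel) \<partial>lborel)"
      by (rule lborel_pair.Fubini'[symmetric]) (use k1[of x] in \<open>simp add: case_prod_beta'\<close>)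
    also have "\<dots> \<le> (\<integral>\<^sup>+ y. ennreal C3 * ennreal (\<bar>f x - f y\<bar>\<^sup>2 / norm (x - y) powr p) \<partial>lborel)"
    proof (rule nn_integral_mono)
      fix y
      show "(\<integral>\<^sup>+ z. indicator {0<..} z * k x z y \<partial>lborel) \<le> ennreal C3 * ennreal (\<bar>f x - f y\<bar>\<^sup>2 / norm (x - y) powr p)"
      proof (cases "x = y")
        case False
        then have rp: "norm (x - y) > 0" by simp
        have "(\<integral>\<^sup>+ z. indicator {0<..} z * k x z y \<partial>lborel) = (\<integral>\<^sup>+ z. ennreal (\<bar>f x - f y\<bar>\<^sup>2) *
           (indicator {0<..} z * ennreal (z powr (a / 2 - 1) * ((norm (x - y))\<^sup>2 + z\<^sup>2) powr (- (p / 2 + a / 4)))) \<partial>lborel)"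
          unfolding k_def by (intro nn_integral_cong) (simp add: ennreal_mult'' mult.left_commute)
        also have "\<dots> = ennreal (\<bar>f x - f y\<bar>\<^sup>2) * (\<integral>\<^sup>+ z.
           indicator {0<..} z * ennreal (z powr (a / 2 - 1) * ((norm (x - y))\<^sup>2 + z\<^sup>2) powr (- (p / 2 + a / 4))) \<partial>lborel)"
          by (rule nn_integral_cmult) measurable
        also have "\<dots> \<le> ennreal (\<bar>f x - f y\<bar>\<^sup>2) * ennreal (C3 * norm (x - y) powr (- p))"
          unfolding C3_def by (intro mult_left_mono nn_integral_powr_kernel rp a p) auto
        also have "\<dots> = ennreal C3 * ennreal (\<bar>f x - f y\<bar>\<^sup>2 / norm (x - y) powr p)"
          using C30 by (simp add: ennreal_mult''[symmetric] powr_minus_divide mult.commute)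
        finally show ?thesis .
      qed (simp add: k_def)
    qed
    finally show "(\<integral>\<^sup>+ z. B x * (indicator {0<..} z * (\<integral>\<^sup>+ y. k x z y \<partial>lborel)) \<partial>lborel) \<le>
       B x * (\<integral>\<^sup>+ y. ennreal C3 * ennreal (\<bar>f x - f y\<bar>\<^sup>2 / norm (x - y) powr p) \<partial>lborel)"
      by (simp add: mult_left_mono)
  qed
  also have "(\<integral>\<^sup>+ x. B x * (\<integral>\<^sup>+ y. ennreal C3 * ennreal (\<bar>f x - f y\<bar>\<^sup>2 / norm (x - y) powr p) \<partial>lborel) \<partial>lborel)
      = (\<integral>\<^sup>+ x. ennreal C3 * (B x * (\<integral>\<^sup>+ y. ennreal (\<bar>f x - f y\<bar>\<^sup>2 / norm (x - y) powr p) \<partial>lborel)) \<partial>lborel)"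
    by (subst nn_integral_cmult) (measurable, simp add: mult.left_commute)
  also have "\<dots> = ennreal C3 * local_energy a f"
    unfolding local_energy_def B_def[symmetric] p_def[symmetric] by (rule nn_integral_cmult) measurable
  finally have "(\<integral>\<^sup>+ X. indicator (half_ball r) X * ennreal (snd X powr (1 - a) * (norm (extension_grad a f X))\<^sup>2) \<partial>lborel)
      \<le> ennreal K0 * (ennreal C3 * local_energy a f)" by (simp add: mult_left_mono)
  also have "\<dots> < \<infinity>" using J by (simp add: ennreal_mult_less_top)
  finally show ?thesis .
qed

text \<open>Cauchy-Schwarz with respect to the kernel, which has unit mass, bounds the square by the
  kernel average of \<open>|f(y) - f(x)|^2\<close>. Dropping \<open>z^2\<close> from the denominator
  of the kernel produces the factor \<open>z powr a\<close> and the Gagliardo kernel.\<close>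

lemma extension_diff_bound:
  fixes f :: "real ^ 'n \<Rightarrow> real"
  assumes f: "weight_integrable a f" and a: "a > 0" and X: "X \<in> half_space"
  shows "ennreal (\<bar>poisson_extension a f X - f (fst X)\<bar>\<^sup>2) \<le> ennreal (snd X powr a / poisson_mass TYPE('n) a) *
     (\<integral>\<^sup>+ y. ennreal (\<bar>f (fst X) - f y\<bar>\<^sup>2 / norm (fst X - y) powr (real CARD('n) + a)) \<partial>lborel)"
proof -
  define x z where "x = fst X" and "z = snd X"
  define p where "p = real CARD('n) + a"
  define c where "c = poisson_mass TYPE('n) a"
  have c: "c > 0" unfolding c_def by (rule poisson_mass_pos[OF a])
  have p: "p > 0" unfolding p_def using a by simp
  have z: "z > 0" unfolding z_def using half_spaceD[OF X] .
  have fm [measurable]: "f \<in> borel_measurable borel" using f unfolding weight_integrable_def by simp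
  define S where "S = (\<integral>\<^sup>+ y. ennreal (\<bar>f x - f y\<bar>\<^sup>2 / norm (x - y) powr p) \<partial>lborel)"
  have "ennreal (\<bar>poisson_extension a f X - f x\<bar>\<^sup>2) \<le> ennreal (z powr a / c) * S"
  proof (cases "S < \<infinity>")
    case False
    then have "S = \<infinity>" by (simp add: less_top[symmetric])
    moreover have "z powr a / c > 0" using c z by simp

    then have "ennreal (z powr a / c) \<noteq> 0" by (simp only: ennreal_eq_0_iff not_le)
    ultimately show ?thesis by (simp add: ennreal_mult_top)
  next
    case True
    define s where "s y = \<bar>f x - f y\<bar>\<^sup>2 / norm (x - y) powr p" for y
    have s0: "s y \<ge> 0" for y unfolding s_def by auto
    have [measurable]: "s \<in> borel_measurable borel" unfolding s_def by measurable
    have si: "integrable lborel s"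
      using True s0 unfolding S_def s_def[symmetric] by (intro integrableI_nonneg) auto
    have Ss: "S = ennreal (LINT y|lborel. s y)"
      unfolding S_def s_def[symmetric] using si s0 by (intro nn_integral_eq_integral) auto
    define P where "P y = poisson_kernel a (x - y) z" for y
    have P0: "P y \<ge> 0" for y unfolding P_def by (rule poisson_kernel_nonneg[OF a])
    have iP: "integrable lborel P" "(LINT y|lborel. P y) = 1"
      unfolding P_def using integral_poisson_kernel[OF z a] by auto
    have Pm [measurable]: "P \<in> borel_measurable borel" unfolding P_def by measurable
    have Ps: "\<bar>f y - f x\<bar>\<^sup>2 * P y \<le> z powr a / c * s y" for y
    proof (cases "x = y")
      case False
      have "((norm (x - y))\<^sup>2 + z\<^sup>2) powr (- p / 2) \<le> ((norm (x - y))\<^sup>2) powr (- p / 2)"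
        using False p by (intro powr_mono2') auto
      also have "\<dots> = norm (x - y) powr (- p)" using False powr_powr[of "norm (x - y)" 2 "- p / 2"] by simp
      finally have "P y \<le> z powr a * norm (x - y) powr (- p) / c"
        unfolding P_def poisson_kernel_eq p_def[symmetric] c_def[symmetric]
        using c by (intro divide_right_mono mult_left_mono) auto
      then have "\<bar>f y - f x\<bar>\<^sup>2 * P y \<le> \<bar>f y - f x\<bar>\<^sup>2 * (z powr a * norm (x - y) powr (- p) / c)"
        by (intro mult_left_mono) auto
      also have "\<dots> = z powr a / c * s y"
        unfolding s_def by (simp add: powr_minus_divide abs_minus_commute mult.commute power2_commute)
      finally show ?thesis .
    qed (simp add: s_def)
    have iu: "integrable lborel (\<lambda>y. \<bar>f y - f x\<bar>\<^sup>2 * P y)"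
    proof (rule Bochner_Integration.integrable_bound)
      show "integrable lborel (\<lambda>y. z powr a / c * s y)" using si by simp
      show "AE y in lborel. norm (\<bar>f y - f x\<bar>\<^sup>2 * P y) \<le> norm (z powr a / c * s y)"
      proof (rule AE_I2)
        fix y
        have "0 \<le> \<bar>f y - f x\<bar>\<^sup>2 * P y" using P0 by simp
        then show "norm (\<bar>f y - f x\<bar>\<^sup>2 * P y) \<le> norm (z powr a / c * s y)"
          using Ps[of y] unfolding real_norm_def by linarith
      qed
    qed auto
    define g where "g y = (f y - f x) * P y" for y
    have gi: "poisson_extension a f X - f x = (LINT y|lborel. g y)"
    proof -
      have "poisson_extension a f X = (LINT y|lborel. f y * P y)"
        by (simp add: poisson_extension_lborel[OF fm] P_def x_def z_def)
      moreover have "integrable lborel (\<lambda>y. f y * P y)"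
        unfolding P_def by (rule weight_integrable_kernel[OF f a z])
      ultimately show ?thesis unfolding g_def left_diff_distrib using iP by simp
    qed
    have "(norm (LINT y|lborel. g y))\<^sup>2 \<le> (LINT y|lborel. \<bar>f y - f x\<bar>\<^sup>2 * P y) * (LINT y|lborel. P y)"
    proof (rule integral_Cauchy_Schwarz(2)[OF _ iu iP(1)])
      show "g \<in> borel_measurable lborel" unfolding g_def by measurable
      show "(norm (g y))\<^sup>2 \<le> \<bar>f y - f x\<bar>\<^sup>2 * P y * P y" for y
        unfolding g_def by (simp add: power_mult_distrib power2_eq_square)
    qed (use P0 in auto)
    also have "\<dots> \<le> (LINT y|lborel. z powr a / c * s y)"
      unfolding iP(2) mult_1_right using iu si Ps by (intro integral_mono) auto
    also have "\<dots> = z powr a / c * (LINT y|lborel. s y)" by simp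
    finally show ?thesis unfolding gi Ss using c by (simp add: ennreal_mult''[symmetric] ennreal_leI s0)
  qed
  then show ?thesis unfolding S_def x_def z_def p_def c_def .
qed

text \<open>The extension \<open>w\<close> is compared with its boundary value through
  \<open>|w|^2 \<le> 2 |w - f|^2 + 2 f^2\<close>. In the first term the weight and the factor
  \<open>z powr a\<close> combine to \<open>z\<close>; in the second, \<open>z powr (1 - a)\<close>
  is integrable near 0 because \<open>a < 2\<close>.\<close>

lemma extension_L2_finite:
  fixes f :: "real ^ 'n \<Rightarrow> real"
  assumes fm [measurable]: "f \<in> borel_measurable borel" and a: "0 < a" "a < 2" and J: "local_energy a f < \<infinity>" and r: "r \<le> 2"
  shows "(\<integral>\<^sup>+ X. indicator (half_ball r) X * ennreal (snd X powr (1 - a) * \<bar>poisson_extension a f X\<bar>\<^sup>2) \<partial>lborel) < \<infinity>"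
proof -
  have f: "weight_integrable a f" and f2: "weight_integrable a (\<lambda>y. (f y)\<^sup>2)"
    using local_energy_imp_weight_integrable[OF fm a(1) J] by auto
  define p where "p = real CARD('n) + a"
  have p: "p > 0" unfolding p_def using a by simp
  define c where "c = poisson_mass TYPE('n) a"
  have c: "c > 0" unfolding c_def by (rule poisson_mass_pos[OF a(1)])
  define I where "I x = (\<integral>\<^sup>+ y. ennreal (\<bar>f x - f y\<bar>\<^sup>2 / norm (x - y) powr p) \<partial>lborel)" for x
  have [measurable]: "I \<in> borel_measurable borel" unfolding I_def by measurable
  define B where "B = (indicator (ball 0 2) :: real ^ 'n \<Rightarrow> ennreal)"
  have [measurable]: "B \<in> borel_measurable borel" unfolding B_def by (rule borel_measurable_indicator) simp
  define G where "G x z = ennreal (2 / c) * (B x * I x) * (ennreal (z powr 1) * indicator {0..2} z)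
      + B x * ennreal (2 * (f x)\<^sup>2) * (ennreal (z powr (1 - a)) * indicator {0..2} z)" for x z
  have le: "indicator (half_ball r) X * ennreal (snd X powr (1 - a) * \<bar>poisson_extension a f X\<bar>\<^sup>2) \<le> G (fst X) (snd X)" for X
  proof (cases "X \<in> half_ball r")
    case True
    note h = half_ball_subset_cylinder[OF r True]
    define x z where "x = fst X" and "z = snd X"
    have z: "z > 0" "z \<le> 2" and x: "x \<in> ball 0 2" using h unfolding x_def z_def by auto
    define w where "w = poisson_extension a f X"
    have 1: "ennreal (\<bar>w - f x\<bar>\<^sup>2) \<le> ennreal (z powr a / c) * I x"
      using extension_diff_bound[OF f a(1)] h unfolding w_def x_def z_def c_def I_def p_def by simp
    have "\<bar>w\<bar>\<^sup>2 \<le> 2 * \<bar>w - f x\<bar>\<^sup>2 + 2 * (f x)\<^sup>2"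
      using zero_le_power2[of "w - 2 * f x"] by (simp add: power2_eq_square algebra_simps)
    then have "z powr (1 - a) * \<bar>w\<bar>\<^sup>2 \<le> z powr (1 - a) * (2 * \<bar>w - f x\<bar>\<^sup>2 + 2 * (f x)\<^sup>2)"
      by (intro mult_left_mono) auto
    then have "ennreal (z powr (1 - a) * \<bar>w\<bar>\<^sup>2) \<le> ennreal (2 * z powr (1 - a) * \<bar>w - f x\<bar>\<^sup>2 + z powr (1 - a) * (2 * (f x)\<^sup>2))"
      by (intro ennreal_leI) (simp add: algebra_simps)
    also have "\<dots> = ennreal (2 * z powr (1 - a)) * ennreal (\<bar>w - f x\<bar>\<^sup>2) + ennreal (z powr (1 - a)) * ennreal (2 * (f x)\<^sup>2)"
      by (simp add: ennreal_mult''[symmetric] ennreal_plus[symmetric] del: ennreal_plus)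
    also have "\<dots> \<le> ennreal (2 * z powr (1 - a)) * (ennreal (z powr a / c) * I x) + ennreal (z powr (1 - a)) * ennreal (2 * (f x)\<^sup>2)"
      by (intro add_right_mono mult_left_mono 1) auto
    also have "ennreal (2 * z powr (1 - a)) * (ennreal (z powr a / c) * I x) = ennreal (2 * z powr (1 - a) * (z powr a / c)) * I x"
      using c by (simp add: mult.assoc[symmetric] ennreal_mult''[symmetric])
    also have "2 * z powr (1 - a) * (z powr a / c) = 2 / c * z powr 1"
      using powr_add[of z "1 - a" a] by (simp add: mult.commute)
    also have "ennreal (2 / c * z powr 1) = ennreal (2 / c) * ennreal (z powr 1)" using c by (intro ennreal_mult) auto
    finally show ?thesis using True x z unfolding G_def B_def w_def x_def z_def by (simp add: ac_simps)
  qed simp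
  have Gm: "(\<lambda>X. G (fst X) (snd X)) \<in> borel_measurable borel"
    unfolding G_def borel_prod[symmetric] by measurable
  have z1: "(\<integral>\<^sup>+ z. ennreal (z powr e) * indicator {0..2} z \<partial>lborel) < \<infinity>" if "e > -1" for e
    using nn_integral_has_integral_lebesgue'[OF _ has_integral_powr_from_0[of e 2]] that by simp
  have fB: "(\<integral>\<^sup>+ x. B x * ennreal (2 * (f x)\<^sup>2) \<partial>lborel) < \<infinity>"
  proof -
    have i: "integrable lborel (\<lambda>y. (f y)\<^sup>2 * bracket p y)" using f2 unfolding weight_integrable_def p_def by simp
    \<comment> \<open>On \<open>B_2\<close> the weight is bounded below, as
      \<open>1 + |x|^2 \<le> 5\<close>.\<close>
    define M where "M = 2 * 5 powr (p / 2)"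
    have b: "1 \<le> 5 powr (p / 2) * bracket p x" if "x \<in> ball 0 2" for x :: "real ^ 'n"
    proof -
      have "(norm x)\<^sup>2 \<le> 4" using power_mono[of "norm x" 2 2] that by simp
      then have "5 powr (- p / 2) \<le> bracket p x"
        unfolding bracket_def using p by (intro powr_mono2') (auto simp: add_pos_nonneg)
      then have "5 powr (p / 2) * 5 powr (- p / 2) \<le> 5 powr (p / 2) * bracket p x" by (intro mult_left_mono) auto
      then show ?thesis by (simp add: powr_add[symmetric])
    qed
    have "(\<integral>\<^sup>+ x. B x * ennreal (2 * (f x)\<^sup>2) \<partial>lborel) \<le> (\<integral>\<^sup>+ x. ennreal (M * ((f x)\<^sup>2 * bracket p x)) \<partial>lborel)"
    proof (rule nn_integral_mono)
      fix x
      show "B x * ennreal (2 * (f x)\<^sup>2) \<le> ennreal (M * ((f x)\<^sup>2 * bracket p x))"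
      proof (cases "x \<in> ball 0 2")
        case True
        have "2 * (f x)\<^sup>2 * 1 \<le> 2 * (f x)\<^sup>2 * (5 powr (p / 2) * bracket p x)"
          by (intro mult_left_mono b True) auto
        then show ?thesis using True unfolding B_def M_def by (simp add: ennreal_leI ac_simps)
      qed (simp add: B_def)
    qed
    also have "\<dots> = ennreal (LINT x|lborel. M * ((f x)\<^sup>2 * bracket p x))"
      using i bracket_pos[of p] by (intro nn_integral_eq_integral integrable_mult_right) (auto simp: M_def)
    also have "\<dots> < \<infinity>" by simp
    finally show ?thesis .
  qed
  have JB: "(\<integral>\<^sup>+ x. B x * I x \<partial>lborel) < \<infinity>" using J unfolding local_energy_def B_def I_def p_def .
  have "(\<integral>\<^sup>+ X. indicator (half_ball r) X * ennreal (snd X powr (1 - a) * \<bar>poisson_extension a f X\<bar>\<^sup>2) \<partial>lborel)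
      \<le> (\<integral>\<^sup>+ X. G (fst X) (snd X) \<partial>lborel)" by (intro nn_integral_mono le)
  also have "\<dots> = (\<integral>\<^sup>+ x. \<integral>\<^sup>+ z. G x z \<partial>lborel \<partial>lborel)" by (rule nn_integral_lborel_pair[OF Gm])
  also have "\<dots> = (\<integral>\<^sup>+ x. ennreal (2 / c) * (B x * I x) * (\<integral>\<^sup>+ z. ennreal (z powr 1) * indicator {0..2} z \<partial>lborel)
      + B x * ennreal (2 * (f x)\<^sup>2) * (\<integral>\<^sup>+ z. ennreal (z powr (1 - a)) * indicator {0..2} z \<partial>lborel) \<partial>lborel)"
    unfolding G_def by (intro nn_integral_cong, subst nn_integral_add) (simp_all add: nn_integral_cmult)
  also have "\<dots> = ennreal (2 / c) * (\<integral>\<^sup>+ x. B x * I x \<partial>lborel) * (\<integral>\<^sup>+ z. ennreal (z powr 1) * indicator {0..2} z \<partial>lborel)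
      + (\<integral>\<^sup>+ x. B x * ennreal (2 * (f x)\<^sup>2) \<partial>lborel) * (\<integral>\<^sup>+ z. ennreal (z powr (1 - a)) * indicator {0..2} z \<partial>lborel)"
    by (subst nn_integral_add) (simp_all add: nn_integral_cmult nn_integral_multc)
  also have "\<dots> < \<infinity>" using JB fB z1[of 1] z1[of "1 - a"] a by (simp add: ennreal_mult_less_top)
  finally show ?thesis .
qed

lemma set_integrable_half_ballI:
  fixes g :: "(real ^ 'n) \<times> real \<Rightarrow> real"
  assumes m: "(\<lambda>X. indicator half_space X *\<^sub>R g X) \<in> borel_measurable borel"
    and fin: "(\<integral>\<^sup>+ X. indicator (half_ball r) X * ennreal \<bar>g X\<bar> \<partial>lborel) < \<infinity>"
  shows "set_integrable lborel (half_ball r) g"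
proof -
  have "(\<lambda>X. indicator (half_ball r) X *\<^sub>R g X) = (\<lambda>X. indicator (half_ball r) X *\<^sub>R (indicator half_space X *\<^sub>R g X))"
    by (auto simp: fun_eq_iff half_ball_def indicator_def)
  then have m': "(\<lambda>X. indicator (half_ball r) X *\<^sub>R g X) \<in> borel_measurable borel"
    using m by (simp add: borel_measurable_times borel_measurable_indicator)
  have "(\<integral>\<^sup>+ X. ennreal (norm (indicator (half_ball r) X *\<^sub>R g X)) \<partial>lborel) = (\<integral>\<^sup>+ X. indicator (half_ball r) X * ennreal \<bar>g X\<bar> \<partial>lborel)"
    by (intro nn_integral_cong) (auto simp: indicator_def)
  then show ?thesis unfolding set_integrable_def using m' fin by (simp add: integrable_iff_bounded)
qed

section \<open>Traces of Poisson extensions\<close>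

lemma lborel_integral_translation:
  fixes g :: "'a::euclidean_space \<Rightarrow> 'b::{banach, second_countable_topology}"
  assumes "g \<in> borel_measurable borel"
  shows "integrable lborel (\<lambda>x. g (x + t)) \<longleftrightarrow> integrable lborel g"
    "(LINT x|lborel. g (x + t)) = (LINT x|lborel. g x)"
  using lborel_integral_affine[OF assms, of 1 t] by (simp_all add: add.commute)

definition L1_translation_continuous :: "('a::euclidean_space \<Rightarrow> real) \<Rightarrow> bool" where
  "L1_translation_continuous g \<longleftrightarrow>
     (\<forall>h::nat \<Rightarrow> 'a. h \<longlonglongrightarrow> 0 \<longrightarrow> (\<lambda>k. LINT x|lborel. \<bar>g (x + h k) - g x\<bar>) \<longlonglongrightarrow> 0)"

text \<open>For \<open>x\<close> in the open set \<open>U\<close> also \<open>x + h k\<close> is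
  eventually in \<open>U\<close>, which settles the points that leave \<open>U\<close>. The points
  that enter \<open>U\<close> are those that leave it under the opposite translation.\<close>

lemma L1_translation_continuous_open:
  fixes U :: "'a::euclidean_space set"
  assumes U: "open U" "emeasure lborel U < \<infinity>"
  shows "L1_translation_continuous (indicator U)"
  unfolding L1_translation_continuous_def
proof (intro allI impI)
  fix h :: "nat \<Rightarrow> 'a" assume h: "h \<longlonglongrightarrow> 0"
  have Um: "U \<in> sets borel" using U by simp
  have iU: "integrable lborel (indicator U :: 'a \<Rightarrow> real)" using U by (simp add: integrable_indicator_iff)
  have Ut: "(\<lambda>x. indicator U (x + t) :: real) \<in> borel_measurable borel" for t
    by (rule measurable_compose[where g="indicator U" and N=borel]) (use Um in auto)
  define d where "d t x = indicator U x * (1 - indicator U (x + t) :: real)" for t x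
  have dm: "d t \<in> borel_measurable borel" for t unfolding d_def
    using Ut Um by (intro borel_measurable_times borel_measurable_diff borel_measurable_indicator) auto
  have di: "integrable lborel (d t)" for t
    by (rule Bochner_Integration.integrable_bound[OF iU]) (use dm in \<open>auto simp: d_def indicator_def\<close>)
  have lim: "(\<lambda>k. LINT x|lborel. d (t k) x) \<longlonglongrightarrow> 0" if t: "t \<longlonglongrightarrow> 0" for t :: "nat \<Rightarrow> 'a"
  proof -
    have "(\<lambda>k. LINT x|lborel. d (t k) x) \<longlonglongrightarrow> (LINT x|(lborel::'a measure). (0::real))"
    proof (rule integral_dominated_convergence[where w="indicator U"])
      show "AE x in lborel. (\<lambda>k. d (t k) x) \<longlonglongrightarrow> 0"
      proof (rule AE_I2)
        fix x
        show "(\<lambda>k. d (t k) x) \<longlonglongrightarrow> 0"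
        proof (cases "x \<in> U")
          case True
          have "(\<lambda>k. x + t k) \<longlonglongrightarrow> x + 0" using t by (intro tendsto_intros)
          then have "\<forall>\<^sub>F k in sequentially. x + t k \<in> U" using U(1) True by (simp add: topological_tendstoD)
          then have "\<forall>\<^sub>F k in sequentially. d (t k) x = 0" by eventually_elim (simp add: d_def)
          then show ?thesis by (rule tendsto_eventually)
        qed (simp add: d_def)
      qed
      show "AE x in lborel. norm (d (t k) x) \<le> indicator U x" for k by (auto simp: d_def indicator_def)
    qed (use dm iU in auto)
    then show ?thesis by simp
  qed
  have e: "(LINT x|lborel. \<bar>indicator U (x + h k) - indicator U x\<bar>) = (LINT x|lborel. d (h k) x) + (LINT x|lborel. d (- h k) x)" for k
  proof -
    have "(LINT x|lborel. d (- h k) x) = (LINT x|lborel. d (- h k) (x + h k))"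
      using lborel_integral_translation(2)[OF dm, of "- h k" "h k"] by simp
    moreover have "integrable lborel (\<lambda>x. d (- h k) (x + h k))"
      using lborel_integral_translation(1)[OF dm, of "- h k" "h k"] di by simp
    moreover have "\<bar>indicator U (x + h k) - indicator U x\<bar> = d (h k) x + d (- h k) (x + h k)" for x
      by (auto simp: d_def indicator_def)
    ultimately show ?thesis using di[of "h k"] by simp
  qed
  have "(\<lambda>k. - h k) \<longlonglongrightarrow> - 0" using h by (intro tendsto_intros)
  then have "(\<lambda>k. (LINT x|lborel. d (h k) x) + (LINT x|lborel. d (- h k) x)) \<longlonglongrightarrow> 0 + 0"
    by (intro tendsto_add lim h) simp
  then show "(\<lambda>k. LINT x|lborel. \<bar>indicator U (x + h k) - indicator U x :: real\<bar>) \<longlonglongrightarrow> 0"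
    unfolding e by simp
qed

text \<open>Of the three error terms two coincide, since translation preserves the L^1 distance of
  \<open>g\<close> and its approximation.\<close>

lemma L1_translation_continuous_approx:
  fixes g :: "'a::euclidean_space \<Rightarrow> real"
  assumes g: "integrable lborel g"
    and ap: "\<And>e. e > 0 \<Longrightarrow> \<exists>g'. integrable lborel g' \<and> L1_translation_continuous g' \<and> (LINT x|lborel. \<bar>g x - g' x\<bar>) < e"
  shows "L1_translation_continuous g"
  unfolding L1_translation_continuous_def
proof (intro allI impI)
  fix h :: "nat \<Rightarrow> 'a" assume h: "h \<longlonglongrightarrow> 0"
  show "(\<lambda>k. LINT x|lborel. \<bar>g (x + h k) - g x\<bar>) \<longlonglongrightarrow> 0"
  proof (rule LIMSEQ_I)
    fix e :: real assume e: "e > 0"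
    then obtain g' where g': "integrable lborel g'" "L1_translation_continuous g'" "(LINT x|lborel. \<bar>g x - g' x\<bar>) < e / 3"
      using ap[of "e / 3"] by auto
    have gm: "g \<in> borel_measurable borel" "g' \<in> borel_measurable borel"
      using g g' by (auto dest: borel_measurable_integrable)
    have "(\<lambda>k. LINT x|lborel. \<bar>g' (x + h k) - g' x\<bar>) \<longlonglongrightarrow> 0"
      using g'(2) h unfolding L1_translation_continuous_def by blast
    from LIMSEQ_D[OF this, of "e / 3"] e obtain N where
      N: "\<And>k. k \<ge> N \<Longrightarrow> \<bar>LINT x|lborel. \<bar>g' (x + h k) - g' x\<bar>\<bar> < e / 3" by auto
    have "\<bar>LINT x|lborel. \<bar>g (x + h k) - g x\<bar>\<bar> < e" if k: "k \<ge> N" for k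
    proof -
      have gt: "integrable lborel (\<lambda>x. g (x + h k))" "integrable lborel (\<lambda>x. g' (x + h k))"
        using lborel_integral_translation(1)[OF gm(1), of "h k"] lborel_integral_translation(1)[OF gm(2), of "h k"] g g' by auto
      have eqt: "(LINT x|lborel. \<bar>g (x + h k) - g' (x + h k)\<bar>) = (LINT x|lborel. \<bar>g x - g' x\<bar>)"
        using gm by (intro lborel_integral_translation(2)[of "\<lambda>x. \<bar>g x - g' x\<bar>"]) measurable
      have "(LINT x|lborel. \<bar>g (x + h k) - g x\<bar>) \<le>
          (LINT x|lborel. \<bar>g (x + h k) - g' (x + h k)\<bar> + \<bar>g' (x + h k) - g' x\<bar> + \<bar>g x - g' x\<bar>)"
        using gt g g'(1) by (intro integral_mono integrable_abs Bochner_Integration.integrable_add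
            Bochner_Integration.integrable_diff) auto
      also have "\<dots> = (LINT x|lborel. \<bar>g x - g' x\<bar>) + (LINT x|lborel. \<bar>g' (x + h k) - g' x\<bar>) + (LINT x|lborel. \<bar>g x - g' x\<bar>)"
        using gt g g'(1) eqt by simp
      also have "\<dots> < e / 3 + e / 3 + e / 3"
        using g'(3) N[OF k] by linarith
      finally show ?thesis by (simp add: abs_of_nonneg integral_nonneg_AE)
    qed
    then show "\<exists>N. \<forall>k\<ge>N. norm ((LINT x|lborel. \<bar>g (x + h k) - g x\<bar>) - 0) < e" by auto
  qed
qed

lemma L1_translation_continuous_cmult:
  assumes "L1_translation_continuous g"
  shows "L1_translation_continuous (\<lambda>x. g x * c)"
proof -
  have "(\<lambda>k. (LINT x|lborel. \<bar>g (x + h k) - g x\<bar>) * \<bar>c\<bar>) \<longlonglongrightarrow> 0 * \<bar>c\<bar>" if "h \<longlonglongrightarrow> 0" for h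
    using assms that unfolding L1_translation_continuous_def by (intro tendsto_intros) auto
  moreover have "\<bar>g (x + h) * c - g x * c\<bar> = \<bar>g (x + h) - g x\<bar> * \<bar>c\<bar>" for x h
    by (simp add: abs_mult[symmetric] left_diff_distrib)
  ultimately show ?thesis unfolding L1_translation_continuous_def by simp
qed

text \<open>Outer regularity replaces a Borel set of finite measure by an open one, the case already
  settled. Sums follow from the triangle inequality and dominated limits by approximation in
  L^1.\<close>

lemma integrable_imp_L1_translation_continuous:
  fixes g :: "'a::euclidean_space \<Rightarrow> real"
  assumes "integrable lborel g"
  shows "L1_translation_continuous g"
  using assms
proof (induction rule: integrable_induct)
  case (base A c)
  have A: "A \<in> sets borel" "emeasure lborel A < \<infinity>" using base by auto
  have iA: "integrable lborel (indicator A :: 'a \<Rightarrow> real)" using A by (simp add: integrable_indicator_iff)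
  have "L1_translation_continuous (indicator A)"
  proof (rule L1_translation_continuous_approx[OF iA])
    fix e :: real assume e: "e > 0"
    obtain U where U: "open U" "A \<subseteq> U" "emeasure lborel (U - A) < ennreal e"
      using outer_regular_lborel[OF A(1) e] by blast
    have "emeasure lborel U = emeasure lborel A + emeasure lborel (U - A)"
      using A(1) U by (subst plus_emeasure) (auto simp: Un_absorb1)
    also have "\<dots> < \<infinity>" using A(2) U(3) by (auto simp: less_top[symmetric])
    finally have Uf: "emeasure lborel U < \<infinity>" .
    have "(LINT x|lborel. \<bar>indicator A x - indicator U x :: real\<bar>) = (LINT x|lborel. indicator (U - A) x)"
      using U(2) by (intro Bochner_Integration.integral_cong) (auto simp: indicator_def)
    also have "\<dots> = measure lborel (U - A)" using U(1) A(1) by simp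
    also have "\<dots> < e" using U(3) e by (simp add: measure_def enn2real_less_iff less_top[symmetric])
       (metis ennreal_less_top enn2real_less_iff order.strict_trans)
    finally show "\<exists>g'. integrable lborel g' \<and> L1_translation_continuous g' \<and> (LINT x|lborel. \<bar>indicator A x - g' x\<bar>) < e"
      using U Uf L1_translation_continuous_open[OF U(1) Uf]
      by (intro exI[of _ "indicator U"]) (auto simp: integrable_indicator_iff)
  qed
  then show ?case using L1_translation_continuous_cmult by simp
next
  case (add f g)
  show ?case unfolding L1_translation_continuous_def
  proof (intro allI impI)
    fix h :: "nat \<Rightarrow> 'a" assume h: "h \<longlonglongrightarrow> 0"
    have l: "(\<lambda>k. (LINT x|lborel. \<bar>f (x + h k) - f x\<bar>) + (LINT x|lborel. \<bar>g (x + h k) - g x\<bar>)) \<longlonglongrightarrow> 0 + 0"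
      using add h unfolding L1_translation_continuous_def by (intro tendsto_add) auto
    have i: "integrable lborel (\<lambda>x. f (x + t))" "integrable lborel (\<lambda>x. g (x + t))" for t
      using add lborel_integral_translation(1)[of f t] lborel_integral_translation(1)[of g t]
      by (auto dest: borel_measurable_integrable)
    have "(LINT x|lborel. \<bar>f (x + h k) + g (x + h k) - (f x + g x)\<bar>)
       \<le> (LINT x|lborel. \<bar>f (x + h k) - f x\<bar> + \<bar>g (x + h k) - g x\<bar>)" for k
      using i add.hyps by (intro integral_mono integrable_abs Bochner_Integration.integrable_add
          Bochner_Integration.integrable_diff) auto
    then have le: "(LINT x|lborel. \<bar>f (x + h k) + g (x + h k) - (f x + g x)\<bar>)
       \<le> (LINT x|lborel. \<bar>f (x + h k) - f x\<bar>) + (LINT x|lborel. \<bar>g (x + h k) - g x\<bar>)" for k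
      using i add.hyps by simp
    show "(\<lambda>k. LINT x|lborel. \<bar>f (x + h k) + g (x + h k) - (f x + g x)\<bar>) \<longlonglongrightarrow> 0"
      by (rule tendsto_sandwich[OF _ _ tendsto_const l[simplified]])
        (auto intro!: always_eventually le integral_nonneg_AE)
  qed
next
  case (lim f s)
  show ?case
  proof (rule L1_translation_continuous_approx[OF lim.hyps(4)])
    fix e :: real assume e: "e > 0"
    have "(\<lambda>i. LINT x|lborel. \<bar>f x - s i x\<bar>) \<longlonglongrightarrow> (LINT x|(lborel::'a measure). (0::real))"
    proof (rule integral_dominated_convergence[where w="\<lambda>x. 3 * \<bar>f x\<bar>"])
      show "AE x in lborel. (\<lambda>i. \<bar>f x - s i x\<bar>) \<longlonglongrightarrow> 0"
      proof (rule AE_I2)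
        fix x
        have "(\<lambda>i. \<bar>f x - s i x\<bar>) \<longlonglongrightarrow> \<bar>f x - f x\<bar>" using lim.hyps(2)[of x] by (intro tendsto_intros) auto
        then show "(\<lambda>i. \<bar>f x - s i x\<bar>) \<longlonglongrightarrow> 0" by simp
      qed
      show "AE x in lborel. norm \<bar>f x - s i x\<bar> \<le> 3 * \<bar>f x\<bar>" for i
      proof (rule AE_I2)
        fix x show "norm \<bar>f x - s i x\<bar> \<le> 3 * \<bar>f x\<bar>" using lim.hyps(3)[of x i] by auto
      qed
    qed (use lim.hyps(1,4) in \<open>auto intro: borel_measurable_integrable\<close>)
    from LIMSEQ_D[OF this, of e] e obtain i where "\<bar>LINT x|lborel. \<bar>f x - s i x\<bar>\<bar> < e" by auto
    then show "\<exists>g'. integrable lborel g' \<and> L1_translation_continuous g' \<and> (LINT x|lborel. \<bar>f x - g' x\<bar>) < e"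
      using lim.hyps(1) lim.IH by (intro exI[of _ "s i"]) auto
  qed
qed

text \<open>The substitution \<open>y = x + z u\<close> turns the error into an average of the
  increments \<open>g(x + z u) - g(x)\<close> against a fixed probability density
  \<open>\<kappa>\<close>. Integrating in \<open>x\<close> before \<open>u\<close>, one may take for
  \<open>\<Omega> z\<close> the \<open>\<kappa>\<close>-average of the L^1 modulus of translation at
  \<open>z u\<close>, which tends to 0 by dominated convergence.\<close>

lemma poisson_approximate_identity:
  fixes g :: "real ^ 'n \<Rightarrow> real"
  assumes g: "integrable lborel g" and W: "weight_integrable a g" and a: "a > 0"
  obtains \<Omega> :: "real \<Rightarrow> real" where
    "\<And>z. z > 0 \<Longrightarrow> (\<integral>\<^sup>+ x. ennreal \<bar>poisson_extension a g (x, z) - g x\<bar> \<partial>lborel) \<le> ennreal (\<Omega> z)"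
    "\<And>z. \<Omega> z \<ge> 0" "\<And>zs :: nat \<Rightarrow> real. zs \<longlonglongrightarrow> 0 \<Longrightarrow> (\<lambda>k. \<Omega> (zs k)) \<longlonglongrightarrow> 0"
proof -
  define p where "p = real CARD('n) + a"
  define c where "c = poisson_mass TYPE('n) a"
  have c: "c > 0" unfolding c_def by (rule poisson_mass_pos[OF a])
  have gm [measurable]: "g \<in> borel_measurable borel" using g by (auto dest: borel_measurable_integrable)
  define \<kappa> where "\<kappa> u = bracket p u / c" for u :: "real ^ 'n"
  have \<kappa>0: "\<kappa> u \<ge> 0" for u unfolding \<kappa>_def using c by simp
  have [measurable]: "\<kappa> \<in> borel_measurable borel" unfolding \<kappa>_def by measurable
  have q: "real DIM(real ^ 'n) < p" unfolding p_def using a by simp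
  have \<kappa>i: "integrable lborel \<kappa>" unfolding \<kappa>_def using integrable_bracket[OF q] by simp
  define \<omega> where "\<omega> h = (LINT x|lborel. \<bar>g (x + h) - g x\<bar>)" for h
  have gt: "integrable lborel (\<lambda>x. g (x + h))" for h
    using lborel_integral_translation(1)[OF gm, of h] g by simp
  have \<omega>0: "\<omega> h \<ge> 0" for h unfolding \<omega>_def by (intro integral_nonneg_AE) auto
  have \<omega>le: "\<omega> h \<le> 2 * (LINT x|lborel. \<bar>g x\<bar>)" for h
  proof -
    have "\<omega> h \<le> (LINT x|lborel. \<bar>g (x + h)\<bar> + \<bar>g x\<bar>)"
      unfolding \<omega>_def using g gt by (intro integral_mono) auto
    also have "\<dots> = (LINT x|lborel. \<bar>g (x + h)\<bar>) + (LINT x|lborel. \<bar>g x\<bar>)" using g gt by simp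
    also have "(LINT x|lborel. \<bar>g (x + h)\<bar>) = (LINT x|lborel. \<bar>g x\<bar>)"
      by (rule lborel_integral_translation(2)) measurable
    finally show ?thesis by simp
  qed
  have \<omega>m [measurable]: "\<omega> \<in> borel_measurable borel"
  proof -
    have "(\<lambda>(h, x). \<bar>g (x + h) - g x\<bar>) \<in> borel_measurable (borel \<Otimes>\<^sub>M lborel)" by measurable
    from lborel.borel_measurable_lebesgue_integral[OF this]
    show ?thesis unfolding \<omega>_def .
  qed
  define \<Omega> where "\<Omega> z = (LINT u|lborel. \<kappa> u * \<omega> (z *\<^sub>R u))" for z
  have \<omega>zm: "(\<lambda>u. \<omega> (z *\<^sub>R u)) \<in> borel_measurable borel" for z by measurable
  have bd: "\<bar>\<kappa> u * \<omega> (z *\<^sub>R u)\<bar> \<le> \<kappa> u * (2 * (LINT x|lborel. \<bar>g x\<bar>))" for u z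
    using \<kappa>0 \<omega>0 \<omega>le by (simp add: abs_mult mult_left_mono)
  have \<Omega>i: "integrable lborel (\<lambda>u. \<kappa> u * \<omega> (z *\<^sub>R u))" for z
  proof (rule Bochner_Integration.integrable_bound)
    show "integrable lborel (\<lambda>u. \<kappa> u * (2 * (LINT x|lborel. \<bar>g x\<bar>)))" using \<kappa>i by simp
  qed (use bd \<omega>zm in \<open>auto intro!: AE_I2 order_trans[OF bd]\<close>)
  show ?thesis
  proof (rule that)
    show "\<Omega> z \<ge> 0" for z unfolding \<Omega>_def using \<kappa>0 \<omega>0 by (intro integral_nonneg_AE) auto
    show "(\<lambda>k. \<Omega> (zs k)) \<longlonglongrightarrow> 0" if zs: "zs \<longlonglongrightarrow> 0" for zs :: "nat \<Rightarrow> real"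
    proof -
      have "(\<lambda>k. \<Omega> (zs k)) \<longlonglongrightarrow> (LINT u|(lborel :: (real ^ 'n) measure). (0::real))"
        unfolding \<Omega>_def
      proof (rule integral_dominated_convergence[where w="\<lambda>u. \<kappa> u * (2 * (LINT x|lborel. \<bar>g x\<bar>))"])
        show "AE u in lborel. (\<lambda>k. \<kappa> u * \<omega> (zs k *\<^sub>R u)) \<longlonglongrightarrow> 0"
        proof (rule AE_I2)
          fix u :: "real ^ 'n"
          have "(\<lambda>k. zs k *\<^sub>R u) \<longlonglongrightarrow> 0 *\<^sub>R u" using zs by (intro tendsto_intros)
          then have "(\<lambda>k. \<omega> (zs k *\<^sub>R u)) \<longlonglongrightarrow> 0"
            using integrable_imp_L1_translation_continuous[OF g]
            unfolding L1_translation_continuous_def \<omega>_def by simp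
          then have "(\<lambda>k. \<kappa> u * \<omega> (zs k *\<^sub>R u)) \<longlonglongrightarrow> \<kappa> u * 0" by (intro tendsto_intros)
          then show "(\<lambda>k. \<kappa> u * \<omega> (zs k *\<^sub>R u)) \<longlonglongrightarrow> 0" by simp
        qed
        show "integrable lborel (\<lambda>u. \<kappa> u * (2 * (LINT x|lborel. \<bar>g x\<bar>)))" using \<kappa>i by simp
        show "AE u in lborel. norm (\<kappa> u * \<omega> (zs k *\<^sub>R u)) \<le> \<kappa> u * (2 * (LINT x|lborel. \<bar>g x\<bar>))" for k
          using bd by simp
      qed (use \<omega>zm in auto)
      then show ?thesis by simp
    qed
    show "(\<integral>\<^sup>+ x. ennreal \<bar>poisson_extension a g (x, z) - g x\<bar> \<partial>lborel) \<le> ennreal (\<Omega> z)" if z: "z > 0" for z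
    proof -
      have pt: "ennreal \<bar>poisson_extension a g (x, z) - g x\<bar> \<le> (\<integral>\<^sup>+ u. ennreal (\<bar>g (x + z *\<^sub>R u) - g x\<bar> * \<kappa> u) \<partial>lborel)" for x
      proof -
        define P where "P y = poisson_kernel a (x - y) z" for y
        have [measurable]: "P \<in> borel_measurable borel" unfolding P_def by measurable
        have iP: "integrable lborel P" "(LINT y|lborel. P y) = 1"
          unfolding P_def using integral_poisson_kernel[OF z a] by auto
        have igP: "integrable lborel (\<lambda>y. g y * P y)"
          unfolding P_def by (rule weight_integrable_kernel[OF W a z])
        have "poisson_extension a g (x, z) = (LINT y|lborel. g y * P y)"
          by (simp add: poisson_extension_lborel[OF gm] P_def)
        then have e: "poisson_extension a g (x, z) - g x = (LINT y|lborel. (g y - g x) * P y)"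
          unfolding left_diff_distrib using iP igP by simp
        have i: "integrable lborel (\<lambda>y. (g y - g x) * P y)"
          unfolding left_diff_distrib using iP igP by simp
        have "ennreal \<bar>poisson_extension a g (x, z) - g x\<bar> \<le> (\<integral>\<^sup>+ y. ennreal (norm ((g y - g x) * P y)) \<partial>lborel)"
          using integral_norm_bound_ennreal[OF i] unfolding e by simp
        also have "\<dots> = ennreal (\<bar>z\<bar> ^ DIM(real ^ 'n)) * (\<integral>\<^sup>+ u. ennreal (norm ((g (x + z *\<^sub>R u) - g x) * P (x + z *\<^sub>R u))) \<partial>lborel)"
          using z by (intro nn_integral_affine) auto
        also have "\<dots> = (\<integral>\<^sup>+ u. ennreal (\<bar>z\<bar> ^ DIM(real ^ 'n)) * ennreal (norm ((g (x + z *\<^sub>R u) - g x) * P (x + z *\<^sub>R u))) \<partial>lborel)"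
          by (rule nn_integral_cmult[symmetric]) measurable
        also have "\<dots> = (\<integral>\<^sup>+ u. ennreal (\<bar>g (x + z *\<^sub>R u) - g x\<bar> * \<kappa> u) \<partial>lborel)"
        proof (rule nn_integral_cong)
          fix u :: "real ^ 'n"
          have "\<bar>z\<bar> ^ DIM(real ^ 'n) * P (x + z *\<^sub>R u) = z powr real CARD('n) * (z powr a * (z powr (- p) * bracket p u) / c)"
            unfolding P_def poisson_kernel_eq p_def[symmetric] c_def[symmetric] dilated_bracket[OF z]
            using z by (simp add: powr_realpow)
          also have "\<dots> = (z powr real CARD('n) * z powr a * z powr (- p)) * \<kappa> u" unfolding \<kappa>_def by simp
          also have "z powr real CARD('n) * z powr a * z powr (- p) = 1"
            using z unfolding p_def by (simp add: powr_add[symmetric])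
          finally have k: "\<bar>z\<bar> ^ DIM(real ^ 'n) * P (x + z *\<^sub>R u) = \<kappa> u" by simp
          have P0: "P (x + z *\<^sub>R u) \<ge> 0" unfolding P_def by (rule poisson_kernel_nonneg[OF a])
          have "ennreal (\<bar>z\<bar> ^ DIM(real ^ 'n)) * ennreal (norm ((g (x + z *\<^sub>R u) - g x) * P (x + z *\<^sub>R u)))
              = ennreal (\<bar>z\<bar> ^ DIM(real ^ 'n) * (\<bar>g (x + z *\<^sub>R u) - g x\<bar> * P (x + z *\<^sub>R u)))"
            using P0 by (simp only: ennreal_mult''[symmetric] norm_ge_zero) (simp add: abs_mult)
          also have "\<bar>z\<bar> ^ DIM(real ^ 'n) * (\<bar>g (x + z *\<^sub>R u) - g x\<bar> * P (x + z *\<^sub>R u)) = \<bar>g (x + z *\<^sub>R u) - g x\<bar> * \<kappa> u"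
            unfolding k[symmetric] by (simp only: ac_simps)
          finally show "ennreal (\<bar>z\<bar> ^ DIM(real ^ 'n)) * ennreal (norm ((g (x + z *\<^sub>R u) - g x) * P (x + z *\<^sub>R u)))
              = ennreal (\<bar>g (x + z *\<^sub>R u) - g x\<bar> * \<kappa> u)" .
        qed
        finally show ?thesis .
      qed
      have jm: "(\<lambda>(x, u). ennreal (\<bar>g (x + z *\<^sub>R u) - g x\<bar> * \<kappa> u)) \<in> borel_measurable (lborel \<Otimes>\<^sub>M lborel)" by measurable
      have "(\<integral>\<^sup>+ x. ennreal \<bar>poisson_extension a g (x, z) - g x\<bar> \<partial>lborel)
          \<le> (\<integral>\<^sup>+ x. \<integral>\<^sup>+ u. ennreal (\<bar>g (x + z *\<^sub>R u) - g x\<bar> * \<kappa> u) \<partial>lborel \<partial>lborel)"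
        by (intro nn_integral_mono pt)
      also have "\<dots> = (\<integral>\<^sup>+ u. \<integral>\<^sup>+ x. ennreal (\<bar>g (x + z *\<^sub>R u) - g x\<bar> * \<kappa> u) \<partial>lborel \<partial>lborel)"
        by (rule lborel_pair.Fubini'[symmetric, OF jm])
      also have "\<dots> = (\<integral>\<^sup>+ u. ennreal (\<kappa> u * \<omega> (z *\<^sub>R u)) \<partial>lborel)"
      proof (rule nn_integral_cong)
        fix u :: "real ^ 'n"
        have "(\<integral>\<^sup>+ x. ennreal (\<bar>g (x + z *\<^sub>R u) - g x\<bar> * \<kappa> u) \<partial>lborel) = ennreal (LINT x|lborel. \<bar>g (x + z *\<^sub>R u) - g x\<bar> * \<kappa> u)"
          using g gt \<kappa>0 by (intro nn_integral_eq_integral) auto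
        then show "(\<integral>\<^sup>+ x. ennreal (\<bar>g (x + z *\<^sub>R u) - g x\<bar> * \<kappa> u) \<partial>lborel) = ennreal (\<kappa> u * \<omega> (z *\<^sub>R u))"
          unfolding \<omega>_def by (simp add: mult.commute)
      qed
      also have "\<dots> = ennreal (\<Omega> z)"
        unfolding \<Omega>_def using \<Omega>i \<kappa>0 \<omega>0 by (intro nn_integral_eq_integral) auto
      finally show ?thesis .
    qed
  qed
qed

lemma poisson_extension_slice_continuous:
  fixes f :: "real ^ 'n \<Rightarrow> real"
  assumes "weight_integrable a f" "a > 0" "z > 0"
  shows "continuous_on UNIV (\<lambda>x. poisson_extension a f (x, z))"
proof -
  have "continuous_on half_space (poisson_extension a f)"
    by (rule GDERIV_imp_continuous_on[OF GDERIV_poisson_extension[OF assms(1,2)]])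
  then show ?thesis
    by (rule continuous_on_compose2) (use assms(3) in \<open>auto intro!: continuous_intros simp: half_space_def\<close>)
qed

lemma poisson_extension_add:
  fixes f g :: "real ^ 'n \<Rightarrow> real"
  assumes f: "weight_integrable a f" and g: "weight_integrable a g" and a: "a > 0" and X: "X \<in> half_space"
  shows "poisson_extension a (\<lambda>y. f y + g y) X = poisson_extension a f X + poisson_extension a g X"
proof -
  have m: "f \<in> borel_measurable borel" "g \<in> borel_measurable borel" "(\<lambda>y. f y + g y) \<in> borel_measurable borel"
    using f g unfolding weight_integrable_def by auto
  show ?thesis
    unfolding poisson_extension_lborel[OF m(1)] poisson_extension_lborel[OF m(2)] poisson_extension_lborel[OF m(3)] distrib_right
    by (intro Bochner_Integration.integral_add weight_integrable_kernel f g a half_spaceD X)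
qed

text \<open>For |x| \<le> R and |y| \<ge> 2 R one has \<open>|x - y| \<ge> |y| / 2\<close>, and
  \<open>|y| \<ge> 1\<close> then gives \<open>(1 + |y|^2) / 8 \<le> |x - y|^2\<close>. So the
  kernel is at most \<open>z powr a\<close> times a multiple of the weight, uniformly in
  \<open>x\<close>.\<close>

lemma poisson_extension_far_bound:
  fixes f :: "real ^ 'n \<Rightarrow> real"
  assumes f: "weight_integrable a f" and a: "a > 0" and R: "R \<ge> 1" and f0: "\<And>y. norm y < 2 * R \<Longrightarrow> f y = 0"
  obtains M where "M \<ge> 0" "\<And>x z. norm x \<le> R \<Longrightarrow> z > 0 \<Longrightarrow> \<bar>poisson_extension a f (x, z)\<bar> \<le> z powr a * M"
proof -
  define p where "p = real CARD('n) + a"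
  have p: "p > 0" unfolding p_def using a by simp
  define c where "c = poisson_mass TYPE('n) a"
  have c: "c > 0" unfolding c_def by (rule poisson_mass_pos[OF a])
  have fm [measurable]: "f \<in> borel_measurable borel" and fi: "integrable lborel (\<lambda>y. f y * bracket p y)"
    using f unfolding weight_integrable_def p_def by auto
  define M where "M = 8 powr (p / 2) / c * (LINT y|lborel. \<bar>f y * bracket p y\<bar>)"
  show ?thesis
  proof (rule that)
    show "M \<ge> 0" unfolding M_def using c by (intro mult_nonneg_nonneg integral_nonneg_AE) auto
    fix x :: "real ^ 'n" and z :: real assume x: "norm x \<le> R" and z: "z > 0"
    have b: "\<bar>f y * poisson_kernel a (x - y) z\<bar> \<le> z powr a * (8 powr (p / 2) / c) * \<bar>f y * bracket p y\<bar>" for y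
    proof (cases "norm y < 2 * R")
      case False
      have "norm y \<le> norm (x - y) + norm x" by (metis add.commute norm_minus_commute norm_triangle_sub)
      then have "norm y / 2 \<le> norm (x - y)" using x False by linarith
      then have "(norm y / 2)\<^sup>2 \<le> (norm (x - y))\<^sup>2" by (intro power_mono) auto
      moreover have "1 \<le> (norm y)\<^sup>2" using False R by (intro one_le_power) linarith
      moreover have "0 \<le> z\<^sup>2" by simp
      moreover have "(norm y / 2)\<^sup>2 = (norm y)\<^sup>2 / 4" by (simp add: power_divide)
      moreover have "A / 4 \<le> B \<Longrightarrow> 1 \<le> A \<Longrightarrow> 0 \<le> C \<Longrightarrow> (1 + A) / 8 \<le> B + C" for A B C :: real by simp
      ultimately have "(1 + (norm y)\<^sup>2) / 8 \<le> (norm (x - y))\<^sup>2 + z\<^sup>2" by metis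
      then have "((norm (x - y))\<^sup>2 + z\<^sup>2) powr (- p / 2) \<le> ((1 + (norm y)\<^sup>2) / 8) powr (- p / 2)"
        using p by (intro powr_mono2') (auto simp: add_pos_nonneg)
      also have "\<dots> = 8 powr (p / 2) * bracket p y"
        unfolding bracket_def by (simp add: powr_divide powr_minus field_simps)
      finally have "poisson_kernel a (x - y) z \<le> z powr a * (8 powr (p / 2) * bracket p y) / c"
        unfolding poisson_kernel_eq p_def[symmetric] c_def[symmetric]
        using c by (intro divide_right_mono mult_left_mono) auto
      then have "\<bar>f y\<bar> * poisson_kernel a (x - y) z \<le> \<bar>f y\<bar> * (z powr a * (8 powr (p / 2) * bracket p y) / c)"
        by (intro mult_left_mono) auto
      then show ?thesis using poisson_kernel_nonneg[OF a, of "x - y" z] by (simp add: abs_mult ac_simps)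
    qed (simp add: f0)
    have "\<bar>poisson_extension a f (x, z)\<bar> \<le> (LINT y|lborel. \<bar>f y * poisson_kernel a (x - y) z\<bar>)"
      unfolding poisson_extension_lborel[OF fm] using integral_norm_bound[of lborel "\<lambda>y. f y * poisson_kernel a (x - y) z"] by simp
    also have "\<dots> \<le> (LINT y|lborel. z powr a * (8 powr (p / 2) / c) * \<bar>f y * bracket p y\<bar>)"
      using b fi weight_integrable_kernel[OF f a z] by (intro integral_mono integrable_abs integrable_mult_right) auto
    also have "\<dots> = z powr a * M" unfolding M_def by simp
    finally show "\<bar>poisson_extension a f (x, z)\<bar> \<le> z powr a * M" .
  qed
qed

text \<open>The datum is cut at twice a radius that contains \<open>K\<close>. The inner part
  \<open>g\<close> is integrable, so the approximate identity applies; the outer part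
  \<open>h\<close> vanishes on \<open>K\<close> and its extension is \<open>O(z powr a)\<close>
  there.\<close>

lemma has_trace_poisson_extension:
  fixes f :: "real ^ 'n \<Rightarrow> real"
  assumes f: "weight_integrable a f" and a: "a > 0"
  shows "has_trace (poisson_extension a f) f"
  unfolding has_trace_def
proof (intro allI impI)
  fix K :: "(real ^ 'n) set" assume K: "compact K"
  have Kb: "K \<in> sets borel" using K by (rule borel_compact)
  define p where "p = real CARD('n) + a"
  have p: "p > 0" unfolding p_def using a by simp
  have fm [measurable]: "f \<in> borel_measurable borel" and fi: "integrable lborel (\<lambda>y. f y * bracket p y)"
    using f unfolding weight_integrable_def p_def by auto
  obtain R0 where R0: "\<And>x. x \<in> K \<Longrightarrow> norm x \<le> R0" using compact_imp_bounded[OF K] unfolding bounded_iff by auto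
  \<comment> \<open>Raised to at least 1, as the far bound uses |y| \<ge> 1 beyond the cut.\<close>
  define R where "R = max 1 R0"
  have R: "R \<ge> 1" "\<And>x. x \<in> K \<Longrightarrow> norm x \<le> R" unfolding R_def using R0 by (auto simp: le_max_iff_disj)
  define g where "g y = f y * indicator (ball 0 (2 * R)) y" for y
  define h where "h y = f y - g y" for y
  have gm [measurable]: "g \<in> borel_measurable borel" unfolding g_def
    by (intro borel_measurable_times fm borel_measurable_indicator) auto
  have gi: "integrable lborel g"
  proof (rule Bochner_Integration.integrable_bound)
    show "integrable lborel (\<lambda>y. (1 + (2 * R)\<^sup>2) powr (p / 2) * (f y * bracket p y))" using fi by simp
    show "AE y in lborel. norm (g y) \<le> norm ((1 + (2 * R)\<^sup>2) powr (p / 2) * (f y * bracket p y))"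
    proof (rule AE_I2)
      fix y
      show "norm (g y) \<le> norm ((1 + (2 * R)\<^sup>2) powr (p / 2) * (f y * bracket p y))"
      proof (cases "norm y < 2 * R")
        case True
        then have "(norm y)\<^sup>2 \<le> (2 * R)\<^sup>2" by (intro power_mono) auto
        then have "(1 + (2 * R)\<^sup>2) powr (- p / 2) \<le> bracket p y"
          unfolding bracket_def using p by (intro powr_mono2') (auto simp: add_pos_nonneg)
        then have "(1 + (2 * R)\<^sup>2) powr (p / 2) * (1 + (2 * R)\<^sup>2) powr (- p / 2) \<le> (1 + (2 * R)\<^sup>2) powr (p / 2) * bracket p y"
          by (intro mult_left_mono) auto
        moreover have "1 + (2 * R)\<^sup>2 \<noteq> 0" using zero_le_power2[of "2 * R"] by linarith
        ultimately have "1 \<le> (1 + (2 * R)\<^sup>2) powr (p / 2) * bracket p y"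
          by (simp add: powr_add[symmetric])
        then have "\<bar>f y\<bar> * 1 \<le> \<bar>f y\<bar> * ((1 + (2 * R)\<^sup>2) powr (p / 2) * bracket p y)" by (intro mult_left_mono) auto
        then show ?thesis using True by (simp add: g_def abs_mult ac_simps)
      qed (simp add: g_def)
    qed
  qed auto
  have gW: "weight_integrable a g" unfolding weight_integrable_def p_def[symmetric]
  proof
    show "integrable lborel (\<lambda>y. g y * bracket p y)"
      by (rule Bochner_Integration.integrable_bound[OF fi]) (auto simp: g_def abs_mult indicator_def)
  qed measurable
  have hW: "weight_integrable a h"
    using f gW unfolding weight_integrable_def h_def left_diff_distrib by auto
  have h0: "h y = 0" if "norm y < 2 * R" for y using that by (simp add: h_def g_def)
  obtain M where M: "M \<ge> 0" "\<And>x z. norm x \<le> R \<Longrightarrow> z > 0 \<Longrightarrow> \<bar>poisson_extension a h (x, z)\<bar> \<le> z powr a * M"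
    using poisson_extension_far_bound[OF hW a R(1) h0] by blast
  obtain \<Omega> where \<Omega>: "\<And>z. z > 0 \<Longrightarrow> (\<integral>\<^sup>+ x. ennreal \<bar>poisson_extension a g (x, z) - g x\<bar> \<partial>lborel) \<le> ennreal (\<Omega> z)"
    "\<And>z. \<Omega> z \<ge> 0" "\<And>zs :: nat \<Rightarrow> real. zs \<longlonglongrightarrow> 0 \<Longrightarrow> (\<lambda>k. \<Omega> (zs k)) \<longlonglongrightarrow> 0"
    using poisson_approximate_identity[OF gi gW a] by blast
  have fg: "f x = g x" if "x \<in> K" for x
  proof -
    have "norm x < 2 * R" using R(2)[OF that] R(1) by linarith
    then show ?thesis by (simp add: g_def)
  qed
  have Tf: "poisson_extension a f (x, z) = poisson_extension a g (x, z) + poisson_extension a h (x, z)" if "z > 0" for x z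
    using poisson_extension_add[OF gW hW a, of "(x, z)"] that by (simp add: half_space_def h_def)
  have fK: "integrable lborel (\<lambda>x. indicator K x *\<^sub>R f x)"
  proof -
    have "integrable lborel (\<lambda>x. indicator K x *\<^sub>R g x)" by (rule integrable_mult_indicator[OF _ gi]) (use Kb in simp)
    also have "(\<lambda>x. indicator K x *\<^sub>R g x) = (\<lambda>x. indicator K x *\<^sub>R f x)" using fg by (auto simp: indicator_def fun_eq_iff)
    finally show ?thesis .
  qed
  have fKm: "(\<lambda>x. indicator K x *\<^sub>R f x) \<in> borel_measurable borel"
    using Kb by (intro borel_measurable_scaleR borel_measurable_indicator fm)
  have TK: "integrable lborel (\<lambda>x. indicator K x *\<^sub>R poisson_extension a f (x, z))" if "z > 0" for z
    by (rule borel_integrable_compact[OF K])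
      (rule continuous_on_subset[OF poisson_extension_slice_continuous[OF f a that] subset_UNIV])
  have TKm: "(\<lambda>x. indicator K x *\<^sub>R poisson_extension a f (x, z)) \<in> borel_measurable borel" if "z > 0" for z
    using TK[OF that] by (auto dest: borel_measurable_integrable)
  have dK: "integrable lborel (\<lambda>x. indicator K x *\<^sub>R \<bar>poisson_extension a f (x, z) - f x\<bar>)" if "z > 0" for z
  proof -
    have "integrable lborel (\<lambda>x. \<bar>indicator K x *\<^sub>R poisson_extension a f (x, z) - indicator K x *\<^sub>R f x\<bar>)"
      using TK[OF that] fK by (intro integrable_abs Bochner_Integration.integrable_diff)
    also have "(\<lambda>x. \<bar>indicator K x *\<^sub>R poisson_extension a f (x, z) - indicator K x *\<^sub>R f x\<bar>)
        = (\<lambda>x. indicator K x *\<^sub>R \<bar>poisson_extension a f (x, z) - f x\<bar>)"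
      by (auto simp: fun_eq_iff indicator_def)
    finally show ?thesis .
  qed
  have dKm: "(\<lambda>x. indicator K x *\<^sub>R \<bar>poisson_extension a f (x, z) - f x\<bar>) \<in> borel_measurable borel" if "z > 0" for z
    using dK[OF that] by (auto dest: borel_measurable_integrable)
  have Kf: "emeasure lborel K < \<infinity>" using emeasure_compact_finite[OF K] by simp
  have le: "(LINT x:K|lebesgue. \<bar>poisson_extension a f (x, z) - f x\<bar>) \<le> \<Omega> z + z powr a * M * measure lborel K" if z: "z > 0" for z
  proof -
    have "ennreal (LINT x|lborel. indicator K x *\<^sub>R \<bar>poisson_extension a f (x, z) - f x\<bar>) =
        (\<integral>\<^sup>+ x. ennreal (indicator K x *\<^sub>R \<bar>poisson_extension a f (x, z) - f x\<bar>) \<partial>lborel)"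
      using dK[OF z] by (intro nn_integral_eq_integral[symmetric]) auto
    also have "\<dots> \<le> (\<integral>\<^sup>+ x. ennreal \<bar>poisson_extension a g (x, z) - g x\<bar> + ennreal (z powr a * M) * indicator K x \<partial>lborel)"
    proof (rule nn_integral_mono)
      fix x
      show "ennreal (indicator K x *\<^sub>R \<bar>poisson_extension a f (x, z) - f x\<bar>) \<le>
         ennreal \<bar>poisson_extension a g (x, z) - g x\<bar> + ennreal (z powr a * M) * indicator K x"
      proof (cases "x \<in> K")
        case True
        have "\<bar>poisson_extension a f (x, z) - f x\<bar> \<le> \<bar>poisson_extension a g (x, z) - g x\<bar> + z powr a * M"
          using M(2)[OF R(2)[OF True] z] Tf[OF z, of x] fg[OF True] by linarith
        then show ?thesis using True M(1) by (simp add: ennreal_plus[symmetric] ennreal_leI del: ennreal_plus)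
      qed simp
    qed
    also have "\<dots> = (\<integral>\<^sup>+ x. ennreal \<bar>poisson_extension a g (x, z) - g x\<bar> \<partial>lborel) + ennreal (z powr a * M) * emeasure lborel K"
    proof (subst nn_integral_add)
      have [measurable]: "(\<lambda>x. poisson_extension a g (x, z)) \<in> borel_measurable borel"
        using poisson_extension_slice_continuous[OF gW a z] by (rule borel_measurable_continuous_onI)
      show "(\<lambda>x. ennreal \<bar>poisson_extension a g (x, z) - g x\<bar>) \<in> borel_measurable lborel" by measurable
    qed (use Kb in \<open>auto simp: nn_integral_cmult_indicator\<close>)
    also have "\<dots> \<le> ennreal (\<Omega> z) + ennreal (z powr a * M) * ennreal (measure lborel K)"
      using \<Omega>(1)[OF z] Kf by (intro add_mono) (auto simp: emeasure_eq_ennreal_measure less_top[symmetric])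
    also have "\<dots> = ennreal (\<Omega> z + z powr a * M * measure lborel K)"
      using M(1) \<Omega>(2)[of z] by (simp add: ennreal_mult''[symmetric])
    finally have "(LINT x|lborel. indicator K x *\<^sub>R \<bar>poisson_extension a f (x, z) - f x\<bar>) \<le> \<Omega> z + z powr a * M * measure lborel K"
      using M(1) \<Omega>(2)[of z] by (subst (asm) ennreal_le_iff) auto
    then show ?thesis
      unfolding set_integrable_lebesgue_eq(2)[OF dKm[OF z]] by (simp add: set_lebesgue_integral_def)
  qed
  show "set_integrable lebesgue K f \<and> (\<forall>\<^sub>F z in at_right 0. set_integrable lebesgue K (\<lambda>x. poisson_extension a f (x, z))) \<and>
       ((\<lambda>z. LINT x:K|lebesgue. \<bar>poisson_extension a f (x, z) - f x\<bar>) \<longlongrightarrow> 0) (at_right 0)"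
  proof (intro conjI)
    show "set_integrable lebesgue K f" unfolding set_integrable_lebesgue_eq(1)[OF fKm] using fK by (simp add: set_integrable_def)
    have "set_integrable lebesgue K (\<lambda>x. poisson_extension a f (x, z))" if "z > 0" for z
      unfolding set_integrable_lebesgue_eq(1)[OF TKm[OF that]] using TK[OF that] by (simp add: set_integrable_def)
    then show "\<forall>\<^sub>F z in at_right 0. set_integrable lebesgue K (\<lambda>x. poisson_extension a f (x, z))"
      by (auto simp: eventually_at_right_field intro!: exI[of _ 1])
    show "((\<lambda>z. LINT x:K|lebesgue. \<bar>poisson_extension a f (x, z) - f x\<bar>) \<longlongrightarrow> 0) (at_right 0)"
      unfolding tendsto_at_iff_sequentially o_def
    proof (intro allI impI)
      fix zs :: "nat \<Rightarrow> real" assume zs: "\<forall>i. zs i \<in> {0<..} - {0}" "zs \<longlonglongrightarrow> 0"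
      have "(\<lambda>i. zs i powr a) \<longlonglongrightarrow> 0"
        by (rule tendsto_zero_powrI[OF zs(2) tendsto_const]) (use zs(1) a in \<open>auto intro!: always_eventually less_imp_le\<close>)
      then have "(\<lambda>i. \<Omega> (zs i) + zs i powr a * M * measure lborel K) \<longlonglongrightarrow> 0 + 0 * M * measure lborel K"
        by (intro tendsto_intros \<Omega>(3) zs(2))
      then have lim: "(\<lambda>i. \<Omega> (zs i) + zs i powr a * M * measure lborel K) \<longlonglongrightarrow> 0" by simp
      show "(\<lambda>i. LINT x:K|lebesgue. \<bar>poisson_extension a f (x, zs i) - f x\<bar>) \<longlonglongrightarrow> 0"
      proof (rule tendsto_sandwich[OF _ _ tendsto_const lim])
        show "\<forall>\<^sub>F i in sequentially. (LINT x:K|lebesgue. \<bar>poisson_extension a f (x, zs i) - f x\<bar>)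
            \<le> \<Omega> (zs i) + zs i powr a * M * measure lborel K"
          using zs(1) by (intro always_eventually allI le) auto
        show "\<forall>\<^sub>F i in sequentially. 0 \<le> (LINT x:K|lebesgue. \<bar>poisson_extension a f (x, zs i) - f x\<bar>)"
          unfolding set_lebesgue_integral_def by (intro always_eventually allI integral_nonneg_AE) auto
      qed
    qed
  qed
qed

text \<open>The kernel is a probability density. The bound on \<open>f\<close> is only almost
  everywhere because it is applied to a Borel representative.\<close>

lemma poisson_extension_bounded:
  fixes f :: "real ^ 'n \<Rightarrow> real"
  assumes f: "weight_integrable a f" and a: "a > 0" and X: "X \<in> half_space" and M: "AE y in lborel. \<bar>f y\<bar> \<le> M"
  shows "\<bar>poisson_extension a f X\<bar> \<le> M"
proof -
  define P where "P y = poisson_kernel a (fst X - y) (snd X)" for y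
  have fm: "f \<in> borel_measurable borel" using f unfolding weight_integrable_def by simp
  have iP: "integrable lborel P" "(LINT y|lborel. P y) = 1"
    unfolding P_def using integral_poisson_kernel[OF half_spaceD[OF X] a] by auto
  have P0: "P y \<ge> 0" for y unfolding P_def by (rule poisson_kernel_nonneg[OF a])
  have i: "integrable lborel (\<lambda>y. f y * P y)"
    unfolding P_def by (rule weight_integrable_kernel[OF f a half_spaceD[OF X]])
  have "\<bar>poisson_extension a f X\<bar> \<le> (LINT y|lborel. \<bar>f y * P y\<bar>)"
    unfolding poisson_extension_lborel[OF fm] P_def[symmetric] using integral_norm_bound[of lborel "\<lambda>y. f y * P y"] by simp
  also have "\<dots> \<le> (LINT y|lborel. M * P y)"
  proof (rule integral_mono_AE)
    show "AE y in lborel. \<bar>f y * P y\<bar> \<le> M * P y"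
      using M by eventually_elim (use P0 in \<open>auto simp: abs_mult intro!: mult_right_mono\<close>)
  qed (use i iP in auto)
  also have "\<dots> = M" using iP by simp
  finally show ?thesis .
qed

section \<open>Borel representatives of Lebesgue measurable data, and the energy of admissible
  pairs\<close>

lemma has_trace_cong_AE:
  assumes "has_trace w f" "AE x in lebesgue. f x = g x" "f \<in> borel_measurable lebesgue" "g \<in> borel_measurable lebesgue"
  shows "has_trace w g"
  unfolding has_trace_def
proof (intro allI impI)
  fix K :: "(real ^ 'a) set" assume K: "compact K"
  have KL: "K \<in> sets lebesgue" using borel_compact[OF K] by simp
  have T: "set_integrable lebesgue K f" "\<forall>\<^sub>F z in at_right 0. set_integrable lebesgue K (\<lambda>x. w (x, z))"
    "((\<lambda>z. LINT x:K|lebesgue. \<bar>w (x, z) - f x\<bar>) \<longlongrightarrow> 0) (at_right 0)"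
    using assms(1) K unfolding has_trace_def by auto
  have m: "(\<lambda>x. indicator K x *\<^sub>R f x) \<in> borel_measurable lebesgue" "(\<lambda>x. indicator K x *\<^sub>R g x) \<in> borel_measurable lebesgue"
    using assms KL by (auto intro!: borel_measurable_scaleR borel_measurable_indicator)
  have g: "set_integrable lebesgue K g"
    using T(1) unfolding set_integrable_def
    by (subst integrable_cong_AE[OF m(2) m(1)]) (use assms(2) in \<open>auto elim!: eventually_mono\<close>)
  have "\<forall>\<^sub>F z in at_right 0. (LINT x:K|lebesgue. \<bar>w (x, z) - f x\<bar>) = (LINT x:K|lebesgue. \<bar>w (x, z) - g x\<bar>)"
    using T(2)
  proof eventually_elim
    case (elim z)
    have "integrable lebesgue (\<lambda>x. \<bar>indicator K x *\<^sub>R w (x, z) - indicator K x *\<^sub>R f x\<bar>)"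
      "integrable lebesgue (\<lambda>x. \<bar>indicator K x *\<^sub>R w (x, z) - indicator K x *\<^sub>R g x\<bar>)"
      using elim T(1) g unfolding set_integrable_def by (auto intro!: integrable_abs Bochner_Integration.integrable_diff)
    moreover have "\<bar>indicator K x *\<^sub>R w (x, z) - indicator K x *\<^sub>R h x\<bar> = indicator K x *\<^sub>R \<bar>w (x, z) - h x\<bar>" for h x
      by (auto simp: indicator_def)
    ultimately show ?case unfolding set_lebesgue_integral_def
      by (intro integral_cong_AE) (use assms(2) in \<open>auto elim!: eventually_mono dest: borel_measurable_integrable\<close>)
  qed
  from tendsto_cong[THEN iffD1, OF this T(3)] g T(2)
  show "set_integrable lebesgue K g \<and> (\<forall>\<^sub>F z in at_right 0. set_integrable lebesgue K (\<lambda>x. w (x, z))) \<and>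
     ((\<lambda>z. LINT x:K|lebesgue. \<bar>w (x, z) - g x\<bar>) \<longlongrightarrow> 0) (at_right 0)"
    by blast
qed

lemma poisson_extension_cong_AE:
  fixes f g :: "real ^ 'n \<Rightarrow> real"
  assumes "AE x in lebesgue. f x = g x" "f \<in> borel_measurable lebesgue" "g \<in> borel_measurable lebesgue"
  shows "poisson_extension a f = poisson_extension a g"
proof
  fix X :: "(real ^ 'n) \<times> real"
  have k: "(\<lambda>y. poisson_kernel a (fst X - y) (snd X)) \<in> borel_measurable lebesgue"
    by (rule measurable_completion) simp
  show "poisson_extension a f X = poisson_extension a g X"
    unfolding poisson_extension_def
    by (rule integral_cong_AE) (use assms k in \<open>auto intro!: borel_measurable_times elim!: eventually_mono\<close>)
qed

definition lebesgue_local_energy :: "real \<Rightarrow> (real ^ 'n \<Rightarrow> real) \<Rightarrow> ennreal" where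
  "lebesgue_local_energy a u = (\<integral>\<^sup>+ x. indicator (ball 0 2) x *
     (\<integral>\<^sup>+ y. ennreal (\<bar>u x - u y\<bar>\<^sup>2 / norm (x - y) powr (real CARD('n) + a)) \<partial>lebesgue) \<partial>lebesgue)"

text \<open>Neither the extension nor the energy sees null sets, so both may be computed with a
  Borel function equal to \<open>u\<close> almost everywhere; the trace is transferred back to
  \<open>u\<close> itself.\<close>

lemma borel_representative:
  fixes u :: "real ^ 'n \<Rightarrow> real"
  assumes u: "u \<in> borel_measurable lebesgue" and a: "a > 0" and J: "lebesgue_local_energy a u < \<infinity>"
  obtains f where "f \<in> borel_measurable borel" "AE x in lborel. u x = f x" "local_energy a f < \<infinity>"
    "weight_integrable a f" "poisson_extension a u = poisson_extension a f" "has_trace (poisson_extension a f) u"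
proof -
  obtain f where f: "f \<in> borel_measurable lborel" "AE x in lborel. u x = f x"
    using completion_ex_borel_measurable_real[OF u] by auto
  have fb: "f \<in> borel_measurable borel" using f by simp
  have fl: "f \<in> borel_measurable lebesgue" by (rule measurable_completion) fact
  have ae: "AE x in lebesgue. u x = f x" "AE x in lebesgue. f x = u x"
    using f(2) by (auto intro!: AE_completion elim!: eventually_mono)
  have "lebesgue_local_energy a u = local_energy a f"
    unfolding lebesgue_local_energy_def local_energy_def nn_integral_completion
  proof (rule nn_integral_cong_AE, use f(2) in eventually_elim)
    case (elim x)
    have "(\<integral>\<^sup>+ y. ennreal (\<bar>u x - u y\<bar>\<^sup>2 / norm (x - y) powr (real CARD('n) + a)) \<partial>lborel)
      = (\<integral>\<^sup>+ y. ennreal (\<bar>f x - f y\<bar>\<^sup>2 / norm (x - y) powr (real CARD('n) + a)) \<partial>lborel)"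
      by (rule nn_integral_cong_AE) (use f(2) elim in \<open>auto elim!: eventually_mono\<close>)
    then show ?case by simp
  qed
  then have Jf: "local_energy a f < \<infinity>" using J by simp
  have W: "weight_integrable a f" by (rule local_energy_imp_weight_integrable(2)[OF fb a Jf])
  show ?thesis
    by (rule that[OF fb f(2) Jf W poisson_extension_cong_AE[OF ae(1) u fl]
        has_trace_cong_AE[OF has_trace_poisson_extension[OF W a] ae(2) fl u]])
qed

text \<open>Tonelli for the product of the two completed measures, which is the measure in the
  definition of the energy, and monotonicity in the domain: pairs with first point in
  \<open>B_2\<close> are not both outside.\<close>

lemma lebesgue_local_energy_le_gagliardo:
  fixes u :: "real ^ 'n \<Rightarrow> real"
  assumes u [measurable]: "u \<in> borel_measurable lebesgue"
  shows "lebesgue_local_energy (2 * s) u \<le> gagliardo_energy s u (ball 0 2)"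
proof -
  interpret L: sigma_finite_measure "lebesgue :: (real ^ 'n) measure"
    by (rule sigma_finite_completion[OF sigma_finite_lborel])
  have id: "(\<lambda>x :: real ^ 'n. x) \<in> borel_measurable lebesgue" by (rule measurable_completion) simp
  define k where "k p = ennreal (\<bar>u (fst p) - u (snd p)\<bar>\<^sup>2 / norm (fst p - snd p) powr (real CARD('n) + 2 * s))" for p :: "(real ^ 'n) \<times> (real ^ 'n)"
  have fs: "fst \<in> borel_measurable (lebesgue \<Otimes>\<^sub>M lebesgue :: ((real ^ 'n) \<times> (real ^ 'n)) measure)"
    "snd \<in> borel_measurable (lebesgue \<Otimes>\<^sub>M lebesgue :: ((real ^ 'n) \<times> (real ^ 'n)) measure)"
    using measurable_compose[OF measurable_fst id] measurable_compose[OF measurable_snd id] by auto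
  have km: "k \<in> borel_measurable (lebesgue \<Otimes>\<^sub>M lebesgue)"
  proof -
    note fs [measurable]
    show ?thesis unfolding k_def by measurable
  qed
  have im: "(\<lambda>p. indicator (ball 0 2) (fst p) :: ennreal) \<in> borel_measurable (lebesgue \<Otimes>\<^sub>M lebesgue :: ((real ^ 'n) \<times> (real ^ 'n)) measure)"
    by (rule measurable_compose[OF fs(1) borel_measurable_indicator]) simp
  have km1: "(\<lambda>y. k (x, y)) \<in> borel_measurable lebesgue" for x
    by (rule measurable_Pair2[OF km]) simp
  have "lebesgue_local_energy (2 * s) u = (\<integral>\<^sup>+ x. \<integral>\<^sup>+ y. indicator (ball 0 2) (fst (x, y)) * k (x, y) \<partial>lebesgue \<partial>lebesgue)"
    unfolding lebesgue_local_energy_def using km1 by (simp add: nn_integral_cmult k_def)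
  also have "\<dots> = (\<integral>\<^sup>+ p. indicator (ball 0 2) (fst p) * k p \<partial>(lebesgue \<Otimes>\<^sub>M lebesgue))"
    by (rule L.nn_integral_fst) (intro borel_measurable_times_ennreal im km)
  also have "\<dots> \<le> gagliardo_energy s u (ball 0 2)"
    unfolding gagliardo_energy_def k_def by (intro nn_integral_mono) (auto simp: indicator_def)
  finally show ?thesis .
qed

text \<open>The factor 8 is 4, the square of the jump of the sign function, times 2: the perimeter
  lists pairs with the point of \<open>E\<close> in first place only, while the local energy meets
  them in both orders.\<close>

lemma lebesgue_local_energy_le_perimeter:
  fixes E :: "(real ^ 'n) set"
  assumes E: "E \<in> sets lebesgue"
  shows "lebesgue_local_energy \<sigma> (sign_of_set E) \<le> 8 * fractional_perimeter \<sigma> E (ball 0 2)"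
proof -
  interpret L: sigma_finite_measure "lebesgue :: (real ^ 'n) measure"
    by (rule sigma_finite_completion[OF sigma_finite_lborel])
  interpret LL: pair_sigma_finite "lebesgue :: (real ^ 'n) measure" "lebesgue :: (real ^ 'n) measure" ..
  let ?M = "lebesgue \<Otimes>\<^sub>M lebesgue :: ((real ^ 'n) \<times> (real ^ 'n)) measure"
  define \<Omega> where "\<Omega> = ball (0 :: real ^ 'n) 2"
  have \<Omega>: "\<Omega> \<in> sets lebesgue" unfolding \<Omega>_def by simp
  have id: "(\<lambda>x :: real ^ 'n. x) \<in> borel_measurable lebesgue" by (rule measurable_completion) simp
  have fs: "fst \<in> borel_measurable ?M" "snd \<in> borel_measurable ?M"
    using measurable_compose[OF measurable_fst id] measurable_compose[OF measurable_snd id] by auto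
  define k where "k p = ennreal (1 / norm (fst p - snd p) powr (real CARD('n) + \<sigma>))" for p :: "(real ^ 'n) \<times> (real ^ 'n)"
  have km: "k \<in> borel_measurable ?M"
  proof -
    note fs [measurable]
    show ?thesis unfolding k_def by measurable
  qed
  have C: "- X \<in> sets lebesgue" if "X \<in> sets lebesgue" for X :: "(real ^ 'n) set"
    using sets.compl_sets[OF that] by (simp add: Compl_eq_Diff_UNIV)
  have rs: "(E \<inter> \<Omega>) \<times> (- E \<inter> \<Omega>) \<in> sets ?M" "(E \<inter> \<Omega>) \<times> (- E \<inter> - \<Omega>) \<in> sets ?M" "(E \<inter> - \<Omega>) \<times> (- E \<inter> \<Omega>) \<in> sets ?M"
    using E \<Omega> C by (auto intro!: pair_measureI sets.Int)
  define A where "A p = 4 * (k p * indicator ((E \<inter> \<Omega>) \<times> (- E \<inter> \<Omega>)) p + k p * indicator ((E \<inter> \<Omega>) \<times> (- E \<inter> - \<Omega>)) p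
     + k p * indicator ((E \<inter> - \<Omega>) \<times> (- E \<inter> \<Omega>)) p)" for p
  have Am: "A \<in> borel_measurable ?M" unfolding A_def
    using rs by (intro borel_measurable_times_ennreal borel_measurable_add km borel_measurable_indicator) auto
  have IA: "(\<integral>\<^sup>+ p. A p \<partial>?M) = 4 * fractional_perimeter \<sigma> E \<Omega>"
    unfolding A_def fractional_perimeter_def interaction_def k_def[symmetric]
    using rs km by (simp add: nn_integral_cmult nn_integral_add borel_measurable_times_ennreal)
  have A1: "(\<integral>\<^sup>+ x. \<integral>\<^sup>+ y. A (x, y) \<partial>lebesgue \<partial>lebesgue) = (\<integral>\<^sup>+ p. A p \<partial>?M)"
    by (rule L.nn_integral_fst[OF Am])
  have A2: "(\<integral>\<^sup>+ x. \<integral>\<^sup>+ y. A (y, x) \<partial>lebesgue \<partial>lebesgue) = (\<integral>\<^sup>+ p. A p \<partial>?M)"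
    by (rule LL.nn_integral_snd[OF Am])
  have Am1: "(\<lambda>y. A (x, y)) \<in> borel_measurable lebesgue" "(\<lambda>y. A (y, x)) \<in> borel_measurable lebesgue" for x
    using measurable_Pair2[OF Am, of x] measurable_Pair1[OF Am, of x] by auto
  have Am2: "(\<lambda>x. \<integral>\<^sup>+ y. A (x, y) \<partial>lebesgue) \<in> borel_measurable lebesgue"
    by (rule L.borel_measurable_nn_integral_fst[OF Am])
  have Am3: "(\<lambda>x. \<integral>\<^sup>+ y. A (y, x) \<partial>lebesgue) \<in> borel_measurable lebesgue"
    using L.borel_measurable_nn_integral_fst[OF measurable_pair_swap[OF Am]] by simp
  have "lebesgue_local_energy \<sigma> (sign_of_set E) \<le> (\<integral>\<^sup>+ x. (\<integral>\<^sup>+ y. A (x, y) + A (y, x) \<partial>lebesgue) \<partial>lebesgue)"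
    unfolding lebesgue_local_energy_def
  proof (rule nn_integral_mono)
    fix x :: "real ^ 'n"
    show "indicator (ball 0 2) x * (\<integral>\<^sup>+ y. ennreal (\<bar>sign_of_set E x - sign_of_set E y\<bar>\<^sup>2 / norm (x - y) powr (real CARD('n) + \<sigma>)) \<partial>lebesgue)
       \<le> (\<integral>\<^sup>+ y. A (x, y) + A (y, x) \<partial>lebesgue)"
    proof (cases "x \<in> \<Omega>")
      case True
      have "ennreal (\<bar>sign_of_set E x - sign_of_set E y\<bar>\<^sup>2 / norm (x - y) powr (real CARD('n) + \<sigma>)) \<le> A (x, y) + A (y, x)" for y
      proof -
        have n: "norm (y - x) = norm (x - y)" by (rule norm_minus_commute)
        have e4: "ennreal (4 / t) = 4 * ennreal (1 / t)" for t :: real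
          using ennreal_mult'[of 4 "1 / t"] by simp
        show ?thesis
          using True unfolding A_def k_def fst_conv snd_conv n
          by (cases "x \<in> E"; cases "y \<in> E"; cases "y \<in> \<Omega>") (simp_all add: sign_of_set_def e4)
      qed
      then show ?thesis using True unfolding \<Omega>_def by (auto intro!: nn_integral_mono)
    qed (simp add: \<Omega>_def)
  qed
  also have "\<dots> = (\<integral>\<^sup>+ p. A p \<partial>?M) + (\<integral>\<^sup>+ p. A p \<partial>?M)"
    using Am1 Am2 Am3 by (simp add: nn_integral_add A1 A2)
  also have "\<dots> = 8 * fractional_perimeter \<sigma> E \<Omega>"
    unfolding IA by (simp add: mult_2[symmetric] distrib_right[symmetric])
  finally show ?thesis unfolding \<Omega>_def .
qed

section \<open>Calculus of limits\<close>

lemma c1_limitI_C1: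
  fixes f :: "'a::euclidean_space \<Rightarrow> real"
  assumes f: "\<And>x. x \<in> \<Omega> \<Longrightarrow> GDERIV f x :> G x" and G: "continuous_on \<Omega> G"
  shows "c1_limit \<Omega> f G"
  unfolding c1_limit_def
proof (intro exI[of _ "\<lambda>_. f"] exI[of _ "\<lambda>_. G"] conjI allI impI ballI)
  fix K assume K: "compact K \<and> K \<subseteq> \<Omega>"
  have "bounded (f ` K)" "bounded (G ` K)"
    using K G GDERIV_imp_continuous_on[OF f] by (auto intro!: compact_imp_bounded compact_continuous_image intro: continuous_on_subset)
  then obtain B1 B2 where "\<And>x. x \<in> K \<Longrightarrow> \<bar>f x\<bar> \<le> B1" "\<And>x. x \<in> K \<Longrightarrow> norm (G x) \<le> B2"
    unfolding bounded_iff by auto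
  then show "\<exists>B. \<forall>k. \<forall>x\<in>K. \<bar>f x\<bar> \<le> B \<and> norm (G x) \<le> B"
    by (intro exI[of _ "max B1 B2"]) (auto simp: le_max_iff_disj)
qed (use f G in auto)

lemma c1_limitE:
  assumes "c1_limit \<Omega> f G"
  obtains F H where "\<And>k x. x \<in> \<Omega> \<Longrightarrow> GDERIV (F k) x :> H k x" "\<And>k. continuous_on \<Omega> (H k)"
     "\<And>x. x \<in> \<Omega> \<Longrightarrow> (\<lambda>k::nat. F k x) \<longlonglongrightarrow> f x" "\<And>x. x \<in> \<Omega> \<Longrightarrow> (\<lambda>k. H k x) \<longlonglongrightarrow> G x"
     "\<And>K. compact K \<Longrightarrow> K \<subseteq> \<Omega> \<Longrightarrow> (\<exists>B. \<forall>k. \<forall>x\<in>K. \<bar>F k x\<bar> \<le> B \<and> norm (H k x) \<le> B)"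
  using assms unfolding c1_limit_def by metis

lemma c1_limit_add:
  fixes f g :: "'a::euclidean_space \<Rightarrow> real"
  assumes "c1_limit \<Omega> f G" "c1_limit \<Omega> g H"
  shows "c1_limit \<Omega> (\<lambda>x. f x + g x) (\<lambda>x. G x + H x)"
proof -
  obtain F1 H1 where 1: "\<And>k x. x \<in> \<Omega> \<Longrightarrow> GDERIV (F1 k) x :> H1 k x" "\<And>k. continuous_on \<Omega> (H1 k)"
     "\<And>x. x \<in> \<Omega> \<Longrightarrow> (\<lambda>k::nat. F1 k x) \<longlonglongrightarrow> f x" "\<And>x. x \<in> \<Omega> \<Longrightarrow> (\<lambda>k. H1 k x) \<longlonglongrightarrow> G x"
     "\<And>K. compact K \<Longrightarrow> K \<subseteq> \<Omega> \<Longrightarrow> (\<exists>B. \<forall>k. \<forall>x\<in>K. \<bar>F1 k x\<bar> \<le> B \<and> norm (H1 k x) \<le> B)"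
    using c1_limitE[OF assms(1)] by blast
  obtain F2 H2 where 2: "\<And>k x. x \<in> \<Omega> \<Longrightarrow> GDERIV (F2 k) x :> H2 k x" "\<And>k. continuous_on \<Omega> (H2 k)"
     "\<And>x. x \<in> \<Omega> \<Longrightarrow> (\<lambda>k::nat. F2 k x) \<longlonglongrightarrow> g x" "\<And>x. x \<in> \<Omega> \<Longrightarrow> (\<lambda>k. H2 k x) \<longlonglongrightarrow> H x"
     "\<And>K. compact K \<Longrightarrow> K \<subseteq> \<Omega> \<Longrightarrow> (\<exists>B. \<forall>k. \<forall>x\<in>K. \<bar>F2 k x\<bar> \<le> B \<and> norm (H2 k x) \<le> B)"
    using c1_limitE[OF assms(2)] by blast
  show ?thesis unfolding c1_limit_def
  proof (intro exI[of _ "\<lambda>k x. F1 k x + F2 k x"] exI[of _ "\<lambda>k x. H1 k x + H2 k x"] conjI allI impI ballI)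
    fix K assume K: "compact K \<and> K \<subseteq> \<Omega>"
    from 1(5)[OF conjunct1[OF K] conjunct2[OF K]]
    obtain B1 where B1: "\<And>k x. x \<in> K \<Longrightarrow> \<bar>F1 k x\<bar> \<le> B1 \<and> norm (H1 k x) \<le> B1" by blast
    from 2(5)[OF conjunct1[OF K] conjunct2[OF K]]
    obtain B2 where B2: "\<And>k x. x \<in> K \<Longrightarrow> \<bar>F2 k x\<bar> \<le> B2 \<and> norm (H2 k x) \<le> B2" by blast
    have "\<bar>F1 k x + F2 k x\<bar> \<le> B1 + B2 \<and> norm (H1 k x + H2 k x) \<le> B1 + B2" if "x \<in> K" for k x
      using B1[OF that, of k] B2[OF that, of k] norm_triangle_ineq[of "H1 k x" "H2 k x"] by auto
    then show "\<exists>B. \<forall>k. \<forall>x\<in>K. \<bar>F1 k x + F2 k x\<bar> \<le> B \<and> norm (H1 k x + H2 k x) \<le> B" by blast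
  qed (use 1(1-4) 2(1-4) in \<open>auto intro!: GDERIV_add continuous_intros tendsto_add\<close>)
qed

lemma c1_limit_mult:
  fixes f g :: "'a::euclidean_space \<Rightarrow> real"
  assumes "c1_limit \<Omega> f G" "c1_limit \<Omega> g H"
  shows "c1_limit \<Omega> (\<lambda>x. f x * g x) (\<lambda>x. f x *\<^sub>R H x + g x *\<^sub>R G x)"
proof -
  obtain F1 H1 where 1: "\<And>k x. x \<in> \<Omega> \<Longrightarrow> GDERIV (F1 k) x :> H1 k x" "\<And>k. continuous_on \<Omega> (H1 k)"
     "\<And>x. x \<in> \<Omega> \<Longrightarrow> (\<lambda>k::nat. F1 k x) \<longlonglongrightarrow> f x" "\<And>x. x \<in> \<Omega> \<Longrightarrow> (\<lambda>k. H1 k x) \<longlonglongrightarrow> G x"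
     "\<And>K. compact K \<Longrightarrow> K \<subseteq> \<Omega> \<Longrightarrow> (\<exists>B. \<forall>k. \<forall>x\<in>K. \<bar>F1 k x\<bar> \<le> B \<and> norm (H1 k x) \<le> B)"
    using c1_limitE[OF assms(1)] by blast
  obtain F2 H2 where 2: "\<And>k x. x \<in> \<Omega> \<Longrightarrow> GDERIV (F2 k) x :> H2 k x" "\<And>k. continuous_on \<Omega> (H2 k)"
     "\<And>x. x \<in> \<Omega> \<Longrightarrow> (\<lambda>k::nat. F2 k x) \<longlonglongrightarrow> g x" "\<And>x. x \<in> \<Omega> \<Longrightarrow> (\<lambda>k. H2 k x) \<longlonglongrightarrow> H x"
     "\<And>K. compact K \<Longrightarrow> K \<subseteq> \<Omega> \<Longrightarrow> (\<exists>B. \<forall>k. \<forall>x\<in>K. \<bar>F2 k x\<bar> \<le> B \<and> norm (H2 k x) \<le> B)"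
    using c1_limitE[OF assms(2)] by blast
  have c: "continuous_on \<Omega> (F1 k)" "continuous_on \<Omega> (F2 k)" for k
    using GDERIV_imp_continuous_on[OF 1(1)] GDERIV_imp_continuous_on[OF 2(1)] by auto
  show ?thesis unfolding c1_limit_def
  proof (intro exI[of _ "\<lambda>k x. F1 k x * F2 k x"] exI[of _ "\<lambda>k x. F1 k x *\<^sub>R H2 k x + F2 k x *\<^sub>R H1 k x"] conjI allI impI ballI)
    fix K assume K: "compact K \<and> K \<subseteq> \<Omega>"
    from 1(5)[OF conjunct1[OF K] conjunct2[OF K]]
    obtain B1 where B1: "\<And>k x. x \<in> K \<Longrightarrow> \<bar>F1 k x\<bar> \<le> B1 \<and> norm (H1 k x) \<le> B1" by blast
    from 2(5)[OF conjunct1[OF K] conjunct2[OF K]]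
    obtain B2 where B2: "\<And>k x. x \<in> K \<Longrightarrow> \<bar>F2 k x\<bar> \<le> B2 \<and> norm (H2 k x) \<le> B2" by blast
    have "\<bar>F1 k x * F2 k x\<bar> \<le> 2 * (B1 * B2) \<and> norm (F1 k x *\<^sub>R H2 k x + F2 k x *\<^sub>R H1 k x) \<le> 2 * (B1 * B2)" if "x \<in> K" for k x
    proof -
      note b = B1[OF that, of k] B2[OF that, of k]
      have p: "0 \<le> B1" "0 \<le> B2" using b abs_ge_zero[of "F1 k x"] abs_ge_zero[of "F2 k x"] by linarith+
      have "\<bar>F1 k x\<bar> * \<bar>F2 k x\<bar> \<le> B1 * B2" "\<bar>F1 k x\<bar> * norm (H2 k x) \<le> B1 * B2" "norm (H1 k x) * \<bar>F2 k x\<bar> \<le> B1 * B2"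
        using b p by (auto intro!: mult_mono)
      moreover have "0 \<le> B1 * B2" using p by simp
      moreover have "norm (F1 k x *\<^sub>R H2 k x + F2 k x *\<^sub>R H1 k x) \<le> \<bar>F1 k x\<bar> * norm (H2 k x) + \<bar>F2 k x\<bar> * norm (H1 k x)"
        using norm_triangle_ineq[of "F1 k x *\<^sub>R H2 k x" "F2 k x *\<^sub>R H1 k x"] by simp
      ultimately show ?thesis by (simp add: abs_mult mult.commute)
    qed
    then show "\<exists>B. \<forall>k. \<forall>x\<in>K. \<bar>F1 k x * F2 k x\<bar> \<le> B \<and> norm (F1 k x *\<^sub>R H2 k x + F2 k x *\<^sub>R H1 k x) \<le> B" by blast
  qed (use 1(1-4) 2(1-4) c in \<open>auto intro!: GDERIV_mult continuous_intros tendsto_add tendsto_mult tendsto_scaleR\<close>)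
qed

lemma c1_limit_cong:
  assumes "c1_limit \<Omega> f G" "\<And>x. x \<in> \<Omega> \<Longrightarrow> f x = f' x" "\<And>x. x \<in> \<Omega> \<Longrightarrow> G x = G' x"
  shows "c1_limit \<Omega> f' G'"
  using assms unfolding c1_limit_def by (simp cong: ball_cong)

lemma c1_limit_const: "c1_limit \<Omega> (\<lambda>x. c) (\<lambda>x. 0)"
  by (rule c1_limitI_C1) (auto simp: GDERIV_const)

lemma c1_limit_cmult: "c1_limit \<Omega> f G \<Longrightarrow> c1_limit \<Omega> (\<lambda>x. c * f x) (\<lambda>x. c *\<^sub>R G x)"
  using c1_limit_mult[OF c1_limit_const[of \<Omega> c], of f G] by simp

lemma c1_limit_diff:
  "c1_limit \<Omega> f G \<Longrightarrow> c1_limit \<Omega> g H \<Longrightarrow> c1_limit \<Omega> (\<lambda>x. f x - g x) (\<lambda>x. G x - H x)"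
  using c1_limit_add[OF _ c1_limit_cmult[of \<Omega> g H "-1"], of f G] by simp

lemma inverse_Suc_tendsto: "(\<lambda>k. 1 / real (Suc k)) \<longlonglongrightarrow> 0"
  by (rule LIMSEQ_Suc[OF lim_1_over_n])

text \<open>The derivatives \<open>t / sqrt (t^2 + e k)\<close> of the approximations stay in
  [-1, 1] and converge at every point, also at 0, where they vanish and \<open>sgn 0 = 0\<close>.
  The limit gradient thus exists everywhere, without an exceptional null set.\<close>

lemma c1_limit_abs:
  fixes f :: "'a::euclidean_space \<Rightarrow> real"
  assumes f: "\<And>x. x \<in> \<Omega> \<Longrightarrow> GDERIV f x :> G x" and G: "continuous_on \<Omega> G"
  shows "c1_limit \<Omega> (\<lambda>x. \<bar>f x\<bar>) (\<lambda>x. sgn (f x) *\<^sub>R G x)"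
proof -
  have cf: "continuous_on \<Omega> f" by (rule GDERIV_imp_continuous_on[OF f])
  define e where "e k = 1 / real (Suc k)" for k
  have e: "e k > 0" "e k \<le> 1" "e \<longlonglongrightarrow> 0" for k
    unfolding e_def by (simp_all add: inverse_Suc_tendsto del: of_nat_Suc)
  define S where "S k t = sqrt (t\<^sup>2 + e k)" for k t
  have pos: "t\<^sup>2 + e k > 0" for k t using e by (intro add_nonneg_pos) auto
  have Spos: "S k t > 0" for k t unfolding S_def using pos by simp
  have dS: "DERIV (S k) t :> t / S k t" for k t
    unfolding S_def using pos[of t k] by (auto intro!: derivative_eq_intros simp: field_simps)
  have Sge: "\<bar>t\<bar> \<le> S k t" for k t
    unfolding S_def using e(1)[of k] by (intro real_le_rsqrt) simp
  have Sle: "S k t \<le> \<bar>t\<bar> + 1" for k t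
  proof -
    have "t\<^sup>2 + e k \<le> (\<bar>t\<bar> + 1)\<^sup>2"
      using e(2)[of k] by (simp add: power2_eq_square algebra_simps)
    then show ?thesis unfolding S_def using pos[of t k] by (intro real_le_lsqrt) (auto simp: less_imp_le)
  qed
  have Slim: "(\<lambda>k. S k t) \<longlonglongrightarrow> \<bar>t\<bar>" for t
  proof -
    have "(\<lambda>k. S k t) \<longlonglongrightarrow> sqrt (t\<^sup>2 + 0)" unfolding S_def by (intro tendsto_intros e(3))
    then show ?thesis by simp
  qed
  show ?thesis unfolding c1_limit_def
  proof (intro exI[of _ "\<lambda>k x. S k (f x)"] exI[of _ "\<lambda>k x. (f x / S k (f x)) *\<^sub>R G x"] conjI allI impI ballI)
    fix k x assume "x \<in> \<Omega>"
    then show "GDERIV (\<lambda>x. S k (f x)) x :> (f x / S k (f x)) *\<^sub>R G x"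
      by (intro GDERIV_DERIV_compose[OF f dS])
  next
    fix k
    have "continuous_on \<Omega> (\<lambda>x. S k (f x))" unfolding S_def by (intro continuous_intros cf)
    then show "continuous_on \<Omega> (\<lambda>x. (f x / S k (f x)) *\<^sub>R G x)"
      using Spos by (intro continuous_intros cf G) (auto simp: less_imp_neq[symmetric])
  next
    fix x show "(\<lambda>k. S k (f x)) \<longlonglongrightarrow> \<bar>f x\<bar>" by (rule Slim)
    show "(\<lambda>k. (f x / S k (f x)) *\<^sub>R G x) \<longlonglongrightarrow> sgn (f x) *\<^sub>R G x"
    proof (cases "f x = 0")
      case False
      then have "(\<lambda>k. (f x / S k (f x)) *\<^sub>R G x) \<longlonglongrightarrow> (f x / \<bar>f x\<bar>) *\<^sub>R G x"
        by (intro tendsto_intros Slim) auto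
      moreover have "f x / \<bar>f x\<bar> = sgn (f x)" using False by (auto simp: sgn_real_def abs_if)
      ultimately show ?thesis by simp
    qed simp
  next
    fix K assume K: "compact K \<and> K \<subseteq> \<Omega>"
    have "bounded (f ` K)" "bounded (G ` K)"
      using K G cf by (auto intro!: compact_imp_bounded compact_continuous_image intro: continuous_on_subset)
    then obtain B1 B2 where B: "\<And>x. x \<in> K \<Longrightarrow> \<bar>f x\<bar> \<le> B1" "\<And>x. x \<in> K \<Longrightarrow> norm (G x) \<le> B2"
      unfolding bounded_iff by auto
    have "\<bar>S k (f x)\<bar> \<le> max (B1 + 1) B2 \<and> norm ((f x / S k (f x)) *\<^sub>R G x) \<le> max (B1 + 1) B2" if "x \<in> K" for k x
    proof
      show "\<bar>S k (f x)\<bar> \<le> max (B1 + 1) B2" using B(1)[OF that] Sle[of k "f x"] Spos[of k "f x"] by simp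
      have "\<bar>f x\<bar> / S k (f x) \<le> 1" using Sge[of "f x" k] Spos[of k "f x"] by simp
      then have "\<bar>f x\<bar> / S k (f x) * norm (G x) \<le> 1 * norm (G x)" by (intro mult_right_mono) auto
      then show "norm ((f x / S k (f x)) *\<^sub>R G x) \<le> max (B1 + 1) B2"
        using B(2)[OF that] Spos[of k "f x"] by (simp add: abs_of_pos)
    qed
    then show "\<exists>B. \<forall>k. \<forall>x\<in>K. \<bar>S k (f x)\<bar> \<le> B \<and> norm ((f x / S k (f x)) *\<^sub>R G x) \<le> B" by blast
  qed
qed

text \<open>The value \<open>1 / 2\<close> of the derivative at the two kinks is the limit of the derivatives of the
  approximations \<open>sqrt (t\<^sup>2 + 1 / k)\<close> of the absolute value.\<close>

definition clamp01 :: "real \<Rightarrow> real" where "clamp01 t = (\<bar>t\<bar> - \<bar>t - 1\<bar> + 1) / 2"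
definition clamp01_deriv :: "real \<Rightarrow> real" where "clamp01_deriv t = (sgn t - sgn (t - 1)) / 2"

lemma clamp01_eq: "clamp01 t = (if t < 0 then 0 else if t < 1 then t else 1)"
  by (auto simp: clamp01_def)

lemma clamp01_bounds: "0 \<le> clamp01 t" "clamp01 t \<le> 1"
  by (auto simp: clamp01_eq)

lemma clamp01_deriv_bound: "\<bar>clamp01_deriv t\<bar> \<le> 1"
  by (auto simp: clamp01_deriv_def sgn_real_def)

lemma clamp01_deriv_0: "t < 0 \<or> t > 1 \<Longrightarrow> clamp01_deriv t = 0"
  by (auto simp: clamp01_deriv_def sgn_real_def)

lemma c1_limit_clamp01:
  fixes f :: "'a::euclidean_space \<Rightarrow> real"
  assumes f: "\<And>x. x \<in> \<Omega> \<Longrightarrow> GDERIV f x :> G x" and G: "continuous_on \<Omega> G"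
  shows "c1_limit \<Omega> (\<lambda>x. clamp01 (f x)) (\<lambda>x. clamp01_deriv (f x) *\<^sub>R G x)"
proof -
  have f1: "\<And>x. x \<in> \<Omega> \<Longrightarrow> GDERIV (\<lambda>x. f x - 1) x :> G x"
    using GDERIV_diff[OF f GDERIV_const[of 1]] by simp
  note c = c1_limit_cmult[OF c1_limit_add[OF c1_limit_diff[OF c1_limit_abs[OF f G] c1_limit_abs[OF f1 G]] c1_limit_const[of \<Omega> 1]], of "1/2"]
  show ?thesis
    by (rule c1_limit_cong[OF c])
      (auto simp: clamp01_def clamp01_deriv_def scaleR_diff_left[symmetric] diff_divide_distrib)
qed

section \<open>The cutoff\<close>

lemma half_space_nonzero: "X \<in> half_space \<Longrightarrow> X \<noteq> 0"
  by (auto simp: half_space_def)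

lemma GDERIV_norm_fst_sq:
  fixes X :: "(real ^ 'n) \<times> real"
  shows "GDERIV (\<lambda>X. (norm (fst X))\<^sup>2) X :> (2 *\<^sub>R fst X, 0)"
proof -
  have d: "(fst has_derivative fst) (at X)"
    by (rule bounded_linear_imp_has_derivative[OF bounded_linear_fst])
  show ?thesis
    unfolding gderiv_def power2_norm_eq_inner
    by (rule has_derivative_eq_rhs[OF has_derivative_inner[OF d d]])
      (simp add: fun_eq_iff inner_prod_def inner_commute)
qed

text \<open>A replacement for the norm that is continuously differentiable at \<open>0\<close> and agrees with it for \<open>|x| \<ge> 1 / 2\<close>. In the cutoff
  the norm of \<open>x\<close> only matters for \<open>z < \<epsilon> / 2\<close> and \<open>||x| - 1| < z\<close>.\<close>

definition smooth_norm :: "real ^ 'n \<Rightarrow> real" where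
  "smooth_norm x = sqrt ((norm x)\<^sup>2 + pos_part_sq (1 / 4 - (norm x)\<^sup>2))"

lemma smooth_norm_pos: "(norm x)\<^sup>2 + pos_part_sq (1 / 4 - (norm x)\<^sup>2) > 0"
  unfolding pos_part_sq_def by (cases "x = 0") (auto intro!: add_pos_nonneg)

lemma smooth_norm_eq: "norm x \<ge> 1 / 2 \<Longrightarrow> smooth_norm x = norm x"
proof -
  assume "norm x \<ge> 1 / 2"
  then have "(1 / 2)\<^sup>2 \<le> (norm x)\<^sup>2" by (intro power_mono) auto
  then have "pos_part_sq (1 / 4 - (norm x)\<^sup>2) = 0" by (simp add: pos_part_sq_def power_divide)
  then show ?thesis by (simp add: smooth_norm_def)
qed

lemma smooth_norm_le: "norm x < 1 / 2 \<Longrightarrow> smooth_norm x \<le> 1 / 2"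
proof -
  assume "norm x < 1 / 2"
  then have t: "(norm x)\<^sup>2 \<le> (1 / 2)\<^sup>2" by (intro power_mono) auto
  define s where "s = (norm x)\<^sup>2"
  have s: "0 \<le> s" "s \<le> 1 / 4" using t by (auto simp: s_def power_divide)
  have "s * s \<le> 1 / 4 * s" using s by (intro mult_right_mono) auto
  then have "s + pos_part_sq (1 / 4 - s) \<le> (1 / 2)\<^sup>2" using s by (simp add: pos_part_sq_def power2_eq_square algebra_simps)
  then show ?thesis unfolding smooth_norm_def s_def[symmetric] by (intro real_le_lsqrt) auto
qed

definition smooth_norm_grad :: "(real ^ 'n) \<times> real \<Rightarrow> (real ^ 'n) \<times> real" where
  "smooth_norm_grad X = ((1 - 2 * max 0 (1 / 4 - (norm (fst X))\<^sup>2)) / (2 * smooth_norm (fst X))) *\<^sub>R (2 *\<^sub>R fst X, 0)"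

lemma GDERIV_smooth_norm:
  fixes X :: "(real ^ 'n) \<times> real"
  shows "GDERIV (\<lambda>X. smooth_norm (fst X)) X :> smooth_norm_grad X"
proof -
  define t where "t = (norm (fst X))\<^sup>2"
  have p: "DERIV (\<lambda>t. t + pos_part_sq (1 / 4 - t)) t :> 1 - 2 * max 0 (1 / 4 - t)"
  proof -
    have "DERIV (\<lambda>t. pos_part_sq (1 / 4 - t)) t :> (2 * max 0 (1 / 4 - t)) * (- 1)"
      by (rule DERIV_chain2[OF DERIV_pos_part_sq]) (auto intro!: derivative_eq_intros)
    from DERIV_add[OF DERIV_ident this] show ?thesis by simp
  qed
  have "DERIV (\<lambda>t. sqrt (t + pos_part_sq (1 / 4 - t))) t :> (inverse (sqrt (t + pos_part_sq (1 / 4 - t))) / 2) * (1 - 2 * max 0 (1 / 4 - t))"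
    by (rule DERIV_chain2[OF DERIV_real_sqrt p]) (use smooth_norm_pos[of "fst X"] in \<open>simp add: t_def\<close>)
  from GDERIV_DERIV_compose[OF GDERIV_norm_fst_sq this[unfolded t_def]]
  show ?thesis unfolding smooth_norm_grad_def smooth_norm_def by (simp add: field_simps)
qed

lemma continuous_on_smooth_norm_grad: "continuous_on S (smooth_norm_grad :: (real ^ 'n) \<times> real \<Rightarrow> _)"
proof -
  have "sqrt ((norm (fst X))\<^sup>2 + pos_part_sq (1 / 4 - (norm (fst X))\<^sup>2)) \<noteq> 0" for X :: "(real ^ 'n) \<times> real"
    using smooth_norm_pos[of "fst X"] by auto
  then show ?thesis unfolding smooth_norm_grad_def smooth_norm_def
    by (intro continuous_intros) auto
qed

lemma smooth_norm_grad_norm: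
  assumes "norm (fst X) \<ge> 1 / 2" shows "norm (smooth_norm_grad X) \<le> 1"
proof -
  have "(1 / 2)\<^sup>2 \<le> (norm (fst X))\<^sup>2" using assms by (intro power_mono) auto
  then have "max 0 (1 / 4 - (norm (fst X))\<^sup>2) = 0" by (simp add: power_divide)
  moreover have "norm (fst X) > 0" using assms by linarith
  ultimately show ?thesis unfolding smooth_norm_grad_def smooth_norm_eq[OF assms] by simp
qed

text \<open>The form in which the rules for sums, products and clamps deliver the gradient, whence
  the unsimplified \<open>0 - H\<close>. With \<open>smooth_norm\<close> in place of the norm of
  \<open>x\<close> it is meaningful at \<open>x = 0\<close> too.\<close>

definition cutoff_grad :: "real \<Rightarrow> (real ^ 'n) \<times> real \<Rightarrow> (real ^ 'n) \<times> real" where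
  "cutoff_grad \<epsilon> X =
    (let e = \<epsilon> / 2; z = snd X;
         f1 = (norm X - 1 + e) / (2 * e); G1 = clamp01_deriv f1 *\<^sub>R ((1 / (2 * e)) *\<^sub>R sgn X);
         f2 = (smooth_norm (fst X) - 1 + z) / (2 * z);
         G2 = clamp01_deriv f2 *\<^sub>R ((1 / (2 * z)) *\<^sub>R smooth_norm_grad X + ((1 - smooth_norm (fst X)) / (2 * z\<^sup>2)) *\<^sub>R (0, 1));
         \<eta> = clamp01 (z / e); H = clamp01_deriv (z / e) *\<^sub>R ((1 / e) *\<^sub>R (0, 1))
     in (\<eta> *\<^sub>R G1 + clamp01 f1 *\<^sub>R H) + ((1 - \<eta>) *\<^sub>R G2 + clamp01 f2 *\<^sub>R (0 - H)))"

lemma cutoff_eq: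
  fixes X :: "(real ^ 'n) \<times> real"
  assumes \<epsilon>: "0 < \<epsilon>" "\<epsilon> < 1 / 4" and X: "X \<in> half_space"
  defines "e \<equiv> \<epsilon> / 2"
  shows "cutoff \<epsilon> X = clamp01 (snd X / e) * clamp01 ((norm X - 1 + e) / (2 * e))
      + (1 - clamp01 (snd X / e)) * clamp01 ((smooth_norm (fst X) - 1 + snd X) / (2 * snd X))"
proof -
  have e: "e > 0" "e < 1 / 8" using \<epsilon> by (auto simp: e_def)
  define z where "z = snd X"
  have z: "z > 0" unfolding z_def using half_spaceD[OF X] .
  have "0 \<le> z / e" using z e by simp
  then have eta: "min (z / e) 1 = clamp01 (z / e)" by (auto simp: clamp01_eq min_def)
  have p1: "(if norm X < 1 - e then 0 else if norm X < 1 + e then (norm X - 1 + e) / (2 * e) else 1) = clamp01 ((norm X - 1 + e) / (2 * e))"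
    using e by (auto simp: clamp01_eq field_simps)
  have p2: "(if norm (fst X) < 1 - z then 0 else if norm (fst X) < 1 + z then (norm (fst X) - 1 + z) / (2 * z) else 1) = clamp01 ((norm (fst X) - 1 + z) / (2 * z))"
    using z by (auto simp: clamp01_eq field_simps)
  \<comment> \<open>For \<open>z \<ge> e\<close> the factor \<open>1 - \<eta>\<close> vanishes; for
    \<open>z < e < 1/8\<close> and |x| < 1/2 both ramps are still 0; in the remaining case the two
    norms agree.\<close>
  have p3: "(1 - clamp01 (z / e)) * clamp01 ((norm (fst X) - 1 + z) / (2 * z)) = (1 - clamp01 (z / e)) * clamp01 ((smooth_norm (fst X) - 1 + z) / (2 * z))"
  proof (cases "z < e \<and> norm (fst X) < 1 / 2")
    case True
    then have "(norm (fst X) - 1 + z) / (2 * z) < 0" "(smooth_norm (fst X) - 1 + z) / (2 * z) < 0"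
      using e z smooth_norm_le[of "fst X"] by (auto intro!: divide_neg_pos)
    then show ?thesis by (simp add: clamp01_eq)
  next
    case False
    show ?thesis
    proof (cases "z < e")
      case True
      then show ?thesis using False smooth_norm_eq[of "fst X"] by simp
    next
      case False
      then have "1 \<le> z / e" using e by simp
      then show ?thesis by (simp add: clamp01_eq)
    qed
  qed
  show ?thesis
    unfolding cutoff_def Let_def e_def[symmetric] z_def[symmetric] eta p1 p2 p3 ..
qed

lemma cutoff_bounds:
  assumes "0 < \<epsilon>" "\<epsilon> < 1 / 4" "X \<in> half_space"
  shows "0 \<le> cutoff \<epsilon> X" "cutoff \<epsilon> X \<le> 1"
proof -
  have *: "0 \<le> t * u + (1 - t) * v \<and> t * u + (1 - t) * v \<le> 1"
    if "0 \<le> t" "t \<le> 1" "0 \<le> u" "u \<le> 1" "0 \<le> v" "v \<le> 1" for t u v :: real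
  proof -
    have "t * u \<le> t * 1" "(1 - t) * v \<le> (1 - t) * 1" using that by (intro mult_left_mono; simp)+
    moreover have "0 \<le> t * u" "0 \<le> (1 - t) * v" using that by auto
    ultimately show ?thesis by simp
  qed
  show "0 \<le> cutoff \<epsilon> X" "cutoff \<epsilon> X \<le> 1"
    unfolding cutoff_eq[OF assms] using * clamp01_bounds by blast+
qed

lemma c1_limit_cutoff:
  assumes \<epsilon>: "0 < \<epsilon>" "\<epsilon> < 1 / 4"
  shows "c1_limit half_space (cutoff \<epsilon> :: (real ^ 'n) \<times> real \<Rightarrow> real) (cutoff_grad \<epsilon>)"
proof -
  define e where "e = \<epsilon> / 2"
  have e: "e > 0" using \<epsilon> by (simp add: e_def)
  let ?H = "half_space :: ((real ^ 'n) \<times> real) set"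
  have z: "snd X \<noteq> 0" "X \<noteq> 0" if "X \<in> ?H" for X using half_spaceD[OF that] half_space_nonzero[OF that] by auto
  have 1: "c1_limit ?H (\<lambda>X. clamp01 ((norm X - 1 + e) / (2 * e))) (\<lambda>X. clamp01_deriv ((norm X - 1 + e) / (2 * e)) *\<^sub>R ((1 / (2 * e)) *\<^sub>R sgn X))"
  proof (rule c1_limit_clamp01)
    fix X assume "X \<in> ?H"
    show "GDERIV (\<lambda>X. (norm X - 1 + e) / (2 * e)) X :> (1 / (2 * e)) *\<^sub>R sgn X"
      by (rule GDERIV_DERIV_compose[OF GDERIV_norm, of X "\<lambda>t. (t - 1 + e) / (2 * e)"])
        (use z \<open>X \<in> ?H\<close> e in \<open>auto intro!: derivative_eq_intros\<close>)
  next
    show "continuous_on ?H (\<lambda>X. (1 / (2 * e)) *\<^sub>R sgn X)" using z by (intro continuous_intros) auto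
  qed
  have 2: "c1_limit ?H (\<lambda>X. clamp01 (snd X / e)) (\<lambda>X. clamp01_deriv (snd X / e) *\<^sub>R ((1 / e) *\<^sub>R (0, 1)))"
  proof (rule c1_limit_clamp01)
    fix X assume "X \<in> ?H"
    show "GDERIV (\<lambda>X. snd X / e) X :> (1 / e) *\<^sub>R (0, 1)"
      by (rule GDERIV_DERIV_compose[OF GDERIV_snd, of "\<lambda>t. t / e"]) (use e in \<open>auto intro!: derivative_eq_intros\<close>)
  qed (intro continuous_intros)
  have 3: "c1_limit ?H (\<lambda>X. clamp01 ((smooth_norm (fst X) - 1 + snd X) / (2 * snd X)))
    (\<lambda>X. clamp01_deriv ((smooth_norm (fst X) - 1 + snd X) / (2 * snd X)) *\<^sub>R
       ((1 / (2 * snd X)) *\<^sub>R smooth_norm_grad X + ((1 - smooth_norm (fst X)) / (2 * (snd X)\<^sup>2)) *\<^sub>R (0, 1)))"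
  proof (rule c1_limit_clamp01)
    fix X assume X: "X \<in> ?H"
    have i: "GDERIV (\<lambda>X. 1 / (2 * snd X)) X :> (- 1 / (2 * (snd X)\<^sup>2)) *\<^sub>R (0, 1)"
      by (rule GDERIV_DERIV_compose[OF GDERIV_snd, of "\<lambda>t. 1 / (2 * t)"])
        (use z[OF X] in \<open>auto intro!: derivative_eq_intros simp: power2_eq_square\<close>)
    have "GDERIV (\<lambda>X. smooth_norm (fst X) - 1 + snd X) X :> (smooth_norm_grad X - 0) + (0, 1)"
      by (intro GDERIV_add GDERIV_diff GDERIV_smooth_norm GDERIV_const GDERIV_snd)
    from GDERIV_mult[OF this i]
    have g: "GDERIV (\<lambda>X. (smooth_norm (fst X) - 1 + snd X) / (2 * snd X)) X :>
       (smooth_norm (fst X) - 1 + snd X) *\<^sub>R ((- 1 / (2 * (snd X)\<^sup>2)) *\<^sub>R (0, 1)) + (1 / (2 * snd X)) *\<^sub>R ((smooth_norm_grad X - 0) + (0, 1))"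
      by simp
    have "(smooth_norm (fst X) - 1 + snd X) * (- 1 / (2 * (snd X)\<^sup>2)) + 1 / (2 * snd X) = (1 - smooth_norm (fst X)) / (2 * (snd X)\<^sup>2)"
      using z[OF X] by (simp add: field_simps power2_eq_square)
    then show "GDERIV (\<lambda>X. (smooth_norm (fst X) - 1 + snd X) / (2 * snd X)) X :>
       (1 / (2 * snd X)) *\<^sub>R smooth_norm_grad X + ((1 - smooth_norm (fst X)) / (2 * (snd X)\<^sup>2)) *\<^sub>R (0, 1)"
      by (intro GDERIV_subst[OF g]) (simp add: scaleR_add_right scaleR_add_left[symmetric] prod_eq_iff)
  next
    have "continuous_on ?H (\<lambda>X. smooth_norm (fst X))"
      by (rule GDERIV_imp_continuous_on[OF GDERIV_smooth_norm])
    then show "continuous_on ?H (\<lambda>X. (1 / (2 * snd X)) *\<^sub>R smooth_norm_grad X + ((1 - smooth_norm (fst X)) / (2 * (snd X)\<^sup>2)) *\<^sub>R (0, 1))"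
      using z by (intro continuous_intros continuous_on_smooth_norm_grad) auto
  qed
  have 4: "c1_limit ?H (\<lambda>X. 1 - clamp01 (snd X / e)) (\<lambda>X. 0 - clamp01_deriv (snd X / e) *\<^sub>R ((1 / e) *\<^sub>R (0, 1)))"
    by (rule c1_limit_diff[OF c1_limit_const 2])
  show ?thesis
    by (rule c1_limit_cong[OF c1_limit_add[OF c1_limit_mult[OF 2 1] c1_limit_mult[OF 4 3]]])
      (simp_all add: cutoff_eq[OF \<epsilon>] cutoff_grad_def Let_def e_def)
qed

text \<open>The first ramp and the two terms with the gradient of \<eta> contribute
  \<open>1 / \<epsilon> + 2 / \<epsilon> + 2 / \<epsilon>\<close>. The second ramp has slope at most
  \<open>1 / (2 z)\<close> horizontally and \<open>||x| - 1| / (2 z^2)\<close> vertically, hence at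
  most \<open>1 / z\<close> where \<open>||x| - 1| \<le> z\<close>, and it is switched off from the
  height \<open>\<epsilon> / 2\<close> on.\<close>

lemma cutoff_grad_bound:
  fixes X :: "(real ^ 'n) \<times> real"
  assumes \<epsilon>: "0 < \<epsilon>" "\<epsilon> < 1 / 4" and X: "X \<in> half_space"
  shows "norm (cutoff_grad \<epsilon> X) \<le> 5 / \<epsilon> + (if \<bar>norm (fst X) - 1\<bar> \<le> snd X \<and> snd X < 1 then 1 / snd X else 0)"
proof -
  define e where "e = \<epsilon> / 2"
  have e: "e > 0" "e < 1 / 8" using \<epsilon> by (auto simp: e_def)
  define z where "z = snd X"
  have z: "z > 0" unfolding z_def using half_spaceD[OF X] .
  define f1 where "f1 = (norm X - 1 + e) / (2 * e)"
  define G1 where "G1 = clamp01_deriv f1 *\<^sub>R ((1 / (2 * e)) *\<^sub>R sgn X)"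
  define f2 where "f2 = (smooth_norm (fst X) - 1 + z) / (2 * z)"
  define G2 where "G2 = clamp01_deriv f2 *\<^sub>R ((1 / (2 * z)) *\<^sub>R smooth_norm_grad X + ((1 - smooth_norm (fst X)) / (2 * z\<^sup>2)) *\<^sub>R (0, 1))"
  define \<eta> where "\<eta> = clamp01 (z / e)"
  define H where "H = clamp01_deriv (z / e) *\<^sub>R ((1 / e) *\<^sub>R (0 :: real ^ 'n, 1 :: real))"
  have \<eta>: "0 \<le> \<eta>" "\<eta> \<le> 1" unfolding \<eta>_def by (rule clamp01_bounds)+
  have n1: "norm G1 \<le> 1 / (2 * e)"
  proof -
    have "norm G1 = \<bar>clamp01_deriv f1\<bar> * (1 / (2 * e) * norm (sgn X))" unfolding G1_def using e by simp
    also have "\<dots> \<le> 1 * (1 / (2 * e) * 1)"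
      using e clamp01_deriv_bound by (intro mult_mono mult_left_mono) (auto simp: norm_sgn)
    finally show ?thesis by simp
  qed
  have nH: "norm H \<le> 1 / e"
  proof -
    have "norm H = \<bar>clamp01_deriv (z / e)\<bar> * (1 / e)" unfolding H_def norm_scaleR using e by simp
    also have "\<dots> \<le> 1 * (1 / e)" using e clamp01_deriv_bound by (intro mult_right_mono) auto
    finally show ?thesis by simp
  qed
  have n2: "norm ((1 - \<eta>) *\<^sub>R G2) \<le> (if \<bar>norm (fst X) - 1\<bar> \<le> z \<and> z < 1 then 1 / z else 0)"
  proof (cases "z < e")
    case False
    then have "1 \<le> z / e" using e by simp
    then have "\<eta> = 1" by (simp add: \<eta>_def clamp01_eq)
    then show ?thesis using z by simp
  next
    case True
    show ?thesis
    proof (cases "f2 < 0 \<or> f2 > 1")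
      case True
      then show ?thesis using z by (simp add: G2_def clamp01_deriv_0)
    next
      case False
      have x: "norm (fst X) \<ge> 1 / 2"
      proof (rule ccontr)
        assume "\<not> norm (fst X) \<ge> 1 / 2"
        then have "f2 < 0" unfolding f2_def using smooth_norm_le[of "fst X"] \<open>z < e\<close> e z by (intro divide_neg_pos) auto
        then show False using False by simp
      qed
      have "0 \<le> f2" "f2 \<le> 1" using False by auto
      then have a: "\<bar>norm (fst X) - 1\<bar> \<le> z"
        using z unfolding f2_def smooth_norm_eq[OF x] by (auto simp: field_simps abs_le_iff)
      have "norm ((1 / (2 * z)) *\<^sub>R smooth_norm_grad X + ((1 - smooth_norm (fst X)) / (2 * z\<^sup>2)) *\<^sub>R (0 :: real ^ 'n, 1 :: real))
        \<le> norm ((1 / (2 * z)) *\<^sub>R smooth_norm_grad X) + norm (((1 - smooth_norm (fst X)) / (2 * z\<^sup>2)) *\<^sub>R (0 :: real ^ 'n, 1 :: real))"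
        by (rule norm_triangle_ineq)
      also have "\<dots> = 1 / (2 * z) * norm (smooth_norm_grad X) + \<bar>1 - norm (fst X)\<bar> / (2 * z\<^sup>2)"
        using z unfolding norm_scaleR smooth_norm_eq[OF x] by (simp add: abs_divide)
      also have "\<dots> \<le> 1 / (2 * z) * 1 + z / (2 * z\<^sup>2)"
        using z a smooth_norm_grad_norm[OF x] by (intro add_mono mult_left_mono divide_right_mono) (auto simp: abs_minus_commute)
      also have "\<dots> = 1 / z" using z by (simp add: power2_eq_square)
      finally have b: "norm ((1 / (2 * z)) *\<^sub>R smooth_norm_grad X + ((1 - smooth_norm (fst X)) / (2 * z\<^sup>2)) *\<^sub>R (0 :: real ^ 'n, 1 :: real)) \<le> 1 / z" .
      have "norm G2 \<le> 1 * (1 / z)"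
        unfolding G2_def norm_scaleR[of "clamp01_deriv f2"] using z b clamp01_deriv_bound[of f2] by (intro mult_mono) auto
      then have "\<bar>1 - \<eta>\<bar> * norm G2 \<le> 1 * (1 / z)" using \<eta> z by (intro mult_mono) auto
      then show ?thesis using a \<open>z < e\<close> e by simp
    qed
  qed
  have "cutoff_grad \<epsilon> X = (\<eta> *\<^sub>R G1 + clamp01 f1 *\<^sub>R H) + ((1 - \<eta>) *\<^sub>R G2 + clamp01 f2 *\<^sub>R (0 - H))"
    unfolding cutoff_grad_def Let_def e_def f1_def G1_def f2_def G2_def \<eta>_def H_def z_def by simp
  also have "norm \<dots> \<le> (norm (\<eta> *\<^sub>R G1) + norm (clamp01 f1 *\<^sub>R H)) + (norm ((1 - \<eta>) *\<^sub>R G2) + norm (clamp01 f2 *\<^sub>R (0 - H)))"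
    by (intro norm_triangle_mono norm_triangle_ineq)
  also have "\<dots> \<le> (1 / (2 * e) + 1 / e) + (norm ((1 - \<eta>) *\<^sub>R G2) + 1 / e)"
  proof (intro add_mono order_refl)
    have "\<bar>\<eta>\<bar> * norm G1 \<le> 1 * (1 / (2 * e))" using \<eta> n1 by (intro mult_mono) auto
    then show "norm (\<eta> *\<^sub>R G1) \<le> 1 / (2 * e)" by simp
    have "\<bar>clamp01 f\<bar> * norm H \<le> 1 * (1 / e)" for f using clamp01_bounds[of f] nH by (intro mult_mono) auto
    then show "norm (clamp01 f1 *\<^sub>R H) \<le> 1 / e" "norm (clamp01 f2 *\<^sub>R (0 - H)) \<le> 1 / e" by simp_all
  qed
  finally have "norm (cutoff_grad \<epsilon> X) \<le> (1 / (2 * e) + 1 / e) + (norm ((1 - \<eta>) *\<^sub>R G2) + 1 / e)" .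
  moreover have "1 / (2 * e) + 1 / e + 1 / e = 5 / \<epsilon>" using \<epsilon> by (simp add: e_def)
  ultimately show ?thesis using n2 unfolding z_def by linarith
qed

text \<open>The difference \<open>(1 + z)^n - (1 - z)^n\<close> is of first order in
  \<open>z\<close>, by induction on \<open>n\<close>. This single power of \<open>z\<close> is what
  makes the squared gradient of the cutoff integrable.\<close>

lemma shell_volume:
  assumes z: "0 < z" "z < 1"
  shows "emeasure lborel {x :: 'a::euclidean_space. \<bar>norm x - 1\<bar> \<le> z} \<le> ennreal (unit_ball_vol (real DIM('a)) * (2 * 2 ^ DIM('a)) * z)"
proof -
  have p: "(1 + z) ^ n - (1 - z) ^ n \<le> 2 * 2 ^ n * z" for n
  proof (induction n)
    case (Suc n)
    have a: "(1 + z) ^ n \<le> 2 ^ n" "(1 - z) ^ n \<le> 1"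
      using z by (auto intro!: power_mono power_le_one)
    have a2: "(1 - z) ^ n \<le> 2 ^ n" using a(2) one_le_power[of "2 :: real" n] by linarith
    have "(1 + z) ^ Suc n - (1 - z) ^ Suc n = ((1 + z) ^ n - (1 - z) ^ n) + z * ((1 + z) ^ n + (1 - z) ^ n)"
      by (simp add: algebra_simps)
    also have "\<dots> \<le> 2 * 2 ^ n * z + z * (2 ^ n + 2 ^ n)"
      using a(1) a2 z Suc.IH by (intro add_mono mult_left_mono) auto
    finally show ?case by (simp add: algebra_simps)
  qed (use z in simp)
  define V where "V = unit_ball_vol (real DIM('a))"
  have V: "V \<ge> 0" unfolding V_def by simp
  have "{x :: 'a. \<bar>norm x - 1\<bar> \<le> z} = cball 0 (1 + z) - ball 0 (1 - z)" by (auto simp: abs_le_iff)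
  moreover have "emeasure lborel (cball (0 :: 'a) (1 + z) - ball 0 (1 - z)) = emeasure lborel (cball (0 :: 'a) (1 + z)) - emeasure lborel (ball (0 :: 'a) (1 - z))"
    by (rule emeasure_Diff) (use z in \<open>auto simp: emeasure_ball\<close>)
  ultimately have "emeasure lborel {x :: 'a. \<bar>norm x - 1\<bar> \<le> z} = emeasure lborel (cball (0 :: 'a) (1 + z)) - emeasure lborel (ball (0 :: 'a) (1 - z))"
    by simp
  also have "\<dots> = ennreal (V * (1 + z) ^ DIM('a)) - ennreal (V * (1 - z) ^ DIM('a))"
    using z by (simp add: emeasure_ball emeasure_cball V_def)
  also have "\<dots> = ennreal (V * ((1 + z) ^ DIM('a) - (1 - z) ^ DIM('a)))"
    using z V by (simp add: ennreal_minus right_diff_distrib)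
  also have "\<dots> \<le> ennreal (V * (2 * 2 ^ DIM('a) * z))" using p V by (intro ennreal_leI mult_left_mono) auto
  finally show ?thesis unfolding V_def by (simp add: mult.assoc)
qed

text \<open>The singular part is \<open>z powr (1 - \<sigma>) / z^2\<close> on a shell of volume
  \<open>O(z)\<close>, in total \<open>z powr (- \<sigma>)\<close>, which is integrable at 0 because
  \<open>\<sigma> < 1\<close>. To use the volume, the integration in \<open>x\<close> is the inner
  one.\<close>

lemma cutoff_grad_energy_finite:
  assumes \<epsilon>: "0 < \<epsilon>" "\<epsilon> < 1 / 4" and \<sigma>: "0 < \<sigma>" "\<sigma> < 1" and r: "r \<le> 2"
  shows "(\<integral>\<^sup>+ X. indicator (half_ball r :: ((real ^ 'n) \<times> real) set) X * ennreal (snd X powr (1 - \<sigma>) * (norm (cutoff_grad \<epsilon> X))\<^sup>2) \<partial>lborel) < \<infinity>"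
proof -
  define c1 where "c1 = 2 * (5 / \<epsilon>)\<^sup>2"
  have c1: "c1 \<ge> 0" unfolding c1_def by simp
  define B where "B = (indicator (ball 0 2) :: real ^ 'n \<Rightarrow> ennreal)"
  have [measurable]: "B \<in> borel_measurable borel" unfolding B_def by (rule borel_measurable_indicator) simp
  have IB: "(\<integral>\<^sup>+ x. B x \<partial>lborel) = emeasure lborel (ball (0 :: real ^ 'n) 2)" unfolding B_def by simp
  define G where "G x z = B x * (ennreal c1 * (ennreal (z powr (1 - \<sigma>)) * indicator {0..2} z))
      + (2 * (ennreal (z powr (- 1 - \<sigma>)) * indicator {0<..<1} z)) * indicator {x. \<bar>norm x - 1\<bar> \<le> z} x" for x :: "real ^ 'n" and z :: real
  have le: "indicator (half_ball r) X * ennreal (snd X powr (1 - \<sigma>) * (norm (cutoff_grad \<epsilon> X))\<^sup>2) \<le> G (fst X) (snd X)" for X :: "(real ^ 'n) \<times> real"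
  proof (cases "X \<in> half_ball r")
    case True
    note h = half_ball_subset_cylinder[OF r True]
    define z where "z = snd X"
    have z: "z > 0" "z \<le> 2" using h by (auto simp: z_def)
    define q where "q = (if \<bar>norm (fst X) - 1\<bar> \<le> z \<and> z < 1 then 1 / z else 0)"
    have q0: "q \<ge> 0" using z by (simp add: q_def)
    have "norm (cutoff_grad \<epsilon> X) \<le> 5 / \<epsilon> + q" using cutoff_grad_bound[OF \<epsilon>, of X] h unfolding q_def z_def by simp
    then have "(norm (cutoff_grad \<epsilon> X))\<^sup>2 \<le> (5 / \<epsilon> + q)\<^sup>2" by (intro power_mono) auto
    also have "\<dots> \<le> c1 + 2 * q\<^sup>2"
      unfolding c1_def using zero_le_power2[of "5 / \<epsilon> - q"] by (simp add: power2_eq_square algebra_simps)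
    finally have "z powr (1 - \<sigma>) * (norm (cutoff_grad \<epsilon> X))\<^sup>2 \<le> z powr (1 - \<sigma>) * (c1 + 2 * q\<^sup>2)"
      by (intro mult_left_mono) auto
    then have "ennreal (z powr (1 - \<sigma>) * (norm (cutoff_grad \<epsilon> X))\<^sup>2) \<le> ennreal (c1 * z powr (1 - \<sigma>) + 2 * (z powr (1 - \<sigma>) * q\<^sup>2))"
      by (intro ennreal_leI) (simp add: algebra_simps)
    also have "\<dots> = ennreal c1 * ennreal (z powr (1 - \<sigma>)) + 2 * ennreal (z powr (1 - \<sigma>) * q\<^sup>2)"
      using c1 q0 by (simp add: ennreal_mult')
    also have "\<dots> \<le> G (fst X) z"
    proof (cases "\<bar>norm (fst X) - 1\<bar> \<le> z \<and> z < 1")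
      case True
      have "z powr (1 - \<sigma>) = z powr (- 1 - \<sigma>) * z\<^sup>2" using z powr_add[of z "- 1 - \<sigma>" 2] by simp
      then have "z powr (1 - \<sigma>) * q\<^sup>2 = z powr (- 1 - \<sigma>)" using True z unfolding q_def by (simp add: power_divide)
      then show ?thesis using True h z unfolding G_def B_def z_def by simp
    next
      case False
      then have "q = 0" unfolding q_def by (rule if_not_P)
      then show ?thesis using h z unfolding G_def B_def z_def by simp
    qed
    finally show ?thesis using True unfolding z_def by simp
  qed simp
  have S: "{p :: (real ^ 'n) \<times> real. \<bar>norm (fst p) - 1\<bar> \<le> snd p} \<in> sets borel"
    by (intro borel_closed closed_Collect_le continuous_intros)
  have Gm: "(\<lambda>X. G (fst X) (snd X)) \<in> borel_measurable borel"
  proof -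
    have i: "(\<lambda>X. indicator {x :: real ^ 'n. \<bar>norm x - 1\<bar> \<le> snd X} (fst X)) = (indicator {p. \<bar>norm (fst p) - 1\<bar> \<le> snd p} :: _ \<Rightarrow> ennreal)"
      by (auto simp: fun_eq_iff indicator_def)
    have m1: "(\<lambda>X :: (real ^ 'n) \<times> real. B (fst X) * (ennreal c1 * (ennreal (snd X powr (1 - \<sigma>)) * indicator {0..2} (snd X)))) \<in> borel_measurable borel"
      unfolding borel_prod[symmetric] by measurable
    have m2: "(\<lambda>X :: (real ^ 'n) \<times> real. 2 * (ennreal (snd X powr (- 1 - \<sigma>)) * indicator {0<..<1} (snd X))) \<in> borel_measurable borel"
      unfolding borel_prod[symmetric] by measurable
    have m3: "(\<lambda>X. indicator {x :: real ^ 'n. \<bar>norm x - 1\<bar> \<le> snd X} (fst X) :: ennreal) \<in> borel_measurable borel"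
      unfolding i using S by simp
    show ?thesis unfolding G_def
      by (rule borel_measurable_add[OF m1 borel_measurable_times_ennreal[OF m2 m3]])
  qed
  define W where "W = unit_ball_vol (real DIM(real ^ 'n)) * (2 * 2 ^ DIM(real ^ 'n))"
  have W: "W \<ge> 0" unfolding W_def by simp
  have z1: "(\<integral>\<^sup>+ z. ennreal (z powr e) * indicator {0..2} z \<partial>lborel) < \<infinity>" if "e > -1" for e
    using nn_integral_has_integral_lebesgue'[OF _ has_integral_powr_from_0[of e 2]] that by simp
  have Sz: "{x :: real ^ 'n. \<bar>norm x - 1\<bar> \<le> z} \<in> sets borel" for z
    by (intro borel_closed closed_Collect_le continuous_intros)
  have "(\<integral>\<^sup>+ X. indicator (half_ball r :: ((real ^ 'n) \<times> real) set) X * ennreal (snd X powr (1 - \<sigma>) * (norm (cutoff_grad \<epsilon> X))\<^sup>2) \<partial>lborel)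
     \<le> (\<integral>\<^sup>+ X. G (fst X) (snd X) \<partial>lborel)" by (intro nn_integral_mono le)
  also have "\<dots> = (\<integral>\<^sup>+ p. G (fst p) (snd p) \<partial>(lborel \<Otimes>\<^sub>M lborel))" by (simp add: lborel_prod)
  also have "\<dots> = (\<integral>\<^sup>+ z. \<integral>\<^sup>+ x. G x z \<partial>lborel \<partial>lborel)"
    using lborel_pair.nn_integral_snd[of "\<lambda>X. G (fst X) (snd X)"] Gm by (simp add: lborel_prod)
  also have "\<dots> \<le> (\<integral>\<^sup>+ z. emeasure lborel (ball (0 :: real ^ 'n) 2) * (ennreal c1 * (ennreal (z powr (1 - \<sigma>)) * indicator {0..2} z))
      + ennreal (2 * W) * (ennreal (z powr (- \<sigma>)) * indicator {0..2} z) \<partial>lborel)"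
  proof (rule nn_integral_mono)
    fix z :: real
    have "(\<integral>\<^sup>+ x. G x z \<partial>lborel) = emeasure lborel (ball (0 :: real ^ 'n) 2) * (ennreal c1 * (ennreal (z powr (1 - \<sigma>)) * indicator {0..2} z))
        + (2 * (ennreal (z powr (- 1 - \<sigma>)) * indicator {0<..<1} z)) * emeasure lborel {x :: real ^ 'n. \<bar>norm x - 1\<bar> \<le> z}"
      unfolding G_def using Sz
      by (subst nn_integral_add) (auto simp: IB nn_integral_multc nn_integral_cmult nn_integral_cmult_indicator intro!: borel_measurable_times_ennreal)
    also have "(2 * (ennreal (z powr (- 1 - \<sigma>)) * indicator {0<..<1} z)) * emeasure lborel {x :: real ^ 'n. \<bar>norm x - 1\<bar> \<le> z}
        \<le> ennreal (2 * W) * (ennreal (z powr (- \<sigma>)) * indicator {0..2} z)"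
    proof (cases "0 < z \<and> z < 1")
      case True
      have "(2 * ennreal (z powr (- 1 - \<sigma>))) * emeasure lborel {x :: real ^ 'n. \<bar>norm x - 1\<bar> \<le> z} \<le> (2 * ennreal (z powr (- 1 - \<sigma>))) * ennreal (W * z)"
        unfolding W_def using True by (intro mult_left_mono shell_volume) auto
      also have "\<dots> = ennreal (2 * z powr (- 1 - \<sigma>) * (W * z))" using True W by (simp add: ennreal_mult')
      also have "2 * z powr (- 1 - \<sigma>) * (W * z) = 2 * W * (z powr (- 1 - \<sigma>) * z powr 1)" using True by simp
      also have "\<dots> = 2 * W * z powr (- \<sigma>)" by (simp only: powr_add[symmetric]) simp
      also have "ennreal \<dots> = ennreal (2 * W) * ennreal (z powr (- \<sigma>))" using W by (simp add: ennreal_mult')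
      finally show ?thesis using True by simp
    qed auto
    finally show "(\<integral>\<^sup>+ x. G x z \<partial>lborel) \<le> emeasure lborel (ball (0 :: real ^ 'n) 2) * (ennreal c1 * (ennreal (z powr (1 - \<sigma>)) * indicator {0..2} z))
      + ennreal (2 * W) * (ennreal (z powr (- \<sigma>)) * indicator {0..2} z)" by (simp add: add_left_mono)
  qed
  also have "\<dots> = emeasure lborel (ball (0 :: real ^ 'n) 2) * (ennreal c1 * (\<integral>\<^sup>+ z. ennreal (z powr (1 - \<sigma>)) * indicator {0..2} z \<partial>lborel))
      + ennreal (2 * W) * (\<integral>\<^sup>+ z. ennreal (z powr (- \<sigma>)) * indicator {0..2} z \<partial>lborel)"
    by (subst nn_integral_add) (auto simp: nn_integral_cmult)
  also have "\<dots> < \<infinity>"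
    using z1[of "1 - \<sigma>"] z1[of "- \<sigma>"] \<sigma> by (simp add: ennreal_mult_less_top emeasure_ball)
  finally show ?thesis .
qed

text \<open>Building the cutoff with \<open>e = \<epsilon> / 2\<close> leaves the room needed near
  the boundary: for |X| \<ge> 1 + \<epsilon> and \<open>z < e\<close> one has |x| \<ge> 1 + z, since
  otherwise \<open>(1 + 2 e)^2 < (1 + e)^2 + e^2\<close>. Similarly, for |X| < 1 - \<epsilon> the
  second ramp can be nonzero only at heights where its coefficient \<open>1 - \<eta>\<close> is
  0.\<close>

lemma cutoff_values:
  fixes X :: "(real ^ 'n) \<times> real"
  assumes \<epsilon>: "0 < \<epsilon>" "\<epsilon> < 1 / 4" and X: "X \<in> half_space"
  shows "norm X < 1 - \<epsilon> \<Longrightarrow> cutoff \<epsilon> X = 0" "norm X \<ge> 1 + \<epsilon> \<Longrightarrow> cutoff \<epsilon> X = 1"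
proof -
  define e where "e = \<epsilon> / 2"
  have e: "e > 0" "e < 1 / 8" "\<epsilon> = 2 * e" using \<epsilon> by (auto simp: e_def)
  define z where "z = snd X"
  have z: "z > 0" unfolding z_def using half_spaceD[OF X] .
  have nX: "(norm X)\<^sup>2 = (norm (fst X))\<^sup>2 + z\<^sup>2" unfolding z_def by (cases X) (simp add: norm_Pair)
  have fX: "norm (fst X) \<le> norm X" using norm_fst_le[of "fst X" "snd X"] by simp
  show "cutoff \<epsilon> X = 0" if n: "norm X < 1 - \<epsilon>"
  proof -
    have "min (z / e) 1 = 1" if "\<not> norm (fst X) < 1 - z" using that n fX e by (auto simp: min_def field_simps)
    then show ?thesis using n e unfolding cutoff_def Let_def e_def[symmetric] z_def[symmetric] by auto
  qed
  show "cutoff \<epsilon> X = 1" if n: "norm X \<ge> 1 + \<epsilon>"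
  proof -
    have c: "min (z / e) 1 = 1" if "norm (fst X) < 1 + z"
    proof (rule ccontr)
      assume "min (z / e) 1 \<noteq> 1"
      then have "\<not> 1 \<le> z / e" using min_absorb2[of 1 "z / e"] by blast
      then have ze: "z < e" using e by simp
      have "(norm (fst X))\<^sup>2 < (1 + z)\<^sup>2" using that by (intro power_strict_mono) auto
      moreover have "(1 + 2 * e)\<^sup>2 \<le> (norm X)\<^sup>2" using n e by (intro power_mono) auto
      ultimately have "(1 + 2 * e)\<^sup>2 < (1 + z)\<^sup>2 + z\<^sup>2" using nX by linarith
      moreover have "(1 + z)\<^sup>2 \<le> (1 + e)\<^sup>2" "z\<^sup>2 \<le> e\<^sup>2" using z ze by (auto intro!: power_mono)
      ultimately have "(1 + 2 * e)\<^sup>2 < (1 + e)\<^sup>2 + e\<^sup>2" by linarith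
      moreover have "0 \<le> e * e" by simp
      ultimately show False using e by (simp add: power2_eq_square algebra_simps)
    qed
    show ?thesis
    proof (cases "norm (fst X) < 1 + z")
      case True
      then show ?thesis using n e c unfolding cutoff_def Let_def e_def[symmetric] z_def[symmetric] by auto
    next
      case False
      then show ?thesis using n e z unfolding cutoff_def Let_def e_def[symmetric] z_def[symmetric] by auto
    qed
  qed
qed

section \<open>The common part of two functions\<close>

text \<open>At the origin \<open>common_part 0\<close> is \<open>0\<close> by division by zero; a positive \<open>d\<close> makes the function
  continuously differentiable. The factor \<open>2\<close> gives the value \<open>t\<close> on the diagonal.\<close>

definition common_part :: "real \<Rightarrow> real \<Rightarrow> real \<Rightarrow> real" where
  "common_part d a b = 2 * (a + b) * (max 0 (a * b))\<^sup>2 / (a\<^sup>2 + b\<^sup>2 + d)\<^sup>2"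

text \<open>The derivative in the first argument; by symmetry of the common part, exchanging
  \<open>a\<close> and \<open>b\<close> gives the one in the second.\<close>

definition common_part_deriv :: "real \<Rightarrow> real \<Rightarrow> real \<Rightarrow> real" where
  "common_part_deriv d a b =
     (let c = max 0 (a * b); S = a\<^sup>2 + b\<^sup>2 + d
      in 2 * c\<^sup>2 / S\<^sup>2 + 4 * (a + b) * c * b / S\<^sup>2 - 8 * (a + b) * c\<^sup>2 * a / S ^ 3)"

lemma common_part_commute: "common_part d a b = common_part d b a"
  by (simp add: common_part_def mult.commute add.commute)

lemma max_mult_le: "max 0 (a * b) \<le> (a\<^sup>2 + b\<^sup>2) / 2" for a b :: real
  using sum_squares_bound[of a b] by (simp add: max_def)

text \<open>The derivative is a polynomial in the quotients \<open>A\<close>, \<open>B\<close> and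
  \<open>C\<close>, which are bounded independently of \<open>d\<close>. With
  \<open>0 \<le> A \<le> 1/2\<close> and \<open>|B|, |C| \<le> 2\<close> the three terms are at most
  \<open>1/2\<close>, 4 and 4.\<close>

lemma common_part_deriv_bound:
  assumes d: "d \<ge> 0" shows "\<bar>common_part_deriv d a b\<bar> \<le> 9"
proof -
  define c where "c = max 0 (a * b)"
  define S where "S = a\<^sup>2 + b\<^sup>2 + d"
  show ?thesis
  proof (cases "S = 0")
    case True
    then show ?thesis unfolding common_part_deriv_def Let_def S_def[symmetric] by simp
  next
    case False
    then have S: "S > 0" unfolding S_def using d by (simp add: add_nonneg_nonneg less_le)
    have c: "0 \<le> c" "c \<le> S / 2" using max_mult_le[of a b] d unfolding c_def S_def by auto
    define A where "A = c / S"
    define B where "B = (a + b) * b / S"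
    define C where "C = (a + b) * a / S"
    have A: "0 \<le> A" "A \<le> 1 / 2" using c S by (auto simp: A_def field_simps)
    have q: "\<bar>(x + y) * y\<bar> \<le> 2 * (x\<^sup>2 + y\<^sup>2)" for x y :: real
    proof -
      have "2 * (\<bar>x\<bar> * \<bar>y\<bar>) \<le> x\<^sup>2 + y\<^sup>2" using sum_squares_bound[of "\<bar>x\<bar>" "\<bar>y\<bar>"] by simp
      moreover have "0 \<le> \<bar>x\<bar> * \<bar>y\<bar>" by simp
      ultimately have "\<bar>x\<bar> * \<bar>y\<bar> \<le> x\<^sup>2 + y\<^sup>2" by linarith
      moreover have "\<bar>(x + y) * y\<bar> \<le> \<bar>x\<bar> * \<bar>y\<bar> + y\<^sup>2"
        using abs_triangle_ineq[of "x * y" "y\<^sup>2"] by (simp add: power2_eq_square distrib_right abs_mult)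
      moreover have "0 \<le> x\<^sup>2" by simp
      ultimately show ?thesis by (simp only: distrib_left)
    qed
    have B: "\<bar>B\<bar> \<le> 2"
      using q[of a b] S d unfolding B_def S_def by (simp add: abs_divide divide_le_eq)
    have C: "\<bar>C\<bar> \<le> 2"
      using q[of b a] S d unfolding C_def S_def by (simp add: abs_divide divide_le_eq add.commute)
    have e: "common_part_deriv d a b = 2 * A\<^sup>2 + 4 * (A * B) - 8 * (A\<^sup>2 * C)"
      unfolding common_part_deriv_def Let_def c_def[symmetric] S_def[symmetric] A_def B_def C_def
      using S by (simp add: field_simps power2_eq_square power3_eq_cube)
    have A2: "0 \<le> A\<^sup>2" "A\<^sup>2 \<le> (1 / 2)\<^sup>2" using A by (auto intro!: power_mono)
    have A2': "A\<^sup>2 \<le> 1 / 4" using A2 by (simp add: power_divide)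
    have AB: "\<bar>A * B\<bar> \<le> 1 / 2 * 2" unfolding abs_mult using A B by (intro mult_mono) auto
    have AC: "\<bar>A\<^sup>2 * C\<bar> \<le> 1 / 4 * 2" unfolding abs_mult using A2 A2' C by (intro mult_mono) auto
    show ?thesis unfolding e using A2(1) A2' AB AC by linarith
  qed
qed

lemma common_part_bound:
  assumes d: "d \<ge> 0" shows "\<bar>common_part d a b\<bar> \<le> \<bar>a\<bar> + \<bar>b\<bar>"
proof -
  define c where "c = max 0 (a * b)"
  define S where "S = a\<^sup>2 + b\<^sup>2 + d"
  have S: "S \<ge> 0" unfolding S_def using d by simp
  have c: "0 \<le> c" "c \<le> S / 2" using max_mult_le[of a b] d unfolding c_def S_def by auto
  have "c / S \<le> 1 / 2" using c S by (cases "S = 0") (auto simp: field_simps)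
  then have "(c / S)\<^sup>2 \<le> (1 / 2)\<^sup>2" using c S by (intro power_mono) auto
  moreover have "(1 / 2 :: real)\<^sup>2 = 1 / 4" by (simp add: power2_eq_square)
  ultimately have "2 * (c / S)\<^sup>2 \<le> 1" by linarith
  then have "\<bar>a + b\<bar> * (2 * (c / S)\<^sup>2) \<le> \<bar>a + b\<bar> * 1" by (intro mult_left_mono) auto
  moreover have "common_part d a b = (a + b) * (2 * (c / S)\<^sup>2)"
    unfolding common_part_def c_def S_def by (simp add: power_divide)
  ultimately show ?thesis by (simp add: abs_mult)
qed

lemma GDERIV_common_part:
  fixes f g :: "'a::real_inner \<Rightarrow> real"
  assumes f: "GDERIV f x :> G" and g: "GDERIV g x :> H" and d: "d > 0"
  shows "GDERIV (\<lambda>x. common_part d (f x) (g x)) x :>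
     common_part_deriv d (f x) (g x) *\<^sub>R G + common_part_deriv d (g x) (f x) *\<^sub>R H"
proof -
  define a b where "a = f x" and "b = g x"
  define S where "S = a\<^sup>2 + b\<^sup>2 + d"
  have S: "S > 0" unfolding S_def using d by (simp add: add_nonneg_pos)
  define c where "c = max 0 (a * b)"
  have p: "GDERIV (\<lambda>x. pos_part_sq (f x * g x)) x :> (2 * c) *\<^sub>R (a *\<^sub>R H + b *\<^sub>R G)"
    unfolding a_def b_def c_def by (rule GDERIV_DERIV_compose[OF GDERIV_mult[OF f g] DERIV_pos_part_sq])
  have s: "GDERIV (\<lambda>x. 2 * (f x + g x)) x :> 2 *\<^sub>R (G + H)"
    using GDERIV_mult[OF GDERIV_const[of 2] GDERIV_add[OF f g]] by simp
  have sq: "GDERIV (\<lambda>x. (u x)\<^sup>2) x :> (2 * u x) *\<^sub>R U" if "GDERIV u x :> U" for u U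
    by (rule GDERIV_DERIV_compose[OF that]) (auto intro!: derivative_eq_intros)
  have SS: "GDERIV (\<lambda>x. (f x)\<^sup>2 + (g x)\<^sup>2 + d) x :> ((2 * a) *\<^sub>R G + (2 * b) *\<^sub>R H) + 0"
    unfolding a_def b_def by (intro GDERIV_add sq f g GDERIV_const)
  have dS: "DERIV (\<lambda>t. 1 / t\<^sup>2) S :> - 2 / S ^ 3"
    using S by (auto intro!: derivative_eq_intros simp: power2_eq_square power3_eq_cube field_simps)
  have i: "GDERIV (\<lambda>x. 1 / ((f x)\<^sup>2 + (g x)\<^sup>2 + d)\<^sup>2) x :> (- 2 / S ^ 3) *\<^sub>R (((2 * a) *\<^sub>R G + (2 * b) *\<^sub>R H) + 0)"
    by (rule GDERIV_DERIV_compose[OF SS, of "\<lambda>t. 1 / t\<^sup>2"]) (use dS in \<open>simp add: S_def a_def b_def\<close>)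
  note D = GDERIV_mult[OF GDERIV_mult[OF s p] i]
  have e: "(\<lambda>x. 2 * (f x + g x) * pos_part_sq (f x * g x) * (1 / ((f x)\<^sup>2 + (g x)\<^sup>2 + d)\<^sup>2)) = (\<lambda>x. common_part d (f x) (g x))"
    by (simp add: common_part_def pos_part_sq_def)
  have pc: "pos_part_sq (a * b) = c\<^sup>2" by (simp add: pos_part_sq_def c_def)
  have ca: "2 * (a + b) * c\<^sup>2 * (- 2 / S ^ 3 * (2 * a)) + 1 / S\<^sup>2 * (2 * (a + b) * (2 * c * b)) + 1 / S\<^sup>2 * (c\<^sup>2 * 2) = common_part_deriv d a b"
    unfolding common_part_deriv_def Let_def c_def[symmetric] S_def[symmetric]
    by (simp add: algebra_simps add_divide_distrib diff_divide_distrib)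
  have "common_part_deriv d b a = 2 * c\<^sup>2 / S\<^sup>2 + 4 * (a + b) * c * a / S\<^sup>2 - 8 * (a + b) * c\<^sup>2 * b / S ^ 3"
    unfolding common_part_deriv_def Let_def c_def S_def by (simp add: add.commute mult.commute)
  then have cb: "2 * (a + b) * c\<^sup>2 * (- 2 / S ^ 3 * (2 * b)) + 1 / S\<^sup>2 * (2 * (a + b) * (2 * c * a)) + 1 / S\<^sup>2 * (c\<^sup>2 * 2) = common_part_deriv d b a"
    by (simp add: algebra_simps add_divide_distrib diff_divide_distrib)
  have gen: "n *\<^sub>R (k *\<^sub>R (((2 * a) *\<^sub>R G + (2 * b) *\<^sub>R H) + 0)) + i *\<^sub>R (m *\<^sub>R ((2 * c) *\<^sub>R (a *\<^sub>R H + b *\<^sub>R G)) + q *\<^sub>R (2 *\<^sub>R (G + H)))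
     = (n * (k * (2 * a)) + i * (m * (2 * c * b)) + i * (q * 2)) *\<^sub>R G + (n * (k * (2 * b)) + i * (m * (2 * c * a)) + i * (q * 2)) *\<^sub>R H"
    for n k i m q by (simp add: scaleR_add_left scaleR_add_right ac_simps)
  show ?thesis
    using D unfolding e a_def[symmetric] b_def[symmetric] pc S_def[symmetric] gen ca cb .
qed

lemma common_part_tendsto:
  "(\<lambda>k. common_part (1 / real (Suc k)) a b) \<longlonglongrightarrow> common_part 0 a b"
  "(\<lambda>k. common_part_deriv (1 / real (Suc k)) a b) \<longlonglongrightarrow> common_part_deriv 0 a b"
proof -
  have "(\<lambda>k. common_part (1 / real (Suc k)) a b) \<longlonglongrightarrow> common_part 0 a b \<and>
    (\<lambda>k. common_part_deriv (1 / real (Suc k)) a b) \<longlonglongrightarrow> common_part_deriv 0 a b"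
  \<comment> \<open>At the origin all numerators vanish, and division by zero gives 0 for
    \<open>d = 0\<close> as well; elsewhere the denominators have a nonzero limit.\<close>
  proof (cases "a = 0 \<and> b = 0")
    case True
    then show ?thesis by (simp add: common_part_def common_part_deriv_def)
  next
    case False
    then have "a\<^sup>2 + b\<^sup>2 + 0 \<noteq> 0" by (simp add: sum_power2_eq_zero_iff)
    then show ?thesis unfolding common_part_def common_part_deriv_def Let_def
      by (intro conjI tendsto_intros inverse_Suc_tendsto) auto
  qed
  then show "(\<lambda>k. common_part (1 / real (Suc k)) a b) \<longlonglongrightarrow> common_part 0 a b"
    "(\<lambda>k. common_part_deriv (1 / real (Suc k)) a b) \<longlonglongrightarrow> common_part_deriv 0 a b" by auto
qed

text \<open>For \<open>d > 0\<close> the function is differentiable with a bound that does not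
  depend on \<open>d\<close>, and the resulting estimate passes to the limit.\<close>

lemma common_part_lipschitz_left: "\<bar>common_part 0 a b - common_part 0 a' b\<bar> \<le> 9 * \<bar>a - a'\<bar>"
proof (rule LIMSEQ_le_const2)
  show "(\<lambda>k. \<bar>common_part (1 / real (Suc k)) a b - common_part (1 / real (Suc k)) a' b\<bar>) \<longlonglongrightarrow> \<bar>common_part 0 a b - common_part 0 a' b\<bar>"
    by (intro tendsto_intros common_part_tendsto)
  have "\<bar>common_part d a b - common_part d a' b\<bar> \<le> 9 * \<bar>a - a'\<bar>" if d: "d > 0" for d
  proof -
    have D: "DERIV (\<lambda>t. common_part d t b) t :> common_part_deriv d t b" for t
      using GDERIV_common_part[OF _ GDERIV_const[of b] d, of "\<lambda>t. t" t 1] by simp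
    have "norm (common_part d a b - common_part d a' b) \<le> 9 * norm (a - a')"
      using D common_part_deriv_bound[of d _ b] d
      by (intro field_differentiable_bound[OF convex_UNIV, of "\<lambda>t. common_part d t b"])
        (auto intro: has_field_derivative_at_within)
    then show ?thesis by simp
  qed
  then show "\<exists>N. \<forall>k\<ge>N. \<bar>common_part (1 / real (Suc k)) a b - common_part (1 / real (Suc k)) a' b\<bar> \<le> 9 * \<bar>a - a'\<bar>"
    by auto
qed

lemma common_part_lipschitz: "\<bar>common_part 0 a b - common_part 0 a' b'\<bar> \<le> 9 * \<bar>a - a'\<bar> + 9 * \<bar>b - b'\<bar>"
  using common_part_lipschitz_left[of a b a'] common_part_lipschitz_left[of b a' b']
  by (simp add: common_part_commute[of 0 _ a'])

lemma common_part_diag: "common_part 0 t t = t"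
proof (cases "t = 0")
  case False
  have "(max 0 (t * t))\<^sup>2 = t ^ 4" by (simp add: max_def power2_eq_square power4_eq_xxxx)
  moreover have "(t\<^sup>2 + t\<^sup>2 + 0)\<^sup>2 = 4 * t ^ 4" by (simp add: power2_eq_square power4_eq_xxxx)
  ultimately show ?thesis using False by (simp add: common_part_def)
qed (simp add: common_part_def)

lemma common_part_diff: "\<bar>a - common_part 0 a b\<bar> \<le> 9 * \<bar>a - b\<bar>" "\<bar>b - common_part 0 a b\<bar> \<le> 9 * \<bar>a - b\<bar>"
  using common_part_lipschitz[of a b a a] common_part_lipschitz[of a b b b]
  by (simp_all add: common_part_diag abs_minus_commute)

lemma common_part_sign:
  "a \<ge> 0 \<Longrightarrow> common_part 0 a b \<ge> 0" "a \<le> 0 \<Longrightarrow> common_part 0 a b \<le> 0"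
proof -
  assume a: "a \<ge> 0"
  show "common_part 0 a b \<ge> 0"
  proof (cases "b \<ge> 0")
    case True
    then show ?thesis using a unfolding common_part_def by (intro divide_nonneg_nonneg mult_nonneg_nonneg) auto
  next
    case False
    then have "max 0 (a * b) = 0" using a by (intro max_absorb1 mult_nonneg_nonpos) auto
    then show ?thesis by (simp add: common_part_def)
  qed
next
  assume a: "a \<le> 0"
  show "common_part 0 a b \<le> 0"
  proof (cases "b \<le> 0")
    case True
    then have "2 * (a + b) * (max 0 (a * b))\<^sup>2 \<le> 0"
      using a mult_nonpos_nonneg[of "2 * (a + b)" "(max 0 (a * b))\<^sup>2"] by simp
    then show ?thesis unfolding common_part_def by (intro divide_nonpos_nonneg) auto
  next
    case False
    then have "max 0 (a * b) = 0" using a by (intro max_absorb1 mult_nonpos_nonneg) auto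
    then show ?thesis by (simp add: common_part_def)
  qed
qed

lemma c1_limit_common_part:
  fixes f g :: "'a::euclidean_space \<Rightarrow> real"
  assumes f: "\<And>x. x \<in> \<Omega> \<Longrightarrow> GDERIV f x :> G x" and G: "continuous_on \<Omega> G"
    and g: "\<And>x. x \<in> \<Omega> \<Longrightarrow> GDERIV g x :> H x" and H: "continuous_on \<Omega> H"
  shows "c1_limit \<Omega> (\<lambda>x. common_part 0 (f x) (g x))
    (\<lambda>x. common_part_deriv 0 (f x) (g x) *\<^sub>R G x + common_part_deriv 0 (g x) (f x) *\<^sub>R H x)"
proof -
  have cf: "continuous_on \<Omega> f" "continuous_on \<Omega> g"
    using GDERIV_imp_continuous_on[OF f] GDERIV_imp_continuous_on[OF g] by auto
  define d where "d k = 1 / real (Suc k)" for k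
  have d: "d k > 0" for k unfolding d_def by simp
  have cd: "continuous_on \<Omega> (\<lambda>x. common_part_deriv (d k) (u x) (v x))"
    if "continuous_on \<Omega> u" "continuous_on \<Omega> v" for k u v
  proof -
    have "(u x)\<^sup>2 + (v x)\<^sup>2 + d k \<noteq> 0" for x
      using d[of k] zero_le_power2[of "u x"] zero_le_power2[of "v x"] by linarith
    then show ?thesis unfolding common_part_deriv_def Let_def by (intro continuous_intros that) auto
  qed
  show ?thesis unfolding c1_limit_def
  proof (intro exI[of _ "\<lambda>k x. common_part (d k) (f x) (g x)"]
      exI[of _ "\<lambda>k x. common_part_deriv (d k) (f x) (g x) *\<^sub>R G x + common_part_deriv (d k) (g x) (f x) *\<^sub>R H x"] conjI allI impI ballI)
    fix k x assume "x \<in> \<Omega>"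
    then show "GDERIV (\<lambda>x. common_part (d k) (f x) (g x)) x :>
        common_part_deriv (d k) (f x) (g x) *\<^sub>R G x + common_part_deriv (d k) (g x) (f x) *\<^sub>R H x"
      by (intro GDERIV_common_part f g d)
  next
    fix k show "continuous_on \<Omega> (\<lambda>x. common_part_deriv (d k) (f x) (g x) *\<^sub>R G x + common_part_deriv (d k) (g x) (f x) *\<^sub>R H x)"
      by (intro continuous_intros cd cf G H)
  next
    fix x show "(\<lambda>k. common_part (d k) (f x) (g x)) \<longlonglongrightarrow> common_part 0 (f x) (g x)"
      unfolding d_def by (rule common_part_tendsto)
    show "(\<lambda>k. common_part_deriv (d k) (f x) (g x) *\<^sub>R G x + common_part_deriv (d k) (g x) (f x) *\<^sub>R H x)
        \<longlonglongrightarrow> common_part_deriv 0 (f x) (g x) *\<^sub>R G x + common_part_deriv 0 (g x) (f x) *\<^sub>R H x"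
      unfolding d_def by (intro tendsto_intros common_part_tendsto)
  next
    fix K assume K: "compact K \<and> K \<subseteq> \<Omega>"
    have "\<exists>B. \<forall>x\<in>K. norm (u x) \<le> B" if "continuous_on \<Omega> u" for u :: "'a \<Rightarrow> 'b::euclidean_space"
    proof -
      have "bounded (u ` K)" using K that by (auto intro!: compact_imp_bounded compact_continuous_image intro: continuous_on_subset)
      then show ?thesis unfolding bounded_iff by auto
    qed
    note bb = this
    obtain B1 where B1: "\<And>x. x \<in> K \<Longrightarrow> norm (f x) \<le> B1" using bb[OF cf(1)] by blast
    obtain B2 where B2: "\<And>x. x \<in> K \<Longrightarrow> norm (g x) \<le> B2" using bb[OF cf(2)] by blast
    obtain B3 where B3: "\<And>x. x \<in> K \<Longrightarrow> norm (G x) \<le> B3" using bb[OF G] by blast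
    obtain B4 where B4: "\<And>x. x \<in> K \<Longrightarrow> norm (H x) \<le> B4" using bb[OF H] by blast
    have "\<bar>common_part (d k) (f x) (g x)\<bar> \<le> max (B1 + B2) (9 * B3 + 9 * B4) \<and>
        norm (common_part_deriv (d k) (f x) (g x) *\<^sub>R G x + common_part_deriv (d k) (g x) (f x) *\<^sub>R H x) \<le> max (B1 + B2) (9 * B3 + 9 * B4)"
      if x: "x \<in> K" for k x
    proof
      show "\<bar>common_part (d k) (f x) (g x)\<bar> \<le> max (B1 + B2) (9 * B3 + 9 * B4)"
        using common_part_bound[of "d k" "f x" "g x"] d[of k] B1[OF x] B2[OF x] by simp
      have *: "\<bar>common_part_deriv (d k) u v\<bar> * norm w \<le> 9 * B" if "norm w \<le> B" for u v B and w :: 'a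
        using common_part_deriv_bound[of "d k" u v] d[of k] that by (intro mult_mono) auto
      show "norm (common_part_deriv (d k) (f x) (g x) *\<^sub>R G x + common_part_deriv (d k) (g x) (f x) *\<^sub>R H x) \<le> max (B1 + B2) (9 * B3 + 9 * B4)"
        using norm_triangle_ineq[of "common_part_deriv (d k) (f x) (g x) *\<^sub>R G x" "common_part_deriv (d k) (g x) (f x) *\<^sub>R H x"]
          *[OF B3[OF x], of "f x" "g x"] *[OF B4[OF x], of "g x" "f x"] by simp
    qed
    then show "\<exists>B. \<forall>k. \<forall>x\<in>K. \<bar>common_part (d k) (f x) (g x)\<bar> \<le> B \<and>
        norm (common_part_deriv (d k) (f x) (g x) *\<^sub>R G x + common_part_deriv (d k) (g x) (f x) *\<^sub>R H x) \<le> B" by blast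
  qed
qed

text \<open>Piecewise quadratic: \<open>2 t^2\<close> on [0, 1/2] and \<open>1 - 2 (1 - t)^2\<close>
  on [1/2, 1]. The derivative is a tent of height 2, the origin of the Lipschitz constant
  \<open>2 / \<epsilon>\<close> of the radial cutoffs.\<close>

definition smooth_step :: "real \<Rightarrow> real" where
  "smooth_step t = 2 * pos_part_sq t - 4 * pos_part_sq (t - 1 / 2) + 2 * pos_part_sq (t - 1)"

definition smooth_step_deriv :: "real \<Rightarrow> real" where
  "smooth_step_deriv t = 4 * max 0 t - 8 * max 0 (t - 1 / 2) + 4 * max 0 (t - 1)"

lemma DERIV_smooth_step: "DERIV smooth_step t :> smooth_step_deriv t"
proof -
  have s: "DERIV (\<lambda>t. pos_part_sq (t - c)) t :> 2 * max 0 (t - c)" for c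
  proof -
    have "DERIV (\<lambda>t. pos_part_sq (t - c)) t :> (2 * max 0 (t - c)) * 1"
      by (rule DERIV_chain2[OF DERIV_pos_part_sq]) (auto intro!: derivative_eq_intros)
    then show ?thesis by simp
  qed
  have "DERIV (\<lambda>t. 2 * pos_part_sq t - 4 * pos_part_sq (t - 1 / 2) + 2 * pos_part_sq (t - 1)) t :>
     2 * (2 * max 0 t) - 4 * (2 * max 0 (t - 1 / 2)) + 2 * (2 * max 0 (t - 1))"
    by (intro DERIV_add DERIV_diff DERIV_cmult s DERIV_pos_part_sq)
  then show ?thesis unfolding smooth_step_def[abs_def] smooth_step_deriv_def by simp
qed

lemma smooth_step_0: "t \<le> 0 \<Longrightarrow> smooth_step t = 0" "t \<le> 0 \<Longrightarrow> smooth_step_deriv t = 0"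
  by (auto simp: smooth_step_def smooth_step_deriv_def pos_part_sq_def)

lemma smooth_step_1: "t \<ge> 1 \<Longrightarrow> smooth_step t = 1" "t \<ge> 1 \<Longrightarrow> smooth_step_deriv t = 0"
  by (auto simp: smooth_step_def smooth_step_deriv_def pos_part_sq_def power2_eq_square algebra_simps)

lemma smooth_step_deriv_bound: "0 \<le> smooth_step_deriv t" "smooth_step_deriv t \<le> 2"
  by (auto simp: smooth_step_deriv_def max_def)

lemma smooth_step_bounds: "0 \<le> smooth_step t" "smooth_step t \<le> 1"
proof -
  have mono: "smooth_step s \<le> smooth_step t" if "s \<le> t" for s t
    using that DERIV_smooth_step smooth_step_deriv_bound(1) by (metis DERIV_nonneg_imp_nondecreasing)
  show "0 \<le> smooth_step t" using mono[of "min t 0" t] smooth_step_0(1)[of "min t 0"] by simp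
  show "smooth_step t \<le> 1" using mono[of t "max t 1"] smooth_step_1(1)[of "max t 1"] by simp
qed

lemma smooth_step_lipschitz: "\<bar>smooth_step s - smooth_step t\<bar> \<le> 2 * \<bar>s - t\<bar>"
proof -
  have "norm (smooth_step s - smooth_step t) \<le> 2 * norm (s - t)"
    using smooth_step_deriv_bound
    by (intro field_differentiable_bound[OF convex_UNIV, of smooth_step smooth_step_deriv])
      (auto intro: has_field_derivative_at_within DERIV_smooth_step)
  then show ?thesis by simp
qed

section \<open>Gluing\<close>

text \<open>The type is left general so that the same cutoffs, and the same \<open>glue\<close>,
  apply to points \<open>X\<close> of the half-space and to boundary points \<open>x\<close>; the
  trace of a glued function is then the glued trace.\<close>

definition inner_cutoff :: "real \<Rightarrow> 'a::real_normed_vector \<Rightarrow> real" where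
  "inner_cutoff \<epsilon> X = smooth_step ((1 - norm X) / \<epsilon>)"

definition outer_cutoff :: "real \<Rightarrow> 'a::real_normed_vector \<Rightarrow> real" where
  "outer_cutoff \<epsilon> X = smooth_step ((norm X - 1) / \<epsilon>)"

definition inner_cutoff_grad :: "real \<Rightarrow> 'a::real_normed_vector \<Rightarrow> 'a" where
  "inner_cutoff_grad \<epsilon> X = (smooth_step_deriv ((1 - norm X) / \<epsilon>) * (- 1 / \<epsilon>)) *\<^sub>R sgn X"

definition outer_cutoff_grad :: "real \<Rightarrow> 'a::real_normed_vector \<Rightarrow> 'a" where
  "outer_cutoff_grad \<epsilon> X = (smooth_step_deriv ((norm X - 1) / \<epsilon>) * (1 / \<epsilon>)) *\<^sub>R sgn X"

definition glue :: "real \<Rightarrow> ('a::real_normed_vector \<Rightarrow> real) \<Rightarrow> ('a \<Rightarrow> real) \<Rightarrow> 'a \<Rightarrow> real" where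
  "glue \<epsilon> w1 w2 X = inner_cutoff \<epsilon> X * w1 X + outer_cutoff \<epsilon> X * w2 X
     + (1 - inner_cutoff \<epsilon> X - outer_cutoff \<epsilon> X) * common_part 0 (w1 X) (w2 X)"

text \<open>The terms are grouped so that each cutoff gradient multiplies the difference between one
  of the functions and the common part, which is at most \<open>9 |w1 - w2|\<close>.\<close>

definition glue_grad :: "real \<Rightarrow> ('a::real_normed_vector \<Rightarrow> real) \<Rightarrow> ('a \<Rightarrow> 'a) \<Rightarrow> ('a \<Rightarrow> real) \<Rightarrow> ('a \<Rightarrow> 'a) \<Rightarrow> 'a \<Rightarrow> 'a" where
  "glue_grad \<epsilon> w1 G1 w2 G2 X =
     inner_cutoff \<epsilon> X *\<^sub>R G1 X + outer_cutoff \<epsilon> X *\<^sub>R G2 X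
     + (1 - inner_cutoff \<epsilon> X - outer_cutoff \<epsilon> X) *\<^sub>R
       (common_part_deriv 0 (w1 X) (w2 X) *\<^sub>R G1 X + common_part_deriv 0 (w2 X) (w1 X) *\<^sub>R G2 X)
     + (w1 X - common_part 0 (w1 X) (w2 X)) *\<^sub>R inner_cutoff_grad \<epsilon> X
     + (w2 X - common_part 0 (w1 X) (w2 X)) *\<^sub>R outer_cutoff_grad \<epsilon> X"

text \<open>The inner cutoff vanishes for |X| \<ge> 1 and the outer one for |X| \<le> 1, so at most
  one of them is nonzero and the weight left for the common part lies in [0, 1].\<close>

lemma cutoff_pair_bounds:
  assumes "\<epsilon> > 0"
  shows "0 \<le> inner_cutoff \<epsilon> X" "inner_cutoff \<epsilon> X \<le> 1" "0 \<le> outer_cutoff \<epsilon> X" "outer_cutoff \<epsilon> X \<le> 1"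
    "0 \<le> 1 - inner_cutoff \<epsilon> X - outer_cutoff \<epsilon> X" "1 - inner_cutoff \<epsilon> X - outer_cutoff \<epsilon> X \<le> 1"
proof -
  show b: "0 \<le> inner_cutoff \<epsilon> X" "inner_cutoff \<epsilon> X \<le> 1" "0 \<le> outer_cutoff \<epsilon> X" "outer_cutoff \<epsilon> X \<le> 1"
    unfolding inner_cutoff_def outer_cutoff_def by (rule smooth_step_bounds)+
  have "inner_cutoff \<epsilon> X = 0 \<or> outer_cutoff \<epsilon> X = 0"
  proof (cases "norm X \<ge> 1")
    case True
    then have "(1 - norm X) / \<epsilon> \<le> 0" using assms by (intro divide_nonpos_pos) auto
    then show ?thesis unfolding inner_cutoff_def by (simp add: smooth_step_0)
  next
    case False
    then have "(norm X - 1) / \<epsilon> \<le> 0" using assms by (intro divide_nonpos_pos) auto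
    then show ?thesis unfolding outer_cutoff_def by (simp add: smooth_step_0)
  qed
  then show "0 \<le> 1 - inner_cutoff \<epsilon> X - outer_cutoff \<epsilon> X" "1 - inner_cutoff \<epsilon> X - outer_cutoff \<epsilon> X \<le> 1"
    using b by auto
qed

lemma norm_cutoff_pair_grad:
  assumes "\<epsilon> > 0"
  shows "norm (inner_cutoff_grad \<epsilon> X) \<le> 2 / \<epsilon>" "norm (outer_cutoff_grad \<epsilon> X) \<le> 2 / \<epsilon>"
proof -
  have *: "\<bar>smooth_step_deriv t * c\<bar> * norm (sgn X) \<le> (2 * (1 / \<epsilon>)) * 1" if "\<bar>c\<bar> = 1 / \<epsilon>" for t c
    unfolding abs_mult that using smooth_step_deriv_bound[of t] assms by (intro mult_mono) (auto simp: norm_sgn)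
  show "norm (inner_cutoff_grad \<epsilon> X) \<le> 2 / \<epsilon>" "norm (outer_cutoff_grad \<epsilon> X) \<le> 2 / \<epsilon>"
    unfolding inner_cutoff_grad_def outer_cutoff_grad_def norm_scaleR
    using *[of "- 1 / \<epsilon>"] *[of "1 / \<epsilon>"] assms by auto
qed

text \<open>The norm is smooth away from the origin, which does not belong to the open
  half-space.\<close>

lemma c1_limit_cutoff_pair:
  assumes \<epsilon>: "\<epsilon> > 0"
  shows "c1_limit half_space (inner_cutoff \<epsilon> :: (real ^ 'n) \<times> real \<Rightarrow> real) (inner_cutoff_grad \<epsilon>)"
    "c1_limit half_space (outer_cutoff \<epsilon> :: (real ^ 'n) \<times> real \<Rightarrow> real) (outer_cutoff_grad \<epsilon>)"
proof -
  let ?H = "half_space :: ((real ^ 'n) \<times> real) set"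
  have cd: "continuous_on S (\<lambda>x. smooth_step_deriv (f x))" if "continuous_on S f" for S and f :: "(real ^ 'n) \<times> real \<Rightarrow> real"
    unfolding smooth_step_deriv_def by (intro continuous_intros that)
  show "c1_limit ?H (inner_cutoff \<epsilon>) (inner_cutoff_grad \<epsilon>)"
  proof (rule c1_limitI_C1)
    fix X assume X: "X \<in> ?H"
    have "DERIV (\<lambda>t. smooth_step ((1 - t) / \<epsilon>)) (norm X) :> smooth_step_deriv ((1 - norm X) / \<epsilon>) * (- 1 / \<epsilon>)"
      by (rule DERIV_chain2[OF DERIV_smooth_step]) (use \<epsilon> in \<open>auto intro!: derivative_eq_intros\<close>)
    from GDERIV_DERIV_compose[OF GDERIV_norm[OF half_space_nonzero[OF X]] this]
    show "GDERIV (inner_cutoff \<epsilon>) X :> inner_cutoff_grad \<epsilon> X"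
      unfolding inner_cutoff_def[abs_def] inner_cutoff_grad_def .
  next
    show "continuous_on ?H (inner_cutoff_grad \<epsilon>)"
      unfolding inner_cutoff_grad_def using half_space_nonzero \<epsilon> by (intro continuous_intros cd) auto
  qed
  show "c1_limit ?H (outer_cutoff \<epsilon>) (outer_cutoff_grad \<epsilon>)"
  proof (rule c1_limitI_C1)
    fix X assume X: "X \<in> ?H"
    have "DERIV (\<lambda>t. smooth_step ((t - 1) / \<epsilon>)) (norm X) :> smooth_step_deriv ((norm X - 1) / \<epsilon>) * (1 / \<epsilon>)"
      by (rule DERIV_chain2[OF DERIV_smooth_step]) (use \<epsilon> in \<open>auto intro!: derivative_eq_intros\<close>)
    from GDERIV_DERIV_compose[OF GDERIV_norm[OF half_space_nonzero[OF X]] this]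
    show "GDERIV (outer_cutoff \<epsilon>) X :> outer_cutoff_grad \<epsilon> X"
      unfolding outer_cutoff_def[abs_def] outer_cutoff_grad_def .
  next
    show "continuous_on ?H (outer_cutoff_grad \<epsilon>)"
      unfolding outer_cutoff_grad_def using half_space_nonzero \<epsilon> by (intro continuous_intros cd) auto
  qed
qed

lemma c1_limit_glue:
  fixes w1 w2 :: "(real ^ 'n) \<times> real \<Rightarrow> real"
  assumes \<epsilon>: "\<epsilon> > 0"
    and w1: "\<And>X. X \<in> half_space \<Longrightarrow> GDERIV w1 X :> G1 X" "continuous_on half_space G1"
    and w2: "\<And>X. X \<in> half_space \<Longrightarrow> GDERIV w2 X :> G2 X" "continuous_on half_space G2"
  shows "c1_limit half_space (glue \<epsilon> w1 w2) (glue_grad \<epsilon> w1 G1 w2 G2)"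
proof -
  note p = c1_limit_cutoff_pair[OF \<epsilon>, where 'n='n]
  note C = c1_limit_diff[OF c1_limit_diff[OF c1_limit_const[of half_space 1] p(1)] p(2)]
  note L = c1_limit_add[OF c1_limit_add[OF c1_limit_mult[OF p(1) c1_limitI_C1[OF w1]] c1_limit_mult[OF p(2) c1_limitI_C1[OF w2]]]
      c1_limit_mult[OF C c1_limit_common_part[OF w1 w2]]]
  show ?thesis
    by (rule c1_limit_cong[OF L])
      (simp_all add: glue_def glue_grad_def scaleR_diff_left scaleR_diff_right algebra_simps)
qed

lemma glue_inner:
  assumes \<epsilon>: "\<epsilon> > 0" and X: "norm X < 1 - \<epsilon>"
  shows "glue \<epsilon> w1 w2 X = w1 X" "glue_grad \<epsilon> w1 G1 w2 G2 X = G1 X"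
proof -
  have "(1 - norm X) / \<epsilon> \<ge> 1" using assms by simp
  moreover have "(norm X - 1) / \<epsilon> \<le> 0" using assms by (intro divide_nonpos_pos) auto
  ultimately show "glue \<epsilon> w1 w2 X = w1 X" "glue_grad \<epsilon> w1 G1 w2 G2 X = G1 X"
    unfolding glue_def glue_grad_def inner_cutoff_def outer_cutoff_def inner_cutoff_grad_def outer_cutoff_grad_def
    by (simp_all add: smooth_step_0 smooth_step_1)
qed

lemma glue_outer:
  assumes \<epsilon>: "\<epsilon> > 0" and X: "norm X \<ge> 1 + \<epsilon>"
  shows "glue \<epsilon> w1 w2 X = w2 X" "glue_grad \<epsilon> w1 G1 w2 G2 X = G2 X"
proof -
  have "(norm X - 1) / \<epsilon> \<ge> 1" using assms by simp
  moreover have "(1 - norm X) / \<epsilon> \<le> 0" using assms by (intro divide_nonpos_pos) auto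
  ultimately show "glue \<epsilon> w1 w2 X = w2 X" "glue_grad \<epsilon> w1 G1 w2 G2 X = G2 X"
    unfolding glue_def glue_grad_def inner_cutoff_def outer_cutoff_def inner_cutoff_grad_def outer_cutoff_grad_def
    by (simp_all add: smooth_step_0 smooth_step_1)
qed

text \<open>The gradient is at most \<open>10 g1 + 10 g2 + 36 d\<close>: 10 is 1 from a cutoff plus
  9 from the common part, and 36 is two cutoff terms of \<open>9 * 2\<close> each, with 2 from the
  slope of the step. Squaring a sum of three terms costs a factor 3, and
  \<open>3 * 36^2 = 3888\<close> decides the constant 4000.\<close>

lemma glue_grad_bound:
  assumes \<epsilon>: "\<epsilon> > 0"
  shows "(norm (glue_grad \<epsilon> w1 G1 w2 G2 X))\<^sup>2 \<le> 4000 * ((norm (G1 X))\<^sup>2 + (norm (G2 X))\<^sup>2) + 4000 * (\<epsilon> powr (- 2) * \<bar>w1 X - w2 X\<bar>\<^sup>2)"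
proof -
  note b = cutoff_pair_bounds[OF \<epsilon>, of X]
  define g1 g2 d where "g1 = norm (G1 X)" and "g2 = norm (G2 X)" and "d = \<bar>w1 X - w2 X\<bar> / \<epsilon>"
  have nn: "g1 \<ge> 0" "g2 \<ge> 0" "d \<ge> 0" unfolding g1_def g2_def d_def using \<epsilon> by auto
  define h where "h = common_part 0 (w1 X) (w2 X)"
  have 1: "norm (inner_cutoff \<epsilon> X *\<^sub>R G1 X) \<le> 1 * g1" unfolding norm_scaleR g1_def using b by (intro mult_mono) auto
  have 2: "norm (outer_cutoff \<epsilon> X *\<^sub>R G2 X) \<le> 1 * g2" unfolding norm_scaleR g2_def using b by (intro mult_mono) auto
  have 3: "norm (common_part_deriv 0 (w1 X) (w2 X) *\<^sub>R G1 X + common_part_deriv 0 (w2 X) (w1 X) *\<^sub>R G2 X) \<le> 9 * g1 + 9 * g2"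
  proof -
    have "norm (common_part_deriv 0 (w1 X) (w2 X) *\<^sub>R G1 X) \<le> 9 * g1" "norm (common_part_deriv 0 (w2 X) (w1 X) *\<^sub>R G2 X) \<le> 9 * g2"
      unfolding norm_scaleR g1_def g2_def using common_part_deriv_bound[of 0] by (auto intro!: mult_right_mono)
    then show ?thesis by (rule norm_triangle_mono)
  qed
  then have 3: "norm ((1 - inner_cutoff \<epsilon> X - outer_cutoff \<epsilon> X) *\<^sub>R (common_part_deriv 0 (w1 X) (w2 X) *\<^sub>R G1 X + common_part_deriv 0 (w2 X) (w1 X) *\<^sub>R G2 X)) \<le> 1 * (9 * g1 + 9 * g2)"
    unfolding norm_scaleR using b by (intro mult_mono) auto
  have 4: "norm ((w1 X - h) *\<^sub>R inner_cutoff_grad \<epsilon> X) \<le> (9 * \<bar>w1 X - w2 X\<bar>) * (2 / \<epsilon>)"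
    unfolding norm_scaleR h_def using common_part_diff(1)[of "w1 X" "w2 X"] norm_cutoff_pair_grad(1)[OF \<epsilon>, of X] by (intro mult_mono) auto
  have 5: "norm ((w2 X - h) *\<^sub>R outer_cutoff_grad \<epsilon> X) \<le> (9 * \<bar>w1 X - w2 X\<bar>) * (2 / \<epsilon>)"
    unfolding norm_scaleR h_def using common_part_diff(2)[of "w2 X" "w1 X"] norm_cutoff_pair_grad(2)[OF \<epsilon>, of X] by (intro mult_mono) auto
  have d18: "(9 * \<bar>w1 X - w2 X\<bar>) * (2 / \<epsilon>) = 18 * d" by (simp add: d_def)
  have "norm (glue_grad \<epsilon> w1 G1 w2 G2 X) \<le> (((1 * g1 + 1 * g2) + 1 * (9 * g1 + 9 * g2)) + 18 * d) + 18 * d"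
    unfolding glue_grad_def h_def[symmetric]
    by (intro norm_triangle_mono 1 2 3 4[unfolded d18] 5[unfolded d18])
  then have "norm (glue_grad \<epsilon> w1 G1 w2 G2 X) \<le> 10 * g1 + 10 * g2 + 36 * d" by simp
  then have "(norm (glue_grad \<epsilon> w1 G1 w2 G2 X))\<^sup>2 \<le> (10 * g1 + 10 * g2 + 36 * d)\<^sup>2" by (intro power_mono) auto
  also have "\<dots> \<le> 3 * ((10 * g1)\<^sup>2 + (10 * g2)\<^sup>2 + (36 * d)\<^sup>2)"
    using zero_le_power2[of "10 * g1 - 10 * g2"] zero_le_power2[of "10 * g1 - 36 * d"] zero_le_power2[of "10 * g2 - 36 * d"]
    by (simp add: power2_eq_square algebra_simps)
  also have "\<dots> \<le> 4000 * (g1\<^sup>2 + g2\<^sup>2) + 4000 * d\<^sup>2" by (simp add: power_mult_distrib)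
  also have "d\<^sup>2 = \<epsilon> powr (- 2) * \<bar>w1 X - w2 X\<bar>\<^sup>2"
    unfolding d_def using \<epsilon> by (simp add: power_divide powr_minus_divide)
  finally show ?thesis unfolding g1_def g2_def .
qed

text \<open>In the product rule the gradient of \<eta> multiplies the difference of the two ramps,
  so this difference has to vanish along with their derivatives. For
  \<open>z \<le> \<epsilon> / 2\<close> both ramp arguments lie on the same side, strictly outside
  [0, 1]; above that height \<eta> is constantly 1.\<close>

lemma cutoff_grad_vanishes:
  fixes X :: "(real ^ 'n) \<times> real"
  assumes \<epsilon>: "0 < \<epsilon>" "\<epsilon> < 1 / 4" and X: "X \<in> half_space" and n: "norm X < 1 - \<epsilon> \<or> norm X \<ge> 1 + \<epsilon>"
  shows "cutoff_grad \<epsilon> X = 0"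
proof -
  define e where "e = \<epsilon> / 2"
  have e: "e > 0" "e < 1 / 8" "\<epsilon> = 2 * e" using \<epsilon> by (auto simp: e_def)
  define z where "z = snd X"
  have z: "z > 0" unfolding z_def using half_spaceD[OF X] .
  define f1 f2 where "f1 = (norm X - 1 + e) / (2 * e)" and "f2 = (smooth_norm (fst X) - 1 + z) / (2 * z)"
  have f1: "f1 < 0 \<or> f1 > 1"
    using n e by (auto simp: f1_def divide_less_0_iff field_simps)
  have nX: "(norm X)\<^sup>2 = (norm (fst X))\<^sup>2 + z\<^sup>2" unfolding z_def by (cases X) (simp add: norm_Pair)
  have fX: "norm (fst X) \<le> norm X" using norm_fst_le[of "fst X" "snd X"] by simp
  have d1: "clamp01_deriv f1 = 0" by (rule clamp01_deriv_0[OF f1])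
  show ?thesis
  \<comment> \<open>The height \<open>z = e\<close> belongs to the lower case, because
    \<open>clamp01_deriv 1 = 1/2\<close>.\<close>
  proof (cases "z \<le> e")
    case False
    then have "z / e > 1" using e by simp
    then have "clamp01_deriv (z / e) = 0" "clamp01 (z / e) = 1" by (simp_all add: clamp01_deriv_0 clamp01_eq)
    then show ?thesis using d1
      unfolding cutoff_grad_def Let_def e_def[symmetric] z_def[symmetric] f1_def[symmetric] f2_def[symmetric] by (simp add: zero_prod_def)
  next
    case True
    have "(f1 < 0 \<and> f2 < 0) \<or> (f1 > 1 \<and> f2 > 1)"
    proof (cases "norm X < 1 - \<epsilon>")
      case n1: True
      have "smooth_norm (fst X) - 1 + z < 0"
        using smooth_norm_eq[of "fst X"] smooth_norm_le[of "fst X"] fX n1 True e by (cases "norm (fst X) \<ge> 1 / 2") auto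
      then have "f2 < 0" unfolding f2_def using z by (intro divide_neg_pos) auto
      moreover have "f1 < 0" unfolding f1_def using n1 e by (intro divide_neg_pos) auto
      ultimately show ?thesis by simp
    next
      case False
      then have n2: "norm X \<ge> 1 + \<epsilon>" using n by simp
      have x: "norm (fst X) > 1 + z"
      proof (rule ccontr)
        assume "\<not> norm (fst X) > 1 + z"
        then have "(norm (fst X))\<^sup>2 \<le> (1 + z)\<^sup>2" by (intro power_mono) auto
        moreover have "(1 + 2 * e)\<^sup>2 \<le> (norm X)\<^sup>2" using n2 e by (intro power_mono) auto
        ultimately have "(1 + 2 * e)\<^sup>2 \<le> (1 + z)\<^sup>2 + z\<^sup>2" using nX by linarith
        moreover have "(1 + z)\<^sup>2 \<le> (1 + e)\<^sup>2" "z\<^sup>2 \<le> e\<^sup>2" using z True by (auto intro!: power_mono)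
        ultimately have "(1 + 2 * e)\<^sup>2 \<le> (1 + e)\<^sup>2 + e\<^sup>2" by linarith
        moreover have "0 \<le> e * e" by simp
        ultimately show False using e by (simp add: power2_eq_square algebra_simps)
      qed
      then have "smooth_norm (fst X) = norm (fst X)" using z by (intro smooth_norm_eq) auto
      then have "f2 > 1" unfolding f2_def using x z by (simp add: less_divide_eq)
      moreover have "f1 > 1" unfolding f1_def using n2 e by (simp add: less_divide_eq)
      ultimately show ?thesis by simp
    qed
    then have "clamp01_deriv f2 = 0" "clamp01 f1 = clamp01 f2" by (auto simp: clamp01_deriv_0 clamp01_eq)
    then show ?thesis using d1
      unfolding cutoff_grad_def Let_def e_def[symmetric] z_def[symmetric] f1_def[symmetric] f2_def[symmetric]
      by (simp add: scaleR_diff_right zero_prod_def)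
  qed
qed

section \<open>Evaluation of the chosen weak gradient\<close>

lemma borel_measurable_lebesgue_AE:
  fixes f g :: "'a::euclidean_space \<Rightarrow> 'b::topological_space"
  assumes g: "g \<in> borel_measurable lebesgue" and ae: "AE x in lebesgue. f x = g x"
  shows "f \<in> borel_measurable lebesgue"
proof (rule measurableI)
  obtain N where N: "{x \<in> space lebesgue. \<not> f x = g x} \<subseteq> N" "emeasure lebesgue N = 0" "N \<in> sets lebesgue"
    using AE_E[OF ae] by blast
  have N0: "N \<in> null_sets lebesgue" using N by auto
  fix A :: "'b set" assume A: "A \<in> sets borel"
  have "f -` A \<inter> N \<in> null_sets lebesgue" by (rule null_sets_completion_subset[OF _ N0]) auto
  then have "f -` A \<inter> N \<in> sets lebesgue" by (rule null_setsD2)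
  then have "(g -` A - N) \<union> (f -` A \<inter> N) \<in> sets lebesgue"
    using measurable_sets[OF g A] N(3) by (intro sets.Un sets.Diff) auto
  moreover have "(g -` A - N) \<union> (f -` A \<inter> N) = f -` A \<inter> space lebesgue" using N(1) by auto
  ultimately show "f -` A \<inter> space lebesgue \<in> sets lebesgue" by (simp only:)
qed auto

text \<open>\<open>grad f\<close> is some weak gradient and \<open>G\<close> is another, so
  uniqueness identifies them almost everywhere; all later computations with \<open>grad\<close> go
  through this.\<close>

lemma AE_grad:
  assumes "c1_limit half_space f G"
  shows "AE X in lebesgue. X \<in> half_space \<longrightarrow> grad f X = G X" "weakly_differentiable half_space f"
proof -
  have w: "is_weak_gradient half_space f G" by (rule c1_limit_is_weak_gradient[OF assms open_half_space])
  then show "weakly_differentiable half_space f" unfolding weakly_differentiable_def by blast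
  have "is_weak_gradient half_space f (grad f)" unfolding grad_def by (rule someI[of "is_weak_gradient half_space f", OF w])
  from is_weak_gradient_unique[OF open_half_space this w]
  show "AE X in lebesgue. X \<in> half_space \<longrightarrow> grad f X = G X" .
qed

text \<open>Carries the integrals of the statement over to Borel integrands. Measurability of
  \<open>P\<close>, which will contain the chosen gradient, comes from completeness of Lebesgue
  measure.\<close>

lemma set_integral_half_space_cong:
  fixes P Q :: "(real ^ 'n) \<times> real \<Rightarrow> real"
  assumes S: "S \<in> sets borel" "S \<subseteq> half_space"
    and PQ: "AE X in lebesgue. X \<in> half_space \<longrightarrow> P X = Q X"
    and Q: "(\<lambda>X. indicator half_space X *\<^sub>R Q X) \<in> borel_measurable borel"
  shows "set_integrable lebesgue S P \<longleftrightarrow> set_integrable lborel S Q"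
    "(LINT X:S|lebesgue. P X) = (LINT X:S|lborel. Q X)"
proof -
  have "(\<lambda>X. indicator S X *\<^sub>R Q X) = (\<lambda>X. indicator S X *\<^sub>R (indicator half_space X *\<^sub>R Q X))"
    using S(2) by (auto simp: fun_eq_iff indicator_def)
  then have Qm: "(\<lambda>X. indicator S X *\<^sub>R Q X) \<in> borel_measurable borel"
    using borel_measurable_scaleR[OF borel_measurable_indicator[of S borel] Q] S(1) by simp
  have Qm': "(\<lambda>X. indicator S X *\<^sub>R Q X) \<in> borel_measurable lebesgue"
    by (rule measurable_completion) (use Qm in simp)
  have ae: "AE X in lebesgue. indicator S X *\<^sub>R P X = indicator S X *\<^sub>R Q X"
    using PQ by eventually_elim (use S(2) in \<open>auto simp: indicator_def\<close>)
  have Pm: "(\<lambda>X. indicator S X *\<^sub>R P X) \<in> borel_measurable lebesgue"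
    by (rule borel_measurable_lebesgue_AE[OF Qm' ae])
  show "set_integrable lebesgue S P \<longleftrightarrow> set_integrable lborel S Q"
    using integrable_cong_AE[OF Pm Qm' ae] set_integrable_lebesgue_eq(1)[OF Qm] by (simp add: set_integrable_def)
  show "(LINT X:S|lebesgue. P X) = (LINT X:S|lborel. Q X)"
    using integral_cong_AE[OF Pm Qm' ae] set_integrable_lebesgue_eq(2)[OF Qm] by (simp add: set_lebesgue_integral_def)
qed

lemma snd_powr_measurable: "(\<lambda>X :: (real ^ 'n) \<times> real. snd X powr b) \<in> borel_measurable borel"
  unfolding borel_prod[symmetric] by measurable

lemma weighted_measurable:
  fixes G :: "(real ^ 'n) \<times> real \<Rightarrow> 'b::euclidean_space"
  assumes "(\<lambda>X. indicator half_space X *\<^sub>R G X) \<in> borel_measurable borel"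
  shows "(\<lambda>X. indicator half_space X *\<^sub>R (snd X powr b * (norm (G X))\<^sup>2)) \<in> borel_measurable borel"
proof -
  have "(\<lambda>X. snd X powr b * (norm (indicator half_space X *\<^sub>R G X))\<^sup>2) \<in> borel_measurable borel"
    by (intro borel_measurable_times snd_powr_measurable borel_measurable_power borel_measurable_norm[THEN measurable_compose[OF assms]])
  also have "(\<lambda>X. snd X powr b * (norm (indicator half_space X *\<^sub>R G X))\<^sup>2) = (\<lambda>X. indicator half_space X *\<^sub>R (snd X powr b * (norm (G X))\<^sup>2))"
    by (auto simp: fun_eq_iff indicator_def)
  finally show ?thesis .
qed

lemma half_ball_subset_half_space: "half_ball r \<subseteq> half_space"
  by (auto simp: half_ball_def)

lemma finite_weighted_energyI:
  assumes f: "c1_limit half_space f G" and i: "set_integrable lborel (half_ball r) (\<lambda>X. snd X powr b * (norm (G X))\<^sup>2)"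
  shows "finite_weighted_energy b r f"
proof -
  have "set_integrable lebesgue (half_ball r) (\<lambda>X. snd X powr b * (norm (grad f X))\<^sup>2)"
    unfolding set_integral_half_space_cong(1)[OF half_ball_sets half_ball_subset_half_space _
      weighted_measurable[OF c1_limit_measurable(2)[OF f open_half_space]],
      of "\<lambda>X. snd X powr b * (norm (grad f X))\<^sup>2" b, OF eventually_mono[OF AE_grad(1)[OF f]], simplified]
    using i by simp
  then show ?thesis unfolding finite_weighted_energy_def using AE_grad(2)[OF f] by simp
qed

text \<open>The integrands are compared pointwise in three regions. Inside, \<open>Gv = G1\<close>
  gives equality; outside, both sides vanish; in the annulus \<open>A\<close>, which straddles |X| =
  1, nonnegativity of the energy densities covers the parts on either side.\<close>

lemma energy_comparison:
  fixes G1 G2 Gv :: "(real ^ 'n) \<times> real \<Rightarrow> (real ^ 'n) \<times> real"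
  defines "E \<equiv> \<lambda>b G X. snd X powr b * (norm (G X :: (real ^ 'n) \<times> real))\<^sup>2"
  assumes i1: "set_integrable lborel (half_ball (3 / 2)) (E b G1)" and i2: "set_integrable lborel (half_ball (3 / 2)) (E b G2)"
    and iv: "set_integrable lborel (half_ball (3 / 2)) (E b Gv)" and iR: "set_integrable lborel A R"
    and A: "A = half_ball (1 + \<epsilon>) - half_ball (1 - \<epsilon>)" and \<epsilon>: "0 < \<epsilon>" "\<epsilon> < 1 / 4" and K: "K \<ge> 0"
    and R: "\<And>X. X \<in> A \<Longrightarrow> R X \<ge> 0"
    and ins: "\<And>X. X \<in> half_space \<Longrightarrow> norm X < 1 - \<epsilon> \<Longrightarrow> Gv X = G1 X"
    and out: "\<And>X. X \<in> half_space \<Longrightarrow> norm X \<ge> 1 + \<epsilon> \<Longrightarrow> Gv X = G2 X"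
    and mid: "\<And>X. X \<in> A \<Longrightarrow> E b Gv X \<le> K * (E b G1 X + E b G2 X) + R X"
  shows "(LINT X:half_ball (3 / 2)|lborel. E b Gv X - E b G2 X) \<le>
     (LINT X:half_ball 1|lborel. E b G1 X - E b G2 X) + (LINT X:A|lborel. R X) + (K + 1) * (LINT X:A|lborel. E b G1 X + E b G2 X)"
proof -
  have Eb: "E b G X \<ge> 0" for G X unfolding E_def by simp
  have s1: "half_ball 1 \<in> sets (lborel :: ((real ^ 'n) \<times> real) measure)" by simp
  have sA: "A \<in> sets (lborel :: ((real ^ 'n) \<times> real) measure)" unfolding A by simp
  have sub: "half_ball 1 \<subseteq> half_ball (3 / 2)" "A \<subseteq> half_ball (3 / 2)" using \<epsilon> unfolding A half_ball_def by auto
  note j = set_integrable_subset[OF _ s1 sub(1)] set_integrable_subset[OF _ sA sub(2)]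
  have L: "set_integrable lborel (half_ball (3 / 2)) (\<lambda>X. E b Gv X - E b G2 X)"
    "set_integrable lborel (half_ball 1) (\<lambda>X. E b G1 X - E b G2 X)"
    "set_integrable lborel A (\<lambda>X. E b G1 X + E b G2 X)"
    using i1 i2 iv j by auto
  have "(LINT X:half_ball (3 / 2)|lborel. E b Gv X - E b G2 X) \<le>
     (LINT X|lborel. indicator (half_ball 1) X *\<^sub>R (E b G1 X - E b G2 X) + indicator A X *\<^sub>R R X + (K + 1) * (indicator A X *\<^sub>R (E b G1 X + E b G2 X)))"
    unfolding set_lebesgue_integral_def
  proof (rule integral_mono)
    show "integrable lborel (\<lambda>X. indicator (half_ball (3 / 2)) X *\<^sub>R (E b Gv X - E b G2 X))"
      using L(1) unfolding set_integrable_def .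
    show "integrable lborel (\<lambda>X. indicator (half_ball 1) X *\<^sub>R (E b G1 X - E b G2 X) + indicator A X *\<^sub>R R X + (K + 1) * (indicator A X *\<^sub>R (E b G1 X + E b G2 X)))"
      using L(2,3) iR unfolding set_integrable_def
      by (intro Bochner_Integration.integrable_add integrable_mult_right)
    fix X :: "(real ^ 'n) \<times> real"
    note e = Eb[of Gv X] Eb[of G1 X] Eb[of G2 X]
    have KE: "0 \<le> K * (E b G1 X + E b G2 X)" using K e by simp
    show "indicator (half_ball (3 / 2)) X *\<^sub>R (E b Gv X - E b G2 X) \<le>
        indicator (half_ball 1) X *\<^sub>R (E b G1 X - E b G2 X) + indicator A X *\<^sub>R R X + (K + 1) * (indicator A X *\<^sub>R (E b G1 X + E b G2 X))"
    proof (cases "X \<in> half_ball (3 / 2)")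
      case False
      then have "X \<notin> half_ball 1" "X \<notin> A" using sub by auto
      then show ?thesis using False by simp
    next
      case True
      then have H: "X \<in> half_space" by (simp add: half_ball_def)
      consider "norm X < 1 - \<epsilon>" | "X \<in> A" | "norm X \<ge> 1 + \<epsilon>" using H unfolding A half_ball_def by force
      then show ?thesis
      proof cases
        case 1
        then have "X \<in> half_ball 1" "X \<notin> A" using H \<epsilon> unfolding A half_ball_def by auto
        moreover have "E b Gv X = E b G1 X" unfolding E_def using ins[OF H 1] by simp
        ultimately show ?thesis using True by simp
      next
        case 2
        then show ?thesis using True mid[OF 2] R[OF 2] e KE by (cases "X \<in> half_ball 1") (auto simp: distrib_right)
      next
        case 3
        then have "X \<notin> half_ball 1" "X \<notin> A" using H \<epsilon> unfolding A half_ball_def by auto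
        moreover have "E b Gv X = E b G2 X" unfolding E_def using out[OF H 3] by simp
        ultimately show ?thesis by simp
      qed
    qed
  qed
  also have "\<dots> = (LINT X:half_ball 1|lborel. E b G1 X - E b G2 X) + (LINT X:A|lborel. R X) + (K + 1) * (LINT X:A|lborel. E b G1 X + E b G2 X)"
    using L(2,3) iR unfolding set_integrable_def set_lebesgue_integral_def by simp
  finally show ?thesis .
qed

text \<open>Common frame for both gluings: the slices of \<open>v\<close> differ from
  \<open>g\<close> by the errors of the two given traces and by a remainder \<open>r\<close>, which
  collects the change of the cutoffs between height \<open>z\<close> and the boundary.\<close>

lemma has_trace_approx:
  fixes v w1 w2 :: "(real ^ 'n) \<times> real \<Rightarrow> real" and g f1 f2 :: "real ^ 'n \<Rightarrow> real"
  assumes w1: "has_trace w1 f1" and w2: "has_trace w2 f2"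
    and vm: "\<And>z. z > 0 \<Longrightarrow> (\<lambda>x. v (x, z)) \<in> borel_measurable lebesgue" and gm: "g \<in> borel_measurable lebesgue"
    and g: "\<And>x. \<bar>g x\<bar> \<le> L * (\<bar>f1 x\<bar> + \<bar>f2 x\<bar>)"
    and ri: "\<And>K z. compact K \<Longrightarrow> z > 0 \<Longrightarrow> set_integrable lebesgue K (r z)"
    and rl: "\<And>K. compact K \<Longrightarrow> ((\<lambda>z. LINT x:K|lebesgue. r z x) \<longlongrightarrow> 0) (at_right 0)"
    and b: "\<And>x z. z > 0 \<Longrightarrow> \<bar>v (x, z) - g x\<bar> \<le> L * (\<bar>w1 (x, z) - f1 x\<bar> + \<bar>w2 (x, z) - f2 x\<bar>) + r z x"
  shows "has_trace v g"
  unfolding has_trace_def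
proof (intro allI impI)
  fix K :: "(real ^ 'n) set" assume K: "compact K"
  have KL: "K \<in> sets lebesgue" using borel_compact[OF K] by simp
  have im: "(\<lambda>x. indicator K x *\<^sub>R h x) \<in> borel_measurable lebesgue" if "h \<in> borel_measurable lebesgue" for h :: "real ^ 'n \<Rightarrow> real"
    using KL that by (intro borel_measurable_scaleR borel_measurable_indicator)
  have T1: "set_integrable lebesgue K f1" "\<forall>\<^sub>F z in at_right 0. set_integrable lebesgue K (\<lambda>x. w1 (x, z))"
    "((\<lambda>z. LINT x:K|lebesgue. \<bar>w1 (x, z) - f1 x\<bar>) \<longlongrightarrow> 0) (at_right 0)"
    using w1 K unfolding has_trace_def by auto
  have T2: "set_integrable lebesgue K f2" "\<forall>\<^sub>F z in at_right 0. set_integrable lebesgue K (\<lambda>x. w2 (x, z))"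
    "((\<lambda>z. LINT x:K|lebesgue. \<bar>w2 (x, z) - f2 x\<bar>) \<longlongrightarrow> 0) (at_right 0)"
    using w2 K unfolding has_trace_def by auto
  have abs_i: "set_integrable lebesgue K (\<lambda>x. \<bar>h x\<bar>)" if "set_integrable lebesgue K h" for h :: "real ^ 'n \<Rightarrow> real"
    using set_integrable_abs[OF that] .
  have dom: "set_integrable lebesgue K h" if "h \<in> borel_measurable lebesgue" "set_integrable lebesgue K u" "\<And>x. \<bar>h x\<bar> \<le> u x" for h u :: "real ^ 'n \<Rightarrow> real"
    unfolding set_integrable_def
    by (rule Bochner_Integration.integrable_bound[OF that(2)[unfolded set_integrable_def] im[OF that(1)]])
      (use that(3) in \<open>auto intro!: AE_I2 order_trans[OF _ abs_ge_self] simp: indicator_def\<close>)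
  have gi: "set_integrable lebesgue K g"
    by (rule dom[OF gm _ g]) (intro set_integrable_mult_right set_integral_add(1) abs_i T1(1) T2(1))
  have ev: "\<forall>\<^sub>F z in at_right 0. (z :: real) > 0" by (simp add: eventually_at_right_less)
  have main: "\<forall>\<^sub>F z in at_right 0. set_integrable lebesgue K (\<lambda>x. v (x, z)) \<and>
     (LINT x:K|lebesgue. \<bar>v (x, z) - g x\<bar>) \<le>
       L * ((LINT x:K|lebesgue. \<bar>w1 (x, z) - f1 x\<bar>) + (LINT x:K|lebesgue. \<bar>w2 (x, z) - f2 x\<bar>)) + (LINT x:K|lebesgue. r z x)"
    using T1(2) T2(2) ev
  proof eventually_elim
    case (elim z)
    have i1: "set_integrable lebesgue K (\<lambda>x. \<bar>w1 (x, z) - f1 x\<bar>)" by (intro abs_i set_integral_diff(1) elim T1)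
    have i2: "set_integrable lebesgue K (\<lambda>x. \<bar>w2 (x, z) - f2 x\<bar>)" by (intro abs_i set_integral_diff(1) elim T2)
    have u: "set_integrable lebesgue K (\<lambda>x. L * (\<bar>w1 (x, z) - f1 x\<bar> + \<bar>w2 (x, z) - f2 x\<bar>) + r z x)"
      by (intro set_integral_add(1) set_integrable_mult_right i1 i2 ri K elim)
    have di: "set_integrable lebesgue K (\<lambda>x. v (x, z) - g x)"
      by (rule dom[OF _ u b]) (use vm gm elim in auto)
    have "set_integrable lebesgue K (\<lambda>x. (v (x, z) - g x) + g x)" by (intro set_integral_add(1) di gi)
    then have vi: "set_integrable lebesgue K (\<lambda>x. v (x, z))" by simp
    have "(LINT x:K|lebesgue. \<bar>v (x, z) - g x\<bar>) \<le> (LINT x:K|lebesgue. L * (\<bar>w1 (x, z) - f1 x\<bar> + \<bar>w2 (x, z) - f2 x\<bar>) + r z x)"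
      by (intro set_integral_mono abs_i di u b elim)
    also have "\<dots> = L * ((LINT x:K|lebesgue. \<bar>w1 (x, z) - f1 x\<bar>) + (LINT x:K|lebesgue. \<bar>w2 (x, z) - f2 x\<bar>)) + (LINT x:K|lebesgue. r z x)"
    proof -
      have a: "set_integrable lebesgue K (\<lambda>x. \<bar>w1 (x, z) - f1 x\<bar> + \<bar>w2 (x, z) - f2 x\<bar>)" by (intro set_integral_add(1) i1 i2)
      show ?thesis
        using set_integral_add(2)[OF set_integrable_mult_right[of L, OF a] ri[OF K elim(3)]] set_integral_add(2)[OF i1 i2] by simp
    qed
    finally show ?case using vi by simp
  qed
  have lim: "((\<lambda>z. L * ((LINT x:K|lebesgue. \<bar>w1 (x, z) - f1 x\<bar>) + (LINT x:K|lebesgue. \<bar>w2 (x, z) - f2 x\<bar>)) + (LINT x:K|lebesgue. r z x)) \<longlongrightarrow> L * (0 + 0) + 0) (at_right 0)"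
    by (intro tendsto_intros T1(3) T2(3) rl K)
  have "((\<lambda>z. LINT x:K|lebesgue. \<bar>v (x, z) - g x\<bar>) \<longlongrightarrow> 0) (at_right 0)"
  proof (rule tendsto_sandwich[OF _ _ tendsto_const lim[simplified]])
    show "\<forall>\<^sub>F z in at_right 0. 0 \<le> (LINT x:K|lebesgue. \<bar>v (x, z) - g x\<bar>)"
      unfolding set_lebesgue_integral_def by (intro always_eventually allI integral_nonneg_AE) auto
  qed (use main in \<open>auto elim: eventually_mono\<close>)
  then show "set_integrable lebesgue K g \<and> (\<forall>\<^sub>F z in at_right 0. set_integrable lebesgue K (\<lambda>x. v (x, z))) \<and>
     ((\<lambda>z. LINT x:K|lebesgue. \<bar>v (x, z) - g x\<bar>) \<longlongrightarrow> 0) (at_right 0)"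
    using gi main by (auto elim: eventually_mono)
qed

text \<open>The boundary values of the cutoff jump on the unit sphere, so convergence of its slices
  is claimed off this null set.\<close>

lemma AE_norm_neq_1: "AE x in lebesgue. norm (x :: 'a::euclidean_space) \<noteq> 1"
proof -
  have "negligible (frontier (cball (0 :: 'a) 1))" by (rule negligible_convex_frontier[OF convex_cball])
  then have "{x :: 'a. norm x = 1} \<in> null_sets lebesgue"
    by (simp add: negligible_iff_null_sets frontier_cball sphere_def)
  from AE_not_in[OF this] show ?thesis by simp
qed

lemma slice_measurable:
  fixes v :: "(real ^ 'n) \<times> real \<Rightarrow> real"
  assumes v: "c1_limit half_space v G" and z: "z > 0"
  shows "(\<lambda>x. v (x, z)) \<in> borel_measurable borel"
proof -
  have "(\<lambda>x :: real ^ 'n. (x, z)) \<in> borel_measurable borel"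
    by (intro borel_measurable_continuous_onI continuous_intros)
  from measurable_compose[OF this c1_limit_measurable(1)[OF v open_half_space]]
  show ?thesis using z by (simp add: half_space_def)
qed

text \<open>Below the height \<open>||x| - 1|\<close> the second ramp is exactly 0 or 1, so the
  deviation comes from terms with the coefficient \<eta>, which is at most
  \<open>z / (\<epsilon> / 2)\<close>.\<close>

lemma cutoff_boundary:
  fixes x :: "real ^ 'n"
  assumes \<epsilon>: "0 < \<epsilon>" "\<epsilon> < 1 / 4" and z: "0 < z" "z < \<bar>norm x - 1\<bar>"
  shows "\<bar>cutoff \<epsilon> (x, z) - (if norm x < 1 then 0 else 1)\<bar> \<le> z / (\<epsilon> / 2)"
proof -
  define e where "e = \<epsilon> / 2"
  have e: "e > 0" using \<epsilon> by (simp add: e_def)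
  define p where "p = (if norm (x, z) < 1 - e then 0 else if norm (x, z) < 1 + e then (norm (x, z) - 1 + e) / (2 * e) else 1)"
  have "p = clamp01 ((norm (x, z) - 1 + e) / (2 * e))" unfolding p_def using e by (auto simp: clamp01_eq field_simps)
  then have p: "0 \<le> p" "p \<le> 1" using clamp01_bounds by auto
  define t where "t = min (z / e) 1"
  have t: "0 \<le> t" "t \<le> z / e" unfolding t_def using z e by auto
  have tp: "t * p \<le> t * 1" "0 \<le> t * p" using t p mult_left_mono[OF p(2) t(1)] by auto
  show ?thesis
  proof (cases "norm x < 1")
    case True
    then have "cutoff \<epsilon> (x, z) = t * p"
      using z unfolding cutoff_def Let_def e_def[symmetric] p_def t_def by simp
    then show ?thesis using True tp t unfolding e_def[symmetric] by simp
  next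
    case False
    then have "cutoff \<epsilon> (x, z) = t * p + (1 - t)"
      using z unfolding cutoff_def Let_def e_def[symmetric] p_def t_def by simp
    then show ?thesis using False tp t unfolding e_def[symmetric] by simp
  qed
qed

lemma has_trace_cutoff_blend:
  fixes U1 U2 :: "(real ^ 'n) \<times> real \<Rightarrow> real" and f1 f2 :: "real ^ 'n \<Rightarrow> real"
  assumes \<epsilon>: "0 < \<epsilon>" "\<epsilon> < 1 / 4" and U1: "has_trace U1 f1" and U2: "has_trace U2 f2"
    and f: "f1 \<in> borel_measurable lebesgue" "f2 \<in> borel_measurable lebesgue" "\<And>x. \<bar>f1 x\<bar> \<le> 1" "\<And>x. \<bar>f2 x\<bar> \<le> 1"
    and V: "c1_limit half_space (\<lambda>X. (1 - cutoff \<epsilon> X) * U1 X + cutoff \<epsilon> X * U2 X) GV"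
  shows "has_trace (\<lambda>X. (1 - cutoff \<epsilon> X) * U1 X + cutoff \<epsilon> X * U2 X) (\<lambda>x. if norm x < 1 then f1 x else f2 x)"
proof -
  define \<theta> where "\<theta> x = (if norm (x :: real ^ 'n) < 1 then 0 else 1 :: real)" for x
  \<comment> \<open>The factor 2 bounds \<open>|f2 - f1|\<close> for data of modulus at most 1. The
    rate of convergence degenerates near |x| = 1, which is why the integral of \<open>r\<close> is
    handled by dominated convergence.\<close>
  define r where "r z x = 2 * \<bar>cutoff \<epsilon> (x, z) - \<theta> x\<bar>" for z x
  have \<theta>m: "\<theta> \<in> borel_measurable borel" unfolding \<theta>_def by measurable
  have rm: "r z \<in> borel_measurable borel" if "z > 0" for z
    using slice_measurable[OF c1_limit_cutoff[OF \<epsilon>] that] \<theta>m unfolding r_def by measurable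
  have r2: "0 \<le> r z x" "r z x \<le> 2" if "z > 0" for z x
    using cutoff_bounds[OF \<epsilon>, of "(x, z)"] that unfolding r_def \<theta>_def by (auto simp: half_space_def)
  have K2: "integrable lborel (\<lambda>x. indicator K x *\<^sub>R (2 :: real))" if "compact K" for K :: "(real ^ 'n) set"
    using borel_integrable_compact[OF that, of "\<lambda>_. 2 :: real"] by simp
  have Krm: "(\<lambda>x. indicator K x *\<^sub>R r z x) \<in> borel_measurable borel" if "compact K" "z > 0" for K z
    using borel_compact[OF that(1)] rm[OF that(2)] by (intro borel_measurable_scaleR borel_measurable_indicator) auto
  show ?thesis
  proof (rule has_trace_approx[OF U1 U2, where L=1 and r=r])
    show "(\<lambda>x. (1 - cutoff \<epsilon> (x, z)) * U1 (x, z) + cutoff \<epsilon> (x, z) * U2 (x, z)) \<in> borel_measurable lebesgue" if "z > 0" for z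
      by (rule measurable_completion) (use slice_measurable[OF V that] in simp)
    show "(\<lambda>x. if norm x < 1 then f1 x else f2 x) \<in> borel_measurable lebesgue"
    proof (rule measurable_If[OF f(1,2)])
      have "{x :: real ^ 'n. norm x < 1} = ball 0 1" by auto
      then show "{x \<in> space (lebesgue :: (real ^ 'n) measure). norm x < 1} \<in> sets lebesgue" by simp
    qed
    show "\<bar>if norm x < 1 then f1 x else f2 x\<bar> \<le> 1 * (\<bar>f1 x\<bar> + \<bar>f2 x\<bar>)" for x by simp
    show "set_integrable lebesgue K (r z)" if K: "compact K" and z: "z > 0" for K z
      unfolding set_integrable_lebesgue_eq(1)[OF Krm[OF K z]]
      unfolding set_integrable_def
      by (rule Bochner_Integration.integrable_bound[OF K2[OF K]])
        (use Krm[OF K z] r2[OF z] in \<open>auto simp: indicator_def\<close>)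
    show "((\<lambda>z. LINT x:K|lebesgue. r z x) \<longlongrightarrow> 0) (at_right 0)" if K: "compact K" for K
      unfolding tendsto_at_iff_sequentially o_def
    proof (intro allI impI)
      fix zs :: "nat \<Rightarrow> real" assume zs: "\<forall>i. zs i \<in> {0<..} - {0}" "zs \<longlonglongrightarrow> 0"
      then have zp: "zs i > 0" for i by auto
      have "(\<lambda>i. LINT x|lebesgue. indicator K x *\<^sub>R r (zs i) x) \<longlonglongrightarrow> (LINT x|(lebesgue :: (real ^ 'n) measure). (0 :: real))"
      proof (rule integral_dominated_convergence[where w="\<lambda>x. indicator K x *\<^sub>R 2"])
        show "integrable lebesgue (\<lambda>x. indicator K x *\<^sub>R (2 :: real))"
          by (rule integrable_completion[THEN iffD2]) (use K2[OF K] in \<open>auto dest: borel_measurable_integrable\<close>)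
        show "(\<lambda>x. indicator K x *\<^sub>R r (zs i) x) \<in> borel_measurable lebesgue" for i
          by (rule measurable_completion) (use Krm[OF K zp] in simp)
        show "AE x in lebesgue. norm (indicator K x *\<^sub>R r (zs i) x) \<le> indicator K x *\<^sub>R 2" for i
          using r2[OF zp] by (auto simp: indicator_def)
        show "AE x in lebesgue. (\<lambda>i. indicator K x *\<^sub>R r (zs i) x) \<longlonglongrightarrow> 0"
          using AE_norm_neq_1
        proof eventually_elim
          case (elim x)
          then have d: "\<bar>norm x - 1\<bar> > 0" by simp
          have "(\<lambda>i. r (zs i) x) \<longlonglongrightarrow> 0"
          proof (rule tendsto_sandwich[of "\<lambda>_. 0" _ _ "\<lambda>i. 2 * (zs i / (\<epsilon> / 2))"])
            show "\<forall>\<^sub>F i in sequentially. 0 \<le> r (zs i) x" by (simp add: r_def)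
            have ev: "\<forall>\<^sub>F i in sequentially. zs i < \<bar>norm x - 1\<bar>" using order_tendstoD(2)[OF zs(2) d] .
            have rb: "r (zs i) x \<le> 2 * (zs i / (\<epsilon> / 2))" if "zs i < \<bar>norm x - 1\<bar>" for i
              unfolding r_def \<theta>_def by (rule mult_left_mono[OF cutoff_boundary[OF \<epsilon> zp that]]) simp
            show "\<forall>\<^sub>F i in sequentially. r (zs i) x \<le> 2 * (zs i / (\<epsilon> / 2))"
              by (rule eventually_mono[OF ev rb])
            have "(\<lambda>i. 2 * (zs i / (\<epsilon> / 2))) \<longlonglongrightarrow> 2 * (0 / (\<epsilon> / 2))" using \<epsilon> by (intro tendsto_intros zs(2)) auto
            then show "(\<lambda>i. 2 * (zs i / (\<epsilon> / 2))) \<longlonglongrightarrow> 0" by simp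
          qed simp
          then show ?case by (auto simp: indicator_def)
        qed
      qed auto
      then show "(\<lambda>i. LINT x:K|lebesgue. r (zs i) x) \<longlonglongrightarrow> 0" by (simp add: set_lebesgue_integral_def)
    qed
    show "\<bar>(1 - cutoff \<epsilon> (x, z)) * U1 (x, z) + cutoff \<epsilon> (x, z) * U2 (x, z) - (if norm x < 1 then f1 x else f2 x)\<bar>
        \<le> 1 * (\<bar>U1 (x, z) - f1 x\<bar> + \<bar>U2 (x, z) - f2 x\<bar>) + r z x" if z: "z > 0" for x z
    proof -
      define t where "t = cutoff \<epsilon> (x, z)"
      have t: "0 \<le> t" "t \<le> 1" using cutoff_bounds[OF \<epsilon>, of "(x, z)"] z unfolding t_def by (auto simp: half_space_def)
      have e: "(1 - t) * U1 (x, z) + t * U2 (x, z) - (if norm x < 1 then f1 x else f2 x)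
         = (1 - t) * (U1 (x, z) - f1 x) + t * (U2 (x, z) - f2 x) + (t - \<theta> x) * (f2 x - f1 x)"
        by (simp add: \<theta>_def algebra_simps)
      have "\<bar>(1 - t) * (U1 (x, z) - f1 x)\<bar> \<le> 1 * \<bar>U1 (x, z) - f1 x\<bar>" "\<bar>t * (U2 (x, z) - f2 x)\<bar> \<le> 1 * \<bar>U2 (x, z) - f2 x\<bar>"
        unfolding abs_mult using t by (intro mult_right_mono; simp)+
      moreover have "\<bar>(t - \<theta> x) * (f2 x - f1 x)\<bar> \<le> \<bar>t - \<theta> x\<bar> * 2"
        unfolding abs_mult using f(3)[of x] f(4)[of x] by (intro mult_left_mono) auto
      moreover have "\<bar>A + B + C\<bar> \<le> A' + B' + C'" if "\<bar>A\<bar> \<le> A'" "\<bar>B\<bar> \<le> B'" "\<bar>C\<bar> \<le> C'" for A B C A' B' C' :: real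
        using that by linarith
      ultimately show ?thesis unfolding t_def[symmetric] e r_def by fastforce
    qed
  qed
qed

lemma glue_measurable:
  fixes f1 f2 :: "real ^ 'n \<Rightarrow> real"
  assumes [measurable]: "f1 \<in> borel_measurable lebesgue" "f2 \<in> borel_measurable lebesgue"
  shows "glue \<epsilon> f1 f2 \<in> borel_measurable lebesgue"
proof -
  have "inner_cutoff \<epsilon> \<in> borel_measurable (borel :: (real ^ 'n) measure)" "outer_cutoff \<epsilon> \<in> borel_measurable (borel :: (real ^ 'n) measure)"
    unfolding inner_cutoff_def outer_cutoff_def smooth_step_def pos_part_sq_def by measurable
  then have [measurable]: "inner_cutoff \<epsilon> \<in> borel_measurable (lebesgue :: (real ^ 'n) measure)" "outer_cutoff \<epsilon> \<in> borel_measurable (lebesgue :: (real ^ 'n) measure)"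
    by (auto intro: measurable_completion)
  show ?thesis unfolding glue_def common_part_def by measurable
qed

text \<open>\<open>L = 10\<close> is 1 from a cutoff plus 9 from the Lipschitz constant of the
  common part. For the remainder, |X| and |x| differ by at most \<open>z\<close>, so each of the two
  cutoffs changes by at most \<open>2 z / \<epsilon>\<close>; it multiplies a difference of size at
  most \<open>2 (|f1| + |f2|)\<close>, which gives the factor 8.\<close>

lemma has_trace_glue:
  fixes w1 w2 :: "(real ^ 'n) \<times> real \<Rightarrow> real" and f1 f2 :: "real ^ 'n \<Rightarrow> real"
  assumes \<epsilon>: "0 < \<epsilon>" and w1: "has_trace w1 f1" and w2: "has_trace w2 f2"
    and f: "f1 \<in> borel_measurable lebesgue" "f2 \<in> borel_measurable lebesgue"
    and v: "c1_limit half_space (glue \<epsilon> w1 w2) Gv"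
  shows "has_trace (glue \<epsilon> w1 w2) (glue \<epsilon> f1 f2)"
proof (rule has_trace_approx[OF w1 w2, where L=10 and r="\<lambda>z x. (8 * z / \<epsilon>) * (\<bar>f1 x\<bar> + \<bar>f2 x\<bar>)"])
  show "(\<lambda>x. glue \<epsilon> w1 w2 (x, z)) \<in> borel_measurable lebesgue" if "z > 0" for z
    by (rule measurable_completion) (use slice_measurable[OF v that] in simp)
  show "glue \<epsilon> f1 f2 \<in> borel_measurable lebesgue" by (rule glue_measurable[OF f])
  have cb: "\<bar>common_part 0 (f1 x) (f2 x)\<bar> \<le> \<bar>f1 x\<bar> + \<bar>f2 x\<bar>" for x by (rule common_part_bound) simp
  show "\<bar>glue \<epsilon> f1 f2 x\<bar> \<le> 10 * (\<bar>f1 x\<bar> + \<bar>f2 x\<bar>)" for x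
  proof -
    note b = cutoff_pair_bounds[OF \<epsilon>, of x]
    have "\<bar>inner_cutoff \<epsilon> x * f1 x\<bar> \<le> 1 * \<bar>f1 x\<bar>" "\<bar>outer_cutoff \<epsilon> x * f2 x\<bar> \<le> 1 * \<bar>f2 x\<bar>"
      "\<bar>(1 - inner_cutoff \<epsilon> x - outer_cutoff \<epsilon> x) * common_part 0 (f1 x) (f2 x)\<bar> \<le> 1 * (\<bar>f1 x\<bar> + \<bar>f2 x\<bar>)"
      unfolding abs_mult by (rule mult_mono; use b cb[of x] in simp)+
    then have "\<bar>glue \<epsilon> f1 f2 x\<bar> \<le> 1 * \<bar>f1 x\<bar> + 1 * \<bar>f2 x\<bar> + 1 * (\<bar>f1 x\<bar> + \<bar>f2 x\<bar>)"
      unfolding glue_def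
      by (intro order_trans[OF abs_triangle_ineq] add_mono order_trans[OF abs_triangle_ineq[of "_ * f1 x"]])
    then show ?thesis by simp
  qed
  have fi: "set_integrable lebesgue K (\<lambda>x. \<bar>f1 x\<bar> + \<bar>f2 x\<bar>)" if "compact K" for K
    using w1 w2 that unfolding has_trace_def by (intro set_integral_add(1) set_integrable_abs) auto
  then show "set_integrable lebesgue K (\<lambda>x. (8 * z / \<epsilon>) * (\<bar>f1 x\<bar> + \<bar>f2 x\<bar>))" if "compact K" "z > 0" for K z
    using that by (intro set_integrable_mult_right) auto
  show "((\<lambda>z. LINT x:K|lebesgue. (8 * z / \<epsilon>) * (\<bar>f1 x\<bar> + \<bar>f2 x\<bar>)) \<longlongrightarrow> 0) (at_right 0)" if "compact K" for K
  proof -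
    have "((\<lambda>z. (8 * z / \<epsilon>) * (LINT x:K|lebesgue. \<bar>f1 x\<bar> + \<bar>f2 x\<bar>)) \<longlongrightarrow> (8 * 0 / \<epsilon>) * (LINT x:K|lebesgue. \<bar>f1 x\<bar> + \<bar>f2 x\<bar>)) (at_right 0)"
      using \<epsilon> by (intro tendsto_intros) auto
    then show ?thesis by simp
  qed
  show "\<bar>glue \<epsilon> w1 w2 (x, z) - glue \<epsilon> f1 f2 x\<bar> \<le> 10 * (\<bar>w1 (x, z) - f1 x\<bar> + \<bar>w2 (x, z) - f2 x\<bar>) + 8 * z / \<epsilon> * (\<bar>f1 x\<bar> + \<bar>f2 x\<bar>)"
    if z: "z > 0" for x z
  proof -
    define p q p0 q0 where "p = inner_cutoff \<epsilon> (x, z)" and "q = outer_cutoff \<epsilon> (x, z)" and "p0 = inner_cutoff \<epsilon> x" and "q0 = outer_cutoff \<epsilon> x"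
    define a b h h0 where "a = w1 (x, z)" and "b = w2 (x, z)" and "h = common_part 0 (w1 (x, z)) (w2 (x, z))" and "h0 = common_part 0 (f1 x) (f2 x)"
    note bb = cutoff_pair_bounds[OF \<epsilon>, of "(x, z)", folded p_def q_def]
    have n: "\<bar>norm (x, z) - norm x\<bar> \<le> z"
      using norm_Pair_le[of x z] norm_fst_le[of x z] z by auto
    have l: "\<bar>smooth_step (s / \<epsilon>) - smooth_step (t / \<epsilon>)\<bar> \<le> 2 * z / \<epsilon>" if "\<bar>s - t\<bar> \<le> z" for s t
    proof -
      have "\<bar>s / \<epsilon> - t / \<epsilon>\<bar> \<le> z / \<epsilon>" using that \<epsilon> by (simp add: diff_divide_distrib[symmetric] abs_divide divide_right_mono)
      then show ?thesis using smooth_step_lipschitz[of "s / \<epsilon>" "t / \<epsilon>"] by simp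
    qed
    have pp: "\<bar>p - p0\<bar> \<le> 2 * z / \<epsilon>" "\<bar>q - q0\<bar> \<le> 2 * z / \<epsilon>"
      unfolding p_def q_def p0_def q0_def inner_cutoff_def outer_cutoff_def using n by (intro l; simp add: abs_minus_commute)+
    have hh: "\<bar>h - h0\<bar> \<le> 9 * \<bar>a - f1 x\<bar> + 9 * \<bar>b - f2 x\<bar>" unfolding h_def h0_def a_def b_def by (rule common_part_lipschitz)
    have h0: "\<bar>h0\<bar> \<le> \<bar>f1 x\<bar> + \<bar>f2 x\<bar>" unfolding h0_def by (rule cb)
    have e: "glue \<epsilon> w1 w2 (x, z) - glue \<epsilon> f1 f2 x = p * (a - f1 x) + q * (b - f2 x) + (1 - p - q) * (h - h0) + (p - p0) * (f1 x - h0) + (q - q0) * (f2 x - h0)"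
      unfolding glue_def p_def q_def p0_def q0_def a_def b_def h_def h0_def by (simp add: algebra_simps)
    have 1: "\<bar>p * (a - f1 x)\<bar> \<le> 1 * \<bar>a - f1 x\<bar>" "\<bar>q * (b - f2 x)\<bar> \<le> 1 * \<bar>b - f2 x\<bar>"
      "\<bar>(1 - p - q) * (h - h0)\<bar> \<le> 1 * (9 * \<bar>a - f1 x\<bar> + 9 * \<bar>b - f2 x\<bar>)"
      unfolding abs_mult by (rule mult_mono; use bb hh in simp)+
    have 2: "\<bar>(p - p0) * (f1 x - h0)\<bar> \<le> 2 * z / \<epsilon> * (2 * (\<bar>f1 x\<bar> + \<bar>f2 x\<bar>))" "\<bar>(q - q0) * (f2 x - h0)\<bar> \<le> 2 * z / \<epsilon> * (2 * (\<bar>f1 x\<bar> + \<bar>f2 x\<bar>))"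
      unfolding abs_mult using pp h0 z \<epsilon> by (intro mult_mono; auto)+
    have 3: "2 * z / \<epsilon> * (2 * (\<bar>f1 x\<bar> + \<bar>f2 x\<bar>)) + 2 * z / \<epsilon> * (2 * (\<bar>f1 x\<bar> + \<bar>f2 x\<bar>)) = 8 * z / \<epsilon> * (\<bar>f1 x\<bar> + \<bar>f2 x\<bar>)"
      by (simp add: algebra_simps add_divide_distrib)
    have tri: "\<bar>A + B + C + D + E\<bar> \<le> A' + B' + C' + D' + E'"
      if "\<bar>A\<bar> \<le> A'" "\<bar>B\<bar> \<le> B'" "\<bar>C\<bar> \<le> C'" "\<bar>D\<bar> \<le> D'" "\<bar>E\<bar> \<le> E'" for A B C D E A' B' C' D' E' :: real
      using that by linarith
    have fin: "1 * \<alpha> + 1 * \<beta> + 1 * (9 * \<alpha> + 9 * \<beta>) + T + T \<le> 10 * (\<alpha> + \<beta>) + (T + T)" for \<alpha> \<beta> T :: real by simp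
    show ?thesis unfolding e a_def[symmetric] b_def[symmetric] 3[symmetric] by (rule order_trans[OF tri[OF 1 2] fin])
  qed
qed

text \<open>On each side of |x| = 1 one cutoff vanishes, so the value is a convex combination of one
  of the functions and the common part, which never has the opposite sign.\<close>

lemma glue_sign:
  fixes f1 f2 :: "real ^ 'n \<Rightarrow> real"
  assumes \<epsilon>: "\<epsilon> > 0"
  shows "norm x < 1 \<Longrightarrow> f1 x \<ge> 0 \<Longrightarrow> glue \<epsilon> f1 f2 x \<ge> 0" "norm x < 1 \<Longrightarrow> f1 x \<le> 0 \<Longrightarrow> glue \<epsilon> f1 f2 x \<le> 0"
    "norm x \<ge> 1 \<Longrightarrow> f2 x \<ge> 0 \<Longrightarrow> glue \<epsilon> f1 f2 x \<ge> 0" "norm x \<ge> 1 \<Longrightarrow> f2 x \<le> 0 \<Longrightarrow> glue \<epsilon> f1 f2 x \<le> 0"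
proof -
  note b = cutoff_pair_bounds[OF \<epsilon>, of x]
  have o: "outer_cutoff \<epsilon> x = 0" if "norm x < 1"
  proof -
    have "(norm x - 1) / \<epsilon> \<le> 0" using that \<epsilon> by (intro divide_nonpos_pos) auto
    then show ?thesis by (simp add: outer_cutoff_def smooth_step_0)
  qed
  have i: "inner_cutoff \<epsilon> x = 0" if "norm x \<ge> 1"
  proof -
    have "(1 - norm x) / \<epsilon> \<le> 0" using that \<epsilon> by (intro divide_nonpos_pos) auto
    then show ?thesis by (simp add: inner_cutoff_def smooth_step_0)
  qed
  note c = common_part_sign(1)[of "f1 x" "f2 x"] common_part_sign(2)[of "f1 x" "f2 x"]
    common_part_sign(1)[of "f2 x" "f1 x", unfolded common_part_commute[of 0 "f2 x"]]
    common_part_sign(2)[of "f2 x" "f1 x", unfolded common_part_commute[of 0 "f2 x"]]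
  show "norm x < 1 \<Longrightarrow> f1 x \<ge> 0 \<Longrightarrow> glue \<epsilon> f1 f2 x \<ge> 0"
    using b c by (simp add: glue_def o)
  show "norm x < 1 \<Longrightarrow> f1 x \<le> 0 \<Longrightarrow> glue \<epsilon> f1 f2 x \<le> 0"
    using b c by (simp add: glue_def o add_nonpos_nonpos mult_nonneg_nonpos)
  show "norm x \<ge> 1 \<Longrightarrow> f2 x \<ge> 0 \<Longrightarrow> glue \<epsilon> f1 f2 x \<ge> 0"
    using b c by (simp add: glue_def i)
  show "norm x \<ge> 1 \<Longrightarrow> f2 x \<le> 0 \<Longrightarrow> glue \<epsilon> f1 f2 x \<le> 0"
    using b c by (simp add: glue_def i add_nonpos_nonpos mult_nonneg_nonpos)
qed

section \<open>Energy estimates for the glued extensions\<close>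

lemma poisson_extension_properties:
  fixes u :: "real ^ 'n \<Rightarrow> real"
  assumes u: "u \<in> borel_measurable lebesgue" and a: "0 < a" "a < 2" and J: "lebesgue_local_energy a u < \<infinity>"
  obtains G where "\<And>X. X \<in> half_space \<Longrightarrow> GDERIV (poisson_extension a u) X :> G X" "continuous_on half_space G"
    "set_integrable lborel (half_ball (3 / 2)) (\<lambda>X. snd X powr (1 - a) * (norm (G X))\<^sup>2)"
    "set_integrable lborel (half_ball (3 / 2)) (\<lambda>X. snd X powr (1 - a) * (norm (poisson_extension a u X))\<^sup>2)"
    "has_trace (poisson_extension a u) u"
    "(\<And>y. \<bar>u y\<bar> \<le> 1) \<Longrightarrow> (\<And>X. X \<in> half_space \<Longrightarrow> \<bar>poisson_extension a u X\<bar> \<le> 1)"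
proof -
  obtain f where f: "f \<in> borel_measurable borel" "AE x in lborel. u x = f x" "local_energy a f < \<infinity>"
    "weight_integrable a f" "poisson_extension a u = poisson_extension a f" "has_trace (poisson_extension a f) u"
    by (rule borel_representative[OF u a(1) J])
  have D: "\<And>X. X \<in> half_space \<Longrightarrow> GDERIV (poisson_extension a f) X :> extension_grad a f X"
    by (rule GDERIV_poisson_extension[OF f(4) a(1)])
  have C: "continuous_on half_space (extension_grad a f)" by (rule continuous_on_extension_grad[OF f(4) a(1)])
  have L: "c1_limit half_space (poisson_extension a f) (extension_grad a f)" by (rule c1_limitI_C1[OF D C])
  have m: "(\<lambda>X. indicator half_space X *\<^sub>R poisson_extension a f X) \<in> borel_measurable borel"
    using c1_limit_measurable(1)[OF L open_half_space] by simp
  have 1: "set_integrable lborel (half_ball (3 / 2)) (\<lambda>X. snd X powr (1 - a) * (norm (extension_grad a f X))\<^sup>2)"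
    by (rule set_integrable_half_ballI[OF weighted_measurable[OF c1_limit_measurable(2)[OF L open_half_space]]])
      (use extension_energy_finite[OF f(1) a(1) f(3), of "3 / 2"] in simp)
  have 2: "set_integrable lborel (half_ball (3 / 2)) (\<lambda>X. snd X powr (1 - a) * (norm (poisson_extension a f X))\<^sup>2)"
    by (rule set_integrable_half_ballI[OF weighted_measurable[OF m]])
      (use extension_L2_finite[OF f(1) a f(3), of "3 / 2"] in simp)
  have 3: "\<bar>poisson_extension a f X\<bar> \<le> 1" if "\<And>y. \<bar>u y\<bar> \<le> 1" "X \<in> half_space" for X
  proof (rule poisson_extension_bounded[OF f(4) a(1) that(2)])
    show "AE y in lborel. \<bar>f y\<bar> \<le> 1" using f(2) by eventually_elim (metis that(1))
  qed
  show ?thesis by (rule that[of "extension_grad a f"]) (use D C 1 2 3 f(5,6) in auto)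
qed

lemma set_integrable_dominated:
  fixes f g :: "(real ^ 'n) \<times> real \<Rightarrow> real"
  assumes S: "S \<in> sets borel" "S \<subseteq> half_space" and m: "(\<lambda>X. indicator half_space X *\<^sub>R f X) \<in> borel_measurable borel"
    and g: "set_integrable lborel S g" and le: "\<And>X. X \<in> S \<Longrightarrow> \<bar>f X\<bar> \<le> g X"
  shows "set_integrable lborel S f"
  unfolding set_integrable_def
proof (rule Bochner_Integration.integrable_bound[OF g[unfolded set_integrable_def]])
  have "(\<lambda>X. indicator S X *\<^sub>R f X) = (\<lambda>X. indicator S X *\<^sub>R (indicator half_space X *\<^sub>R f X))"
    using S(2) by (auto simp: fun_eq_iff indicator_def)
  then show "(\<lambda>X. indicator S X *\<^sub>R f X) \<in> borel_measurable lborel"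
    using borel_measurable_scaleR[OF borel_measurable_indicator[of S borel] m] S(1) by simp
  show "AE X in lborel. norm (indicator S X *\<^sub>R f X) \<le> norm (indicator S X *\<^sub>R g X)"
  proof (rule AE_I2)
    fix X show "norm (indicator S X *\<^sub>R f X) \<le> norm (indicator S X *\<^sub>R g X)"
      using le[of X] by (cases "X \<in> S") auto
  qed
qed

lemma grad_energy_integrals:
  fixes f g :: "(real ^ 'n) \<times> real \<Rightarrow> real"
  assumes f: "c1_limit half_space f F" and g: "c1_limit half_space g G" and S: "S \<in> sets borel" "S \<subseteq> half_space"
  shows "(LINT X:S|lebesgue. snd X powr b * ((norm (grad f X))\<^sup>2 - (norm (grad g X))\<^sup>2)) =
      (LINT X:S|lborel. snd X powr b * (norm (F X))\<^sup>2 - snd X powr b * (norm (G X))\<^sup>2)"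
    "(LINT X:S|lebesgue. snd X powr b * ((norm (grad f X))\<^sup>2 + (norm (grad g X))\<^sup>2)) =
      (LINT X:S|lborel. snd X powr b * (norm (F X))\<^sup>2 + snd X powr b * (norm (G X))\<^sup>2)"
proof -
  note m = weighted_measurable[OF c1_limit_measurable(2)[OF f open_half_space], of b] weighted_measurable[OF c1_limit_measurable(2)[OF g open_half_space], of b]
  have ae: "AE X in lebesgue. X \<in> half_space \<longrightarrow> grad f X = F X \<and> grad g X = G X"
    using AE_grad(1)[OF f] AE_grad(1)[OF g] by eventually_elim auto
  show "(LINT X:S|lebesgue. snd X powr b * ((norm (grad f X))\<^sup>2 - (norm (grad g X))\<^sup>2)) =
      (LINT X:S|lborel. snd X powr b * (norm (F X))\<^sup>2 - snd X powr b * (norm (G X))\<^sup>2)"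
  proof (rule set_integral_half_space_cong(2)[OF S])
    show "AE X in lebesgue. X \<in> half_space \<longrightarrow> snd X powr b * ((norm (grad f X))\<^sup>2 - (norm (grad g X))\<^sup>2)
        = snd X powr b * (norm (F X))\<^sup>2 - snd X powr b * (norm (G X))\<^sup>2"
      using ae by eventually_elim (simp add: right_diff_distrib)
    show "(\<lambda>X. indicator half_space X *\<^sub>R (snd X powr b * (norm (F X))\<^sup>2 - snd X powr b * (norm (G X))\<^sup>2)) \<in> borel_measurable borel"
      unfolding scaleR_diff_right by (rule borel_measurable_diff[OF m])
  qed
  show "(LINT X:S|lebesgue. snd X powr b * ((norm (grad f X))\<^sup>2 + (norm (grad g X))\<^sup>2)) =
      (LINT X:S|lborel. snd X powr b * (norm (F X))\<^sup>2 + snd X powr b * (norm (G X))\<^sup>2)"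
  proof (rule set_integral_half_space_cong(2)[OF S])
    show "AE X in lebesgue. X \<in> half_space \<longrightarrow> snd X powr b * ((norm (grad f X))\<^sup>2 + (norm (grad g X))\<^sup>2)
        = snd X powr b * (norm (F X))\<^sup>2 + snd X powr b * (norm (G X))\<^sup>2"
      using ae by eventually_elim (simp add: distrib_left)
    show "(\<lambda>X. indicator half_space X *\<^sub>R (snd X powr b * (norm (F X))\<^sup>2 + snd X powr b * (norm (G X))\<^sup>2)) \<in> borel_measurable borel"
      unfolding scaleR_add_right by (rule borel_measurable_add[OF m])
  qed
qed

text \<open>Both gluings fit one pattern: the energy density of \<open>v\<close> is at most
  \<open>K\<close> times the given ones plus a term \<open>R\<close> that carries the gradient of a
  cutoff. Integrability of this majorant yields the finite energy of \<open>v\<close> before any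
  integrals are compared.\<close>

lemma gluing_estimate:
  fixes f1 f2 v :: "(real ^ 'n) \<times> real \<Rightarrow> real" and R :: "(real ^ 'n) \<times> real \<Rightarrow> real"
  defines "E \<equiv> \<lambda>b G X. snd X powr b * (norm (G X :: (real ^ 'n) \<times> real))\<^sup>2"
  assumes f1: "c1_limit half_space f1 G1" and f2: "c1_limit half_space f2 G2" and v: "c1_limit half_space v Gv"
    and i1: "set_integrable lborel (half_ball (3 / 2)) (E b G1)" and i2: "set_integrable lborel (half_ball (3 / 2)) (E b G2)"
    and R: "set_integrable lborel (half_ball (3 / 2)) R" "\<And>X. X \<in> half_space \<Longrightarrow> R X \<ge> 0"
    and A: "A = half_ball (1 + \<epsilon>) - half_ball (1 - \<epsilon>)" and \<epsilon>: "0 < \<epsilon>" "\<epsilon> < 1 / 4" and K: "K \<ge> 0"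
    and ins: "\<And>X. X \<in> half_space \<Longrightarrow> norm X < 1 - \<epsilon> \<Longrightarrow> Gv X = G1 X"
    and out: "\<And>X. X \<in> half_space \<Longrightarrow> norm X \<ge> 1 + \<epsilon> \<Longrightarrow> Gv X = G2 X"
    and bnd: "\<And>X. X \<in> half_space \<Longrightarrow> E b Gv X \<le> K * (E b G1 X + E b G2 X) + R X"
  shows "finite_weighted_energy b (3 / 2) v"
    and "(LINT X : half_ball (3 / 2) | lebesgue. snd X powr b * ((norm (grad v X))\<^sup>2 - (norm (grad f2 X))\<^sup>2)) \<le>
      (LINT X : half_ball 1 | lebesgue. snd X powr b * ((norm (grad f1 X))\<^sup>2 - (norm (grad f2 X))\<^sup>2)) + (LINT X:A|lborel. R X)
      + (K + 1) * (LINT X : A | lebesgue. snd X powr b * ((norm (grad f1 X))\<^sup>2 + (norm (grad f2 X))\<^sup>2))"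
proof -
  have sA: "A \<in> sets borel" unfolding A by simp
  have sub: "A \<subseteq> half_ball (3 / 2)" "A \<subseteq> half_space" using \<epsilon> unfolding A half_ball_def by auto
  have iv: "set_integrable lborel (half_ball (3 / 2)) (E b Gv)"
  proof (rule set_integrable_dominated[OF half_ball_sets half_ball_subset_half_space])
    show "(\<lambda>X. indicator half_space X *\<^sub>R E b Gv X) \<in> borel_measurable borel"
      unfolding E_def by (rule weighted_measurable[OF c1_limit_measurable(2)[OF v open_half_space]])
    show "set_integrable lborel (half_ball (3 / 2)) (\<lambda>X. K * (E b G1 X + E b G2 X) + R X)"
      by (intro set_integral_add(1) set_integrable_mult_right i1 i2 R(1))
    show "\<bar>E b Gv X\<bar> \<le> K * (E b G1 X + E b G2 X) + R X" if "X \<in> half_ball (3 / 2)" for X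
      using bnd[of X] that by (simp add: E_def half_ball_def)
  qed
  show "finite_weighted_energy b (3 / 2) v" by (rule finite_weighted_energyI[OF v iv[unfolded E_def]])
  show "(LINT X : half_ball (3 / 2) | lebesgue. snd X powr b * ((norm (grad v X))\<^sup>2 - (norm (grad f2 X))\<^sup>2)) \<le>
      (LINT X : half_ball 1 | lebesgue. snd X powr b * ((norm (grad f1 X))\<^sup>2 - (norm (grad f2 X))\<^sup>2)) + (LINT X:A|lborel. R X)
      + (K + 1) * (LINT X : A | lebesgue. snd X powr b * ((norm (grad f1 X))\<^sup>2 + (norm (grad f2 X))\<^sup>2))"
    unfolding grad_energy_integrals(1)[OF v f2 half_ball_sets half_ball_subset_half_space]
      grad_energy_integrals(1)[OF f1 f2 half_ball_sets half_ball_subset_half_space] grad_energy_integrals(2)[OF f1 f2 sA sub(2)]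
  proof (rule energy_comparison[OF i1[unfolded E_def] i2[unfolded E_def] iv[unfolded E_def] _ A \<epsilon> K _ ins out])
    show "set_integrable lborel A R" by (rule set_integrable_subset[OF R(1) _ sub(1)]) (use sA in simp)
    show "R X \<ge> 0" if "X \<in> A" for X using R(2)[OF subsetD[OF sub(2) that]] .
    show "snd X powr b * (norm (Gv X))\<^sup>2 \<le> K * (snd X powr b * (norm (G1 X))\<^sup>2 + snd X powr b * (norm (G2 X))\<^sup>2) + R X"
      if "X \<in> A" for X using bnd[OF subsetD[OF sub(2) that]] unfolding E_def .
  qed
qed

lemma glued_extension_energy:
  fixes u1 u2 :: "real ^ 'n \<Rightarrow> real" and a \<epsilon> :: real
  defines "w1 \<equiv> poisson_extension a u1" and "w2 \<equiv> poisson_extension a u2"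
  defines "v \<equiv> glue \<epsilon> w1 w2"
  assumes a: "0 < a" "a < 2" and \<epsilon>: "0 < \<epsilon>" "\<epsilon> < 1 / 4"
    and u1: "u1 \<in> borel_measurable lebesgue" "lebesgue_local_energy a u1 < \<infinity>"
    and u2: "u2 \<in> borel_measurable lebesgue" "lebesgue_local_energy a u2 < \<infinity>"
    and A: "A = half_ball (1 + \<epsilon>) - half_ball (1 - \<epsilon>)"
  shows "has_trace v (glue \<epsilon> u1 u2)"
    and "\<forall>f \<in> {w1, w2, v}. finite_weighted_energy (1 - a) (3 / 2) f"
    and "set_integrable lebesgue A (\<lambda>X. snd X powr (1 - a) * \<bar>w1 X - w2 X\<bar>\<^sup>2)"
    and "(LINT X : half_ball (3 / 2) | lebesgue. snd X powr (1 - a) * ((norm (grad v X))\<^sup>2 - (norm (grad w2 X))\<^sup>2)) \<le>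
      (LINT X : half_ball 1 | lebesgue. snd X powr (1 - a) * ((norm (grad w1 X))\<^sup>2 - (norm (grad w2 X))\<^sup>2))
      + 4001 * \<epsilon> powr (- 2) * (LINT X : A | lebesgue. snd X powr (1 - a) * \<bar>w1 X - w2 X\<bar>\<^sup>2)
      + 4001 * (LINT X : A | lebesgue. snd X powr (1 - a) * ((norm (grad w1 X))\<^sup>2 + (norm (grad w2 X))\<^sup>2))"
proof -
  obtain G1 where G1: "\<And>X. X \<in> half_space \<Longrightarrow> GDERIV w1 X :> G1 X" "continuous_on half_space G1"
    "set_integrable lborel (half_ball (3 / 2)) (\<lambda>X. snd X powr (1 - a) * (norm (G1 X))\<^sup>2)"
    "set_integrable lborel (half_ball (3 / 2)) (\<lambda>X. snd X powr (1 - a) * (norm (w1 X))\<^sup>2)" "has_trace w1 u1"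
    unfolding w1_def by (rule poisson_extension_properties[OF u1(1) a u1(2)]) blast
  obtain G2 where G2: "\<And>X. X \<in> half_space \<Longrightarrow> GDERIV w2 X :> G2 X" "continuous_on half_space G2"
    "set_integrable lborel (half_ball (3 / 2)) (\<lambda>X. snd X powr (1 - a) * (norm (G2 X))\<^sup>2)"
    "set_integrable lborel (half_ball (3 / 2)) (\<lambda>X. snd X powr (1 - a) * (norm (w2 X))\<^sup>2)" "has_trace w2 u2"
    unfolding w2_def by (rule poisson_extension_properties[OF u2(1) a u2(2)]) blast
  have L1: "c1_limit half_space w1 G1" by (rule c1_limitI_C1[OF G1(1,2)])
  have L2: "c1_limit half_space w2 G2" by (rule c1_limitI_C1[OF G2(1,2)])
  have Lv: "c1_limit half_space v (glue_grad \<epsilon> w1 G1 w2 G2)" unfolding v_def by (rule c1_limit_glue[OF \<epsilon>(1) G1(1,2) G2(1,2)])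
  show "has_trace v (glue \<epsilon> u1 u2)" unfolding v_def by (rule has_trace_glue[OF \<epsilon>(1) G1(5) G2(5) u1(1) u2(1) Lv[unfolded v_def]])
  have sA: "A \<in> sets borel" unfolding A by simp
  have sub: "A \<subseteq> half_ball (3 / 2)" "A \<subseteq> half_space" using \<epsilon> unfolding A half_ball_def by auto
  define D where "D X = snd X powr (1 - a) * \<bar>w1 X - w2 X\<bar>\<^sup>2" for X
  have D0: "D X \<ge> 0" for X by (simp add: D_def)
  have Dm: "(\<lambda>X. indicator half_space X *\<^sub>R D X) \<in> borel_measurable borel"
    using weighted_measurable[of "\<lambda>X. w1 X - w2 X" "1 - a"] c1_limit_measurable(1)[OF c1_limit_diff[OF L1 L2] open_half_space]
    by (simp add: D_def)
  have Di: "set_integrable lborel (half_ball (3 / 2)) D"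
  proof (rule set_integrable_dominated[OF half_ball_sets half_ball_subset_half_space Dm])
    show "set_integrable lborel (half_ball (3 / 2)) (\<lambda>X. 2 * (snd X powr (1 - a) * (norm (w1 X))\<^sup>2) + 2 * (snd X powr (1 - a) * (norm (w2 X))\<^sup>2))"
      by (intro set_integral_add(1) set_integrable_mult_right G1(4) G2(4))
    fix X
    have "\<bar>w1 X - w2 X\<bar>\<^sup>2 \<le> 2 * (w1 X)\<^sup>2 + 2 * (w2 X)\<^sup>2"
      using zero_le_power2[of "w1 X + w2 X"] by (simp add: power2_eq_square algebra_simps)
    then have "D X \<le> snd X powr (1 - a) * (2 * (w1 X)\<^sup>2 + 2 * (w2 X)\<^sup>2)" unfolding D_def by (rule mult_left_mono) simp
    then show "\<bar>D X\<bar> \<le> 2 * (snd X powr (1 - a) * (norm (w1 X))\<^sup>2) + 2 * (snd X powr (1 - a) * (norm (w2 X))\<^sup>2)"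
      using D0[of X] by (simp add: algebra_simps)
  qed
  note Dcong = set_integral_half_space_cong[OF sA sub(2) _ Dm, of D, simplified]
  have DA: "set_integrable lborel A D" by (rule set_integrable_subset[OF Di _ sub(1)]) (use sA in simp)
  show "set_integrable lebesgue A (\<lambda>X. snd X powr (1 - a) * \<bar>w1 X - w2 X\<bar>\<^sup>2)"
    using Dcong(1) DA unfolding D_def[abs_def] by simp
  \<comment> \<open>Here \<open>R\<close> is \<open>4000 * \<epsilon> powr (- 2)\<close> times the
    weighted square of \<open>w1 - w2\<close>, the second term in
    \<open>glue_grad_bound\<close>.\<close>
  note est = gluing_estimate[OF L1 L2 Lv G1(3) G2(3) set_integrable_mult_right[of "4000 * \<epsilon> powr (- 2)", OF Di] _ A \<epsilon>, of 4000]
  have b: "snd X powr (1 - a) * (norm (glue_grad \<epsilon> w1 G1 w2 G2 X))\<^sup>2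
     \<le> 4000 * (snd X powr (1 - a) * (norm (G1 X))\<^sup>2 + snd X powr (1 - a) * (norm (G2 X))\<^sup>2) + 4000 * \<epsilon> powr (- 2) * D X" for X
    using mult_left_mono[OF glue_grad_bound[OF \<epsilon>(1), of w1 G1 w2 G2 X], of "snd X powr (1 - a)"]
    by (simp add: D_def algebra_simps)
  have fin: "finite_weighted_energy (1 - a) (3 / 2) v"
    by (rule est(1)) (use D0 b glue_inner(2)[OF \<epsilon>(1)] glue_outer(2)[OF \<epsilon>(1)] in auto)
  then show "\<forall>f \<in> {w1, w2, v}. finite_weighted_energy (1 - a) (3 / 2) f"
    using finite_weighted_energyI[OF L1 G1(3)] finite_weighted_energyI[OF L2 G2(3)] by simp
  have main: "(LINT X : half_ball (3 / 2) | lebesgue. snd X powr (1 - a) * ((norm (grad v X))\<^sup>2 - (norm (grad w2 X))\<^sup>2)) \<le>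
      (LINT X : half_ball 1 | lebesgue. snd X powr (1 - a) * ((norm (grad w1 X))\<^sup>2 - (norm (grad w2 X))\<^sup>2))
      + (LINT X : A | lborel. 4000 * \<epsilon> powr (- 2) * D X)
      + (4000 + 1) * (LINT X : A | lebesgue. snd X powr (1 - a) * ((norm (grad w1 X))\<^sup>2 + (norm (grad w2 X))\<^sup>2))"
    by (rule est(2)) (use D0 b glue_inner(2)[OF \<epsilon>(1)] glue_outer(2)[OF \<epsilon>(1)] in auto)
  have "0 \<le> (LINT X : A | lborel. D X)" unfolding set_lebesgue_integral_def using D0 by (intro Bochner_Integration.integral_nonneg) simp
  then have "(LINT X : A | lborel. 4000 * \<epsilon> powr (- 2) * D X) \<le> 4001 * \<epsilon> powr (- 2) * (LINT X : A | lborel. D X)"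
    unfolding set_integral_mult_right by (intro mult_right_mono) auto
  also have "(LINT X : A | lborel. D X) = (LINT X : A | lebesgue. snd X powr (1 - a) * \<bar>w1 X - w2 X\<bar>\<^sup>2)"
    using Dcong(2) unfolding D_def[abs_def] by simp
  finally have "(LINT X : A | lborel. 4000 * \<epsilon> powr (- 2) * D X) \<le> 4001 * \<epsilon> powr (- 2) * (LINT X : A | lebesgue. snd X powr (1 - a) * \<bar>w1 X - w2 X\<bar>\<^sup>2)" .
  with main show "(LINT X : half_ball (3 / 2) | lebesgue. snd X powr (1 - a) * ((norm (grad v X))\<^sup>2 - (norm (grad w2 X))\<^sup>2)) \<le>
      (LINT X : half_ball 1 | lebesgue. snd X powr (1 - a) * ((norm (grad w1 X))\<^sup>2 - (norm (grad w2 X))\<^sup>2))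
      + 4001 * \<epsilon> powr (- 2) * (LINT X : A | lebesgue. snd X powr (1 - a) * \<bar>w1 X - w2 X\<bar>\<^sup>2)
      + 4001 * (LINT X : A | lebesgue. snd X powr (1 - a) * ((norm (grad w1 X))\<^sup>2 + (norm (grad w2 X))\<^sup>2))" by simp
qed

lemma blended_extension_energy:
  fixes u1 u2 :: "real ^ 'n \<Rightarrow> real" and \<sigma> \<epsilon> :: real
  defines "U1 \<equiv> poisson_extension \<sigma> u1" and "U2 \<equiv> poisson_extension \<sigma> u2"
  defines "V \<equiv> \<lambda>X. (1 - cutoff \<epsilon> X) * U1 X + cutoff \<epsilon> X * U2 X"
  assumes \<sigma>: "0 < \<sigma>" "\<sigma> < 1" and \<epsilon>: "0 < \<epsilon>" "\<epsilon> < 1 / 4"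
    and u1: "u1 \<in> borel_measurable lebesgue" "lebesgue_local_energy \<sigma> u1 < \<infinity>" "\<And>x. \<bar>u1 x\<bar> \<le> 1"
    and u2: "u2 \<in> borel_measurable lebesgue" "lebesgue_local_energy \<sigma> u2 < \<infinity>" "\<And>x. \<bar>u2 x\<bar> \<le> 1"
    and A: "A = half_ball (1 + \<epsilon>) - half_ball (1 - \<epsilon>)"
  shows "has_trace V (\<lambda>x. if norm x < 1 then u1 x else u2 x)"
    and "\<forall>f \<in> {U1, U2, V}. finite_weighted_energy (1 - \<sigma>) (3 / 2) f"
    and "set_integrable lebesgue A (\<lambda>X. snd X powr (1 - \<sigma>) * (norm (grad (cutoff \<epsilon>) X))\<^sup>2 * \<bar>U1 X - U2 X\<bar>\<^sup>2)"
    and "(LINT X : half_ball (3 / 2) | lebesgue. snd X powr (1 - \<sigma>) * ((norm (grad V X))\<^sup>2 - (norm (grad U2 X))\<^sup>2)) \<le>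
      (LINT X : half_ball 1 | lebesgue. snd X powr (1 - \<sigma>) * ((norm (grad U1 X))\<^sup>2 - (norm (grad U2 X))\<^sup>2))
      + 4001 * (LINT X : A | lebesgue. snd X powr (1 - \<sigma>) * (norm (grad (cutoff \<epsilon>) X))\<^sup>2 * \<bar>U1 X - U2 X\<bar>\<^sup>2)
      + 4001 * (LINT X : A | lebesgue. snd X powr (1 - \<sigma>) * ((norm (grad U1 X))\<^sup>2 + (norm (grad U2 X))\<^sup>2))"
proof -
  have \<sigma>2: "\<sigma> < 2" using \<sigma> by simp
  obtain G1 where G1: "\<And>X. X \<in> half_space \<Longrightarrow> GDERIV U1 X :> G1 X" "continuous_on half_space G1"
    "set_integrable lborel (half_ball (3 / 2)) (\<lambda>X. snd X powr (1 - \<sigma>) * (norm (G1 X))\<^sup>2)"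
    "has_trace U1 u1" "\<And>X. X \<in> half_space \<Longrightarrow> \<bar>U1 X\<bar> \<le> 1"
    unfolding U1_def by (rule poisson_extension_properties[OF u1(1) \<sigma>(1) \<sigma>2 u1(2)]) (use u1(3) in blast)
  obtain G2 where G2: "\<And>X. X \<in> half_space \<Longrightarrow> GDERIV U2 X :> G2 X" "continuous_on half_space G2"
    "set_integrable lborel (half_ball (3 / 2)) (\<lambda>X. snd X powr (1 - \<sigma>) * (norm (G2 X))\<^sup>2)"
    "has_trace U2 u2" "\<And>X. X \<in> half_space \<Longrightarrow> \<bar>U2 X\<bar> \<le> 1"
    unfolding U2_def by (rule poisson_extension_properties[OF u2(1) \<sigma>(1) \<sigma>2 u2(2)]) (use u2(3) in blast)
  have L1: "c1_limit half_space U1 G1" by (rule c1_limitI_C1[OF G1(1,2)])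
  have L2: "c1_limit half_space U2 G2" by (rule c1_limitI_C1[OF G2(1,2)])
  define \<phi> :: "(real ^ 'n) \<times> real \<Rightarrow> real" where "\<phi> = cutoff \<epsilon>"
  define H :: "(real ^ 'n) \<times> real \<Rightarrow> (real ^ 'n) \<times> real" where "H = cutoff_grad \<epsilon>"
  have L\<phi>: "c1_limit half_space \<phi> H" unfolding \<phi>_def H_def by (rule c1_limit_cutoff[OF \<epsilon>])
  define GV where "GV X = (1 - \<phi> X) *\<^sub>R G1 X + \<phi> X *\<^sub>R G2 X - (U1 X - U2 X) *\<^sub>R H X" for X
  have LV: "c1_limit half_space V GV"
    by (rule c1_limit_cong[OF c1_limit_add[OF c1_limit_mult[OF c1_limit_diff[OF c1_limit_const[of _ 1] L\<phi>] L1] c1_limit_mult[OF L\<phi> L2]]])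
      (simp_all add: V_def \<phi>_def GV_def algebra_simps)
  show "has_trace V (\<lambda>x. if norm x < 1 then u1 x else u2 x)"
    unfolding V_def by (rule has_trace_cutoff_blend[OF \<epsilon> G1(4) G2(4) u1(1) u2(1) u1(3) u2(3) LV[unfolded V_def]])
  have sA: "A \<in> sets borel" unfolding A by simp
  have sub: "A \<subseteq> half_ball (3 / 2)" "A \<subseteq> half_space" using \<epsilon> unfolding A half_ball_def by auto
  define D where "D X = snd X powr (1 - \<sigma>) * (norm (H X))\<^sup>2 * \<bar>U1 X - U2 X\<bar>\<^sup>2" for X
  have D0: "D X \<ge> 0" for X by (simp add: D_def)
  note Hm = weighted_measurable[OF c1_limit_measurable(2)[OF L\<phi> open_half_space], of "1 - \<sigma>"]
  have Hi: "set_integrable lborel (half_ball (3 / 2)) (\<lambda>X. snd X powr (1 - \<sigma>) * (norm (H X))\<^sup>2)"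
    by (rule set_integrable_half_ballI[OF Hm]) (use cutoff_grad_energy_finite[OF \<epsilon> \<sigma>, of "3 / 2", where 'n='n] in \<open>simp add: H_def\<close>)
  have Dm: "(\<lambda>X. indicator half_space X *\<^sub>R D X) \<in> borel_measurable borel"
  proof -
    have "(\<lambda>X. indicator half_space X *\<^sub>R (snd X powr (1 - \<sigma>) * (norm (H X))\<^sup>2) * (indicator half_space X * (U1 X - U2 X))\<^sup>2) \<in> borel_measurable borel"
      by (intro borel_measurable_times borel_measurable_power Hm c1_limit_measurable(1)[OF c1_limit_diff[OF L1 L2] open_half_space])
    also have "(\<lambda>X. indicator half_space X *\<^sub>R (snd X powr (1 - \<sigma>) * (norm (H X))\<^sup>2) * (indicator half_space X * (U1 X - U2 X))\<^sup>2)
        = (\<lambda>X. indicator half_space X *\<^sub>R D X)"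
      by (auto simp: fun_eq_iff indicator_def D_def)
    finally show ?thesis .
  qed
  have Di: "set_integrable lborel (half_ball (3 / 2)) D"
  proof (rule set_integrable_dominated[OF half_ball_sets half_ball_subset_half_space Dm])
    show "set_integrable lborel (half_ball (3 / 2)) (\<lambda>X. 4 * (snd X powr (1 - \<sigma>) * (norm (H X))\<^sup>2))"
      by (rule set_integrable_mult_right[OF Hi])
    fix X :: "(real ^ 'n) \<times> real" assume "X \<in> half_ball (3 / 2)"
    then have X: "X \<in> half_space" by (simp add: half_ball_def)
    \<comment> \<open>Extensions of data bounded by 1 stay bounded by 1, so the term is dominated by
      the energy of the cutoff.\<close>
    have "\<bar>U1 X - U2 X\<bar>\<^sup>2 \<le> 2\<^sup>2" using G1(5)[OF X] G2(5)[OF X] by (intro power_mono) auto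
    then have "D X \<le> snd X powr (1 - \<sigma>) * (norm (H X))\<^sup>2 * 2\<^sup>2" unfolding D_def by (rule mult_left_mono) simp
    then show "\<bar>D X\<bar> \<le> 4 * (snd X powr (1 - \<sigma>) * (norm (H X))\<^sup>2)" using D0[of X] by simp
  qed
  have "AE X in lebesgue. X \<in> half_space \<longrightarrow> snd X powr (1 - \<sigma>) * (norm (grad \<phi> X))\<^sup>2 * \<bar>U1 X - U2 X\<bar>\<^sup>2 = D X"
    using AE_grad(1)[OF L\<phi>] by eventually_elim (auto simp: D_def)
  note Dcong = set_integral_half_space_cong[OF sA sub(2) this Dm]
  have DA: "set_integrable lborel A D" by (rule set_integrable_subset[OF Di _ sub(1)]) (use sA in simp)
  show "set_integrable lebesgue A (\<lambda>X. snd X powr (1 - \<sigma>) * (norm (grad (cutoff \<epsilon>) X))\<^sup>2 * \<bar>U1 X - U2 X\<bar>\<^sup>2)"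
    using Dcong(1) DA unfolding \<phi>_def by simp
  note est = gluing_estimate[OF L1 L2 LV G1(3) G2(3) set_integrable_mult_right[of 3, OF Di] _ A \<epsilon>, of 3]
  have b: "snd X powr (1 - \<sigma>) * (norm (GV X))\<^sup>2
     \<le> 3 * (snd X powr (1 - \<sigma>) * (norm (G1 X))\<^sup>2 + snd X powr (1 - \<sigma>) * (norm (G2 X))\<^sup>2) + 3 * D X" if X: "X \<in> half_space" for X
  proof -
    define p q r where "p = norm (G1 X)" and "q = norm (G2 X)" and "r = \<bar>U1 X - U2 X\<bar> * norm (H X)"
    have t: "0 \<le> \<phi> X" "\<phi> X \<le> 1" unfolding \<phi>_def using cutoff_bounds[OF \<epsilon> X] by auto
    have "norm ((1 - \<phi> X) *\<^sub>R G1 X) \<le> 1 * p" "norm (\<phi> X *\<^sub>R G2 X) \<le> 1 * q"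
      unfolding norm_scaleR p_def q_def using t by (intro mult_right_mono; simp)+
    moreover have "norm ((U1 X - U2 X) *\<^sub>R H X) \<le> r" by (simp add: r_def)
    ultimately have "norm (GV X) \<le> p + q + r"
      unfolding GV_def using norm_triangle_ineq4[of "(1 - \<phi> X) *\<^sub>R G1 X + \<phi> X *\<^sub>R G2 X" "(U1 X - U2 X) *\<^sub>R H X"]
        norm_triangle_ineq[of "(1 - \<phi> X) *\<^sub>R G1 X" "\<phi> X *\<^sub>R G2 X"] by linarith
    then have "(norm (GV X))\<^sup>2 \<le> (p + q + r)\<^sup>2" by (intro power_mono) auto
    moreover have "(p + q + r)\<^sup>2 \<le> 3 * p\<^sup>2 + 3 * q\<^sup>2 + 3 * r\<^sup>2"
      using zero_le_power2[of "p - q"] zero_le_power2[of "q - r"] zero_le_power2[of "p - r"] by (simp add: power2_eq_square algebra_simps)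
    ultimately have "(norm (GV X))\<^sup>2 \<le> 3 * p\<^sup>2 + 3 * q\<^sup>2 + 3 * r\<^sup>2" by linarith
    from mult_left_mono[OF this, of "snd X powr (1 - \<sigma>)"] show ?thesis
      by (simp add: D_def p_def q_def r_def power_mult_distrib algebra_simps)
  qed
  have e: "GV X = G1 X" if "X \<in> half_space" "norm X < 1 - \<epsilon>" for X
    using cutoff_values(1)[OF \<epsilon> that] cutoff_grad_vanishes[OF \<epsilon> that(1)] that(2) by (simp add: GV_def \<phi>_def H_def)
  have e': "GV X = G2 X" if "X \<in> half_space" "norm X \<ge> 1 + \<epsilon>" for X
    using cutoff_values(2)[OF \<epsilon> that] cutoff_grad_vanishes[OF \<epsilon> that(1)] that(2) by (simp add: GV_def \<phi>_def H_def)
  have fin: "finite_weighted_energy (1 - \<sigma>) (3 / 2) V"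
    by (rule est(1)) (use D0 b e e' in auto)
  then show "\<forall>f \<in> {U1, U2, V}. finite_weighted_energy (1 - \<sigma>) (3 / 2) f"
    using finite_weighted_energyI[OF L1 G1(3)] finite_weighted_energyI[OF L2 G2(3)] by simp
  have main: "(LINT X : half_ball (3 / 2) | lebesgue. snd X powr (1 - \<sigma>) * ((norm (grad V X))\<^sup>2 - (norm (grad U2 X))\<^sup>2)) \<le>
      (LINT X : half_ball 1 | lebesgue. snd X powr (1 - \<sigma>) * ((norm (grad U1 X))\<^sup>2 - (norm (grad U2 X))\<^sup>2))
      + (LINT X : A | lborel. 3 * D X)
      + (3 + 1) * (LINT X : A | lebesgue. snd X powr (1 - \<sigma>) * ((norm (grad U1 X))\<^sup>2 + (norm (grad U2 X))\<^sup>2))"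
    by (rule est(2)) (use D0 b e e' in auto)
  have "0 \<le> (LINT X : A | lborel. D X)" unfolding set_lebesgue_integral_def using D0 by (intro Bochner_Integration.integral_nonneg) simp
  then have "(LINT X : A | lborel. 3 * D X) \<le> 4001 * (LINT X : A | lborel. D X)"
    unfolding set_integral_mult_right by (intro mult_right_mono) auto
  moreover have "(LINT X : A | lborel. D X) = (LINT X : A | lebesgue. snd X powr (1 - \<sigma>) * (norm (grad (cutoff \<epsilon>) X))\<^sup>2 * \<bar>U1 X - U2 X\<bar>\<^sup>2)"
    using Dcong(2) unfolding \<phi>_def by simp
  moreover have "0 \<le> (LINT X : A | lebesgue. snd X powr (1 - \<sigma>) * ((norm (grad U1 X))\<^sup>2 + (norm (grad U2 X))\<^sup>2))"
    unfolding set_lebesgue_integral_def by (intro Bochner_Integration.integral_nonneg) simp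
  \<comment> \<open>The constants found here are 3 and \<open>3 + 1\<close>; they are enlarged to
    4001 so that one constant serves both estimates.\<close>
  moreover have arith: "a \<le> b + 4001 * f + 4001 * d"
    if "c \<le> 4001 * e" "e = f" "0 \<le> d" "a \<le> b + c + 4 * d" for a b c d e f :: real
    using that by linarith
  ultimately show "(LINT X : half_ball (3 / 2) | lebesgue. snd X powr (1 - \<sigma>) * ((norm (grad V X))\<^sup>2 - (norm (grad U2 X))\<^sup>2)) \<le>
      (LINT X : half_ball 1 | lebesgue. snd X powr (1 - \<sigma>) * ((norm (grad U1 X))\<^sup>2 - (norm (grad U2 X))\<^sup>2))
      + 4001 * (LINT X : A | lebesgue. snd X powr (1 - \<sigma>) * (norm (grad (cutoff \<epsilon>) X))\<^sup>2 * \<bar>U1 X - U2 X\<bar>\<^sup>2)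
      + 4001 * (LINT X : A | lebesgue. snd X powr (1 - \<sigma>) * ((norm (grad U1 X))\<^sup>2 + (norm (grad U2 X))\<^sup>2))"
    using main by (intro arith) simp_all
qed

text \<open>Finite energies and integrability of the error terms are claimed along with the
  inequalities, since a Bochner integral of a function that is not integrable is 0 and an inequality
  between such integrals would carry no information.\<close>

theorem lemma6p2:
  fixes s \<sigma> :: real
  assumes "0 < s" "s < 1" "0 < \<sigma>" "\<sigma> < 1"
  shows "\<exists>C>0. \<forall>\<epsilon>. 0 < \<epsilon> \<and> \<epsilon> < 1 / 4 \<longrightarrow>
    (\<forall>(u1 :: real ^ 'n \<Rightarrow> real) E1 (u2 :: real ^ 'n \<Rightarrow> real) E2.
      admissible_pair s \<sigma> (ball 0 2) u1 E1 \<and> admissible_pair s \<sigma> (ball 0 2) u2 E2 \<longrightarrow>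
      (let w1 = s_extension s u1; w2 = s_extension s u2;
           U1 = sigma_extension \<sigma> E1; U2 = sigma_extension \<sigma> E2;
           \<phi> = cutoff \<epsilon>;
           A = half_ball (1 + \<epsilon>) - half_ball (1 - \<epsilon>)
       in \<exists>(F :: (real ^ 'n) set) (v :: (real ^ 'n) \<times> real \<Rightarrow> real) (V :: (real ^ 'n) \<times> real \<Rightarrow> real).
         F \<inter> ball 0 1 = E1 \<inter> ball 0 1 \<and> F - ball 0 1 = E2 - ball 0 1 \<and>
         agree_near_hemisphere (3 / 2) V U2 \<and>
         has_trace V (sign_of_set F) \<and>
         agree_near_hemisphere (3 / 2) v w2 \<and>
         (\<exists>g. has_trace v g \<and> (AE x in lebesgue. x \<in> F \<longrightarrow> g x \<ge> 0) \<and>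
              (AE x in lebesgue. x \<in> - F \<longrightarrow> g x \<le> 0)) \<and>
         (\<forall>f \<in> {w1, w2, v}. finite_weighted_energy (1 - 2 * s) (3 / 2) f) \<and>
         (\<forall>f \<in> {U1, U2, V}. finite_weighted_energy (1 - \<sigma>) (3 / 2) f) \<and>
         weakly_differentiable half_space \<phi> \<and>
         set_integrable lebesgue A (\<lambda>X. snd X powr (1 - 2 * s) * \<bar>w1 X - w2 X\<bar>\<^sup>2) \<and>
         set_integrable lebesgue A
           (\<lambda>X. snd X powr (1 - \<sigma>) * (norm (grad \<phi> X))\<^sup>2 * \<bar>U1 X - U2 X\<bar>\<^sup>2) \<and>
         (LINT X : half_ball (3 / 2) | lebesgue.
            snd X powr (1 - 2 * s) * ((norm (grad v X))\<^sup>2 - (norm (grad w2 X))\<^sup>2))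
         \<le> (LINT X : half_ball 1 | lebesgue.
              snd X powr (1 - 2 * s) * ((norm (grad w1 X))\<^sup>2 - (norm (grad w2 X))\<^sup>2))
           + C * \<epsilon> powr (- 2) * (LINT X : A | lebesgue.
              snd X powr (1 - 2 * s) * \<bar>w1 X - w2 X\<bar>\<^sup>2)
           + C * (LINT X : A | lebesgue.
              snd X powr (1 - 2 * s) * ((norm (grad w1 X))\<^sup>2 + (norm (grad w2 X))\<^sup>2)) \<and>
         (LINT X : half_ball (3 / 2) | lebesgue.
            snd X powr (1 - \<sigma>) * ((norm (grad V X))\<^sup>2 - (norm (grad U2 X))\<^sup>2))
         \<le> (LINT X : half_ball 1 | lebesgue.
              snd X powr (1 - \<sigma>) * ((norm (grad U1 X))\<^sup>2 - (norm (grad U2 X))\<^sup>2))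
           + C * (LINT X : A | lebesgue.
              snd X powr (1 - \<sigma>) * (norm (grad \<phi> X))\<^sup>2 * \<bar>U1 X - U2 X\<bar>\<^sup>2)
           + C * (LINT X : A | lebesgue.
              snd X powr (1 - \<sigma>) * ((norm (grad U1 X))\<^sup>2 + (norm (grad U2 X))\<^sup>2))))"
proof -
  have main: "\<exists>(F :: (real ^ 'n) set) v V.
         F \<inter> ball 0 1 = E1 \<inter> ball 0 1 \<and> F - ball 0 1 = E2 - ball 0 1 \<and>
         agree_near_hemisphere (3 / 2) V U2 \<and>
         has_trace V (sign_of_set F) \<and>
         agree_near_hemisphere (3 / 2) v w2 \<and>
         (\<exists>g. has_trace v g \<and> (AE x in lebesgue. x \<in> F \<longrightarrow> g x \<ge> 0) \<and>
              (AE x in lebesgue. x \<in> - F \<longrightarrow> g x \<le> 0)) \<and>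
         (\<forall>f \<in> {w1, w2, v}. finite_weighted_energy (1 - 2 * s) (3 / 2) f) \<and>
         (\<forall>f \<in> {U1, U2, V}. finite_weighted_energy (1 - \<sigma>) (3 / 2) f) \<and>
         weakly_differentiable half_space \<phi> \<and>
         set_integrable lebesgue A (\<lambda>X. snd X powr (1 - 2 * s) * \<bar>w1 X - w2 X\<bar>\<^sup>2) \<and>
         set_integrable lebesgue A
           (\<lambda>X. snd X powr (1 - \<sigma>) * (norm (grad \<phi> X))\<^sup>2 * \<bar>U1 X - U2 X\<bar>\<^sup>2) \<and>
         (LINT X : half_ball (3 / 2) | lebesgue.
            snd X powr (1 - 2 * s) * ((norm (grad v X))\<^sup>2 - (norm (grad w2 X))\<^sup>2))
         \<le> (LINT X : half_ball 1 | lebesgue.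
              snd X powr (1 - 2 * s) * ((norm (grad w1 X))\<^sup>2 - (norm (grad w2 X))\<^sup>2))
           + 4001 * \<epsilon> powr (- 2) * (LINT X : A | lebesgue.
              snd X powr (1 - 2 * s) * \<bar>w1 X - w2 X\<bar>\<^sup>2)
           + 4001 * (LINT X : A | lebesgue.
              snd X powr (1 - 2 * s) * ((norm (grad w1 X))\<^sup>2 + (norm (grad w2 X))\<^sup>2)) \<and>
         (LINT X : half_ball (3 / 2) | lebesgue.
            snd X powr (1 - \<sigma>) * ((norm (grad V X))\<^sup>2 - (norm (grad U2 X))\<^sup>2))
         \<le> (LINT X : half_ball 1 | lebesgue.
              snd X powr (1 - \<sigma>) * ((norm (grad U1 X))\<^sup>2 - (norm (grad U2 X))\<^sup>2))
           + 4001 * (LINT X : A | lebesgue.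
              snd X powr (1 - \<sigma>) * (norm (grad \<phi> X))\<^sup>2 * \<bar>U1 X - U2 X\<bar>\<^sup>2)
           + 4001 * (LINT X : A | lebesgue.
              snd X powr (1 - \<sigma>) * ((norm (grad U1 X))\<^sup>2 + (norm (grad U2 X))\<^sup>2))"
    if \<epsilon>: "0 < \<epsilon>" "\<epsilon> < 1 / 4"
      and 1: "admissible_pair s \<sigma> (ball 0 2) u1 E1" and 2: "admissible_pair s \<sigma> (ball 0 2) u2 E2"
      and w: "w1 = s_extension s u1" "w2 = s_extension s u2"
      and U: "U1 = sigma_extension \<sigma> E1" "U2 = sigma_extension \<sigma> E2"
      and \<phi>: "\<phi> = cutoff \<epsilon>" and A: "A = half_ball (1 + \<epsilon>) - half_ball (1 - \<epsilon>)"
    for \<epsilon> and u1 u2 :: "real ^ 'n \<Rightarrow> real" and E1 E2 w1 w2 U1 U2 \<phi> A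
  proof -
    have u: "u1 \<in> borel_measurable lebesgue" "u2 \<in> borel_measurable lebesgue"
      and E: "E1 \<in> sets lebesgue" "E2 \<in> sets lebesgue"
      and sgn: "AE x in lebesgue. x \<in> E1 \<longrightarrow> u1 x \<ge> 0" "AE x in lebesgue. x \<in> - E1 \<longrightarrow> u1 x \<le> 0"
        "AE x in lebesgue. x \<in> E2 \<longrightarrow> u2 x \<ge> 0" "AE x in lebesgue. x \<in> - E2 \<longrightarrow> u2 x \<le> 0"
      using 1 2 unfolding admissible_pair_def by auto
    have J: "lebesgue_local_energy (2 * s) u < \<infinity>" "lebesgue_local_energy \<sigma> (sign_of_set E) < \<infinity>"
      if "admissible_pair s \<sigma> (ball 0 2) u E" for u :: "real ^ 'n \<Rightarrow> real" and E
    proof -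
      have *: "u \<in> borel_measurable lebesgue" "E \<in> sets lebesgue"
        "gagliardo_energy s u (ball 0 2) < \<infinity>" "fractional_perimeter \<sigma> E (ball 0 2) < \<infinity>"
        using that unfolding admissible_pair_def by (auto simp: top.not_eq_extremum[symmetric])
      show "lebesgue_local_energy (2 * s) u < \<infinity>"
        by (rule order.strict_trans1[OF lebesgue_local_energy_le_gagliardo[OF *(1)] *(3)])
      show "lebesgue_local_energy \<sigma> (sign_of_set E) < \<infinity>"
        by (rule order.strict_trans1[OF lebesgue_local_energy_le_perimeter[OF *(2)]])
          (use *(4) in \<open>simp add: ennreal_mult_less_top\<close>)
    qed
    have S: "sign_of_set E \<in> borel_measurable lebesgue" if "E \<in> sets lebesgue" for E :: "(real ^ 'n) set"
      unfolding sign_of_set_def[abs_def]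
      by (intro borel_measurable_diff borel_measurable_indicator) (use that Compl_in_sets_lebesgue in auto)
    have S1: "\<bar>sign_of_set E x\<bar> \<le> 1" for E and x :: "real ^ 'n" by (simp add: sign_of_set_def indicator_def)
    define F where "F = (E1 \<inter> ball 0 1) \<union> (E2 - ball 0 1)"
    define v where "v = glue \<epsilon> w1 w2"
    define V where "V = (\<lambda>X. (1 - \<phi> X) * U1 X + \<phi> X * U2 X)"
    have F: "F \<inter> ball 0 1 = E1 \<inter> ball 0 1" "F - ball 0 1 = E2 - ball 0 1" unfolding F_def by auto
    \<comment> \<open>Both kinds of cutoff are constant beyond |X| = 1 + \<epsilon>, and
      \<open>1 + \<epsilon> < 5/4 < 3/2\<close>.\<close>
    have N: "open {X :: (real ^ 'n) \<times> real. norm X > 5 / 4}"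
      "{X :: (real ^ 'n) \<times> real. norm X = 3 / 2 \<and> snd X \<ge> 0} \<subseteq> {X. norm X > 5 / 4}"
      by (auto intro!: open_Collect_less continuous_intros)
    have far: "\<phi> X = 1" "v X = w2 X" if "X \<in> {X. norm X > 5 / 4} \<inter> half_space" for X
      using cutoff_values(2)[OF \<epsilon>, of X] glue_outer(1)[OF \<epsilon>(1), of X] that \<epsilon> by (simp_all add: v_def \<phi>)
    have aV: "agree_near_hemisphere (3 / 2) V U2"
      unfolding agree_near_hemisphere_def
      by (rule exI, intro conjI, rule N(1), rule N(2)) (use far(1) in \<open>simp add: V_def\<close>)
    have av: "agree_near_hemisphere (3 / 2) v w2"
      unfolding agree_near_hemisphere_def
      by (rule exI, intro conjI, rule N(1), rule N(2)) (use far(2) in blast)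
    have s2: "0 < 2 * s" "2 * s < 2" using assms by auto
    note v = glued_extension_energy[OF s2 \<epsilon> u(1) J(1)[OF 1] u(2) J(1)[OF 2] A,
        folded s_extension_def w, folded v_def]
    note V = blended_extension_energy[OF assms(3,4) \<epsilon> S[OF E(1)] J(2)[OF 1] S1 S[OF E(2)] J(2)[OF 2] S1 A,
        folded sigma_extension_def U \<phi>, folded V_def]
    have "(\<lambda>x. if norm x < 1 then sign_of_set E1 x else sign_of_set E2 x) = sign_of_set F"
      by (auto simp: fun_eq_iff sign_of_set_def F_def indicator_def)
    with V(1) have tV: "has_trace V (sign_of_set F)" by simp
    \<comment> \<open>The trace of \<open>v\<close> is the glued datum, so the sign condition for
      \<open>F\<close> reduces to those of the two given pairs, one on each side of the unit
      sphere.\<close>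
    have g: "AE x in lebesgue. x \<in> F \<longrightarrow> glue \<epsilon> u1 u2 x \<ge> 0"
      using sgn(1,3) by eventually_elim (auto simp: F_def intro: glue_sign(1,3)[OF \<epsilon>(1)])
    have g': "AE x in lebesgue. x \<in> - F \<longrightarrow> glue \<epsilon> u1 u2 x \<le> 0"
      using sgn(2,4)
    proof eventually_elim
      case (elim x)
      then show ?case
        using glue_sign(2)[OF \<epsilon>(1), of x u1 u2] glue_sign(4)[OF \<epsilon>(1), of x u2 u1] by (cases "norm x < 1") (auto simp: F_def)
    qed
    have tv: "\<exists>g. has_trace v g \<and> (AE x in lebesgue. x \<in> F \<longrightarrow> g x \<ge> 0) \<and> (AE x in lebesgue. x \<in> - F \<longrightarrow> g x \<le> 0)"
      using v(1) g g' by blast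
    have w\<phi>: "weakly_differentiable half_space \<phi>" unfolding \<phi> by (rule AE_grad(2)[OF c1_limit_cutoff[OF \<epsilon>]])
    show ?thesis
      by (rule exI[of _ F], rule exI[of _ v], rule exI[of _ V],
        intro conjI F aV tV av tv v(2,3,4) V(2,3,4) w\<phi>)
  qed
  show ?thesis
    unfolding Let_def
  \<comment> \<open>4000 comes from \<open>glue_grad_bound\<close> and is raised by one in
    \<open>energy_comparison\<close>.\<close>
  proof (rule exI[of _ 4001], intro conjI allI impI, goal_cases)
    case 2
    then show ?case by (intro main) auto
  qed simp
qed

end
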